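(* For every $i\in I$ the irreducible $R^{\Lambda_0}(2\delta-\alpha_i)$-module is unique (up to isomorphism), and the following hold. (1) For $0\le i\le \ell-1$ there is an algebra isomorphism $R^{\Lambda_0}(2\delta-\alpha_i)\simeq \mathrm{Mat}(\dim\mathcal{L}_i,\mathbf{k})$, where $\mathcal{L}_i$ (defined in the context) is the unique irreducible $R^{\Lambda_0}(2\delta-\alpha_i)$-module, and $$\dim\mathcal{L}_i=2\binom{h-2}{i}-2\binom{h-2}{i-1}.$$ (2) There is an algebra isomorphism $R^{\Lambda_0}(2\delta-\alpha_\ell)\simeq\mathrm{Mat}(\dim\widetilde{\mathcal{L}}_\ell,\mathbf{k}[x]/(x^2))$, where $\widetilde{\mathcal{L}}_\ell$ (defined in the context) is the unique irreducible $R^{\Lambda_0}(2\delta-\alpha_\ell)$-module, and $$\dim\widetilde{\mathcal{L}}_\ell=\binom{h-2}{\ell}-\binom{h-2}{\ell-1}.$$ Furthermore, $\mathcal{L}_\ell$ is the unique indecomposable projective $R^{\Lambda_0}(2\delta-\alpha_\ell)$-module.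
   Context: Let $\mathbf{k}$ be an algebraically closed field, $\ell\ge 2$, $I=\{0,1,\dots,\ell\}$, and let $(a_{ij})_{i,j\in I}$ be the affine Cartan matrix of type $D^{(2)}_{\ell+1}$: $a_{ii}=2$, $a_{01}=-2$, $a_{10}=-1$, $a_{\ell-1,\ell}=-1$, $a_{\ell,\ell-1}=-2$, $a_{i,i+1}=a_{i+1,i}=-1$ for $1\le i\le \ell-2$, all other entries $0$. Let $\alpha_i$ ($i\in I$) be the simple roots (linearly independent), $\mathsf{Q}^+=\sum_i\mathbb{Z}_{\ge0}\alpha_i$, $|\sum k_i\alpha_i|=\sum k_i$, $\delta=\alpha_0+\cdots+\alpha_\ell$. Put $(\alpha_i|\alpha_j)=d_ia_{ij}$ with $(d_0,d_1,\dots,d_{\ell-1},d_\ell)=(1,2,\dots,2,1)$. Fix polynomials $\mathcal{Q}_{i,j}(u,v)\in\mathbf{k}[u,v]$ with $\mathcal{Q}_{i,i}=0$ and, for $i\ne j$, $\mathcal{Q}_{i,j}(u,v)=\sum t_{i,j;p,q}u^pv^q$ summed over $p,q\ge 0$ with $p(\alpha_i|\alpha_i)+q(\alpha_j|\alpha_j)+2(\alpha_i|\alpha_j)=0$, where $t_{i,j;-a_{ij},0}\neq0$ and $\mathcal{Q}_{i,j}(u,v)=\mathcal{Q}_{j,i}(v,u)$; moreover assume $\mathcal{Q}_{0,1}(u,v)=u^2+v$, $\mathcal{Q}_{\ell-1,\ell}(u,v)=u+v^2$, and $\mathcal{Q}_{i,j}(u,v)=1$ if $a_{ij}=0$. For $n\ge1$,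 $R^{\Lambda_0}(n)$ is the unital associative $\mathbf{k}$-algebra generated by $e(\nu)$ ($\nu\in I^n$), $x_1,\dots,x_n$, $\psi_1,\dots,\psi_{n-1}$ with relations: $e(\nu)e(\nu')=\delta_{\nu,\nu'}e(\nu)$, $\sum_\nu e(\nu)=1$, $x_ke(\nu)=e(\nu)x_k$, $x_kx_l=x_lx_k$; $\psi_le(\nu)=e(s_l\nu)\psi_l$ ($s_l$ acting by place permutation), $\psi_k\psi_l=\psi_l\psi_k$ if $|k-l|>1$; $\psi_k^2e(\nu)=\mathcal{Q}_{\nu_k,\nu_{k+1}}(x_k,x_{k+1})e(\nu)$; $(\psi_kx_l-x_{s_k(l)}\psi_k)e(\nu)$ equals $-e(\nu)$ if $l=k$ and $\nu_k=\nu_{k+1}$, $e(\nu)$ if $l=k+1$ and $\nu_k=\nu_{k+1}$, and $0$ otherwise; $(\psi_{k+1}\psi_k\psi_{k+1}-\psi_k\psi_{k+1}\psi_k)e(\nu)$ equals $\frac{\mathcal{Q}_{\nu_k,\nu_{k+1}}(x_k,x_{k+1})-\mathcal{Q}_{\nu_k,\nu_{k+1}}(x_{k+2},x_{k+1})}{x_k-x_{k+2}}e(\nu)$ if $\nu_k=\nu_{k+2}$ and $0$ otherwise; and $x_1e(\nu)=0$ if $\nu_1=0$, $e(\nu)=0$ if $\nu_1\ne0$. For $\beta\in\mathsf{Q}^+$ with $|\beta|=n$, let $I^\beta=\{\nu\in I^n:\sum_k\alpha_{\nu_k}=\beta\}$, $e(\beta)=\sum_{\nu\in I^\beta}e(\nu)$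 (a central idempotent), $R^{\Lambda_0}(\beta)=R^{\Lambda_0}(n)e(\beta)$ (finite-dimensional). Modules are left modules. Put $h=2\ell+2$. The shifted Young diagram of $\lambda=(\lambda_1>\cdots>\lambda_r>0)$ has boxes $(a,b)$ with $1\le a\le r$, $a\le b\le a+\lambda_a-1$. Residues of boxes are given by repeating the pattern $0,1,\dots,\ell-1,\ell,\ell,\ell-1,\dots,1,0$ from left to right in each row, starting at box $(a,a)$ (so $(a,b)$ has residue $m$ if $m\le\ell$ and $h-1-m$ if $m>\ell$, where $m\in\{0,\dots,h-1\}$, $m\equiv b-a$ mod $h$). A standard tableau of shape $\lambda$ with $n$ boxes is a bijective filling by $1,\dots,n$ increasing along rows (left to right) and down columns; $\mathrm{ST}(\lambda)$ is the set of these; $\mathrm{res}_k(T)$ is the residue of the box containing $k$, and $\mathrm{res}(T)=(\mathrm{res}_1(T),\dots,\mathrm{res}_n(T))$; $s_kT$ is $T$ with $k$ and $k+1$ exchanged. For $0\le i\le\ell$ let $\lambda(i)=(h-i-1,i)$ (so $\lambda(0)=(h-1)$). Let $\mathcal{N}=\mathbf{k}^2$, $\xi_1=\begin{pmatrix}0&1\\0&0\end{pmatrix}$, $\xi_2=\begin{pmatrix}0&-1\\0&0\end{pmatrix}$, $\partial=\begin{pmatrix}0&0\\-1&0\end{pmatrix}$. For $0\le i\le\ell$ let $\mathcal{L}_i=\bigoplus_{T\in\mathrm{ST}(\lambda(i))}\mathcal{N}\otimes T$ (copies of $\mathcal{N}$ indexed by $\mathrm{ST}(\lambda(i))$), an $R^{\Lambda_0}(2\delta-\alpha_i)$-module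 by: $e(\nu)(v\otimes T)=v\otimes T$ if $\nu=\mathrm{res}(T)$ and $0$ otherwise; and - for $0\le i\le\ell-1$: $x_k(v\otimes T)=\xi_1v\otimes T$ if $k$ is located at box $(1,\ell+1)$ of $T$, $\xi_2v\otimes T$ if $k$ is located at $(1,\ell+2)$, $0$ otherwise; $\psi_k(v\otimes T)=\partial v\otimes T$ if $k$ and $k+1$ are located at $(1,\ell+1)$ and $(1,\ell+2)$, $v\otimes s_kT$ if $s_kT$ is standard, $0$ otherwise; - for $i=\ell$: $x_k(v\otimes T)=\xi_1v\otimes T$ if $k$ is located at $(1,\ell+1)$, $0$ otherwise; $\psi_k(v\otimes T)=v\otimes s_kT$ if $s_kT$ is standard, $0$ otherwise. Let $\widetilde{\mathcal{L}}_\ell=\bigoplus_{T\in\mathrm{ST}(\lambda(\ell))}\mathbf{k}\begin{pmatrix}1\\0\end{pmatrix}\otimes T\subseteq\mathcal{L}_\ell$, a submodule. *)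

theory Defs
  imports
    "HOL-Algebra.QuotRing"
    "HOL-Analysis.Cartesian_Space"
    "HOL-Combinatorics.Transposition"
    "HOL-Computational_Algebra.Polynomial"
    "HOL-Library.Poly_Mapping"
    "Jordan_Normal_Form.Missing_VectorSpace"
begin

hide_const (open) Multiset.mult Polynomial.smult

text \<open>
  Conventions. The letter \<open>l\<close> stands for \<open>\<ell>\<close>, and \<open>{0..l}\<close> for the index set \<open>I\<close>.
  A \<open>'k\<close>-algebra is a record of type \<open>('k, 'a) module\<close>; its scalars are all of the type \<open>'k\<close>.
  A module over it is a record of type \<open>('a, 'm) module\<close>, whose fields \<^const>\<open>mult\<close>
  and \<^const>\<open>one\<close> carry no meaning.
\<close>

section \<open>Algebras over a field\<close>

definition type_algebra :: "('k \<Rightarrow> 'a \<Rightarrow> 'a) \<Rightarrow> ('k, 'a::ring_1) module"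
  where "type_algebra s =
    \<lparr>carrier = UNIV, mult = (*), one = 1, zero = 0, add = (+), smult = s\<rparr>"

definition base_algebra :: "('k::field, 'k) module"
  where "base_algebra = type_algebra (*)"

text \<open>\<open>J\<close> is meant to be a two-sided ideal of \<open>A\<close>.\<close>

definition quotient_algebra :: "('k, 'a) module \<Rightarrow> 'a set \<Rightarrow> ('k, 'a set) module"
  where "quotient_algebra A J =
    \<lparr>carrier = carrier (A Quot J), mult = mult (A Quot J), one = one (A Quot J),
     zero = zero (A Quot J), add = add (A Quot J),
     smult = (\<lambda>c X. \<Union>a\<in>X. J +>\<^bsub>A\<^esub> (c \<odot>\<^bsub>A\<^esub> a))\<rparr>"

text \<open>\<open>k[x]/(x\<^sup>2)\<close>\<close>

definition dual_numbers :: "('k::field, 'k poly set) module"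
  where "dual_numbers =
    (let P = type_algebra Polynomial.smult in quotient_algebra P (Idl\<^bsub>P\<^esub> {monom 1 2}))"

definition matrix_algebra :: "nat \<Rightarrow> ('k, 'b) module \<Rightarrow> ('k, nat \<times> nat \<Rightarrow> 'b) module"
  where "matrix_algebra d B =
    (let D = {..<d} \<times> {..<d} in
    \<lparr>carrier = D \<rightarrow>\<^sub>E carrier B,
     mult = (\<lambda>M N. \<lambda>(i, j)\<in>D. \<Oplus>\<^bsub>B\<^esub>k\<in>{..<d}. M (i, k) \<otimes>\<^bsub>B\<^esub> N (k, j)),
     one = (\<lambda>(i, j)\<in>D. if i = j then \<one>\<^bsub>B\<^esub> else \<zero>\<^bsub>B\<^esub>),
     zero = (\<lambda>_\<in>D. \<zero>\<^bsub>B\<^esub>),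
     add = (\<lambda>M N. \<lambda>p\<in>D. M p \<oplus>\<^bsub>B\<^esub> N p),
     smult = (\<lambda>c M. \<lambda>p\<in>D. c \<odot>\<^bsub>B\<^esub> M p)\<rparr>)"

definition algebra_isomorphic :: "('k, 'a) module \<Rightarrow> ('k, 'b) module \<Rightarrow> bool"
  where "algebra_isomorphic A B \<longleftrightarrow>
    (\<exists>f\<in>ring_iso A B. \<forall>c. \<forall>a\<in>carrier A. f (c \<odot>\<^bsub>A\<^esub> a) = c \<odot>\<^bsub>B\<^esub> f a)"

section \<open>Left modules\<close>

text \<open>The library's locale \<^locale>\<open>module\<close> requires a commutative ring.\<close>

locale left_module = A: ring A + M: abelian_group M
  for A :: "('a, 'c) ring_scheme" and M :: "('a, 'm, 'd) module_scheme" +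
  assumes smult_closed:
      "\<lbrakk>a \<in> carrier A; x \<in> carrier M\<rbrakk> \<Longrightarrow> a \<odot>\<^bsub>M\<^esub> x \<in> carrier M"
    and smult_l_distr:
      "\<lbrakk>a \<in> carrier A; b \<in> carrier A; x \<in> carrier M\<rbrakk> \<Longrightarrow>
        (a \<oplus>\<^bsub>A\<^esub> b) \<odot>\<^bsub>M\<^esub> x = a \<odot>\<^bsub>M\<^esub> x \<oplus>\<^bsub>M\<^esub> b \<odot>\<^bsub>M\<^esub> x"
    and smult_r_distr:
      "\<lbrakk>a \<in> carrier A; x \<in> carrier M; y \<in> carrier M\<rbrakk> \<Longrightarrow>
        a \<odot>\<^bsub>M\<^esub> (x \<oplus>\<^bsub>M\<^esub> y) = a \<odot>\<^bsub>M\<^esub> x \<oplus>\<^bsub>M\<^esub> a \<odot>\<^bsub>M\<^esub> y"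
    and smult_assoc1:
      "\<lbrakk>a \<in> carrier A; b \<in> carrier A; x \<in> carrier M\<rbrakk> \<Longrightarrow>
        (a \<otimes>\<^bsub>A\<^esub> b) \<odot>\<^bsub>M\<^esub> x = a \<odot>\<^bsub>M\<^esub> (b \<odot>\<^bsub>M\<^esub> x)"
    and smult_one: "x \<in> carrier M \<Longrightarrow> \<one>\<^bsub>A\<^esub> \<odot>\<^bsub>M\<^esub> x = x"

definition module_isomorphic ::
  "('a, 'c) ring_scheme \<Rightarrow> ('a, 'm) module \<Rightarrow> ('a, 'n) module \<Rightarrow> bool"
  where "module_isomorphic A M N \<longleftrightarrow>
    (\<exists>f\<in>module_hom A M N. bij_betw f (carrier M) (carrier N))"

definition irreducible_module :: "('a, 'c) ring_scheme \<Rightarrow> ('a, 'm) module \<Rightarrow> bool"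
  where "irreducible_module A M \<longleftrightarrow>
    left_module A M \<and> carrier M \<noteq> {\<zero>\<^bsub>M\<^esub>} \<and>
    (\<forall>N. Module.submodule N A M \<longrightarrow> N = {\<zero>\<^bsub>M\<^esub>} \<or> N = carrier M)"

definition complementary_submodules ::
  "('a, 'c) ring_scheme \<Rightarrow> ('a, 'm) module \<Rightarrow> 'm set \<Rightarrow> 'm set \<Rightarrow> bool"
  where "complementary_submodules A M X Y \<longleftrightarrow>
    Module.submodule X A M \<and> Module.submodule Y A M \<and>
    X \<inter> Y = {\<zero>\<^bsub>M\<^esub>} \<and> X <+>\<^bsub>M\<^esub> Y = carrier M"

definition indecomposable_module :: "('a, 'c) ring_scheme \<Rightarrow> ('a, 'm) module \<Rightarrow> bool"
  where "indecomposable_module A M \<longleftrightarrow>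
    left_module A M \<and> carrier M \<noteq> {\<zero>\<^bsub>M\<^esub>} \<and>
    (\<forall>X Y. complementary_submodules A M X Y \<longrightarrow> X = {\<zero>\<^bsub>M\<^esub>} \<or> Y = {\<zero>\<^bsub>M\<^esub>})"

definition free_module :: "('a, 'c) ring_scheme \<Rightarrow> 'j set \<Rightarrow> ('a, 'j \<Rightarrow> 'a) module"
  where "free_module A J =
    \<lparr>carrier = {f. (\<forall>j. f j \<in> carrier A) \<and> (\<forall>j. j \<notin> J \<longrightarrow> f j = \<zero>\<^bsub>A\<^esub>) \<and>
                   finite {j. f j \<noteq> \<zero>\<^bsub>A\<^esub>}},
     mult = undefined, one = undefined,
     zero = (\<lambda>_. \<zero>\<^bsub>A\<^esub>),
     add = (\<lambda>f g j. f j \<oplus>\<^bsub>A\<^esub> g j),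
     smult = (\<lambda>a f j. a \<otimes>\<^bsub>A\<^esub> f j)\<rparr>"

text \<open>
  Projective: isomorphic to a direct summand of a free module. It is no restriction to take the
  basis \<open>J\<close> of the free module in the type \<open>'m\<close> of \<open>M\<close>: if \<open>M\<close> is a direct
  summand of any free module, then the canonical surjection onto \<open>M\<close> from the free module on
  the set \<^term>\<open>carrier M\<close> splits.
\<close>

definition projective_module :: "('a, 'c) ring_scheme \<Rightarrow> ('a, 'm) module \<Rightarrow> bool"
  where "projective_module A M \<longleftrightarrow>
    left_module A M \<and>
    (\<exists>(J :: 'm set) X Y. complementary_submodules A (free_module A J) X Y \<and>
       module_isomorphic A M ((free_module A J)\<lparr>carrier := X\<rparr>))"

text \<open>Dimension over \<open>'k\<close>, which acts on a module over the \<open>'k\<close>-algebra \<open>A\<close> through \<open>c \<mapsto> c 1\<^sub>A\<close>.\<close>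

definition module_dim :: "('k::field, 'a) module \<Rightarrow> ('a, 'm) module \<Rightarrow> nat"
  where "module_dim A M =
    vectorspace.dim (base_algebra :: ('k, 'k) module)
      \<lparr>carrier = carrier M, mult = mult M, one = one M, zero = zero M, add = add M,
       smult = (\<lambda>c v. (c \<odot>\<^bsub>A\<^esub> \<one>\<^bsub>A\<^esub>) \<odot>\<^bsub>M\<^esub> v)\<rparr>"

section \<open>Free algebras\<close>

text \<open>
  The free monoid on \<open>'g\<close>, written additively so that finitely supported functions on it
  carry the convolution product of the library.
\<close>

datatype 'g gword = Word (letters: "'g list")

instantiation gword :: (type) monoid_add
begin

definition zero_gword :: "'a gword" where "zero_gword = Word []"

definition plus_gword :: "'a gword \<Rightarrow> 'a gword \<Rightarrow> 'a gword"
  where "plus_gword v w = Word (letters v @ letters w)"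

instance
  by standard (simp_all add: zero_gword_def plus_gword_def)

end

definition scalar :: "'k::comm_ring_1 \<Rightarrow> 'g gword \<Rightarrow>\<^sub>0 'k"
  where "scalar c = Poly_Mapping.single 0 c"

definition gen :: "'g \<Rightarrow> 'g gword \<Rightarrow>\<^sub>0 'k::comm_ring_1"
  where "gen g = Poly_Mapping.single (Word [g]) 1"

definition free_algebra :: "'g set \<Rightarrow> ('k::field, 'g gword \<Rightarrow>\<^sub>0 'k) module"
  where "free_algebra G =
    (type_algebra (\<lambda>c a. scalar c * a))
      \<lparr>carrier := {a. \<forall>w\<in>Poly_Mapping.keys a. set (letters w) \<subseteq> G}\<rparr>"

section \<open>Polynomials in two variables\<close>

text \<open>
  A polynomial in \<open>k[u,v]\<close> is an element of \<^typ>\<open>'k poly poly\<close>: the inner variable is \<open>u\<close>,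
  the outer one is \<open>v\<close>.
\<close>

definition coeff2 :: "'k::zero poly poly \<Rightarrow> nat \<Rightarrow> nat \<Rightarrow> 'k"
  where "coeff2 P p q = coeff (coeff P q) p"

definition monom2 :: "nat \<Rightarrow> nat \<Rightarrow> 'k::comm_semiring_1 poly poly"
  where "monom2 p q = monom (monom 1 p) q"

definition eval2 :: "('k::zero \<Rightarrow> 'a::ring_1) \<Rightarrow> 'k poly poly \<Rightarrow> 'a \<Rightarrow> 'a \<Rightarrow> 'a"
  where "eval2 \<iota> P u v =
    (\<Sum>q\<le>degree P. \<Sum>p\<le>degree (coeff P q). \<iota> (coeff2 P p q) * (u ^ p * v ^ q))"

text \<open>The polynomial \<open>(P(u,v) - P(w,v)) / (u - w)\<close>, see \<open>divided_difference\<close> below.\<close>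

definition eval_divided_difference ::
  "('k::zero \<Rightarrow> 'a::ring_1) \<Rightarrow> 'k poly poly \<Rightarrow> 'a \<Rightarrow> 'a \<Rightarrow> 'a \<Rightarrow> 'a"
  where "eval_divided_difference \<iota> P u v w =
    (\<Sum>q\<le>degree P. \<Sum>p\<le>degree (coeff P q).
       \<iota> (coeff2 P p q) * ((\<Sum>i<p. u ^ i * w ^ (p - Suc i)) * v ^ q))"

lemma divided_difference:
  fixes u v w :: "'a::comm_ring_1"
  shows "(u - w) * eval_divided_difference \<iota> P u v w = eval2 \<iota> P u v - eval2 \<iota> P w v"
proof -
  have *: "(u - w) * (\<iota> c * ((\<Sum>i<p. u ^ i * w ^ (p - Suc i)) * v ^ q)) =
      \<iota> c * (u ^ p * v ^ q) - \<iota> c * (w ^ p * v ^ q)" for c p q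
  proof -
    have "u ^ p - w ^ p = (u - w) * (\<Sum>i<p. u ^ i * w ^ (p - Suc i))"
      by (simp only: power_diff_sumr2 mult.commute)
    then have "\<iota> c * ((u ^ p - w ^ p) * v ^ q) =
        (u - w) * (\<iota> c * ((\<Sum>i<p. u ^ i * w ^ (p - Suc i)) * v ^ q))"
      by (simp only: ac_simps)
    then show ?thesis
      by (simp only: left_diff_distrib right_diff_distrib)
  qed
  show ?thesis
    unfolding eval2_def eval_divided_difference_def
    by (simp only: sum_distrib_left * sum_subtractf)
qed

section \<open>Root data of type \<open>D\<^sup>(\<^sup>2\<^sup>)\<^bsub>l+1\<^esub>\<close>\<close>

definition cartan :: "nat \<Rightarrow> nat \<Rightarrow> nat \<Rightarrow> int"
  where "cartan l i j =
    (if i = j then 2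
     else if i = 0 \<and> j = 1 then - 2
     else if i = l \<and> j = l - 1 then - 2
     else if i = Suc j \<or> j = Suc i then - 1
     else 0)"

definition sym_factor :: "nat \<Rightarrow> nat \<Rightarrow> int"
  where "sym_factor l i = (if i = 0 \<or> i = l then 1 else 2)"

definition pairing :: "nat \<Rightarrow> nat \<Rightarrow> nat \<Rightarrow> int"
  where "pairing l i j = sym_factor l i * cartan l i j"

text \<open>
  The monoid \<open>Q\<^sup>+\<close> is the free commutative monoid on the simple roots, that is,
  \<^typ>\<open>nat multiset\<close>; the height \<open>|\<beta>|\<close> is \<^term>\<open>size \<beta>\<close>.
\<close>

definition simple_root :: "nat \<Rightarrow> nat multiset"
  where "simple_root i = {#i#}"

definition null_root :: "nat \<Rightarrow> nat multiset"
  where "null_root l = (\<Sum>i\<in>{0..l}. simple_root i)"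

definition seqs :: "nat \<Rightarrow> nat \<Rightarrow> nat list set"
  where "seqs l n = {\<nu>. length \<nu> = n \<and> set \<nu> \<subseteq> {0..l}}"

definition seqs_weight :: "nat \<Rightarrow> nat multiset \<Rightarrow> nat list set"
  where "seqs_weight l \<beta> = {\<nu>\<in>seqs l (size \<beta>). sum_list (map simple_root \<nu>) = \<beta>}"

definition coxeter :: "nat \<Rightarrow> nat"
  where "coxeter l = 2 * l + 2"

section \<open>The cyclotomic quiver Hecke algebra\<close>

definition klr_polynomials :: "nat \<Rightarrow> (nat \<Rightarrow> nat \<Rightarrow> 'k::field poly poly) \<Rightarrow> bool"
  where "klr_polynomials l Q \<longleftrightarrow>
    (\<forall>i\<le>l. Q i i = 0) \<and>
    (\<forall>i\<le>l. \<forall>j\<le>l. i \<noteq> j \<longrightarrow>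
       (\<forall>p q. coeff2 (Q i j) p q \<noteq> 0 \<longrightarrow>
          int p * pairing l i i + int q * pairing l j j + 2 * pairing l i j = 0) \<and>
       coeff2 (Q i j) (nat (- cartan l i j)) 0 \<noteq> 0 \<and>
       (\<forall>p q. coeff2 (Q i j) p q = coeff2 (Q j i) q p)) \<and>
    Q 0 1 = monom2 2 0 + monom2 0 1 \<and>
    Q (l - 1) l = monom2 1 0 + monom2 0 2 \<and>
    (\<forall>i\<le>l. \<forall>j\<le>l. cartan l i j = 0 \<longrightarrow> Q i j = 1)"

datatype klr_gen = E "nat list" | X nat | Psi nat

type_synonym 'k klr_free = "klr_gen gword \<Rightarrow>\<^sub>0 'k"

abbreviation idem :: "nat list \<Rightarrow> 'k::comm_ring_1 klr_free"
  where "idem \<nu> \<equiv> gen (E \<nu>)"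

abbreviation xx :: "nat \<Rightarrow> 'k::comm_ring_1 klr_free"
  where "xx k \<equiv> gen (X k)"

abbreviation psi :: "nat \<Rightarrow> 'k::comm_ring_1 klr_free"
  where "psi k \<equiv> gen (Psi k)"

definition klr_gens :: "nat \<Rightarrow> nat \<Rightarrow> klr_gen set"
  where "klr_gens l n = E ` seqs l n \<union> X ` {1..n} \<union> Psi ` {1..<n}"

text \<open>Positions in a sequence \<open>\<nu>\<close> are counted from 1.\<close>

definition entry :: "nat list \<Rightarrow> nat \<Rightarrow> nat"
  where "entry \<nu> k = \<nu> ! (k - 1)"

definition swap_entries :: "nat \<Rightarrow> nat list \<Rightarrow> nat list"
  where "swap_entries k \<nu> = \<nu>[k - 1 := entry \<nu> (Suc k), k := entry \<nu> k]"

text \<open>A relation \<open>a = b\<close> is recorded as the element \<open>a - b\<close>.\<close>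

inductive_set klr_relations ::
  "nat \<Rightarrow> (nat \<Rightarrow> nat \<Rightarrow> 'k::field poly poly) \<Rightarrow> nat \<Rightarrow> 'k klr_free set"
  for l :: nat and Q :: "nat \<Rightarrow> nat \<Rightarrow> 'k poly poly" and n :: nat
where
  idem_idem:
    "\<lbrakk>\<nu> \<in> seqs l n; \<nu>' \<in> seqs l n\<rbrakk> \<Longrightarrow>
     idem \<nu> * idem \<nu>' - (if \<nu> = \<nu>' then idem \<nu> else 0) \<in> klr_relations l Q n"
| idem_sum:
    "(\<Sum>\<nu>\<in>seqs l n. idem \<nu>) - 1 \<in> klr_relations l Q n"
| x_idem:
    "\<lbrakk>\<nu> \<in> seqs l n; k \<in> {1..n}\<rbrakk> \<Longrightarrow>
     xx k * idem \<nu> - idem \<nu> * xx k \<in> klr_relations l Q n"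
| x_x:
    "\<lbrakk>k \<in> {1..n}; m \<in> {1..n}\<rbrakk> \<Longrightarrow>
     xx k * xx m - xx m * xx k \<in> klr_relations l Q n"
| psi_idem:
    "\<lbrakk>\<nu> \<in> seqs l n; k \<in> {1..<n}\<rbrakk> \<Longrightarrow>
     psi k * idem \<nu> - idem (swap_entries k \<nu>) * psi k \<in> klr_relations l Q n"
| psi_psi:
    "\<lbrakk>k \<in> {1..<n}; m \<in> {1..<n}; \<bar>int k - int m\<bar> > 1\<rbrakk> \<Longrightarrow>
     psi k * psi m - psi m * psi k \<in> klr_relations l Q n"
| psi_square:
    "\<lbrakk>\<nu> \<in> seqs l n; k \<in> {1..<n}\<rbrakk> \<Longrightarrow>
     psi k ^ 2 * idem \<nu>
       - eval2 scalar (Q (entry \<nu> k) (entry \<nu> (k + 1))) (xx k) (xx (k + 1)) * idem \<nu>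
     \<in> klr_relations l Q n"
| psi_x:
    "\<lbrakk>\<nu> \<in> seqs l n; k \<in> {1..<n}; m \<in> {1..n}\<rbrakk> \<Longrightarrow>
     (psi k * xx m - xx (Transposition.transpose k (k + 1) m) * psi k) * idem \<nu>
       - (if m = k \<and> entry \<nu> k = entry \<nu> (k + 1) then - idem \<nu>
          else if m = k + 1 \<and> entry \<nu> k = entry \<nu> (k + 1) then idem \<nu>
          else 0)
     \<in> klr_relations l Q n"
| braid:
    "\<lbrakk>\<nu> \<in> seqs l n; k \<ge> 1; k + 2 \<le> n\<rbrakk> \<Longrightarrow>
     (psi (k + 1) * psi k * psi (k + 1) - psi k * psi (k + 1) * psi k) * idem \<nu>
       - (if entry \<nu> k = entry \<nu> (k + 2)
          then eval_divided_difference scalar (Q (entry \<nu> k) (entry \<nu> (k + 1)))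
                 (xx k) (xx (k + 1)) (xx (k + 2)) * idem \<nu>
          else 0)
     \<in> klr_relations l Q n"
| cyclotomic_zero:
    "\<lbrakk>\<nu> \<in> seqs l n; entry \<nu> 1 = 0\<rbrakk> \<Longrightarrow> xx 1 * idem \<nu> \<in> klr_relations l Q n"
| cyclotomic_nonzero:
    "\<lbrakk>\<nu> \<in> seqs l n; entry \<nu> 1 \<noteq> 0\<rbrakk> \<Longrightarrow> idem \<nu> \<in> klr_relations l Q n"

definition klr_ideal ::
  "nat \<Rightarrow> (nat \<Rightarrow> nat \<Rightarrow> 'k::field poly poly) \<Rightarrow> nat \<Rightarrow> 'k klr_free set"
  where "klr_ideal l Q n =
    (let F = free_algebra (klr_gens l n) :: ('k, 'k klr_free) module
     in Idl\<^bsub>F\<^esub> (klr_relations l Q n))"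

text \<open>The algebra \<open>R\<^sup>\<Lambda>\<^sup>0(n)\<close>\<close>

definition klr_algebra ::
  "nat \<Rightarrow> (nat \<Rightarrow> nat \<Rightarrow> 'k::field poly poly) \<Rightarrow> nat \<Rightarrow> ('k, 'k klr_free set) module"
  where "klr_algebra l Q n =
    quotient_algebra (free_algebra (klr_gens l n)) (klr_ideal l Q n)"

text \<open>The algebra \<open>R\<^sup>\<Lambda>\<^sup>0(\<beta>) = R\<^sup>\<Lambda>\<^sup>0(n) e(\<beta>)\<close> with \<open>n = |\<beta>|\<close>, whose unit is \<open>e(\<beta>)\<close>\<close>

definition klr_block_idem ::
  "nat \<Rightarrow> (nat \<Rightarrow> nat \<Rightarrow> 'k::field poly poly) \<Rightarrow> nat multiset \<Rightarrow> 'k klr_free set"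
  where "klr_block_idem l Q \<beta> =
    (let F = free_algebra (klr_gens l (size \<beta>)) :: ('k, 'k klr_free) module
     in klr_ideal l Q (size \<beta>) +>\<^bsub>F\<^esub> (\<Sum>\<nu>\<in>seqs_weight l \<beta>. idem \<nu>))"

definition klr_block ::
  "nat \<Rightarrow> (nat \<Rightarrow> nat \<Rightarrow> 'k::field poly poly) \<Rightarrow> nat multiset \<Rightarrow> ('k, 'k klr_free set) module"
  where "klr_block l Q \<beta> =
    (let R = klr_algebra l Q (size \<beta>); e = klr_block_idem l Q \<beta>
     in R\<lparr>carrier := {r \<otimes>\<^bsub>R\<^esub> e | r. r \<in> carrier R}, one := e\<rparr>)"

section \<open>Shifted tableaux\<close>

text \<open>Boxes are pairs (row, column), counted from 1.\<close>

definition shifted_diagram :: "nat list \<Rightarrow> (nat \<times> nat) set"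
  where "shifted_diagram \<mu> =
    {(a, b). 1 \<le> a \<and> a \<le> length \<mu> \<and> a \<le> b \<and> b < a + \<mu> ! (a - 1)}"

definition box_residue :: "nat \<Rightarrow> nat \<times> nat \<Rightarrow> nat"
  where "box_residue l = (\<lambda>(a, b).
    let m = (b - a) mod coxeter l in if m \<le> l then m else coxeter l - 1 - m)"

type_synonym tableau = "nat \<times> nat \<Rightarrow> nat"

text \<open>Fillings are extended by 0 outside the diagram.\<close>

definition standard_tableaux :: "nat list \<Rightarrow> tableau set"
  where "standard_tableaux \<mu> =
    {T. bij_betw T (shifted_diagram \<mu>) {1..sum_list \<mu>} \<and>
        (\<forall>c. c \<notin> shifted_diagram \<mu> \<longrightarrow> T c = 0) \<and>
        (\<forall>a b b'. (a, b) \<in> shifted_diagram \<mu> \<and> (a, b') \<in> shifted_diagram \<mu> \<and> b < b'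
           \<longrightarrow> T (a, b) < T (a, b')) \<and>
        (\<forall>a a' b. (a, b) \<in> shifted_diagram \<mu> \<and> (a', b) \<in> shifted_diagram \<mu> \<and> a < a'
           \<longrightarrow> T (a, b) < T (a', b))}"

definition box_of :: "nat list \<Rightarrow> tableau \<Rightarrow> nat \<Rightarrow> nat \<times> nat"
  where "box_of \<mu> T k = inv_into (shifted_diagram \<mu>) T k"

definition residue_seq :: "nat \<Rightarrow> nat list \<Rightarrow> tableau \<Rightarrow> nat list"
  where "residue_seq l \<mu> T = map (\<lambda>k. box_residue l (box_of \<mu> T k)) [1..<Suc (sum_list \<mu>)]"

definition swap_tableau :: "nat \<Rightarrow> tableau \<Rightarrow> tableau"
  where "swap_tableau k T = Transposition.transpose k (k + 1) \<circ> T"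

definition two_row :: "nat \<Rightarrow> nat \<Rightarrow> nat list"
  where "two_row l i = (if i = 0 then [coxeter l - 1] else [coxeter l - i - 1, i])"

section \<open>The modules \<open>L\<^sub>i\<close>\<close>

definition xi1 :: "'k::comm_ring_1^2^2"
  where "xi1 = vector [vector [0, 1], vector [0, 0]]"

definition xi2 :: "'k::comm_ring_1^2^2"
  where "xi2 = vector [vector [0, -1], vector [0, 0]]"

definition partial :: "'k::comm_ring_1^2^2"
  where "partial = vector [vector [0, 0], vector [-1, 0]]"

text \<open>
  An element of a direct sum of copies of \<open>k\<^sup>2\<close> indexed by tableaux is the function giving
  its components.
\<close>

type_synonym 'k tabsum = "tableau \<Rightarrow> 'k^2"

definition tensor :: "'k::comm_ring_1^2 \<Rightarrow> tableau \<Rightarrow> 'k tabsum"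
  where "tensor v T = (\<lambda>S. if S = T then v else 0)"

fun gen_action :: "nat \<Rightarrow> nat \<Rightarrow> klr_gen \<Rightarrow> 'k::comm_ring_1^2 \<Rightarrow> tableau \<Rightarrow> 'k tabsum"
where
  "gen_action l i (E \<nu>) v T =
    (if \<nu> = residue_seq l (two_row l i) T then tensor v T else (\<lambda>_. 0))"
| "gen_action l i (X k) v T =
    (if box_of (two_row l i) T k = (1, l + 1) then tensor (xi1 *v v) T
     else if i < l \<and> box_of (two_row l i) T k = (1, l + 2) then tensor (xi2 *v v) T
     else (\<lambda>_. 0))"
| "gen_action l i (Psi k) v T =
    (if i < l \<and> box_of (two_row l i) T k = (1, l + 1) \<and>
        box_of (two_row l i) T (k + 1) = (1, l + 2)
     then tensor (partial *v v) T
     else if swap_tableau k T \<in> standard_tableaux (two_row l i)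
     then tensor v (swap_tableau k T)
     else (\<lambda>_. 0))"

definition gen_operator ::
  "nat \<Rightarrow> nat \<Rightarrow> klr_gen \<Rightarrow> 'k::comm_ring_1 tabsum \<Rightarrow> 'k tabsum"
  where "gen_operator l i g f =
    (\<lambda>S. \<Sum>T\<in>standard_tableaux (two_row l i). gen_action l i g (f T) T S)"

definition free_operator ::
  "nat \<Rightarrow> nat \<Rightarrow> 'k::comm_ring_1 klr_free \<Rightarrow> 'k tabsum \<Rightarrow> 'k tabsum"
  where "free_operator l i a f =
    (\<lambda>S. \<Sum>w\<in>Poly_Mapping.keys a.
       Poly_Mapping.lookup a w *s foldr (gen_operator l i) (letters w) f S)"

text \<open>
  A coset acts as the common operator of its representatives. On the carrier the relations act
  by 0, so that \<^const>\<open>the_elem\<close> is applied to a singleton.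
\<close>

definition L_module ::
  "nat \<Rightarrow> nat \<Rightarrow> ('k::field klr_free set, 'k tabsum) module"
  where "L_module l i =
    \<lparr>carrier = {f. \<forall>T. T \<notin> standard_tableaux (two_row l i) \<longrightarrow> f T = 0},
     mult = undefined, one = undefined,
     zero = (\<lambda>_. 0),
     add = (\<lambda>f g T. f T + g T),
     smult = (\<lambda>C f. the_elem ((\<lambda>a. free_operator l i a f) ` C))\<rparr>"

definition L_tilde ::
  "nat \<Rightarrow> ('k::field klr_free set, 'k tabsum) module"
  where "L_tilde l =
    (L_module l l)\<lparr>carrier :=
      {f\<in>carrier (L_module l l). \<forall>T. \<exists>c. f T = c *s vector [1, 0]}\<rparr>"

end

theory Submission
  imports Defs
begin

text \<open>
  The proof exhibits matrix units in each block and reads everything off from them.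

  A standard tableau of a two-row shifted shape is a ballot word, which tells for each number the row
  that contains it. The main point (\<open>vanish\<close>) is that an idempotent of the block is zero
  unless its sequence grows as the residue sequence of such a word; by the weight of the
  block, the idempotents that survive are then those of the standard tableaux of the shape in question
  (\<open>classify\<close>), and they add up to 1. Exchanging a box of the first row with one of the second
  crosses two distant letters, and such a crossing is invertible. So products of crossings, called
  paths, conjugate each of these idempotents to that of the reference tableau \<open>w0\<close>, whose first row is
  filled before the second (\<open>link_path\<close>).

  Consequently the block is spanned by products of a path, an element of the corner ring of the reference
  idempotent \<open>e0\<close>, and a reversed path (\<open>block_span_all\<close>). All dots vanish on \<open>e0\<close> except at
  the middle of the first row, where one has \<open>xe\<close> with square zero. For \<open>i = l\<close> the corner
  is spanned by \<open>e0\<close> and \<open>xe\<close>. For \<open>i < l\<close> the letter \<open>l\<close> occurs twice in a row, its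
  crossing gives a further element \<open>pe\<close> of square zero with \<open>pe xe + xe pe = - e0\<close>, and the corner is
  spanned by \<open>e0\<close>, \<open>xe\<close>, \<open>pe\<close>, \<open>xe pe\<close>, the relations of the two by two matrices.

  The modules provide the lower bounds: the relations of the block hold for the operators on the
  tableau vectors (\<open>relation_acts_zero\<close>), and the operators of the corner elements show that \<open>- xe pe\<close>
  is nonzero for \<open>i < l\<close>, and that \<open>e0\<close> and \<open>xe\<close> are independent for \<open>i = l\<close>. So the block is a matrix algebra over
  the field, of twice the number of tableaux, in the first case, and over the dual numbers in the second. The
  locale \<open>matrix_units\<close> derives from such a system of matrix units the isomorphism with a matrix algebra,
  the uniqueness of the irreducible module, its dimension, and the facts about the indecomposable
  projective module. The number of ballot words is a difference of two binomial coefficients.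

  Computations take place in the free algebra on all generators, modulo a congruence that presents the
  block (\<open>klr_block_presentation\<close>), rather than with cosets.
\<close>

section \<open>Algebras presented by a ring\<close>

text \<open>
  The algebra is a record, hence awkward to compute in. Here it is the image of a ring of a type class,
  so that an identity in the algebra is an equation \<open>\<pi> a = \<pi> b\<close> whose arguments are ordinary ring terms.
\<close>

locale algebra_presentation =
  fixes A :: "('k::field, 'a) module" and \<pi> :: "'r::ring_1 \<Rightarrow> 'a" and sc :: "'k \<Rightarrow> 'r"
  assumes carrier_range: "carrier A = range \<pi>"
    and mult_image: "\<pi> a \<otimes>\<^bsub>A\<^esub> \<pi> b = \<pi> (a * b)"
    and add_image: "\<pi> a \<oplus>\<^bsub>A\<^esub> \<pi> b = \<pi> (a + b)"
    and one_image: "\<one>\<^bsub>A\<^esub> = \<pi> 1"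
    and zero_image: "\<zero>\<^bsub>A\<^esub> = \<pi> 0"
    and smult_image: "c \<odot>\<^bsub>A\<^esub> \<pi> a = \<pi> (sc c * a)"
    and sc_add: "sc (c + d) = sc c + sc d"
    and sc_mult: "sc (c * d) = sc c * sc d"
    and sc_one: "sc 1 = 1"
    and sc_central: "sc c * a = a * sc c"
begin

lemma sc_zero: "sc 0 = 0"
  using sc_add[of 0 0] by simp

lemma image_closed [simp]: "\<pi> a \<in> carrier A"
  by (simp add: carrier_range)

lemma carrierE: assumes "x \<in> carrier A" obtains a where "x = \<pi> a"
  using assms by (auto simp: carrier_range)

lemma ring: "ring A"
proof (intro ringI abelian_groupI monoidI)
  fix x assume "x \<in> carrier A"
  then obtain a where "x = \<pi> a" by (rule carrierE)
  then have "\<pi> (- a) \<oplus>\<^bsub>A\<^esub> x = \<zero>\<^bsub>A\<^esub>" by (simp add: add_image zero_image)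
  then show "\<exists>y\<in>carrier A. y \<oplus>\<^bsub>A\<^esub> x = \<zero>\<^bsub>A\<^esub>" by (intro bexI[of _ "\<pi> (- a)"]) simp_all
qed (auto simp: carrier_range mult_image add_image one_image zero_image algebra_simps)

sublocale A: ring A
  by (rule ring)

lemma image_mult_cong: "\<pi> a = \<pi> a' \<Longrightarrow> \<pi> b = \<pi> b' \<Longrightarrow> \<pi> (a * b) = \<pi> (a' * b')"
  by (simp flip: mult_image)

lemma image_add_cong: "\<pi> a = \<pi> a' \<Longrightarrow> \<pi> b = \<pi> b' \<Longrightarrow> \<pi> (a + b) = \<pi> (a' + b')"
  by (simp flip: add_image)

lemma image_sum_cong: "(\<And>i. i \<in> S \<Longrightarrow> \<pi> (f i) = \<pi> (g i)) \<Longrightarrow> \<pi> (sum f S) = \<pi> (sum g S)"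
  by (induction S rule: infinite_finite_induct) (auto intro: image_add_cong)

lemma image_mult_left: "\<pi> a = \<pi> b \<Longrightarrow> \<pi> (c * a) = \<pi> (c * b)"
  by (rule image_mult_cong) simp_all

lemma image_mult_right: "\<pi> a = \<pi> b \<Longrightarrow> \<pi> (a * c) = \<pi> (b * c)"
  by (rule image_mult_cong) simp_all

lemma image_mult_both: "\<pi> a = \<pi> b \<Longrightarrow> \<pi> (c * a * d) = \<pi> (c * b * d)"
  by (intro image_mult_left image_mult_right)

lemma image_eq_iff_diff: "\<pi> a = \<pi> b \<longleftrightarrow> \<pi> (a - b) = \<pi> 0"
  using image_add_cong[of a b "- b" "- b"] image_add_cong[of "a - b" 0 b b] by auto

context
  fixes M :: "('a, 'm) module"
  assumes M: "left_module A M"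
begin

interpretation M: left_module A M by (rule M)

lemma act_closed: "m \<in> carrier M \<Longrightarrow> \<pi> a \<odot>\<^bsub>M\<^esub> m \<in> carrier M"
  by (simp add: M.smult_closed)

lemma act_add: "m \<in> carrier M \<Longrightarrow> \<pi> (a + b) \<odot>\<^bsub>M\<^esub> m = \<pi> a \<odot>\<^bsub>M\<^esub> m \<oplus>\<^bsub>M\<^esub> \<pi> b \<odot>\<^bsub>M\<^esub> m"
  by (simp add: M.smult_l_distr flip: add_image)

lemma act_mult: "m \<in> carrier M \<Longrightarrow> \<pi> (a * b) \<odot>\<^bsub>M\<^esub> m = \<pi> a \<odot>\<^bsub>M\<^esub> (\<pi> b \<odot>\<^bsub>M\<^esub> m)"
  by (simp add: M.smult_assoc1 flip: mult_image)

lemma act_one: "m \<in> carrier M \<Longrightarrow> \<pi> 1 \<odot>\<^bsub>M\<^esub> m = m"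
  by (simp add: M.smult_one flip: one_image)

lemma act_zero: "m \<in> carrier M \<Longrightarrow> \<pi> 0 \<odot>\<^bsub>M\<^esub> m = \<zero>\<^bsub>M\<^esub>"
  using act_add[of m 0 0] act_closed[of m 0] M.M.add.l_cancel_one' by force

lemma act_on_zero: "\<pi> a \<odot>\<^bsub>M\<^esub> \<zero>\<^bsub>M\<^esub> = \<zero>\<^bsub>M\<^esub>"
  using act_mult[of "\<zero>\<^bsub>M\<^esub>" a 0] act_zero[of "\<zero>\<^bsub>M\<^esub>"] by simp

lemma act_radd: "m \<in> carrier M \<Longrightarrow> n \<in> carrier M \<Longrightarrow>
    \<pi> a \<odot>\<^bsub>M\<^esub> (m \<oplus>\<^bsub>M\<^esub> n) = \<pi> a \<odot>\<^bsub>M\<^esub> m \<oplus>\<^bsub>M\<^esub> \<pi> a \<odot>\<^bsub>M\<^esub> n"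
  by (simp add: M.smult_r_distr)

lemma act_minus: "m \<in> carrier M \<Longrightarrow> \<pi> (- a) \<odot>\<^bsub>M\<^esub> m = \<ominus>\<^bsub>M\<^esub> (\<pi> a \<odot>\<^bsub>M\<^esub> m)"
  using act_add[of m "- a" a] act_zero[of m] act_closed[of m] M.M.minus_equality by simp

lemma act_eq_iff:
  assumes "m \<in> carrier M"
  shows "\<pi> a \<odot>\<^bsub>M\<^esub> m = \<pi> b \<odot>\<^bsub>M\<^esub> m \<longleftrightarrow> \<pi> (a - b) \<odot>\<^bsub>M\<^esub> m = \<zero>\<^bsub>M\<^esub>"
proof -
  have "\<pi> (a - b) \<odot>\<^bsub>M\<^esub> m = \<pi> a \<odot>\<^bsub>M\<^esub> m \<ominus>\<^bsub>M\<^esub> \<pi> b \<odot>\<^bsub>M\<^esub> m"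
    using act_add[OF assms, of a "- b"] act_minus[OF assms, of b] by (simp add: a_minus_def)
  then show ?thesis using act_closed[OF assms]
    by (metis M.M.minus_eq M.M.minus_equality M.M.minus_minus M.M.r_neg M.M.a_inv_closed)
qed

lemma act_sc_cancel:
  assumes "m \<in> carrier M" "\<pi> (sc c) \<odot>\<^bsub>M\<^esub> m = \<zero>\<^bsub>M\<^esub>" "m \<noteq> \<zero>\<^bsub>M\<^esub>"
  shows "c = 0"
proof (rule ccontr)
  assume "c \<noteq> 0"
  then have "m = \<pi> (sc (1 / c) * sc c) \<odot>\<^bsub>M\<^esub> m"
    using assms(1) by (simp add: act_one sc_one flip: sc_mult)
  also have "\<dots> = \<zero>\<^bsub>M\<^esub>" using assms by (simp add: act_mult act_on_zero)
  finally show False using assms(3) by simp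
qed

lemma act_sum_in:
  assumes "m \<in> carrier M" "\<zero>\<^bsub>M\<^esub> \<in> N" "\<And>x y. x \<in> N \<Longrightarrow> y \<in> N \<Longrightarrow> x \<oplus>\<^bsub>M\<^esub> y \<in> N"
    and "\<And>i. i \<in> S \<Longrightarrow> \<pi> (f i) \<odot>\<^bsub>M\<^esub> m \<in> N"
  shows "\<pi> (sum f S) \<odot>\<^bsub>M\<^esub> m \<in> N"
  using assms(4)
  by (induction S rule: infinite_finite_induct) (auto simp: act_zero act_add assms(1-3))

lemma submodule_iff:
  "Module.submodule N A M \<longleftrightarrow> N \<subseteq> carrier M \<and> \<zero>\<^bsub>M\<^esub> \<in> N \<and>
     (\<forall>x\<in>N. \<forall>y\<in>N. x \<oplus>\<^bsub>M\<^esub> y \<in> N) \<and> (\<forall>a. \<forall>x\<in>N. \<pi> a \<odot>\<^bsub>M\<^esub> x \<in> N)"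
proof
  assume N: "Module.submodule N A M"
  interpret N: subgroup N "add_monoid M" using N by (rule Module.submodule.axioms)
  have "N \<subseteq> carrier M" "\<zero>\<^bsub>M\<^esub> \<in> N" "x \<in> N \<Longrightarrow> y \<in> N \<Longrightarrow> x \<oplus>\<^bsub>M\<^esub> y \<in> N" for x y
    using N.subset N.one_closed N.m_closed by auto
  then show "N \<subseteq> carrier M \<and> \<zero>\<^bsub>M\<^esub> \<in> N \<and>
     (\<forall>x\<in>N. \<forall>y\<in>N. x \<oplus>\<^bsub>M\<^esub> y \<in> N) \<and> (\<forall>a. \<forall>x\<in>N. \<pi> a \<odot>\<^bsub>M\<^esub> x \<in> N)"
    by (simp add: Module.submodule.smult_closed[OF N])
next
  assume *: "N \<subseteq> carrier M \<and> \<zero>\<^bsub>M\<^esub> \<in> N \<and>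
     (\<forall>x\<in>N. \<forall>y\<in>N. x \<oplus>\<^bsub>M\<^esub> y \<in> N) \<and> (\<forall>a. \<forall>x\<in>N. \<pi> a \<odot>\<^bsub>M\<^esub> x \<in> N)"
  have "\<ominus>\<^bsub>M\<^esub> x \<in> N" if "x \<in> N" for x
    using act_minus[of x 1] act_one[of x] * that by (metis subsetD)
  then have "subgroup N (add_monoid M)"
    using * by (intro subgroup.intro) (auto simp flip: a_inv_def)
  then show "Module.submodule N A M"
    using * by (intro Module.submodule.intro Module.submodule_axioms.intro) (auto simp: carrier_range)
qed

lemma cyclic_submodule:
  assumes "m \<in> carrier M"
  shows "Module.submodule (range (\<lambda>a. \<pi> a \<odot>\<^bsub>M\<^esub> m)) A M"
  unfolding submodule_iff
proof (intro conjI ballI allI)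
  show "\<zero>\<^bsub>M\<^esub> \<in> range (\<lambda>a. \<pi> a \<odot>\<^bsub>M\<^esub> m)"
    using act_zero[OF assms] by (metis rangeI)
qed (auto simp: act_closed assms simp flip: act_add act_mult)

lemma irreducible_cyclic:
  assumes "irreducible_module A M" "m \<in> carrier M" "m \<noteq> \<zero>\<^bsub>M\<^esub>"
  shows "carrier M = range (\<lambda>a. \<pi> a \<odot>\<^bsub>M\<^esub> m)"
proof -
  have "m \<in> range (\<lambda>a. \<pi> a \<odot>\<^bsub>M\<^esub> m)" using act_one[OF assms(2)] by (metis rangeI)
  then show ?thesis
    using assms cyclic_submodule[OF assms(2)] unfolding irreducible_module_def by blast
qed

lemma submodule_left_module:
  assumes "Module.submodule N A M"
  shows "left_module A (M\<lparr>carrier := N\<rparr>)"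
proof -
  note N = assms[unfolded submodule_iff]
  have "abelian_group (M\<lparr>carrier := N\<rparr>)"
  proof (rule abelian_groupI)
    fix x assume "x \<in> carrier (M\<lparr>carrier := N\<rparr>)"
    then have "\<ominus>\<^bsub>M\<^esub> x \<in> N" "x \<in> carrier M"
      using act_minus[of x 1] act_one[of x] N by (auto, metis subsetD)
    then show "\<exists>y\<in>carrier (M\<lparr>carrier := N\<rparr>). y \<oplus>\<^bsub>M\<lparr>carrier := N\<rparr>\<^esub> x = \<zero>\<^bsub>M\<lparr>carrier := N\<rparr>\<^esub>"
      by (auto intro!: bexI[of _ "\<ominus>\<^bsub>M\<^esub> x"] M.M.l_neg)
  qed (use N in \<open>auto simp: M.M.a_ac subset_iff\<close>)
  then show ?thesis
    using N by (auto intro!: left_module.intro left_module_axioms.intro ring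
        simp: carrier_range act_mult[simplified] act_add subset_iff act_radd one_image act_one mult_image add_image)
qed

end

text \<open>
  Both modules are the quotient of the algebra by the common annihilator of the two generators.
\<close>

lemma cyclic_isomorphic:
  assumes M: "left_module A M" and N: "left_module A N"
    and m: "m \<in> carrier M" "carrier M = range (\<lambda>a. \<pi> a \<odot>\<^bsub>M\<^esub> m)"
    and n: "n \<in> carrier N" "carrier N = range (\<lambda>a. \<pi> a \<odot>\<^bsub>N\<^esub> n)"
    and ann: "\<And>a. \<pi> a \<odot>\<^bsub>M\<^esub> m = \<zero>\<^bsub>M\<^esub> \<longleftrightarrow> \<pi> a \<odot>\<^bsub>N\<^esub> n = \<zero>\<^bsub>N\<^esub>"
  shows "module_isomorphic A M N"
proof -
  have eq: "\<pi> a \<odot>\<^bsub>M\<^esub> m = \<pi> b \<odot>\<^bsub>M\<^esub> m \<longleftrightarrow> \<pi> a \<odot>\<^bsub>N\<^esub> n = \<pi> b \<odot>\<^bsub>N\<^esub> n" for a b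
    using act_eq_iff[OF M m(1)] act_eq_iff[OF N n(1)] ann by blast
  define f where "f x = \<pi> (SOME a. \<pi> a \<odot>\<^bsub>M\<^esub> m = x) \<odot>\<^bsub>N\<^esub> n" for x
  have f: "f (\<pi> a \<odot>\<^bsub>M\<^esub> m) = \<pi> a \<odot>\<^bsub>N\<^esub> n" for a
    unfolding f_def eq[symmetric] by (rule someI) simp
  have "f \<in> module_hom A M N"
    unfolding module_hom_def carrier_range m(2)
    by (auto simp: f n act_closed[OF N] simp flip: act_add[OF M m(1)] act_add[OF N n(1)]
         act_mult[OF M m(1)] act_mult[OF N n(1)])
  moreover have "bij_betw f (carrier M) (carrier N)"
    unfolding bij_betw_def m(2) n(2) by (auto simp: inj_on_def f eq image_image)
  ultimately show ?thesis unfolding module_isomorphic_def by blast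
qed

end

section \<open>Matrix units over a corner\<close>

lemma base_algebra_presentation:
  "algebra_presentation (base_algebra :: ('k::field, 'k) module) (\<lambda>c. c) (\<lambda>c. c)"
  by standard (auto simp: base_algebra_def type_algebra_def algebra_simps)

lemma base_algebra_field: "field (base_algebra :: ('k::field, 'k) module)"
proof -
  interpret B: algebra_presentation "base_algebra :: ('k, 'k) module" "\<lambda>c. c" "\<lambda>c. c"
    by (rule base_algebra_presentation)
  have [simp]: "carrier (base_algebra :: ('k, 'k) module) = UNIV"
    and [simp]: "\<zero>\<^bsub>base_algebra :: ('k, 'k) module\<^esub> = 0"
    using B.carrier_range B.zero_image by simp_all
  have "cring (base_algebra :: ('k, 'k) module)"
    using B.ring by (intro cring.intro comm_monoid.intro comm_monoid_axioms.intro)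
      (auto simp: B.mult_image algebra_simps ring_def)
  then show ?thesis
  proof (rule cring.cring_fieldI2)
    show "\<zero>\<^bsub>base_algebra :: ('k, 'k) module\<^esub> \<noteq> \<one>\<^bsub>base_algebra\<^esub>"
      by (simp add: B.one_image)
  next
    fix a :: 'k assume "a \<in> carrier base_algebra" "a \<noteq> \<zero>\<^bsub>base_algebra\<^esub>"
    then show "\<exists>b\<in>carrier base_algebra. a \<otimes>\<^bsub>base_algebra\<^esub> b = \<one>\<^bsub>base_algebra\<^esub>"
      by (intro bexI[of _ "1 / a"]) (simp_all add: B.mult_image B.one_image)
  qed
qed

text \<open>
  The elements \<open>u p\<close> and \<open>w p\<close> are a column and a row of matrix units: \<open>u p\<close> goes from the corner
  \<open>\<epsilon>\<close> to the position \<open>p\<close>, and \<open>w p\<close> goes back. The corner ring is spanned by \<open>\<epsilon>\<close> and a square-zero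
  element \<open>y\<close>. With \<open>y = 0\<close> this describes matrices over the field, with \<open>y\<close> independent of \<open>\<epsilon>\<close>
  matrices over the dual numbers, and both can be treated together.
\<close>

locale matrix_units = algebra_presentation A \<pi> sc
  for A :: "('k::field, 'a) module" and \<pi> :: "'r::ring_1 \<Rightarrow> 'a" and sc :: "'k \<Rightarrow> 'r" +
  fixes P :: "'p set" and u w :: "'p \<Rightarrow> 'r" and \<epsilon> y :: 'r
  assumes finite_P: "finite P"
    and row_col: "\<lbrakk>p \<in> P; q \<in> P\<rbrakk> \<Longrightarrow> \<pi> (w p * u q) = \<pi> (if p = q then \<epsilon> else 0)"
    and partition: "\<pi> (\<Sum>p\<in>P. u p * w p) = \<pi> 1"
    and u_idem: "p \<in> P \<Longrightarrow> \<pi> (u p * \<epsilon>) = \<pi> (u p)"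
    and idem_w: "p \<in> P \<Longrightarrow> \<pi> (\<epsilon> * w p) = \<pi> (w p)"
    and idem_idem: "\<pi> (\<epsilon> * \<epsilon>) = \<pi> \<epsilon>"
    and idem_y: "\<pi> (\<epsilon> * y) = \<pi> y"
    and y_idem: "\<pi> (y * \<epsilon>) = \<pi> y"
    and y_y: "\<pi> (y * y) = \<pi> 0"
    and corner: "\<exists>c d. \<pi> (\<epsilon> * a * \<epsilon>) = \<pi> (sc c * \<epsilon> + sc d * y)"
begin

lemma image_eqI:
  assumes "\<And>p. p \<in> P \<Longrightarrow> \<pi> (w p * a) = \<pi> (w p * b)"
  shows "\<pi> a = \<pi> b"
proof -
  have "\<pi> ((\<Sum>p\<in>P. u p * w p) * a) = \<pi> ((\<Sum>p\<in>P. u p * w p) * b)"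
    unfolding sum_distrib_right mult.assoc by (intro image_sum_cong image_mult_left assms)
  then show ?thesis
    using image_mult_right[OF partition, of a] image_mult_right[OF partition, of b] by simp
qed

lemma act_in_sumI:
  fixes M :: "('a, 'm) module"
  assumes M: "left_module A M" and m: "m \<in> carrier M"
    and N: "\<zero>\<^bsub>M\<^esub> \<in> N" "\<And>x y. x \<in> N \<Longrightarrow> y \<in> N \<Longrightarrow> x \<oplus>\<^bsub>M\<^esub> y \<in> N"
    and "\<And>p. p \<in> P \<Longrightarrow> \<pi> (u p * w p) \<odot>\<^bsub>M\<^esub> m \<in> N"
  shows "m \<in> N"
proof -
  have "\<pi> (\<Sum>p\<in>P. u p * w p) \<odot>\<^bsub>M\<^esub> m \<in> N"
    using assms by (intro act_sum_in[OF M m]) auto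
  then show ?thesis using act_one[OF M m] partition by simp
qed

lemma act_zeroI:
  fixes M :: "('a, 'm) module"
  assumes M: "left_module A M" and m: "m \<in> carrier M"
    and "\<And>p. p \<in> P \<Longrightarrow> \<pi> (w p) \<odot>\<^bsub>M\<^esub> m = \<zero>\<^bsub>M\<^esub>"
  shows "m = \<zero>\<^bsub>M\<^esub>"
proof -
  interpret M: left_module A M by (rule M)
  have "m \<in> {\<zero>\<^bsub>M\<^esub>}"
    using assms(3) by (intro act_in_sumI[OF M m]) (auto simp: act_mult[OF M m] act_on_zero[OF M])
  then show ?thesis by simp
qed

text \<open>
  Some \<open>w p\<close> moves \<open>m\<close> to a nonzero vector \<open>n\<close> of the corner. Since \<open>y\<close> has square zero, either \<open>n\<close>
  or \<open>y n\<close> is killed by \<open>y\<close> and nonzero.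
\<close>

lemma corner_vector_exists:
  fixes M :: "('a, 'm) module"
  assumes M: "left_module A M" and "m \<in> carrier M" "m \<noteq> \<zero>\<^bsub>M\<^esub>"
  shows "\<exists>n\<in>carrier M. n \<noteq> \<zero>\<^bsub>M\<^esub> \<and> \<pi> \<epsilon> \<odot>\<^bsub>M\<^esub> n = n \<and> \<pi> y \<odot>\<^bsub>M\<^esub> n = \<zero>\<^bsub>M\<^esub>"
proof -
  obtain p where p: "p \<in> P" "\<pi> (w p) \<odot>\<^bsub>M\<^esub> m \<noteq> \<zero>\<^bsub>M\<^esub>"
    using act_zeroI[OF M] assms by blast
  let ?n = "\<pi> (w p) \<odot>\<^bsub>M\<^esub> m"
  have n: "?n \<in> carrier M" using assms act_closed[OF M] by simp
  have 1: "\<pi> \<epsilon> \<odot>\<^bsub>M\<^esub> ?n = ?n"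
    using p assms by (simp add: idem_w flip: act_mult[OF M])
  have 2: "\<pi> \<epsilon> \<odot>\<^bsub>M\<^esub> (\<pi> y \<odot>\<^bsub>M\<^esub> ?n) = \<pi> y \<odot>\<^bsub>M\<^esub> ?n"
    using n by (simp add: idem_y flip: act_mult[OF M, of ?n])
  have 3: "\<pi> y \<odot>\<^bsub>M\<^esub> (\<pi> y \<odot>\<^bsub>M\<^esub> ?n) = \<zero>\<^bsub>M\<^esub>"
    using n by (simp add: y_y act_zero[OF M n] flip: act_mult[OF M, of ?n])
  show ?thesis
    using n p(2) 1 2 3 act_closed[OF M n] by (cases "\<pi> y \<odot>\<^bsub>M\<^esub> ?n = \<zero>\<^bsub>M\<^esub>") blast+
qed

text \<open>
  The right hand side does not mention the module. This is why two irreducible modules are isomorphic: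
  both are generated by a vector of this kind, and the two vectors have the same annihilator.
\<close>

lemma annihilator_iff:
  fixes M :: "('a, 'm) module"
  assumes M: "left_module A M" and m: "m \<in> carrier M" "m \<noteq> \<zero>\<^bsub>M\<^esub>" "\<pi> \<epsilon> \<odot>\<^bsub>M\<^esub> m = m"
      "\<pi> y \<odot>\<^bsub>M\<^esub> m = \<zero>\<^bsub>M\<^esub>"
  shows "\<pi> a \<odot>\<^bsub>M\<^esub> m = \<zero>\<^bsub>M\<^esub> \<longleftrightarrow> (\<forall>p\<in>P. \<exists>d. \<pi> (w p * a * \<epsilon>) = \<pi> (sc d * y))"
proof (intro iffI ballI)
  note [simp] = act_mult[OF M] act_add[OF M] m act_closed[OF M] act_on_zero[OF M]
  fix p assume a: "\<pi> a \<odot>\<^bsub>M\<^esub> m = \<zero>\<^bsub>M\<^esub>" and p: "p \<in> P"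
  obtain c d where cd: "\<pi> (\<epsilon> * (w p * a) * \<epsilon>) = \<pi> (sc c * \<epsilon> + sc d * y)"
    using corner by blast
  have eq: "\<pi> (w p * a * \<epsilon>) = \<pi> (sc c * \<epsilon> + sc d * y)"
    using image_mult_right[OF idem_w[OF p], of "a * \<epsilon>"] cd by (simp add: mult.assoc)
  have "\<pi> (w p * a * \<epsilon>) \<odot>\<^bsub>M\<^esub> m = \<zero>\<^bsub>M\<^esub>" using a by simp
  then have "\<pi> (sc c) \<odot>\<^bsub>M\<^esub> m = \<zero>\<^bsub>M\<^esub>"
    using left_module.axioms(2)[OF M] unfolding eq by (simp add: abelian_group_def abelian_monoid.r_zero)
  then have "c = 0" using act_sc_cancel[OF M m(1) _ m(2)] by blast
  then show "\<exists>d. \<pi> (w p * a * \<epsilon>) = \<pi> (sc d * y)" using eq by (auto simp: sc_zero)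
next
  note [simp] = act_mult[OF M] act_add[OF M] m act_closed[OF M] act_on_zero[OF M]
  assume *: "\<forall>p\<in>P. \<exists>d. \<pi> (w p * a * \<epsilon>) = \<pi> (sc d * y)"
  show "\<pi> a \<odot>\<^bsub>M\<^esub> m = \<zero>\<^bsub>M\<^esub>"
  proof (rule act_zeroI[OF M])
    fix p assume "p \<in> P"
    then obtain d where "\<pi> (w p * a * \<epsilon>) = \<pi> (sc d * y)" using * by blast
    then have "\<pi> (w p * a * \<epsilon>) \<odot>\<^bsub>M\<^esub> m = \<pi> (sc d * y) \<odot>\<^bsub>M\<^esub> m" by simp
    then show "\<pi> (w p) \<odot>\<^bsub>M\<^esub> (\<pi> a \<odot>\<^bsub>M\<^esub> m) = \<zero>\<^bsub>M\<^esub>" by simp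
  qed simp
qed

lemma irreducible_unique:
  fixes M :: "('a, 'm) module" and N :: "('a, 'n) module"
  assumes "irreducible_module A M" "irreducible_module A N"
  shows "module_isomorphic A M N"
proof -
  have M: "left_module A M" and N: "left_module A N"
    using assms by (simp_all add: irreducible_module_def)
  have ex: "\<exists>m\<in>carrier M. m \<noteq> \<zero>\<^bsub>M\<^esub>" if "irreducible_module A M" for M :: "('a, 'x) module"
  proof -
    interpret left_module A M using that by (simp add: irreducible_module_def)
    show ?thesis using that M.zero_closed unfolding irreducible_module_def by blast
  qed
  obtain m where m: "m \<in> carrier M" "m \<noteq> \<zero>\<^bsub>M\<^esub>" "\<pi> \<epsilon> \<odot>\<^bsub>M\<^esub> m = m" "\<pi> y \<odot>\<^bsub>M\<^esub> m = \<zero>\<^bsub>M\<^esub>"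
    using corner_vector_exists[OF M] ex[OF assms(1)] by blast
  obtain n where n: "n \<in> carrier N" "n \<noteq> \<zero>\<^bsub>N\<^esub>" "\<pi> \<epsilon> \<odot>\<^bsub>N\<^esub> n = n" "\<pi> y \<odot>\<^bsub>N\<^esub> n = \<zero>\<^bsub>N\<^esub>"
    using corner_vector_exists[OF N] ex[OF assms(2)] by blast
  show ?thesis
    using irreducible_cyclic[OF M assms(1) m(1,2)] irreducible_cyclic[OF N assms(2) n(1,2)]
    by (intro cyclic_isomorphic[OF M N m(1) _ n(1)])
      (simp_all add: annihilator_iff[OF M m] annihilator_iff[OF N n])
qed

context
  fixes L :: "('a, 'm) module" and v :: 'm
  assumes L: "left_module A L"
    and v: "v \<in> carrier L" "v \<noteq> \<zero>\<^bsub>L\<^esub>" "\<pi> \<epsilon> \<odot>\<^bsub>L\<^esub> v = v"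
    and line: "\<And>f. f \<in> carrier L \<Longrightarrow> \<exists>c. \<pi> \<epsilon> \<odot>\<^bsub>L\<^esub> f = \<pi> (sc c) \<odot>\<^bsub>L\<^esub> v"
begin

lemma line_row:
  assumes "p \<in> P" "f \<in> carrier L"
  shows "\<exists>c. \<pi> (w p) \<odot>\<^bsub>L\<^esub> f = \<pi> (sc c) \<odot>\<^bsub>L\<^esub> v"
proof -
  have "\<pi> (w p) \<odot>\<^bsub>L\<^esub> f = \<pi> \<epsilon> \<odot>\<^bsub>L\<^esub> (\<pi> (w p) \<odot>\<^bsub>L\<^esub> f)"
    using assms by (simp add: idem_w flip: act_mult[OF L])
  then show ?thesis using line[of "\<pi> (w p) \<odot>\<^bsub>L\<^esub> f"] assms act_closed[OF L] by simp
qed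

text \<open>
  The hypotheses of this context say that the corner of \<open>L\<close> is the line through \<open>v\<close>. A nonzero
  submodule meets the corner, hence contains \<open>v\<close>, and \<open>v\<close> generates \<open>L\<close> because every vector is
  recovered from its rows \<open>w p f\<close> on that line.
\<close>

lemma irreducible_criterion: "irreducible_module A L"
  unfolding irreducible_module_def
proof (intro conjI allI impI L)
  show "carrier L \<noteq> {\<zero>\<^bsub>L\<^esub>}" using v by blast
  fix N assume "Module.submodule N A L"
  note N = this[unfolded submodule_iff[OF L]]
  show "N = {\<zero>\<^bsub>L\<^esub>} \<or> N = carrier L"
  proof (cases "N = {\<zero>\<^bsub>L\<^esub>}")
    case False
    then obtain f where f: "f \<in> N" "f \<noteq> \<zero>\<^bsub>L\<^esub>" using N by blast
    have fL: "f \<in> carrier L" using N f(1) by (meson subsetD)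
    obtain p where p: "p \<in> P" "\<pi> (w p) \<odot>\<^bsub>L\<^esub> f \<noteq> \<zero>\<^bsub>L\<^esub>"
      using act_zeroI[OF L fL] f(2) by meson
    obtain c where c: "\<pi> (w p) \<odot>\<^bsub>L\<^esub> f = \<pi> (sc c) \<odot>\<^bsub>L\<^esub> v"
      using line_row[OF p(1) fL] by meson
    then have "c \<noteq> 0" using p(2) act_zero[OF L v(1)] sc_zero by auto
    then have "v = \<pi> (sc (1 / c)) \<odot>\<^bsub>L\<^esub> (\<pi> (w p) \<odot>\<^bsub>L\<^esub> f)"
      unfolding c by (simp add: sc_one act_one[OF L] v flip: act_mult[OF L] sc_mult)
    then have "v \<in> N" using N f by metis
    have "g \<in> N" if g: "g \<in> carrier L" for g
    proof (rule act_in_sumI[OF L g])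
      fix p assume "p \<in> P"
      then obtain c where "\<pi> (w p) \<odot>\<^bsub>L\<^esub> g = \<pi> (sc c) \<odot>\<^bsub>L\<^esub> v"
        using line_row g by blast
      then show "\<pi> (u p * w p) \<odot>\<^bsub>L\<^esub> g \<in> N"
        using N \<open>v \<in> N\<close> by (simp add: act_mult[OF L g])
    qed (use N in auto)
    then show ?thesis using N by blast
  qed simp
qed

text \<open>
  The vectors \<open>u p v\<close> form a basis.
\<close>

lemma dimension: "module_dim A L = card P"
proof -
  interpret L: left_module A L by (rule L)
  interpret B: algebra_presentation "base_algebra :: ('k, 'k) module" "\<lambda>c. c" "\<lambda>c. c"
    by (rule base_algebra_presentation)
  define V :: "('k, 'm) module" where
    "V = \<lparr>carrier = carrier L, mult = mult L, one = one L, zero = zero L, add = add L,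
       smult = (\<lambda>c v. (c \<odot>\<^bsub>A\<^esub> \<one>\<^bsub>A\<^esub>) \<odot>\<^bsub>L\<^esub> v)\<rparr>"
  have smV: "c \<odot>\<^bsub>V\<^esub> x = \<pi> (sc c) \<odot>\<^bsub>L\<^esub> x" for c x
    by (simp add: V_def one_image smult_image)
  have V [simp]: "carrier V = carrier L" "zero V = zero L" "add V = add L"
    by (simp_all add: V_def)
  have "abelian_group V"
    using L.M.abelian_group_axioms unfolding V_def
    by (auto simp: abelian_group_def abelian_monoid_def abelian_group_axioms_def comm_group_def
        comm_monoid_def comm_monoid_axioms_def group_def group_axioms_def monoid_def Units_def)
  then interpret V: vectorspace "base_algebra :: ('k, 'k) module" V
    unfolding vectorspace_def
    by (intro conjI base_algebra_field module.intro module_axioms.intro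
          field.axioms(1)[OF base_algebra_field, THEN domain.axioms(1)])
       (simp_all add: smV B.add_image B.mult_image B.one_image sc_add sc_mult sc_one act_closed[OF L]
          act_add[OF L] act_radd[OF L] act_mult[OF L] act_one[OF L])
  let ?b = "\<lambda>p. \<pi> (u p) \<odot>\<^bsub>L\<^esub> v"
  have b: "?b p \<in> carrier L" for p by (simp add: act_closed[OF L] v)
  have wb: "\<pi> (w q) \<odot>\<^bsub>L\<^esub> ?b p = (if p = q then v else \<zero>\<^bsub>L\<^esub>)" if "p \<in> P" "q \<in> P" for p q
    using row_col[OF that(2,1)] by (auto simp: act_zero[OF L] v simp flip: act_mult[OF L])
  have inj: "inj_on ?b P"
    by (rule inj_onI) (metis wb v(2))
  have coeff: "\<pi> (w q) \<odot>\<^bsub>L\<^esub> (\<Oplus>\<^bsub>V\<^esub>p\<in>S. c p \<odot>\<^bsub>V\<^esub> ?b p) =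
      (if q \<in> S then \<pi> (sc (c q)) \<odot>\<^bsub>L\<^esub> v else \<zero>\<^bsub>L\<^esub>)" if "S \<subseteq> P" "q \<in> P" for S q c
  proof -
    have "finite S" using that finite_P finite_subset by blast
    then show ?thesis using that(1)
    proof (induction S rule: finite_induct)
      case empty
      then show ?case using act_on_zero[OF L] by simp
    next
      case (insert p S)
      let ?s = "\<Oplus>\<^bsub>V\<^esub>p\<in>S. c p \<odot>\<^bsub>V\<^esub> ?b p"
      have cb: "c p \<odot>\<^bsub>V\<^esub> ?b p \<in> carrier L" for p by (simp add: smV act_closed[OF L] v)
      have s: "?s \<in> carrier L" using V.M.finsum_closed[of _ S] cb by auto
      have "\<pi> (w q) \<odot>\<^bsub>L\<^esub> (c p \<odot>\<^bsub>V\<^esub> ?b p) = \<pi> (sc (c p)) \<odot>\<^bsub>L\<^esub> (\<pi> (w q) \<odot>\<^bsub>L\<^esub> ?b p)"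
        unfolding smV by (simp add: sc_central b flip: act_mult[OF L])
      then have "\<pi> (w q) \<odot>\<^bsub>L\<^esub> (c p \<odot>\<^bsub>V\<^esub> ?b p) = (if p = q then \<pi> (sc (c p)) \<odot>\<^bsub>L\<^esub> v else \<zero>\<^bsub>L\<^esub>)"
        using wb[of p q] insert.prems that by (simp add: act_on_zero[OF L])
      moreover have "(\<Oplus>\<^bsub>V\<^esub>p\<in>insert p S. c p \<odot>\<^bsub>V\<^esub> ?b p) = c p \<odot>\<^bsub>V\<^esub> ?b p \<oplus>\<^bsub>L\<^esub> ?s"
        using V.M.finsum_insert[OF insert.hyps, of "\<lambda>p. c p \<odot>\<^bsub>V\<^esub> ?b p"] cb by simp
      ultimately show ?case
        using insert cb s by (auto simp: act_radd[OF L] act_closed[OF L] v)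
    qed
  qed
  have lc: "V.lincomb a (?b ` P) = (\<Oplus>\<^bsub>V\<^esub>p\<in>P. a (?b p) \<odot>\<^bsub>V\<^esub> ?b p)" for a
    unfolding V.lincomb_def
    by (rule V.M.finsum_reindex[OF _ inj]) (auto simp: smV act_closed[OF L] v)
  have "V.lin_indpt (?b ` P)"
  proof (rule V.finite_lin_indpt2)
    fix a assume "V.lincomb a (?b ` P) = \<zero>\<^bsub>V\<^esub>"
    then have "\<pi> (sc (a (?b q))) \<odot>\<^bsub>L\<^esub> v = \<zero>\<^bsub>L\<^esub>" if "q \<in> P" for q
      using coeff[OF subset_refl that, of "\<lambda>p. a (?b p)"] that lc[of a]
      by (simp add: act_on_zero[OF L])
    then show "\<forall>x\<in>?b ` P. a x = \<zero>\<^bsub>base_algebra\<^esub>"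
      using act_sc_cancel[OF L v(1)] v(2) by (auto simp: B.zero_image)
  qed (auto simp: finite_P b)
  moreover have "V.gen_set (?b ` P)"
  proof -
    have "g \<in> V.span (?b ` P)" if g: "g \<in> carrier L" for g
    proof -
      have "\<forall>p\<in>P. \<exists>c. \<pi> (w p) \<odot>\<^bsub>L\<^esub> g = \<pi> (sc c) \<odot>\<^bsub>L\<^esub> v"
        using line_row g by blast
      then obtain c where c: "\<And>p. p \<in> P \<Longrightarrow> \<pi> (w p) \<odot>\<^bsub>L\<^esub> g = \<pi> (sc (c p)) \<odot>\<^bsub>L\<^esub> v"
        using bchoice by meson
      let ?a = "\<lambda>x. c (the_inv_into P ?b x)"
      let ?s = "V.lincomb ?a (?b ` P)"
      have a: "?a (?b p) = c p" if "p \<in> P" for p using the_inv_into_f_f[OF inj that] by simp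
      have s: "?s \<in> carrier L"
        using V.lincomb_closed[of "?b ` P" ?a] b B.carrier_range by (auto simp: finite_P)
      have "\<pi> (w p) \<odot>\<^bsub>L\<^esub> ?s = \<pi> (w p) \<odot>\<^bsub>L\<^esub> g" if "p \<in> P" for p
        using that coeff[OF subset_refl that, of "\<lambda>p. ?a (?b p)"] unfolding lc by (simp add: a c)
      then have "\<pi> (w p) \<odot>\<^bsub>L\<^esub> (?s \<oplus>\<^bsub>L\<^esub> \<pi> (- 1) \<odot>\<^bsub>L\<^esub> g) = \<zero>\<^bsub>L\<^esub>" if "p \<in> P" for p
        using that g act_zero[OF L g] s
        by (simp add: act_radd[OF L] act_closed[OF L] flip: act_mult[OF L] act_add[OF L])
      then have "?s \<oplus>\<^bsub>L\<^esub> \<pi> (- 1) \<odot>\<^bsub>L\<^esub> g = \<zero>\<^bsub>L\<^esub>"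
        using act_zeroI[OF L] s g act_closed[OF L] by simp
      then have "?s \<oplus>\<^bsub>L\<^esub> \<ominus>\<^bsub>L\<^esub> g = \<zero>\<^bsub>L\<^esub>"
        using act_minus[OF L g, of 1] act_one[OF L g] by simp
      then have "?s = g"
        using L.M.minus_equality[of ?s "\<ominus>\<^bsub>L\<^esub> g"] L.M.minus_minus[OF g] s g by simp
      then show ?thesis
        unfolding V.span_def mem_Collect_eq
        by (intro exI[of _ ?a] exI[of _ "?b ` P"] conjI) (simp_all add: finite_P B.carrier_range)
    qed
    then show ?thesis using V.span_is_subset2[of "?b ` P"] b by auto
  qed
  ultimately have "V.basis (?b ` P)" using b by (auto simp: V.basis_def)
  then have "V.dim = card P"
    using V.dim_basis[of "?b ` P"] finite_P card_image[OF inj] by simp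
  then show ?thesis unfolding module_dim_def V_def .
qed

end

end

context matrix_units
begin

section \<open>Matrix algebras\<close>

text \<open>
  The \<open>(p, q)\<close> entry of the matrix of \<open>a\<close> is the corner element \<open>w p a u q\<close>. The map \<open>\<tau>\<close> is a section
  that identifies the coefficient algebra \<open>B\<close> with the corner; it need only be multiplicative modulo \<open>\<pi>\<close>.
\<close>

lemma matrix_algebra_isomorphic:
  fixes B :: "('k, 'b) module" and \<rho> :: "'s::ring_1 \<Rightarrow> 'b" and scB :: "'k \<Rightarrow> 's" and \<tau> :: "'s \<Rightarrow> 'r"
  assumes B: "algebra_presentation B \<rho> scB"
    and \<tau>_add: "\<And>s t. \<pi> (\<tau> (s + t)) = \<pi> (\<tau> s + \<tau> t)"
    and \<tau>_mult: "\<And>s t. \<pi> (\<tau> (s * t)) = \<pi> (\<tau> s * \<tau> t)"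
    and \<tau>_one: "\<pi> (\<tau> 1) = \<pi> \<epsilon>"
    and \<tau>_smult: "\<And>c s. \<pi> (\<tau> (scB c * s)) = \<pi> (sc c * \<tau> s)"
    and \<tau>_eq: "\<And>s t. \<rho> s = \<rho> t \<longleftrightarrow> \<pi> (\<tau> s) = \<pi> (\<tau> t)"
    and \<tau>_surj: "\<And>a. \<exists>s. \<pi> (\<epsilon> * a * \<epsilon>) = \<pi> (\<tau> s)"
  shows "algebra_isomorphic A (matrix_algebra (card P) B)"
proof -
  interpret B: algebra_presentation B \<rho> scB by (rule B)
  obtain e where e: "bij_betw e {..<card P} P"
    using ex_bij_betw_nat_finite[OF finite_P] by (auto simp: atLeast0LessThan)
  have eP: "i < card P \<Longrightarrow> e i \<in> P" for i using e by (auto simp: bij_betw_def)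
  have e_inj: "i < card P \<Longrightarrow> j < card P \<Longrightarrow> e i = e j \<longleftrightarrow> i = j" for i j
    using e by (auto simp: bij_betw_def inj_on_def)
  define T where "T a = (SOME s. \<pi> (\<epsilon> * a * \<epsilon>) = \<pi> (\<tau> s))" for a
  have T: "\<pi> (\<tau> (T a)) = \<pi> (\<epsilon> * a * \<epsilon>)" for a
    unfolding T_def by (rule someI_ex[OF \<tau>_surj, symmetric])
  define \<beta> where "\<beta> a = \<rho> (T a)" for a
  have \<beta>I: "\<beta> a = \<rho> s" if "\<pi> (\<epsilon> * a * \<epsilon>) = \<pi> (\<tau> s)" for a s
    unfolding \<beta>_def using that by (simp add: \<tau>_eq T)
  have \<beta>_eq: "\<beta> a = \<beta> b \<longleftrightarrow> \<pi> (\<epsilon> * a * \<epsilon>) = \<pi> (\<epsilon> * b * \<epsilon>)" for a b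
    unfolding \<beta>_def by (simp add: \<tau>_eq T)
  have \<beta>_cong: "\<pi> a = \<pi> b \<Longrightarrow> \<beta> a = \<beta> b" for a b
    unfolding \<beta>_eq by (rule image_mult_both)
  have \<beta>_carrier: "\<beta> a \<in> carrier B" for a by (simp add: \<beta>_def)
  have \<beta>_add: "\<beta> (a + b) = \<beta> a \<oplus>\<^bsub>B\<^esub> \<beta> b" for a b
  proof -
    have "\<pi> (\<epsilon> * (a + b) * \<epsilon>) = \<pi> (\<tau> (T a + T b))"
      unfolding \<tau>_add distrib_left distrib_right by (intro image_add_cong T[symmetric])
    from \<beta>I[OF this] show ?thesis by (simp add: \<beta>_def B.add_image)
  qed
  have \<beta>_zero: "\<beta> 0 = \<zero>\<^bsub>B\<^esub>"
  proof -
    have "\<pi> (\<tau> 0 - (\<tau> 0 + \<tau> 0)) = \<pi> 0"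
      using \<tau>_add[of 0 0] image_eq_iff_diff[of "\<tau> 0" "\<tau> 0 + \<tau> 0"] by simp
    then have "\<pi> (- 1 * - \<tau> 0) = \<pi> (- 1 * 0)" by (intro image_mult_left) simp
    then have "\<pi> (\<epsilon> * 0 * \<epsilon>) = \<pi> (\<tau> 0)" by simp
    from \<beta>I[OF this] show ?thesis by (simp add: B.zero_image)
  qed
  have \<beta>_mult: "\<beta> (a * \<epsilon> * b) = \<beta> a \<otimes>\<^bsub>B\<^esub> \<beta> b" for a b
  proof -
    have "\<pi> (\<epsilon> * (a * \<epsilon> * b) * \<epsilon>) = \<pi> ((\<epsilon> * a) * (\<epsilon> * \<epsilon>) * (b * \<epsilon>))"
      using image_mult_both[OF idem_idem, of "\<epsilon> * a" "b * \<epsilon>"] by (simp add: mult.assoc)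
    also have "\<dots> = \<pi> (\<tau> (T a) * \<tau> (T b))"
      using image_mult_cong[OF T[of a] T[of b]] by (simp add: mult.assoc)
    also have "\<dots> = \<pi> (\<tau> (T a * T b))" by (simp add: \<tau>_mult)
    from \<beta>I[OF trans[OF calculation this]] show ?thesis by (simp add: \<beta>_def B.mult_image)
  qed
  have \<beta>_smult: "\<beta> (sc c * a) = c \<odot>\<^bsub>B\<^esub> \<beta> a" for c a
  proof -
    have "\<pi> (\<epsilon> * (sc c * a) * \<epsilon>) = \<pi> (sc c * (\<epsilon> * a * \<epsilon>))"
      by (metis mult.assoc sc_central)
    also have "\<dots> = \<pi> (\<tau> (scB c * T a))"
      using image_mult_left[OF T, of "sc c" a] by (simp add: \<tau>_smult)
    from \<beta>I[OF trans[OF calculation this]] show ?thesis by (simp add: \<beta>_def B.smult_image)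
  qed
  have \<beta>_one: "\<beta> \<epsilon> = \<one>\<^bsub>B\<^esub>"
  proof -
    have "\<pi> (\<epsilon> * \<epsilon> * \<epsilon>) = \<pi> (\<tau> 1)"
      using image_mult_right[OF idem_idem, of \<epsilon>] by (simp add: \<tau>_one idem_idem)
    from \<beta>I[OF this] show ?thesis by (simp add: B.one_image)
  qed
  have \<beta>_sum: "\<beta> (sum f S) = (\<Oplus>\<^bsub>B\<^esub>k\<in>S. \<beta> (f k))" if "finite S" for f :: "nat \<Rightarrow> 'r" and S
    using that
  proof (induction S rule: finite_induct)
    case (insert k S)
    then show ?case
      using B.A.finsum_insert[OF insert.hyps, of "\<lambda>k. \<beta> (f k)"] by (simp add: \<beta>_add \<beta>_carrier)
  qed (simp add: \<beta>_zero)
  have uw: "\<pi> (\<Sum>k<card P. u (e k) * w (e k)) = \<pi> 1"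
    using partition sum.reindex_bij_betw[OF e, of "\<lambda>p. u p * w p"] by simp
  let ?D = "{..<card P} \<times> {..<card P}"
  define G where "G a = (\<lambda>(i, j)\<in>?D. \<beta> (w (e i) * a * u (e j)))" for a
  have G_cong: "G a = G b" if "\<pi> a = \<pi> b" for a b
    unfolding G_def by (intro restrict_ext) (auto intro!: \<beta>_cong image_mult_both that)
  define F where "F x = G (SOME a. \<pi> a = x)" for x
  have F: "F (\<pi> a) = G a" for a
    unfolding F_def by (rule G_cong) (rule someI, rule refl)
  let ?Mat = "matrix_algebra (card P) B"
  have wau: "\<pi> (\<epsilon> * (w (e i) * a * u (e j)) * \<epsilon>) = \<pi> (w (e i) * a * u (e j))"
    if "i < card P" "j < card P" for i j a
    using image_mult_cong[OF image_mult_right[OF idem_w[OF eP[OF that(1)]], of a] u_idem[OF eP[OF that(2)]]]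
    by (simp add: mult.assoc)
  have G_inj: "\<pi> a = \<pi> b" if "G a = G b" for a b
  proof (rule image_eqI)
    fix p assume "p \<in> P"
    then obtain i where i: "i < card P" "p = e i" using e by (auto simp: bij_betw_def)
    have *: "\<pi> (w p * a * u (e j)) = \<pi> (w p * b * u (e j))" if j: "j < card P" for j
    proof -
      have "\<beta> (w (e i) * a * u (e j)) = \<beta> (w (e i) * b * u (e j))"
        using fun_cong[OF \<open>G a = G b\<close>, of "(i, j)"] i j by (simp add: G_def)
      then show ?thesis unfolding \<beta>_eq using wau[OF i(1) j] i(2) by simp
    qed
    have "\<pi> (w p * a * (\<Sum>k<card P. u (e k) * w (e k))) = \<pi> (w p * b * (\<Sum>k<card P. u (e k) * w (e k)))"
      unfolding sum_distrib_left mult.assoc[symmetric] by (intro image_sum_cong image_mult_right *) simp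
    then show "\<pi> (w p * a) = \<pi> (w p * b)"
      using image_mult_left[OF uw, of "w p * a"] image_mult_left[OF uw, of "w p * b"] by simp
  qed
  have G_surj: "\<exists>a. G a = M" if M: "M \<in> ?D \<rightarrow>\<^sub>E carrier B" for M
  proof -
    have "\<forall>x\<in>?D. \<exists>s. M x = \<rho> s" using M by (auto simp: B.carrier_range)
    then obtain S where S: "\<And>x. x \<in> ?D \<Longrightarrow> M x = \<rho> (S x)" using bchoice[of ?D "\<lambda>x s. M x = \<rho> s"] by auto
    define a where "a = (\<Sum>k<card P. \<Sum>m<card P. u (e k) * \<tau> (S (k, m)) * w (e m))"
    have "G a = M"
    proof
      fix x show "G a x = M x"
      proof (cases "x \<in> ?D")
        case True
        then obtain i j where ij: "x = (i, j)" "i < card P" "j < card P" by auto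
        let ?t = "\<tau> (S (i, j))"
        have t: "\<pi> (\<epsilon> * ?t * \<epsilon>) = \<pi> ?t"
        proof -
          have "\<pi> (\<epsilon> * ?t * \<epsilon>) = \<pi> (\<tau> 1 * ?t * \<tau> 1)"
            by (intro image_mult_cong \<tau>_one[symmetric] refl)
          also have "\<dots> = \<pi> (\<tau> (1 * S (i, j)) * \<tau> 1)" by (intro image_mult_right \<tau>_mult[symmetric])
          also have "\<dots> = \<pi> (\<tau> (1 * S (i, j) * 1))" by (simp only: \<tau>_mult)
          finally show ?thesis by simp
        qed
        have "\<pi> (w (e i) * a * u (e j)) =
            \<pi> (\<Sum>k<card P. \<Sum>m<card P. (w (e i) * u (e k)) * \<tau> (S (k, m)) * (w (e m) * u (e j)))"
          unfolding a_def sum_distrib_left sum_distrib_right by (simp only: mult.assoc)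
        also have "\<dots> = \<pi> (\<Sum>k<card P. \<Sum>m<card P. (if i = k \<and> m = j then \<epsilon> * ?t * \<epsilon> else 0))"
        proof (intro image_sum_cong)
          fix k m assume "k \<in> {..<card P}" "m \<in> {..<card P}"
          then have "\<pi> (w (e i) * u (e k) * \<tau> (S (k, m)) * (w (e m) * u (e j))) =
             \<pi> ((if i = k then \<epsilon> else 0) * \<tau> (S (k, m)) * (if m = j then \<epsilon> else 0))"
            using ij by (intro image_mult_cong refl) (simp_all add: row_col eP e_inj)
          then show "\<pi> (w (e i) * u (e k) * \<tau> (S (k, m)) * (w (e m) * u (e j))) =
             \<pi> (if i = k \<and> m = j then \<epsilon> * ?t * \<epsilon> else 0)" by (auto split: if_splits)
        qed
        also have "(\<Sum>k<card P. \<Sum>m<card P. (if i = k \<and> m = j then \<epsilon> * ?t * \<epsilon> else 0)) =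
            (\<Sum>k<card P. if i = k then \<epsilon> * ?t * \<epsilon> else 0)"
          using ij by (intro sum.cong refl) (auto simp: sum.delta)
        also have "\<dots> = \<epsilon> * ?t * \<epsilon>" using ij by (simp add: sum.delta)
        finally have "\<pi> (w (e i) * a * u (e j)) = \<pi> ?t" using t by simp
        then have "\<pi> (\<epsilon> * (w (e i) * a * u (e j)) * \<epsilon>) = \<pi> ?t" using wau[OF ij(2,3)] by simp
        then show ?thesis using ij S[OF True] \<beta>I by (simp add: G_def)
      next
        case False
        then show ?thesis using PiE_arb[OF M, of x] unfolding G_def by simp
      qed
    qed
    then show ?thesis by blast
  qed
  have Mat: "carrier ?Mat = ?D \<rightarrow>\<^sub>E carrier B" by (simp add: matrix_algebra_def Let_def)
  have G_carrier: "G a \<in> carrier ?Mat" for a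
    unfolding Mat by (auto simp: G_def \<beta>_carrier PiE_def extensional_def)
  have "F \<in> ring_iso A ?Mat"
    unfolding ring_iso_def
  proof (intro CollectI conjI ring_hom_memI)
    fix x y assume "x \<in> carrier A" "y \<in> carrier A"
    then obtain a b where [simp]: "x = \<pi> a" "y = \<pi> b" by (auto elim!: carrierE)
    show "F (x \<oplus>\<^bsub>A\<^esub> y) = F x \<oplus>\<^bsub>?Mat\<^esub> F y"
      by (auto simp: add_image F G_def matrix_algebra_def Let_def distrib_left distrib_right \<beta>_add)
    have *: "\<beta> (w (e i) * (a * b) * u (e j)) =
        (\<Oplus>\<^bsub>B\<^esub>k\<in>{..<card P}. \<beta> (w (e i) * a * u (e k)) \<otimes>\<^bsub>B\<^esub> \<beta> (w (e k) * b * u (e j)))"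
      if ij: "i < card P" "j < card P" for i j
    proof -
      have "\<pi> (w (e i) * (a * b) * u (e j)) =
          \<pi> (w (e i) * a * (\<Sum>k<card P. u (e k) * w (e k)) * (b * u (e j)))"
        using image_mult_both[OF uw, of "w (e i) * a" "b * u (e j)"] by (simp add: mult.assoc)
      also have "\<dots> = \<pi> (\<Sum>k<card P. w (e i) * a * u (e k) * (w (e k) * b * u (e j)))"
        by (simp add: sum_distrib_left sum_distrib_right mult.assoc)
      finally have "\<beta> (w (e i) * (a * b) * u (e j)) =
          \<beta> (\<Sum>k<card P. w (e i) * a * u (e k) * (w (e k) * b * u (e j)))"
        by (rule \<beta>_cong)
      also have "\<dots> = (\<Oplus>\<^bsub>B\<^esub>k\<in>{..<card P}. \<beta> (w (e i) * a * u (e k) * (w (e k) * b * u (e j))))"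
        by (rule \<beta>_sum) simp
      also have "\<dots> = (\<Oplus>\<^bsub>B\<^esub>k\<in>{..<card P}. \<beta> (w (e i) * a * u (e k)) \<otimes>\<^bsub>B\<^esub> \<beta> (w (e k) * b * u (e j)))"
      proof (rule B.A.finsum_cong')
        fix k assume "k \<in> {..<card P}"
        then have "\<pi> (w (e i) * a * u (e k) * (w (e k) * b * u (e j))) =
            \<pi> (w (e i) * a * u (e k) * \<epsilon> * (w (e k) * b * u (e j)))"
          using image_mult_both[OF u_idem[OF eP], of k "w (e i) * a" "w (e k) * b * u (e j)"]
          by (simp add: mult.assoc)
        then show "\<beta> (w (e i) * a * u (e k) * (w (e k) * b * u (e j))) =
            \<beta> (w (e i) * a * u (e k)) \<otimes>\<^bsub>B\<^esub> \<beta> (w (e k) * b * u (e j))"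
          using \<beta>_cong \<beta>_mult by metis
      qed (auto simp: \<beta>_carrier)
      finally show ?thesis .
    qed
    show "F (x \<otimes>\<^bsub>A\<^esub> y) = F x \<otimes>\<^bsub>?Mat\<^esub> F y"
    proof
      fix z show "F (x \<otimes>\<^bsub>A\<^esub> y) z = (F x \<otimes>\<^bsub>?Mat\<^esub> F y) z"
      proof (cases "z \<in> ?D")
        case True
        then obtain i j where ij: "z = (i, j)" "i < card P" "j < card P" by auto
        have "(\<Oplus>\<^bsub>B\<^esub>k\<in>{..<card P}. G a (i, k) \<otimes>\<^bsub>B\<^esub> G b (k, j)) =
          (\<Oplus>\<^bsub>B\<^esub>k\<in>{..<card P}. \<beta> (w (e i) * a * u (e k)) \<otimes>\<^bsub>B\<^esub> \<beta> (w (e k) * b * u (e j)))"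
          using ij by (intro B.A.finsum_cong') (auto simp: G_def \<beta>_carrier)
        then show ?thesis
          using ij *[OF ij(2,3)] by (simp add: mult_image F matrix_algebra_def Let_def) (simp add: G_def)
      qed (auto simp: mult_image F matrix_algebra_def Let_def G_def)
    qed
  next
    have "\<beta> (w (e i) * u (e j)) = (if i = j then \<one>\<^bsub>B\<^esub> else \<zero>\<^bsub>B\<^esub>)"
      if "i < card P" "j < card P" for i j
      using \<beta>_cong[OF row_col[OF eP[OF that(1)] eP[OF that(2)]]] e_inj[OF that]
      by (auto simp: \<beta>_one \<beta>_zero)
    then show "F \<one>\<^bsub>A\<^esub> = \<one>\<^bsub>?Mat\<^esub>"
      by (auto simp: one_image F G_def matrix_algebra_def Let_def)
  next
    show "bij_betw F (carrier A) (carrier ?Mat)"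
      unfolding bij_betw_def
    proof (intro conjI inj_onI)
      fix x y assume "x \<in> carrier A" "y \<in> carrier A" "F x = F y"
      then show "x = y" by (auto elim!: carrierE simp: F dest: G_inj)
    next
      show "F ` carrier A = carrier ?Mat"
        using G_carrier G_surj unfolding carrier_range Mat by (auto simp: F image_image) (metis rangeI)
    qed
  qed (auto simp: carrier_range F G_carrier)
  moreover have "F (c \<odot>\<^bsub>A\<^esub> x) = c \<odot>\<^bsub>?Mat\<^esub> F x" if "x \<in> carrier A" for c x
  proof -
    obtain a where [simp]: "x = \<pi> a" using \<open>x \<in> carrier A\<close> by (rule carrierE)
    have "\<beta> (w (e i) * (sc c * a) * u (e j)) = c \<odot>\<^bsub>B\<^esub> \<beta> (w (e i) * a * u (e j))" for i j
      using \<beta>_smult[of c "w (e i) * a * u (e j)"] by (metis mult.assoc sc_central)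
    then show ?thesis by (auto simp: smult_image F G_def matrix_algebra_def Let_def)
  qed
  ultimately show ?thesis unfolding algebra_isomorphic_def by blast
qed

end

context algebra_presentation
begin

section \<open>Projective modules\<close>

lemma free_left_module: "left_module A (free_module A J)"
proof -
  have fin: "finite {j. f j \<oplus>\<^bsub>A\<^esub> g j \<noteq> \<zero>\<^bsub>A\<^esub>}"
    if "finite {j. f j \<noteq> \<zero>\<^bsub>A\<^esub>}" "finite {j. g j \<noteq> \<zero>\<^bsub>A\<^esub>}" for f g :: "'j \<Rightarrow> 'a"
    by (rule finite_subset[OF _ finite_UnI[OF that]]) auto
  have fin': "finite {j. a \<otimes>\<^bsub>A\<^esub> f j \<noteq> \<zero>\<^bsub>A\<^esub>}" if "finite {j. f j \<noteq> \<zero>\<^bsub>A\<^esub>}" "a \<in> carrier A"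
    for a and f :: "'j \<Rightarrow> 'a"
    by (rule finite_subset[OF _ that(1)]) (use that(2) in auto)
  have fin'': "finite {j. \<ominus>\<^bsub>A\<^esub> f j \<noteq> \<zero>\<^bsub>A\<^esub>}" if "finite {j. f j \<noteq> \<zero>\<^bsub>A\<^esub>}" for f :: "'j \<Rightarrow> 'a"
    by (rule finite_subset[OF _ that(1)]) auto
  have "abelian_group (free_module A J)"
  proof (rule abelian_groupI)
    fix f assume "f \<in> carrier (free_module A J)"
    then show "\<exists>g\<in>carrier (free_module A J). g \<oplus>\<^bsub>free_module A J\<^esub> f = \<zero>\<^bsub>free_module A J\<^esub>"
      by (intro bexI[of _ "\<lambda>j. \<ominus>\<^bsub>A\<^esub> f j"]) (auto simp: free_module_def fin'' A.l_neg)
  qed (auto simp: free_module_def fin A.a_ac)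
  then show ?thesis
    by (intro left_module.intro left_module_axioms.intro ring)
      (auto simp: free_module_def fin' A.m_assoc A.l_distr A.r_distr)
qed

end

context matrix_units
begin

lemma sc_left_commute: "a * (sc c * b) = sc c * (a * b)"
  using sc_central[of c a] by (simp flip: mult.assoc)

text \<open>
  A corner element with nonzero coefficient at \<open>\<epsilon>\<close> is a unit of the corner, by the geometric series,
  which stops after two terms.
\<close>

lemma cancel_unit: "c \<noteq> 0 \<Longrightarrow>
  \<pi> ((sc c * \<epsilon> + sc d * y) * (sc (1 / c) * \<epsilon> + sc (- d / c\<^sup>2) * y)) = \<pi> \<epsilon>"
proof -
  assume c: "c \<noteq> 0"
  have "(sc c * \<epsilon> + sc d * y) * (sc (1 / c) * \<epsilon> + sc (- d / c\<^sup>2) * y) =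
    sc c * (\<epsilon> * (sc (1 / c) * \<epsilon>)) + sc d * (y * (sc (1 / c) * \<epsilon>)) +
    (sc c * (\<epsilon> * (sc (- d / c\<^sup>2) * y)) + sc d * (y * (sc (- d / c\<^sup>2) * y)))"
    by (simp only: distrib_left distrib_right mult.assoc add.assoc)
  also have "\<dots> = sc c * sc (1 / c) * (\<epsilon> * \<epsilon>) + sc d * sc (1 / c) * (y * \<epsilon>) +
    (sc c * sc (- d / c\<^sup>2) * (\<epsilon> * y) + sc d * sc (- d / c\<^sup>2) * (y * y))"
    by (simp only: sc_left_commute[of \<epsilon>] sc_left_commute[of y] mult.assoc)
  finally have "\<pi> ((sc c * \<epsilon> + sc d * y) * (sc (1 / c) * \<epsilon> + sc (- d / c\<^sup>2) * y)) =
    \<pi> (sc c * sc (1 / c) * \<epsilon> + sc d * sc (1 / c) * y +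
    (sc c * sc (- d / c\<^sup>2) * y + sc d * sc (- d / c\<^sup>2) * 0))"
    by (simp only:) (intro image_add_cong image_mult_left idem_idem y_idem idem_y y_y)
  also have "sc c * sc (1 / c) * \<epsilon> + sc d * sc (1 / c) * y +
    (sc c * sc (- d / c\<^sup>2) * y + sc d * sc (- d / c\<^sup>2) * 0) =
    sc (c * (1 / c)) * \<epsilon> + sc (d * (1 / c) + c * (- d / c\<^sup>2)) * y"
    by (simp only: sc_mult sc_add) (simp add: algebra_simps)
  also have "\<dots> = \<epsilon>" using c by (simp add: sc_one sc_zero power2_eq_square field_simps)
  finally show ?thesis .
qed

context
  fixes G :: "('a, 'm) module" and g :: 'm
  assumes G: "left_module A G"
    and g: "g \<in> carrier G" "\<pi> \<epsilon> \<odot>\<^bsub>G\<^esub> g = g" "\<pi> y \<odot>\<^bsub>G\<^esub> g \<noteq> \<zero>\<^bsub>G\<^esub>"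
begin

lemma act_corner_zero:
  assumes "\<pi> (sc c * \<epsilon> + sc d * y) \<odot>\<^bsub>G\<^esub> g = \<zero>\<^bsub>G\<^esub>"
  shows "c = 0" "d = 0"
proof -
  note [simp] = act_closed[OF G] act_on_zero[OF G] g(1) g(2)
  have *: "\<pi> (y * (sc c * \<epsilon> + sc d * y)) = \<pi> (sc c * y)" for c d
  proof -
    have "y * (sc c * \<epsilon> + sc d * y) = sc c * (y * \<epsilon>) + sc d * (y * y)"
      by (simp only: distrib_left sc_left_commute[of y])
    then have "\<pi> (y * (sc c * \<epsilon> + sc d * y)) = \<pi> (sc c * y + sc d * 0)"
      by (simp only:) (intro image_add_cong image_mult_left y_idem y_y)
    then show ?thesis by simp
  qed
  have "\<pi> (y * (sc c * \<epsilon> + sc d * y)) \<odot>\<^bsub>G\<^esub> g = \<zero>\<^bsub>G\<^esub>"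
    using assms by (simp add: act_mult[OF G])
  then have "\<pi> (sc c) \<odot>\<^bsub>G\<^esub> (\<pi> y \<odot>\<^bsub>G\<^esub> g) = \<zero>\<^bsub>G\<^esub>"
    unfolding * by (simp add: act_mult[OF G])
  then show c: "c = 0"
    using act_sc_cancel[OF G act_closed[OF G g(1)] _ g(3)] by blast
  have "\<pi> (sc d) \<odot>\<^bsub>G\<^esub> (\<pi> y \<odot>\<^bsub>G\<^esub> g) = \<zero>\<^bsub>G\<^esub>"
    using assms by (simp add: c sc_zero act_mult[OF G])
  then show "d = 0"
    using act_sc_cancel[OF G act_closed[OF G g(1)] _ g(3)] by blast
qed

lemma row_corner:
  assumes p: "p \<in> P"
  shows "\<exists>c d. \<pi> (w p * a * \<epsilon>) = \<pi> (sc c * \<epsilon> + sc d * y)"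
proof -
  have "\<pi> (w p * a * \<epsilon>) = \<pi> (\<epsilon> * (w p * a) * \<epsilon>)"
    using image_mult_right[OF idem_w[OF p], of "a * \<epsilon>"] by (simp add: mult.assoc)
  then show ?thesis using corner[of "w p * a"] by simp
qed

text \<open>
  The vector \<open>y g\<close> is nonzero, so \<open>g\<close> and \<open>y g\<close> are independent and \<open>g\<close> has no more relations than
  \<open>\<epsilon>\<close> in the left ideal \<open>A \<epsilon>\<close>.
\<close>

lemma free_annihilator: "\<pi> a \<odot>\<^bsub>G\<^esub> g = \<zero>\<^bsub>G\<^esub> \<longleftrightarrow> \<pi> (a * \<epsilon>) = \<pi> 0"
proof
  assume a: "\<pi> a \<odot>\<^bsub>G\<^esub> g = \<zero>\<^bsub>G\<^esub>"
  show "\<pi> (a * \<epsilon>) = \<pi> 0"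
  proof (rule image_eqI)
    fix p assume p: "p \<in> P"
    obtain c d where cd: "\<pi> (w p * a * \<epsilon>) = \<pi> (sc c * \<epsilon> + sc d * y)"
      using row_corner[OF p] by blast
    have "\<pi> (w p * a * \<epsilon>) \<odot>\<^bsub>G\<^esub> g = \<zero>\<^bsub>G\<^esub>"
      using a g by (simp add: act_mult[OF G] act_closed[OF G] act_on_zero[OF G])
    then have "c = 0" "d = 0" using act_corner_zero[of c d] unfolding cd by auto
    then show "\<pi> (w p * (a * \<epsilon>)) = \<pi> (w p * 0)"
      using cd by (simp add: sc_zero mult.assoc)
  qed
next
  assume "\<pi> (a * \<epsilon>) = \<pi> 0"
  then have "\<pi> (a * \<epsilon>) \<odot>\<^bsub>G\<^esub> g = \<zero>\<^bsub>G\<^esub>" using act_zero[OF G g(1)] by simp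
  then show "\<pi> a \<odot>\<^bsub>G\<^esub> g = \<zero>\<^bsub>G\<^esub>" using g by (simp add: act_mult[OF G])
qed

context
  assumes gen: "carrier G = range (\<lambda>a. \<pi> a \<odot>\<^bsub>G\<^esub> g)"
begin

text \<open>
  Every nonzero submodule contains \<open>y g\<close>: move a nonzero vector into the corner, where it is
  \<open>c g + d y g\<close>, and multiply by \<open>y\<close> unless \<open>c = 0\<close>. Two nonzero submodules therefore never have zero
  intersection.
\<close>

lemma indecomposable_criterion: "indecomposable_module A G"
  unfolding indecomposable_module_def
proof (intro conjI allI impI G)
  have "\<pi> y \<odot>\<^bsub>G\<^esub> g \<in> carrier G" by (rule act_closed[OF G g(1)])
  then show "carrier G \<noteq> {\<zero>\<^bsub>G\<^esub>}" using g(3) by blast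
  have socle: "\<pi> y \<odot>\<^bsub>G\<^esub> g \<in> X" if X: "Module.submodule X A G" and "X \<noteq> {\<zero>\<^bsub>G\<^esub>}" for X
  proof -
    have X1: "X \<subseteq> carrier G" "\<zero>\<^bsub>G\<^esub> \<in> X" and X2: "\<And>a x. x \<in> X \<Longrightarrow> \<pi> a \<odot>\<^bsub>G\<^esub> x \<in> X"
      using X unfolding submodule_iff[OF G] by blast+
    obtain x where x: "x \<in> X" "x \<noteq> \<zero>\<^bsub>G\<^esub>" using X1 \<open>X \<noteq> {\<zero>\<^bsub>G\<^esub>}\<close> by blast
    have xG: "x \<in> carrier G" using x X1 by blast
    obtain p where p: "p \<in> P" "\<pi> (w p) \<odot>\<^bsub>G\<^esub> x \<noteq> \<zero>\<^bsub>G\<^esub>"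
      using act_zeroI[OF G xG] x(2) by meson
    obtain a where a: "x = \<pi> a \<odot>\<^bsub>G\<^esub> g" using xG gen by blast
    obtain c d where cd: "\<pi> (w p * a * \<epsilon>) = \<pi> (sc c * \<epsilon> + sc d * y)"
      using row_corner[OF p(1)] by blast
    have wx: "\<pi> (w p) \<odot>\<^bsub>G\<^esub> x = \<pi> (sc c * \<epsilon> + sc d * y) \<odot>\<^bsub>G\<^esub> g"
      unfolding cd[symmetric] a using g by (simp add: act_mult[OF G] act_closed[OF G])
    have wxX: "\<pi> (w p) \<odot>\<^bsub>G\<^esub> x \<in> X" by (rule X2[OF x(1)])
    show ?thesis
    proof (cases "c = 0")
      case True
      then have d: "d \<noteq> 0" using p(2) unfolding wx by (auto simp: sc_zero act_zero[OF G g(1)])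
      have "\<pi> (sc (1 / d)) \<odot>\<^bsub>G\<^esub> (\<pi> (w p) \<odot>\<^bsub>G\<^esub> x) = \<pi> (sc (1 / d) * sc d * y) \<odot>\<^bsub>G\<^esub> g"
        unfolding wx using True by (simp add: sc_zero mult.assoc g flip: act_mult[OF G])
      also have "\<dots> = \<pi> y \<odot>\<^bsub>G\<^esub> g" using d by (simp add: sc_one flip: sc_mult)
      finally show ?thesis using X2[OF wxX, of "sc (1 / d)"] by simp
    next
      case False
      define e where "e = sc (1 / c) * \<epsilon> + sc (- d / c\<^sup>2) * y"
      have com: "y * ((sc c * \<epsilon> + sc d * y)) = sc c * (y * \<epsilon>) + sc d * (y * y)"
        by (simp only: distrib_left sc_left_commute[of y])
      have "\<pi> (sc (1 / c) * y * (sc c * \<epsilon> + sc d * y)) = \<pi> (sc (1 / c) * (sc c * y + sc d * 0))"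
        unfolding mult.assoc com by (intro image_mult_left image_add_cong y_idem y_y)
      also have "sc (1 / c) * (sc c * y + sc d * 0) = y"
        using False by (simp add: sc_one mult.assoc[symmetric] flip: sc_mult)
      finally have "\<pi> (sc (1 / c) * y) \<odot>\<^bsub>G\<^esub> (\<pi> (w p) \<odot>\<^bsub>G\<^esub> x) = \<pi> y \<odot>\<^bsub>G\<^esub> g"
        unfolding wx using g by (simp flip: act_mult[OF G])
      then show ?thesis using X2[OF wxX, of "sc (1 / c) * y"] by simp
    qed
  qed
  fix X Y assume "complementary_submodules A G X Y"
  then show "X = {\<zero>\<^bsub>G\<^esub>} \<or> Y = {\<zero>\<^bsub>G\<^esub>}"
    using socle[of X] socle[of Y] g(3) unfolding complementary_submodules_def by blast
qed

text \<open>
  The module is isomorphic to the summand \<open>A \<epsilon>\<close> of \<open>A = A \<epsilon> \<oplus> A (1 - \<epsilon>)\<close>; the basis of the free module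
  of rank one is \<open>{g}\<close>.
\<close>

lemma projective_criterion: "projective_module A G"
proof -
  define J :: "'m set" where "J = {g}"
  let ?F = "free_module A J"
  have F: "left_module A ?F" by (rule free_left_module)
  have Fz: "zero ?F = (\<lambda>_. \<zero>\<^bsub>A\<^esub>)" and Fa: "add ?F = (\<lambda>f h j. f j \<oplus>\<^bsub>A\<^esub> h j)"
    and Fs: "smult ?F = (\<lambda>a f j. a \<otimes>\<^bsub>A\<^esub> f j)"
    by (simp_all add: free_module_def)
  have Fc: "f \<in> carrier ?F \<longleftrightarrow> (\<exists>a. f = (\<lambda>j. if j = g then \<pi> a else \<pi> 0))" for f
  proof
    assume "f \<in> carrier ?F"
    then have *: "f g \<in> carrier A" "\<And>j. j \<noteq> g \<Longrightarrow> f j = \<pi> 0"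
      by (auto simp: free_module_def J_def zero_image)
    obtain a where "f g = \<pi> a" using carrierE[OF *(1)] by blast
    then have "f = (\<lambda>j. if j = g then \<pi> a else \<pi> 0)" using *(2) by auto
    then show "\<exists>a. f = (\<lambda>j. if j = g then \<pi> a else \<pi> 0)" by blast
  next
    assume "\<exists>a. f = (\<lambda>j. if j = g then \<pi> a else \<pi> 0)"
    then obtain a where f: "f = (\<lambda>j. if j = g then \<pi> a else \<pi> 0)" by blast
    have "finite {j. f j \<noteq> \<zero>\<^bsub>A\<^esub>}"
      by (rule finite_subset[of _ "{g}"]) (auto simp: f zero_image)
    then show "f \<in> carrier ?F" by (auto simp: free_module_def f J_def zero_image)
  qed
  define D where "D e = {\<lambda>j. if j = g then \<pi> (a * e) else \<pi> 0 | a. True}" for e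
  have D_sub: "Module.submodule (D e) A ?F" for e
    unfolding submodule_iff[OF F]
  proof (intro conjI ballI allI)
    show "\<zero>\<^bsub>?F\<^esub> \<in> D e" unfolding D_def Fz by (auto intro!: exI[of _ 0] simp: zero_image)
    show "D e \<subseteq> carrier ?F" unfolding D_def by (auto simp: Fc)
  next
    fix f h assume "f \<in> D e" "h \<in> D e"
    then obtain a b where "f = (\<lambda>j. if j = g then \<pi> (a * e) else \<pi> 0)" "h = (\<lambda>j. if j = g then \<pi> (b * e) else \<pi> 0)"
      by (auto simp: D_def)
    then have "f \<oplus>\<^bsub>?F\<^esub> h = (\<lambda>j. if j = g then \<pi> ((a + b) * e) else \<pi> 0)"
      by (auto simp: Fa add_image distrib_right)
    then show "f \<oplus>\<^bsub>?F\<^esub> h \<in> D e" unfolding D_def by blast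
  next
    fix f b assume "f \<in> D e"
    then obtain a where "f = (\<lambda>j. if j = g then \<pi> (a * e) else \<pi> 0)" by (auto simp: D_def)
    then have "\<pi> b \<odot>\<^bsub>?F\<^esub> f = (\<lambda>j. if j = g then \<pi> ((b * a) * e) else \<pi> 0)"
      by (auto simp: Fs mult_image mult.assoc)
    then show "\<pi> b \<odot>\<^bsub>?F\<^esub> f \<in> D e" unfolding D_def by blast
  qed
  let ?X = "D \<epsilon>" and ?Y = "D (1 - \<epsilon>)"
  have compl: "complementary_submodules A ?F ?X ?Y"
    unfolding complementary_submodules_def
  proof (intro conjI D_sub)
    have "f = \<zero>\<^bsub>?F\<^esub>" if f: "f \<in> ?X" "f \<in> ?Y" for f
    proof -
      obtain a b where ab: "f = (\<lambda>j. if j = g then \<pi> (a * \<epsilon>) else \<pi> 0)" "f = (\<lambda>j. if j = g then \<pi> (b * (1 - \<epsilon>)) else \<pi> 0)"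
        using f unfolding D_def by blast
      have eq: "\<pi> (a * \<epsilon>) = \<pi> (b * (1 - \<epsilon>))" using fun_cong[OF ab(1), of g] fun_cong[OF ab(2), of g] by simp
      have "\<pi> (a * \<epsilon>) = \<pi> (a * \<epsilon> * \<epsilon>)"
        using image_mult_left[OF idem_idem, of a] by (simp add: mult.assoc)
      also have "\<dots> = \<pi> (b * (1 - \<epsilon>) * \<epsilon>)" by (rule image_mult_right[OF eq])
      also have "\<dots> = \<pi> (b * \<epsilon> - b * (\<epsilon> * \<epsilon>))" by (simp add: algebra_simps)
      also have "\<dots> = \<pi> 0"
        using image_mult_left[OF idem_idem, of b] image_eq_iff_diff by metis
      finally show ?thesis using ab(1) by (auto simp: Fz zero_image)
    qed
    moreover have "\<zero>\<^bsub>?F\<^esub> \<in> ?X \<inter> ?Y"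
      using D_sub submodule_iff[OF F] by blast
    ultimately show "?X \<inter> ?Y = {\<zero>\<^bsub>?F\<^esub>}" by blast
    have "f \<in> ?X <+>\<^bsub>?F\<^esub> ?Y" if "f \<in> carrier ?F" for f
    proof -
      obtain a where "f = (\<lambda>j. if j = g then \<pi> a else \<pi> 0)" using \<open>f \<in> carrier ?F\<close> Fc by blast
      then have "f = (\<lambda>j. if j = g then \<pi> (a * \<epsilon>) else \<pi> 0) \<oplus>\<^bsub>?F\<^esub> (\<lambda>j. if j = g then \<pi> (a * (1 - \<epsilon>)) else \<pi> 0)"
        by (auto simp: Fa add_image algebra_simps)
      then show ?thesis unfolding set_add_def' D_def by blast
    qed
    moreover have "D e \<subseteq> carrier ?F" for e
      using D_sub[of e] unfolding submodule_iff[OF F] by (rule conjunct1)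
    then have "?X <+>\<^bsub>?F\<^esub> ?Y \<subseteq> carrier ?F"
      using abelian_monoid.a_closed[OF abelian_group.axioms(1)[OF left_module.axioms(2)[OF F]]]
      unfolding set_add_def' by (auto simp: subset_iff)
    ultimately show "?X <+>\<^bsub>?F\<^esub> ?Y = carrier ?F" by blast
  qed
  let ?N = "?F\<lparr>carrier := ?X\<rparr>"
  define h where "h = (\<lambda>j. if j = g then \<pi> \<epsilon> else \<pi> 0)"
  have act_h: "\<pi> a \<odot>\<^bsub>?N\<^esub> h = (\<lambda>j. if j = g then \<pi> (a * \<epsilon>) else \<pi> 0)" for a
    by (auto simp: h_def Fs mult_image)
  have "module_isomorphic A G ?N"
  proof (rule cyclic_isomorphic[OF G submodule_left_module[OF F D_sub] g(1) gen])
    show "h \<in> carrier ?N" unfolding h_def by (auto simp: D_def intro!: exI[of _ 1])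
    show "carrier ?N = range (\<lambda>a. \<pi> a \<odot>\<^bsub>?N\<^esub> h)" unfolding act_h by (auto simp: D_def)
    fix a
    have "\<pi> a \<odot>\<^bsub>?N\<^esub> h = \<zero>\<^bsub>?N\<^esub> \<longleftrightarrow> \<pi> (a * \<epsilon>) = \<pi> 0"
      unfolding act_h by (auto simp: Fz zero_image fun_eq_iff)
    then show "\<pi> a \<odot>\<^bsub>G\<^esub> g = \<zero>\<^bsub>G\<^esub> \<longleftrightarrow> \<pi> a \<odot>\<^bsub>?N\<^esub> h = \<zero>\<^bsub>?N\<^esub>"
      using free_annihilator by blast
  qed
  then show ?thesis unfolding projective_module_def using G compl by blast
qed

end

end

end

context matrix_units
begin

text \<open>
  Nakayama's argument for the nilpotent \<open>y\<close>. If no such entry existed, every corner vector of \<open>X\<close> would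
  be \<open>y\<close> times a vector \<open>t\<close> of the free module. Replacing \<open>t\<close> by its component in \<open>X\<close>, whose corner part
  is again divisible by \<open>y\<close>, would make it zero, since \<open>y\<close> has square zero.
\<close>

lemma projective_corner_unit:
  fixes F :: "('a, 'j \<Rightarrow> 'a) module" and X Y :: "('j \<Rightarrow> 'a) set"
  assumes F: "left_module A F" and F_def: "F = free_module A J"
    and compl: "complementary_submodules A F X Y" and X0: "X \<noteq> {\<zero>\<^bsub>F\<^esub>}"
  shows "\<exists>z\<in>X. \<exists>j b. \<exists>p\<in>P. \<exists>c d. \<pi> \<epsilon> \<odot>\<^bsub>F\<^esub> z = z \<and> z j = \<pi> b \<and>
           \<pi> (b * u p) = \<pi> (sc c * \<epsilon> + sc d * y) \<and> c \<noteq> 0"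
proof (rule ccontr)
  assume no_unit: "\<not> ?thesis"
  interpret F: left_module A F by (rule F)
  have Fz: "zero F = (\<lambda>_. \<zero>\<^bsub>A\<^esub>)" and Fa: "add F = (\<lambda>f h j. f j \<oplus>\<^bsub>A\<^esub> h j)"
    and Fs: "smult F = (\<lambda>a f j. a \<otimes>\<^bsub>A\<^esub> f j)"
    by (simp_all add: F_def free_module_def)
  have X: "X \<subseteq> carrier F" "\<zero>\<^bsub>F\<^esub> \<in> X" "\<And>a x. x \<in> X \<Longrightarrow> \<pi> a \<odot>\<^bsub>F\<^esub> x \<in> X"
      "\<And>x x'. x \<in> X \<Longrightarrow> x' \<in> X \<Longrightarrow> x \<oplus>\<^bsub>F\<^esub> x' \<in> X"
    and Y: "Y \<subseteq> carrier F" "\<And>a x. x \<in> Y \<Longrightarrow> \<pi> a \<odot>\<^bsub>F\<^esub> x \<in> Y"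
    and XY: "X \<inter> Y = {\<zero>\<^bsub>F\<^esub>}" "X <+>\<^bsub>F\<^esub> Y = carrier F"
    using compl unfolding complementary_submodules_def submodule_iff[OF F] by blast+
  have divisible: "\<exists>t\<in>carrier F. z = \<pi> y \<odot>\<^bsub>F\<^esub> t" if z: "z \<in> X" "\<pi> \<epsilon> \<odot>\<^bsub>F\<^esub> z = z" for z
  proof -
    have zF: "z \<in> carrier F" using z X by blast
    have *: "\<exists>b'. z j = \<pi> (y * b')" for j
    proof -
      have "z j \<in> carrier A" using zF by (simp add: F_def free_module_def)
      then obtain b where b: "z j = \<pi> b" by (rule carrierE)
      have eb: "\<pi> (\<epsilon> * b) = \<pi> b" using fun_cong[OF z(2), of j] by (simp add: Fs b mult_image)
      have "\<exists>d. \<pi> (b * u p) = \<pi> (sc d * y)" if p: "p \<in> P" for p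
      proof -
        obtain c d where cd: "\<pi> (\<epsilon> * (b * u p) * \<epsilon>) = \<pi> (sc c * \<epsilon> + sc d * y)"
          using corner by blast
        have "\<pi> (\<epsilon> * (b * u p) * \<epsilon>) = \<pi> (b * u p)"
          using image_mult_cong[OF eb u_idem[OF p]] by (simp add: mult.assoc)
        with cd have "\<pi> (b * u p) = \<pi> (sc c * \<epsilon> + sc d * y)" by simp
        with no_unit z b p have "c = 0" by blast
        then show ?thesis using \<open>\<pi> (b * u p) = _\<close> by (auto simp: sc_zero)
      qed
      then obtain d where d: "\<And>p. p \<in> P \<Longrightarrow> \<pi> (b * u p) = \<pi> (sc (d p) * y)"
        by metis
      have "\<pi> b = \<pi> (b * (\<Sum>p\<in>P. u p * w p))"
        using image_mult_left[OF partition, of b] by simp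
      also have "\<dots> = \<pi> (\<Sum>p\<in>P. sc (d p) * y * w p)"
        unfolding sum_distrib_left mult.assoc[symmetric] by (intro image_sum_cong image_mult_right d)
      also have "(\<Sum>p\<in>P. sc (d p) * y * w p) = y * (\<Sum>p\<in>P. sc (d p) * w p)"
        by (simp only: sc_central[of _ y] sum_distrib_left mult.assoc)
      finally show ?thesis unfolding b by (rule exI)
    qed
    then obtain t where t: "\<And>j. z j = \<pi> (y * t j)" by metis
    define s where "s = (\<lambda>j. if z j = \<zero>\<^bsub>A\<^esub> then \<zero>\<^bsub>A\<^esub> else \<pi> (t j))"
    have "finite {j. z j \<noteq> \<zero>\<^bsub>A\<^esub>}" "\<And>j. j \<notin> J \<Longrightarrow> z j = \<zero>\<^bsub>A\<^esub>"
      using zF by (auto simp: F_def free_module_def)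
    moreover have "{j. s j \<noteq> \<zero>\<^bsub>A\<^esub>} \<subseteq> {j. z j \<noteq> \<zero>\<^bsub>A\<^esub>}" by (auto simp: s_def)
    ultimately have "s \<in> carrier F"
      by (auto simp: F_def free_module_def s_def dest: finite_subset)
    moreover have "z = \<pi> y \<odot>\<^bsub>F\<^esub> s"
      using t by (auto simp: Fs s_def mult_image)
    ultimately show ?thesis by blast
  qed
  have fixed_zero: "z = \<zero>\<^bsub>F\<^esub>" if z: "z \<in> X" "\<pi> \<epsilon> \<odot>\<^bsub>F\<^esub> z = z" for z
  proof -
    obtain t where t: "t \<in> carrier F" "z = \<pi> y \<odot>\<^bsub>F\<^esub> t" using divisible[OF z] by blast
    obtain x1 y1 where xy: "x1 \<in> X" "y1 \<in> Y" "t = x1 \<oplus>\<^bsub>F\<^esub> y1"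
      using t(1) XY(2) unfolding set_add_def' by blast
    have xyF: "x1 \<in> carrier F" "y1 \<in> carrier F" using xy X Y by blast+
    have split: "z = \<pi> y \<odot>\<^bsub>F\<^esub> x1 \<oplus>\<^bsub>F\<^esub> \<pi> y \<odot>\<^bsub>F\<^esub> y1"
      unfolding t(2) xy(3) by (rule act_radd[OF F xyF])
    have yx: "\<pi> y \<odot>\<^bsub>F\<^esub> x1 = \<pi> y \<odot>\<^bsub>F\<^esub> (\<pi> \<epsilon> \<odot>\<^bsub>F\<^esub> x1)"
      using xyF by (simp add: y_idem flip: act_mult[OF F])
    have "\<pi> \<epsilon> \<odot>\<^bsub>F\<^esub> (\<pi> \<epsilon> \<odot>\<^bsub>F\<^esub> x1) = \<pi> \<epsilon> \<odot>\<^bsub>F\<^esub> x1"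
      using xyF by (simp add: idem_idem flip: act_mult[OF F])
    then obtain t' where t': "t' \<in> carrier F" "\<pi> \<epsilon> \<odot>\<^bsub>F\<^esub> x1 = \<pi> y \<odot>\<^bsub>F\<^esub> t'"
      using divisible[OF X(3)[OF xy(1), of \<epsilon>]] by auto
    have "\<pi> y \<odot>\<^bsub>F\<^esub> (\<pi> y \<odot>\<^bsub>F\<^esub> t') = \<zero>\<^bsub>F\<^esub>"
      using t'(1) by (simp add: y_y act_zero[OF F] flip: act_mult[OF F])
    then have yx0: "\<pi> y \<odot>\<^bsub>F\<^esub> x1 = \<zero>\<^bsub>F\<^esub>" unfolding yx t'(2) .
    have yF: "\<pi> y \<odot>\<^bsub>F\<^esub> y1 \<in> carrier F" by (rule act_closed[OF F xyF(2)])
    have "z = \<pi> y \<odot>\<^bsub>F\<^esub> y1" using split yF unfolding yx0 by simp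
    then have "z \<in> Y" using Y(2)[OF xy(2), of y] by simp
    then show ?thesis using z(1) XY(1) by blast
  qed
  have "x = \<zero>\<^bsub>F\<^esub>" if "x \<in> X" for x
  proof (rule act_zeroI[OF F])
    show "x \<in> carrier F" using that X by blast
    fix p assume "p \<in> P"
    then show "\<pi> (w p) \<odot>\<^bsub>F\<^esub> x = \<zero>\<^bsub>F\<^esub>"
      using \<open>x \<in> carrier F\<close> by (intro fixed_zero X(3) that) (simp add: idem_w flip: act_mult[OF F])
  qed
  then show False using X0 X(2) by blast
qed

text \<open>
  A summand of a free module has, by the previous lemma, a corner vector with a coordinate that is a unit
  of the corner. That coordinate gives a retraction onto a copy of \<open>A \<epsilon>\<close>, which is all of an
  indecomposable module.
\<close>

lemma indecomposable_projective_generator: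
  fixes M :: "('a, 'm) module"
  assumes proj: "projective_module A M" and indec: "indecomposable_module A M" and y0: "\<pi> y \<noteq> \<pi> 0"
  shows "\<exists>m\<in>carrier M. \<pi> \<epsilon> \<odot>\<^bsub>M\<^esub> m = m \<and> \<pi> y \<odot>\<^bsub>M\<^esub> m \<noteq> \<zero>\<^bsub>M\<^esub> \<and>
           carrier M = range (\<lambda>a. \<pi> a \<odot>\<^bsub>M\<^esub> m)"
proof -
  have M: "left_module A M" and M0: "carrier M \<noteq> {\<zero>\<^bsub>M\<^esub>}"
    using indec by (simp_all add: indecomposable_module_def)
  interpret M: left_module A M by (rule M)
  obtain J :: "'m set" and X Y where compl: "complementary_submodules A (free_module A J) X Y"
    and iso: "module_isomorphic A M ((free_module A J)\<lparr>carrier := X\<rparr>)"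
    using proj unfolding projective_module_def by blast
  define F where "F = free_module A J"
  have F: "left_module A F" unfolding F_def by (rule free_left_module)
  have Fa: "add F = (\<lambda>f h j. f j \<oplus>\<^bsub>A\<^esub> h j)" and Fs: "smult F = (\<lambda>a f j. a \<otimes>\<^bsub>A\<^esub> f j)"
    by (simp_all add: F_def free_module_def)
  have XF: "X \<subseteq> carrier F" "\<zero>\<^bsub>F\<^esub> \<in> X"
    using compl unfolding complementary_submodules_def F_def[symmetric] submodule_iff[OF F] by blast+
  obtain h where h: "h \<in> module_hom A M (F\<lparr>carrier := X\<rparr>)" "bij_betw h (carrier M) X"
    using iso unfolding module_isomorphic_def F_def by auto
  have h_add: "h (x \<oplus>\<^bsub>M\<^esub> x') = h x \<oplus>\<^bsub>F\<^esub> h x'" if "x \<in> carrier M" "x' \<in> carrier M" for x x'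
    using h(1) that unfolding module_hom_def by simp
  have h_act: "h (\<pi> a \<odot>\<^bsub>M\<^esub> x) = \<pi> a \<odot>\<^bsub>F\<^esub> h x" if "x \<in> carrier M" for a x
    using h(1) that unfolding module_hom_def by simp
  have hX: "h x \<in> X" if "x \<in> carrier M" for x using h(2) that by (auto simp: bij_betw_def)
  have h_inj: "x = x'" if "h x = h x'" "x \<in> carrier M" "x' \<in> carrier M" for x x'
    using h(2) that by (auto simp: bij_betw_def inj_on_def)
  have X0: "X \<noteq> {\<zero>\<^bsub>F\<^esub>}"
  proof
    assume "X = {\<zero>\<^bsub>F\<^esub>}"
    then have h0: "h x = \<zero>\<^bsub>F\<^esub>" if "x \<in> carrier M" for x
      using hX[OF that] by simp
    have "x = \<zero>\<^bsub>M\<^esub>" if "x \<in> carrier M" for x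
      by (rule h_inj[OF _ that M.M.zero_closed]) (simp add: h0 that M.M.zero_closed)
    then have "carrier M = {\<zero>\<^bsub>M\<^esub>}" using M.M.zero_closed by auto
    then show False using M0 by simp
  qed
  obtain z j b p c d where z: "z \<in> X" "\<pi> \<epsilon> \<odot>\<^bsub>F\<^esub> z = z" "z j = \<pi> b" and p: "p \<in> P"
    and bu: "\<pi> (b * u p) = \<pi> (sc c * \<epsilon> + sc d * y)" and c: "c \<noteq> 0"
    using projective_corner_unit[OF F F_def compl[folded F_def] X0] by (elim bexE exE conjE) (rule that)
  define e where "e = sc (1 / c) * \<epsilon> + sc (- d / c\<^sup>2) * y"
  have ee: "\<pi> (e * \<epsilon>) = \<pi> e"
    unfolding e_def distrib_right mult.assoc by (intro image_add_cong image_mult_left idem_idem y_idem)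
  have be: "\<pi> (b * u p * e) = \<pi> \<epsilon>"
    using image_mult_right[OF bu, of e] cancel_unit[OF c, of d] by (simp add: e_def)
  \<comment> \<open>a retraction of the module onto a copy of the left ideal of the corner idempotent\<close>
  define r where "r x = h x j \<otimes>\<^bsub>A\<^esub> \<pi> (u p * e)" for x
  have hA: "h x j \<in> carrier A" if "x \<in> carrier M" for x
    using hX[OF that] XF by (auto simp: F_def free_module_def)
  have r_add: "r (x \<oplus>\<^bsub>M\<^esub> x') = r x \<oplus>\<^bsub>A\<^esub> r x'" if "x \<in> carrier M" "x' \<in> carrier M" for x x'
    using that hA by (simp add: r_def h_add Fa A.l_distr)
  have r_act: "r (\<pi> a \<odot>\<^bsub>M\<^esub> x) = \<pi> a \<otimes>\<^bsub>A\<^esub> r x" if "x \<in> carrier M" for a x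
    using that hA by (simp add: r_def h_act Fs A.m_assoc)
  have r_range: "\<exists>a. r x = \<pi> a \<and> \<pi> (a * \<epsilon>) = \<pi> a" if "x \<in> carrier M" for x
  proof -
    obtain a where "h x j = \<pi> a" using carrierE[OF hA[OF \<open>x \<in> carrier M\<close>]] by blast
    then have "r x = \<pi> (a * (u p * e))" by (simp add: r_def mult_image)
    moreover have "\<pi> (a * (u p * e) * \<epsilon>) = \<pi> (a * (u p * e))"
      using image_mult_left[OF ee, of "a * u p"] by (simp add: mult.assoc)
    ultimately show ?thesis by blast
  qed
  obtain m where m: "m \<in> carrier M" "h m = z" using h(2) z(1) by (auto simp: bij_betw_def)
  have rm: "r m = \<pi> \<epsilon>" using be by (simp add: r_def m z(3) mult_image mult.assoc)
  have em: "\<pi> \<epsilon> \<odot>\<^bsub>M\<^esub> m = m"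
    by (rule h_inj) (simp_all add: h_act m z act_closed[OF M])
  have r0: "r \<zero>\<^bsub>M\<^esub> = \<pi> 0"
    using r_act[OF m(1), of 0] act_zero[OF M m(1)] by (simp add: rm mult_image)
  have ym: "\<pi> y \<odot>\<^bsub>M\<^esub> m \<noteq> \<zero>\<^bsub>M\<^esub>"
    using r_act[OF m(1), of y] r0 y0 by (auto simp: rm mult_image y_idem)
  let ?X = "range (\<lambda>a. \<pi> a \<odot>\<^bsub>M\<^esub> m)" and ?Y = "{x \<in> carrier M. r x = \<pi> 0}"
  have Xsub: "Module.submodule ?X A M" by (rule cyclic_submodule[OF M m(1)])
  have decomp: "\<exists>a. \<exists>y\<in>?Y. x = \<pi> a \<odot>\<^bsub>M\<^esub> m \<oplus>\<^bsub>M\<^esub> y" if x: "x \<in> carrier M" for x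
  proof -
    obtain a where a: "r x = \<pi> a" "\<pi> (a * \<epsilon>) = \<pi> a" using r_range[OF x] by blast
    let ?y = "\<pi> (- a) \<odot>\<^bsub>M\<^esub> m \<oplus>\<^bsub>M\<^esub> x"
    have yc: "\<pi> (- a) \<odot>\<^bsub>M\<^esub> m \<in> carrier M" by (rule act_closed[OF M m(1)])
    have "r ?y = \<pi> (- 1 * (a * \<epsilon>) + a)"
      by (simp add: r_add[OF yc x] r_act[OF m(1)] rm a(1) mult_image add_image)
    also have "\<dots> = \<pi> (- 1 * a + a)" by (intro image_add_cong image_mult_left a(2) refl)
    finally have "?y \<in> ?Y" using yc x by simp
    moreover have "x = \<pi> a \<odot>\<^bsub>M\<^esub> m \<oplus>\<^bsub>M\<^esub> ?y"
    proof -
      have "\<pi> a \<odot>\<^bsub>M\<^esub> m \<oplus>\<^bsub>M\<^esub> ?y = (\<pi> a \<odot>\<^bsub>M\<^esub> m \<oplus>\<^bsub>M\<^esub> \<pi> (- a) \<odot>\<^bsub>M\<^esub> m) \<oplus>\<^bsub>M\<^esub> x"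
        using yc x act_closed[OF M m(1), of a] by (simp add: M.M.a_assoc)
      also have "\<dots> = \<pi> (a + - a) \<odot>\<^bsub>M\<^esub> m \<oplus>\<^bsub>M\<^esub> x" by (simp only: act_add[OF M m(1)])
      also have "\<dots> = x" using x act_zero[OF M m(1)] by simp
      finally show ?thesis by simp
    qed
    ultimately show ?thesis by blast
  qed
  have Ysub: "Module.submodule ?Y A M"
    unfolding submodule_iff[OF M]
    by (auto simp: r0 r_add r_act add_image mult_image act_closed[OF M])
  have inter: "?X \<inter> ?Y = {\<zero>\<^bsub>M\<^esub>}"
  proof -
    have "\<pi> a \<odot>\<^bsub>M\<^esub> m = \<zero>\<^bsub>M\<^esub>" if "r (\<pi> a \<odot>\<^bsub>M\<^esub> m) = \<pi> 0" for a
    proof -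
      have "\<pi> (a * \<epsilon>) = \<pi> 0" using that by (simp add: r_act[OF m(1)] rm mult_image)
      then have "\<pi> (a * \<epsilon>) \<odot>\<^bsub>M\<^esub> m = \<zero>\<^bsub>M\<^esub>" using act_zero[OF M m(1)] by simp
      then show ?thesis by (simp add: act_mult[OF M m(1)] em)
    qed
    moreover have "\<zero>\<^bsub>M\<^esub> \<in> ?X" "\<zero>\<^bsub>M\<^esub> \<in> ?Y"
      using Xsub Ysub unfolding submodule_iff[OF M] by blast+
    ultimately show ?thesis by blast
  qed
  have total: "?X <+>\<^bsub>M\<^esub> ?Y = carrier M"
  proof
    show "?X <+>\<^bsub>M\<^esub> ?Y \<subseteq> carrier M"
      unfolding set_add_def' by (auto simp: act_closed[OF M m(1)])
    show "carrier M \<subseteq> ?X <+>\<^bsub>M\<^esub> ?Y"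
    proof
      fix x assume "x \<in> carrier M"
      then obtain a y' where "y' \<in> ?Y" "x = \<pi> a \<odot>\<^bsub>M\<^esub> m \<oplus>\<^bsub>M\<^esub> y'"
        using decomp by meson
      then show "x \<in> ?X <+>\<^bsub>M\<^esub> ?Y"
        unfolding set_add_def' by (intro UN_I[OF rangeI] UN_I singletonI) auto
    qed
  qed
  have "complementary_submodules A M ?X ?Y"
    unfolding complementary_submodules_def by (intro conjI Xsub Ysub inter total)
  then have "?X = {\<zero>\<^bsub>M\<^esub>} \<or> ?Y = {\<zero>\<^bsub>M\<^esub>}"
    using indec unfolding indecomposable_module_def by simp
  moreover have "\<not> ?X = {\<zero>\<^bsub>M\<^esub>}" using ym by (metis rangeI singletonD)
  ultimately have Y0: "?Y = {\<zero>\<^bsub>M\<^esub>}" by argo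
  have "x \<in> ?X" if x: "x \<in> carrier M" for x
  proof -
    obtain a where "x = \<pi> a \<odot>\<^bsub>M\<^esub> m \<oplus>\<^bsub>M\<^esub> \<zero>\<^bsub>M\<^esub>" using decomp[OF x] unfolding Y0 by blast
    then show ?thesis using act_closed[OF M m(1), of a] by simp
  qed
  then have "carrier M = ?X" using act_closed[OF M m(1)] by blast
  then show ?thesis using m(1) em ym by blast
qed

lemma indecomposable_projective_unique:
  fixes M :: "('a, 'm) module" and G :: "('a, 'n) module"
  assumes "projective_module A M" "indecomposable_module A M"
    and G: "left_module A G" and g: "g \<in> carrier G" "\<pi> \<epsilon> \<odot>\<^bsub>G\<^esub> g = g" "\<pi> y \<odot>\<^bsub>G\<^esub> g \<noteq> \<zero>\<^bsub>G\<^esub>"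
      "carrier G = range (\<lambda>a. \<pi> a \<odot>\<^bsub>G\<^esub> g)"
  shows "module_isomorphic A M G"
proof -
  have M: "left_module A M" using assms(2) by (simp add: indecomposable_module_def)
  have "\<pi> y \<noteq> \<pi> 0" using g(3) act_zero[OF G g(1)] by auto
  then obtain m where m: "m \<in> carrier M" "\<pi> \<epsilon> \<odot>\<^bsub>M\<^esub> m = m" "\<pi> y \<odot>\<^bsub>M\<^esub> m \<noteq> \<zero>\<^bsub>M\<^esub>"
      "carrier M = range (\<lambda>a. \<pi> a \<odot>\<^bsub>M\<^esub> m)"
    using indecomposable_projective_generator[OF assms(1,2)] by blast
  show ?thesis
    using free_annihilator[OF M m(1-3)] free_annihilator[OF G g(1-3)]
    by (intro cyclic_isomorphic[OF M G m(1,4) g(1,4)]) blast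
qed

end

section \<open>Free algebras and two-sided ideals\<close>

lemma scalar_add: "scalar (c + d) = scalar c + scalar d"
  by (simp add: scalar_def single_add)

lemma scalar_mult: "scalar (c * d) = scalar c * scalar d"
  by (simp add: scalar_def mult_single)

lemma scalar_one: "scalar 1 = 1"
  by (simp add: scalar_def)

lemma poly_mapping_sum_monomials:
  fixes a :: "'a \<Rightarrow>\<^sub>0 'b::comm_monoid_add"
  shows
  "(\<Sum>w\<in>Poly_Mapping.keys a. Poly_Mapping.single w (Poly_Mapping.lookup a w)) = a"
proof (rule poly_mapping_eqI)
  fix w
  have "Poly_Mapping.lookup (\<Sum>w\<in>Poly_Mapping.keys a. Poly_Mapping.single w (Poly_Mapping.lookup a w)) w =
    (\<Sum>v\<in>Poly_Mapping.keys a. if v = w then Poly_Mapping.lookup a v else 0)"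
    by (simp add: lookup_sum lookup_single when_def)
  then show "Poly_Mapping.lookup (\<Sum>w\<in>Poly_Mapping.keys a. Poly_Mapping.single w (Poly_Mapping.lookup a w)) w =
     Poly_Mapping.lookup a w" by (simp add: sum.delta' in_keys_iff)
qed

lemma monomial_induct [case_names zero monomial]:
  fixes a :: "'a \<Rightarrow>\<^sub>0 'b::comm_monoid_add"
  assumes "P 0" "\<And>a w c. P a \<Longrightarrow> P (a + Poly_Mapping.single w c)"
  shows "P a"
proof -
  have "P (\<Sum>w\<in>S. Poly_Mapping.single w (Poly_Mapping.lookup a w))" if "finite S" for S
    using that by induction (simp_all add: assms(1) add.commute[of "Poly_Mapping.single _ _"] assms(2))
  from this[of "Poly_Mapping.keys a"] show ?thesis by (simp add: poly_mapping_sum_monomials)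
qed

lemma single_Word_append:
  "Poly_Mapping.single (Word (u @ v)) (c * d) = Poly_Mapping.single (Word u) c * Poly_Mapping.single (Word v) d"
  by (simp add: mult_single plus_gword_def)

lemma single_Word_Nil: "Poly_Mapping.single (Word []) c = scalar c"
  by (simp add: scalar_def zero_gword_def)

lemma single_Word_Cons: "Poly_Mapping.single (Word (g # v)) c = gen g * Poly_Mapping.single (Word v) c"
  using single_Word_append[of "[g]" v 1 c] by (simp add: gen_def)

lemma scalar_central: "scalar c * a = a * scalar (c :: 'k::comm_ring_1)"
proof (induction a rule: monomial_induct)
  case (monomial a w d)
  have "scalar c * Poly_Mapping.single w d = Poly_Mapping.single w d * scalar c"
    by (simp add: scalar_def mult_single mult.commute)
  then show ?case using monomial by (simp add: distrib_left distrib_right)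
qed simp

lemma free_algebra_induct [case_names scalar gen add mult]:
  fixes a :: "'g gword \<Rightarrow>\<^sub>0 'k::comm_ring_1"
  assumes "\<And>c. P (scalar c)" "\<And>g. P (gen g)" "\<And>a b. P a \<Longrightarrow> P b \<Longrightarrow> P (a + b)"
    "\<And>a b. P a \<Longrightarrow> P b \<Longrightarrow> P (a * b)"
  shows "P a"
proof (induction a rule: monomial_induct)
  case zero
  show ?case using assms(1)[of 0] by (simp add: scalar_def)
next
  case (monomial a w c)
  have "P (Poly_Mapping.single (Word u) c)" for u
    by (induction u) (simp_all add: single_Word_Nil single_Word_Cons assms)
  then have "P (Poly_Mapping.single w c)" by (cases w) simp
  then show ?case by (intro assms(3) monomial)
qed

text \<open>
  The homomorphism that sends the generators outside \<open>G\<close> to zero. It makes the free algebra on \<open>G\<close> a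
  quotient of the free algebra on all generators, so that no side condition on generators is needed
  in computations.
\<close>

definition restrict_gens :: "'g set \<Rightarrow> ('g gword \<Rightarrow>\<^sub>0 'k::comm_ring_1) \<Rightarrow> ('g gword \<Rightarrow>\<^sub>0 'k)"
  where "restrict_gens G a = (\<Sum>w\<in>Poly_Mapping.keys a.
    if set (letters w) \<subseteq> G then Poly_Mapping.single w (Poly_Mapping.lookup a w) else 0)"

lemma lookup_restrict_gens:
  "Poly_Mapping.lookup (restrict_gens G a) w =
    (if set (letters w) \<subseteq> G then Poly_Mapping.lookup a w else 0)"
proof -
  have "Poly_Mapping.lookup (restrict_gens G a) w = (\<Sum>v\<in>Poly_Mapping.keys a.
    if v = w then (if set (letters w) \<subseteq> G then Poly_Mapping.lookup a w else 0) else 0)"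
    unfolding restrict_gens_def lookup_sum
    by (intro sum.cong) (auto simp: lookup_single when_def)
  then show ?thesis by (simp add: sum.delta' in_keys_iff)
qed

lemma restrict_gens_add: "restrict_gens G (a + b) = restrict_gens G a + restrict_gens G b"
  by (rule poly_mapping_eqI) (simp add: lookup_restrict_gens lookup_add)

lemma restrict_gens_zero: "restrict_gens G 0 = 0"
  by (rule poly_mapping_eqI) (simp add: lookup_restrict_gens)

lemma restrict_gens_uminus: "restrict_gens G (- a) = - restrict_gens G a"
  by (rule poly_mapping_eqI) (simp add: lookup_restrict_gens)

lemma restrict_gens_minus: "restrict_gens G (a - b) = restrict_gens G a - restrict_gens G b"
  by (rule poly_mapping_eqI) (simp add: lookup_restrict_gens lookup_minus)

lemma restrict_gens_single: "restrict_gens G (Poly_Mapping.single w c) =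
    (if set (letters w) \<subseteq> G then Poly_Mapping.single w c else 0)"
  by (rule poly_mapping_eqI) (auto simp: lookup_restrict_gens lookup_single when_def)

lemma restrict_gens_mult: "restrict_gens G (a * b) = restrict_gens G a * restrict_gens G b"
proof (induction a rule: monomial_induct)
  case (monomial a v c)
  have "restrict_gens G (Poly_Mapping.single v c * b) = restrict_gens G (Poly_Mapping.single v c) * restrict_gens G b"
  proof (induction b rule: monomial_induct)
    case (monomial b w d)
    then show ?case
      by (auto simp: distrib_left restrict_gens_add mult_single restrict_gens_single plus_gword_def)
  qed (simp add: restrict_gens_zero)
  with monomial show ?case by (simp add: distrib_right restrict_gens_add)
qed (simp add: restrict_gens_zero)

lemma restrict_gens_scalar: "restrict_gens G (scalar c) = scalar c"
  by (simp add: scalar_def restrict_gens_single zero_gword_def)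

lemma restrict_gens_one: "restrict_gens G 1 = 1"
  using restrict_gens_scalar[of G 1] by (simp add: scalar_one)

lemma restrict_gens_gen: "restrict_gens G (gen g) = (if g \<in> G then gen g else 0)"
  by (simp add: gen_def restrict_gens_single)

lemma restrict_gens_sum: "restrict_gens G (sum f S) = (\<Sum>x\<in>S. restrict_gens G (f x))"
  by (induction S rule: infinite_finite_induct) (simp_all add: restrict_gens_zero restrict_gens_add)

lemma restrict_gens_power: "restrict_gens G (a ^ k) = restrict_gens G a ^ k"
  by (induction k) (simp_all add: restrict_gens_one restrict_gens_mult)

lemmas restrict_gens_simps = restrict_gens_add restrict_gens_zero restrict_gens_uminus
  restrict_gens_minus restrict_gens_mult restrict_gens_scalar restrict_gens_one restrict_gens_sum
  restrict_gens_power restrict_gens_gen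

lemma restrict_gens_idem: "restrict_gens G (restrict_gens G a) = restrict_gens G a"
  by (rule poly_mapping_eqI) (simp add: lookup_restrict_gens)

lemma free_algebra_carrier_iff: "a \<in> carrier (free_algebra G) \<longleftrightarrow> restrict_gens G a = a"
proof -
  have "restrict_gens G a = a \<longleftrightarrow> (\<forall>w. \<not> set (letters w) \<subseteq> G \<longrightarrow> Poly_Mapping.lookup a w = 0)"
    by (auto simp: poly_mapping_eq_iff fun_eq_iff lookup_restrict_gens)
  then show ?thesis by (auto simp: free_algebra_def in_keys_iff)
qed

lemma free_algebra_ops:
  "add (free_algebra G) = (+)" "mult (free_algebra G) = (*)" "one (free_algebra G) = 1"
  "zero (free_algebra G) = 0" "smult (free_algebra G) = (\<lambda>c a. scalar c * a)"
  by (simp_all add: free_algebra_def type_algebra_def)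

lemma free_algebra_ring: "ring (free_algebra G :: ('k::field, 'g gword \<Rightarrow>\<^sub>0 'k) module)"
proof (intro ringI abelian_groupI monoidI)
  fix a :: "'g gword \<Rightarrow>\<^sub>0 'k" assume "a \<in> carrier (free_algebra G)"
  then show "\<exists>b\<in>carrier (free_algebra G). b \<oplus>\<^bsub>free_algebra G\<^esub> a = \<zero>\<^bsub>free_algebra G\<^esub>"
    by (intro bexI[of _ "- a"]) (simp_all add: free_algebra_ops free_algebra_carrier_iff restrict_gens_simps)
qed (auto simp: free_algebra_ops free_algebra_carrier_iff restrict_gens_simps algebra_simps)

text \<open>
  An ideal of a ring of a type class; the congruence modulo it is the calculus in which the relations of
  the algebra are exploited.
\<close>

inductive_set two_sided_ideal :: "'r::ring_1 set \<Rightarrow> 'r set" for S :: "'r set"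
where
  zero: "0 \<in> two_sided_ideal S"
| step: "a \<in> two_sided_ideal S \<Longrightarrow> s \<in> S \<Longrightarrow> a + u * s * v \<in> two_sided_ideal S"

lemma two_sided_ideal_add:
  assumes "a \<in> two_sided_ideal S" "b \<in> two_sided_ideal S"
  shows "a + b \<in> two_sided_ideal S"
  using assms(2)
proof induction
  case (step b s u v)
  then show ?case using two_sided_ideal.step[of "a + b" S s u v] by (simp add: add.assoc)
qed (simp add: assms(1))

lemma two_sided_ideal_mult:
  "a \<in> two_sided_ideal S \<Longrightarrow> x * a * y \<in> two_sided_ideal S"
proof (induction rule: two_sided_ideal.induct)
  case (step a s u v)
  then show ?case
    using two_sided_ideal.step[of "x * a * y" S s "x * u" "v * y"]
    by (simp add: distrib_left distrib_right mult.assoc)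
qed (simp add: two_sided_ideal.zero)

lemma two_sided_ideal_lmult: "a \<in> two_sided_ideal S \<Longrightarrow> x * a \<in> two_sided_ideal S"
  using two_sided_ideal_mult[of a S x 1] by simp

lemma two_sided_ideal_rmult: "a \<in> two_sided_ideal S \<Longrightarrow> a * x \<in> two_sided_ideal S"
  using two_sided_ideal_mult[of a S 1 x] by simp

lemma two_sided_ideal_uminus: "a \<in> two_sided_ideal S \<Longrightarrow> - a \<in> two_sided_ideal S"
  using two_sided_ideal_lmult[of a S "- 1"] by simp

lemma two_sided_ideal_base: "s \<in> S \<Longrightarrow> s \<in> two_sided_ideal S"
  using two_sided_ideal.step[OF two_sided_ideal.zero, of s S 1 1] by simp

lemma two_sided_ideal_mono: "S \<subseteq> S' \<Longrightarrow> two_sided_ideal S \<subseteq> two_sided_ideal S'"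
proof
  fix a assume "S \<subseteq> S'" "a \<in> two_sided_ideal S"
  from this(2,1) show "a \<in> two_sided_ideal S'"
    by induction (auto intro: two_sided_ideal.intros)
qed

locale ideal_congruence =
  fixes S :: "'r::ring_1 set"
begin

definition cong (infix \<open>\<approx>\<close> 50) where "a \<approx> b \<longleftrightarrow> a - b \<in> two_sided_ideal S"

lemma cong_refl [simp, intro]: "a \<approx> a"
  by (simp add: cong_def two_sided_ideal.zero)

lemma cong_sym: "a \<approx> b \<Longrightarrow> b \<approx> a"
  unfolding cong_def using two_sided_ideal_uminus by fastforce

lemma cong_trans [trans]: "a \<approx> b \<Longrightarrow> b \<approx> c \<Longrightarrow> a \<approx> c"
  unfolding cong_def using two_sided_ideal_add by fastforce

lemma cong_trans_eq [trans]: "a \<approx> b \<Longrightarrow> b = c \<Longrightarrow> a \<approx> c" "a = b \<Longrightarrow> b \<approx> c \<Longrightarrow> a \<approx> c"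
  by simp_all

lemma cong_add: "a \<approx> b \<Longrightarrow> c \<approx> d \<Longrightarrow> a + c \<approx> b + d"
  unfolding cong_def using two_sided_ideal_add[of "a - b" S "c - d"] by (simp add: algebra_simps)

lemma cong_uminus: "a \<approx> b \<Longrightarrow> - a \<approx> - b"
  unfolding cong_def using two_sided_ideal_uminus[of "a - b" S] by (simp add: algebra_simps)

lemma cong_minus: "a \<approx> b \<Longrightarrow> c \<approx> d \<Longrightarrow> a - c \<approx> b - d"
  using cong_add[of a b "- c" "- d"] cong_uminus[of c d] by simp

lemma cong_lmult: "a \<approx> b \<Longrightarrow> x * a \<approx> x * b"
  unfolding cong_def using two_sided_ideal_lmult[of "a - b" S x] by (simp add: algebra_simps)

lemma cong_rmult: "a \<approx> b \<Longrightarrow> a * x \<approx> b * x"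
  unfolding cong_def using two_sided_ideal_rmult[of "a - b" S x] by (simp add: algebra_simps)

lemma cong_mult: "a \<approx> b \<Longrightarrow> c \<approx> d \<Longrightarrow> a * c \<approx> b * d"
  by (rule cong_trans[OF cong_rmult cong_lmult])

lemma cong_mid: "a \<approx> b \<Longrightarrow> x * a * y \<approx> x * b * y"
  by (intro cong_rmult cong_lmult)

lemma cong_sum: "(\<And>i. i \<in> I \<Longrightarrow> f i \<approx> g i) \<Longrightarrow> sum f I \<approx> sum g I"
  by (induction I rule: infinite_finite_induct) (auto intro: cong_add)

lemma cong_zero_lmult: "a \<approx> 0 \<Longrightarrow> x * a \<approx> 0"
  using cong_lmult[of a 0 x] by simp

lemma cong_zero_rmult: "a \<approx> 0 \<Longrightarrow> a * x \<approx> 0"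
  using cong_rmult[of a 0 x] by simp

lemma cong_base: "a - b \<in> S \<Longrightarrow> a \<approx> b"
  unfolding cong_def by (rule two_sided_ideal_base)

lemma cong_iff_diff: "a \<approx> b \<longleftrightarrow> a - b \<approx> 0"
  by (simp add: cong_def)

end

section \<open>Quotient algebras\<close>

lemma quotient_algebra_ops:
  fixes F :: "('k, 'a) module"
  assumes F: "ring F" and J: "ideal J F"
    and sm: "\<forall>c. \<forall>a\<in>carrier F. c \<odot>\<^bsub>F\<^esub> a \<in> carrier F"
    and smJ: "\<forall>c. \<forall>a\<in>carrier F. \<forall>b\<in>J +>\<^bsub>F\<^esub> a. c \<odot>\<^bsub>F\<^esub> b \<in> J +>\<^bsub>F\<^esub> (c \<odot>\<^bsub>F\<^esub> a)"
  shows "carrier (quotient_algebra F J) = (\<lambda>a. J +>\<^bsub>F\<^esub> a) ` carrier F"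
    and "\<lbrakk>a \<in> carrier F; b \<in> carrier F\<rbrakk> \<Longrightarrow>
      (J +>\<^bsub>F\<^esub> a) \<oplus>\<^bsub>quotient_algebra F J\<^esub> (J +>\<^bsub>F\<^esub> b) = J +>\<^bsub>F\<^esub> (a \<oplus>\<^bsub>F\<^esub> b)"
    and "\<lbrakk>a \<in> carrier F; b \<in> carrier F\<rbrakk> \<Longrightarrow>
      (J +>\<^bsub>F\<^esub> a) \<otimes>\<^bsub>quotient_algebra F J\<^esub> (J +>\<^bsub>F\<^esub> b) = J +>\<^bsub>F\<^esub> (a \<otimes>\<^bsub>F\<^esub> b)"
    and "\<one>\<^bsub>quotient_algebra F J\<^esub> = J +>\<^bsub>F\<^esub> \<one>\<^bsub>F\<^esub>"
    and "\<zero>\<^bsub>quotient_algebra F J\<^esub> = J +>\<^bsub>F\<^esub> \<zero>\<^bsub>F\<^esub>"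
    and "a \<in> carrier F \<Longrightarrow>
      c \<odot>\<^bsub>quotient_algebra F J\<^esub> (J +>\<^bsub>F\<^esub> a) = J +>\<^bsub>F\<^esub> (c \<odot>\<^bsub>F\<^esub> a)"
proof -
  interpret F: ring F by (rule F)
  interpret J: ideal J F by (rule J)
  show "carrier (quotient_algebra F J) = (\<lambda>a. J +>\<^bsub>F\<^esub> a) ` carrier F"
    by (auto simp: quotient_algebra_def FactRing_simps a_r_coset_def')
  show "\<zero>\<^bsub>quotient_algebra F J\<^esub> = J +>\<^bsub>F\<^esub> \<zero>\<^bsub>F\<^esub>"
    using F.a_coset_add_zero J.a_subset by (simp add: quotient_algebra_def FactRing_def)
  show "\<one>\<^bsub>quotient_algebra F J\<^esub> = J +>\<^bsub>F\<^esub> \<one>\<^bsub>F\<^esub>"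
    by (simp add: quotient_algebra_def FactRing_def)
  assume a: "a \<in> carrier F"
  have "J +>\<^bsub>F\<^esub> (c \<odot>\<^bsub>F\<^esub> b) = J +>\<^bsub>F\<^esub> (c \<odot>\<^bsub>F\<^esub> a)" if "b \<in> J +>\<^bsub>F\<^esub> a" for b
    using J.a_repr_independence'[of "c \<odot>\<^bsub>F\<^esub> b" "c \<odot>\<^bsub>F\<^esub> a"] smJ sm a that by simp
  then have "(\<Union>b\<in>J +>\<^bsub>F\<^esub> a. J +>\<^bsub>F\<^esub> (c \<odot>\<^bsub>F\<^esub> b)) = J +>\<^bsub>F\<^esub> (c \<odot>\<^bsub>F\<^esub> a)"
    using J.a_rcos_self[OF a] by blast
  then show "c \<odot>\<^bsub>quotient_algebra F J\<^esub> (J +>\<^bsub>F\<^esub> a) = J +>\<^bsub>F\<^esub> (c \<odot>\<^bsub>F\<^esub> a)"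
    by (simp add: quotient_algebra_def)
  assume b: "b \<in> carrier F"
  show "(J +>\<^bsub>F\<^esub> a) \<oplus>\<^bsub>quotient_algebra F J\<^esub> (J +>\<^bsub>F\<^esub> b) = J +>\<^bsub>F\<^esub> (a \<oplus>\<^bsub>F\<^esub> b)"
    using J.a_rcos_sum[OF a b] by (simp add: quotient_algebra_def FactRing_def)
  show "(J +>\<^bsub>F\<^esub> a) \<otimes>\<^bsub>quotient_algebra F J\<^esub> (J +>\<^bsub>F\<^esub> b) = J +>\<^bsub>F\<^esub> (a \<otimes>\<^bsub>F\<^esub> b)"
    using J.rcoset_mult_add[OF a b] by (simp add: quotient_algebra_def FactRing_def)
qed

section \<open>The block as a quotient of the free algebra on all generators\<close>

lemma restrict_gens_eval2:
  "restrict_gens G (eval2 scalar P u v) = eval2 scalar P (restrict_gens G u) (restrict_gens G v)"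
  by (simp add: eval2_def restrict_gens_simps)

lemma restrict_gens_eval_divided_difference:
  "restrict_gens G (eval_divided_difference scalar P u v w) =
    eval_divided_difference scalar P (restrict_gens G u) (restrict_gens G v) (restrict_gens G w)"
  by (simp add: eval_divided_difference_def restrict_gens_simps)

lemma finite_seqs: "finite (seqs l n)"
proof -
  have "seqs l n = {xs. set xs \<subseteq> {0..l} \<and> length xs = n}" by (auto simp: seqs_def)
  then show ?thesis using finite_lists_length_eq[of "{0..l}" n] by simp
qed

lemma swap_entries_append:
  "k = Suc (length p) \<Longrightarrow> swap_entries k (p @ a # b # s) = p @ b # a # s"
  by (simp add: swap_entries_def entry_def list_update_append nth_append)

lemma split_at_pair:
  assumes "1 \<le> k" "k < length \<nu>"
  obtains p a b s where "\<nu> = p @ a # b # s" "k = Suc (length p)"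
proof -
  obtain j where j: "k = Suc j" using assms(1) by (cases k) auto
  have "\<nu> = take j \<nu> @ drop j \<nu>" by simp
  also have "drop j \<nu> = \<nu> ! j # \<nu> ! Suc j # drop (Suc (Suc j)) \<nu>"
    using assms(2) j by (simp add: Cons_nth_drop_Suc)
  finally show ?thesis using that assms(2) j by simp
qed

lemma swap_entries_mset:
  assumes "1 \<le> k" "k < length \<nu>"
  shows "mset (swap_entries k \<nu>) = mset \<nu>"
  using assms by (rule split_at_pair) (simp add: swap_entries_append)

lemma swap_entries_involution:
  assumes "1 \<le> k" "k < length \<nu>"
  shows "swap_entries k (swap_entries k \<nu>) = \<nu>"
  using assms by (rule split_at_pair) (simp add: swap_entries_append)

lemma swap_entries_length [simp]: "length (swap_entries k \<nu>) = length \<nu>"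
  by (simp add: swap_entries_def)

lemma swap_entries_seqs:
  assumes "\<nu> \<in> seqs l n" "1 \<le> k" "k < n"
  shows "swap_entries k \<nu> \<in> seqs l n"
  using assms mset_eq_setD[OF swap_entries_mset[of k \<nu>]] by (auto simp: seqs_def)

lemma sum_list_simple_root: "sum_list (map simple_root \<nu>) = mset \<nu>"
  by (induction \<nu>) (simp_all add: simple_root_def)

lemma seqs_weight_iff: "\<nu> \<in> seqs_weight l \<beta> \<longleftrightarrow> \<nu> \<in> seqs l (size \<beta>) \<and> mset \<nu> = \<beta>"
  by (simp add: seqs_weight_def sum_list_simple_root)

lemma swap_entries_seqs_weight:
  assumes "\<nu> \<in> seqs_weight l \<beta>" "1 \<le> k" "k < size \<beta>"
  shows "swap_entries k \<nu> \<in> seqs_weight l \<beta>"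
  using assms swap_entries_seqs[of \<nu> l "size \<beta>" k] swap_entries_mset[of k \<nu>]
  by (auto simp: seqs_weight_iff seqs_def)

lemma klr_relations_restrict:
  assumes "r \<in> klr_relations l Q n" "1 \<le> n"
  shows "restrict_gens (klr_gens l n) r = r"
proof -
  have 1: "X k \<in> klr_gens l n \<longleftrightarrow> 1 \<le> k \<and> k \<le> n" "Psi k \<in> klr_gens l n \<longleftrightarrow> 1 \<le> k \<and> k < n"
    "E \<nu> \<in> klr_gens l n \<longleftrightarrow> \<nu> \<in> seqs l n" for k \<nu>
    by (auto simp: klr_gens_def)
  have 2: "1 \<le> Transposition.transpose k (k + 1) m" "Transposition.transpose k (k + 1) m \<le> n"
    if "1 \<le> k" "k < n" "1 \<le> m" "m \<le> n" for k m
    using that by (auto simp: Transposition.transpose_def)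
  note [simp] = 1 2 assms(2) swap_entries_seqs restrict_gens_simps
    restrict_gens_eval2 restrict_gens_eval_divided_difference
  from assms(1) show ?thesis
    by cases (auto simp del: One_nat_def Transposition.transpose_apply_first intro!: sum.cong)
qed

locale klr_presentation =
  fixes l :: nat and Q :: "nat \<Rightarrow> nat \<Rightarrow> 'k::field poly poly" and \<beta> :: "nat multiset"
  assumes size_pos: "1 \<le> size \<beta>"
begin

abbreviation "n \<equiv> size \<beta>"
abbreviation "G \<equiv> klr_gens l n"

text \<open>
  Modulo these relations the free algebra on all generators presents \<open>R(n)\<close>.
\<close>

definition outer_relations :: "'k klr_free set"
  where "outer_relations = klr_relations l Q n \<union> gen ` (- G)"

text \<open>
  Killing the idempotents of other weights replaces the multiplication by the central idempotent of the
  block: that idempotent becomes congruent to 1.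
\<close>

definition block_relations :: "'k klr_free set"
  where "block_relations = outer_relations \<union> idem ` (seqs l n - seqs_weight l \<beta>)"

definition block_idem :: "'k klr_free"
  where "block_idem = (\<Sum>\<nu>\<in>seqs_weight l \<beta>. idem \<nu>)"

sublocale ideal_congruence block_relations .

notation cong (infix \<open>\<approx>\<close> 50)

definition block_map :: "'k klr_free \<Rightarrow> 'k klr_free set"
  where "block_map a = klr_ideal l Q n +>\<^bsub>free_algebra G\<^esub> restrict_gens G (a * block_idem)"

interpretation outer: ideal_congruence outer_relations .

lemma outer_le: "outer.cong a b \<Longrightarrow> a \<approx> b"
proof -
  have "outer_relations \<subseteq> block_relations" by (simp add: block_relations_def)
  from two_sided_ideal_mono[OF this] show "outer.cong a b \<Longrightarrow> a \<approx> b"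
    unfolding cong_def outer.cong_def by blast
qed

lemma finite_seqs_weight: "finite (seqs_weight l \<beta>)"
  by (rule finite_subset[OF _ finite_seqs[of l n]]) (auto simp: seqs_weight_iff)

lemma outer_relation: "a - b \<in> klr_relations l Q n \<Longrightarrow> outer.cong a b"
  by (rule outer.cong_base) (simp add: outer_relations_def)

lemma outer_outside: "g \<notin> G \<Longrightarrow> outer.cong (gen g) 0"
  by (rule outer.cong_base) (simp add: outer_relations_def)

lemma outer_idem_mult:
  assumes "\<nu> \<in> seqs l n" "\<nu>' \<in> seqs l n"
  shows "outer.cong (idem \<nu> * idem \<nu>') (if \<nu> = \<nu>' then idem \<nu> else 0)"
  by (rule outer_relation) (rule klr_relations.idem_idem[OF assms])

lemma outer_idem_block:
  assumes "\<nu> \<in> seqs l n"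
  shows "outer.cong (idem \<nu> * block_idem) (if \<nu> \<in> seqs_weight l \<beta> then idem \<nu> else 0)"
    and "outer.cong (block_idem * idem \<nu>) (if \<nu> \<in> seqs_weight l \<beta> then idem \<nu> else 0)"
proof -
  have "outer.cong (idem \<nu> * block_idem) (\<Sum>\<nu>'\<in>seqs_weight l \<beta>. if \<nu> = \<nu>' then idem \<nu> else 0)"
    unfolding block_idem_def sum_distrib_left
    by (intro outer.cong_sum outer_idem_mult assms) (simp add: seqs_weight_iff)
  then show "outer.cong (idem \<nu> * block_idem) (if \<nu> \<in> seqs_weight l \<beta> then idem \<nu> else 0)"
    by (simp add: finite_seqs_weight)
  have "outer.cong (block_idem * idem \<nu>) (\<Sum>\<nu>'\<in>seqs_weight l \<beta>. if \<nu>' = \<nu> then idem \<nu>' else 0)"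
    unfolding block_idem_def sum_distrib_right
    by (intro outer.cong_sum outer_idem_mult assms) (simp add: seqs_weight_iff)
  then show "outer.cong (block_idem * idem \<nu>) (if \<nu> \<in> seqs_weight l \<beta> then idem \<nu> else 0)"
    by (simp add: finite_seqs_weight)
qed

lemma outer_block_gen: "outer.cong (gen g * block_idem) (block_idem * gen g)"
proof (cases "g \<in> G")
  case False
  then show ?thesis
    using outer.cong_trans[OF outer.cong_zero_rmult outer.cong_sym[OF outer.cong_zero_lmult]] outer_outside
    by metis
next
  case True
  show ?thesis
  proof (cases g)
    case (E \<nu>)
    with True have "\<nu> \<in> seqs l n" by (auto simp: klr_gens_def)
    then show ?thesis
      using outer.cong_trans[OF outer_idem_block(1) outer.cong_sym[OF outer_idem_block(2)]] E by simp
  next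
    case (X k)
    with True have "k \<in> {1..n}" by (auto simp: klr_gens_def)
    then show ?thesis
      unfolding X block_idem_def sum_distrib_left sum_distrib_right
      by (intro outer.cong_sum outer_relation klr_relations.x_idem) (auto simp: seqs_weight_iff)
  next
    case (Psi k)
    with True have k: "1 \<le> k" "k < n" by (auto simp: klr_gens_def)
    have "outer.cong (psi k * block_idem) (\<Sum>\<nu>\<in>seqs_weight l \<beta>. idem (swap_entries k \<nu>) * psi k)"
      unfolding block_idem_def sum_distrib_left
      using k by (intro outer.cong_sum outer_relation klr_relations.psi_idem) (auto simp: seqs_weight_iff)
    also have "(\<Sum>\<nu>\<in>seqs_weight l \<beta>. idem (swap_entries k \<nu>) * psi k) = block_idem * psi k"
      unfolding block_idem_def sum_distrib_right
      by (rule sum.reindex_bij_witness[of _ "swap_entries k" "swap_entries k"])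
        (use k swap_entries_involution[of k] swap_entries_seqs_weight[of _ l \<beta> k] in
          \<open>auto simp: seqs_weight_iff seqs_def\<close>)
    finally show ?thesis unfolding Psi .
  qed
qed

text \<open>
  A crossing permutes the idempotents of a given weight, so it commutes with their sum.
\<close>

lemma outer_block_central: "outer.cong (a * block_idem) (block_idem * a)"
proof (induction a rule: free_algebra_induct)
  case (mult a b)
  have "outer.cong (a * (b * block_idem)) (a * (block_idem * b))"
    by (rule outer.cong_lmult) (rule mult)
  moreover have "outer.cong (a * block_idem * b) (block_idem * a * b)"
    by (rule outer.cong_rmult) (rule mult)
  ultimately show ?case using outer.cong_trans by (simp add: mult.assoc)
next
  case (add a b)
  then show ?case unfolding distrib_left distrib_right by (rule outer.cong_add)
qed (simp_all add: scalar_central outer_block_gen)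

lemma outer_block_idem: "outer.cong (block_idem * block_idem) block_idem"
proof -
  have "outer.cong (block_idem * block_idem) (\<Sum>\<nu>\<in>seqs_weight l \<beta>. idem \<nu>)"
  proof -
    have "outer.cong (block_idem * block_idem) (\<Sum>\<nu>\<in>seqs_weight l \<beta>. if \<nu> \<in> seqs_weight l \<beta> then idem \<nu> else 0)"
      by (subst (2) block_idem_def, subst sum_distrib_left)
        (intro outer.cong_sum outer_idem_block(2), simp add: seqs_weight_iff)
    then show ?thesis by (simp cong: sum.cong)
  qed
  then show ?thesis by (simp flip: block_idem_def)
qed

lemma block_idem_one: "block_idem \<approx> 1"
proof -
  have "(\<Sum>\<nu>\<in>seqs l n. idem \<nu>) \<approx> (1 :: 'k klr_free)"
    by (intro outer_le outer_relation klr_relations.idem_sum)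
  moreover have "(\<Sum>\<nu>\<in>seqs l n. idem \<nu>) \<approx> (\<Sum>\<nu>\<in>seqs l n. if \<nu> \<in> seqs_weight l \<beta> then idem \<nu> else 0)"
  proof (rule cong_sum)
    fix \<nu> assume "\<nu> \<in> seqs l n"
    then have "idem \<nu> \<approx> 0" if "\<nu> \<notin> seqs_weight l \<beta>"
      using that by (intro cong_base) (simp add: block_relations_def)
    then show "idem \<nu> \<approx> (if \<nu> \<in> seqs_weight l \<beta> then idem \<nu> else 0)" by simp
  qed
  moreover have "(\<Sum>\<nu>\<in>seqs l n. if \<nu> \<in> seqs_weight l \<beta> then idem \<nu> else 0) = block_idem"
  proof -
    have "seqs l n \<inter> seqs_weight l \<beta> = seqs_weight l \<beta>" by (auto simp: seqs_weight_iff)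
    then show ?thesis unfolding block_idem_def by (simp add: sum.If_cases finite_seqs Int_def[symmetric])
  qed
  ultimately show ?thesis using cong_sym cong_trans by metis
qed

lemma block_to_outer: "a \<approx> 0 \<Longrightarrow> outer.cong (a * block_idem) 0"
  unfolding cong_def outer.cong_def diff_zero
proof (induction rule: two_sided_ideal.induct)
  case (step a s u v)
  have "outer.cong (s * block_idem) 0"
    using step(2) unfolding block_relations_def
  proof
    assume "s \<in> outer_relations"
    then show ?thesis by (intro outer.cong_zero_rmult outer.cong_base) simp
  next
    assume "s \<in> idem ` (seqs l n - seqs_weight l \<beta>)"
    then obtain \<nu> where "s = idem \<nu>" "\<nu> \<in> seqs l n" "\<nu> \<notin> seqs_weight l \<beta>" by auto
    then show ?thesis using outer_idem_block(1)[of \<nu>] by simp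
  qed
  then have "outer.cong (u * (s * block_idem) * v) 0"
    by (rule outer.cong_zero_rmult[OF outer.cong_zero_lmult])
  moreover have "outer.cong (u * s * (v * block_idem)) (u * s * (block_idem * v))"
    by (rule outer.cong_lmult) (rule outer_block_central)
  ultimately have "outer.cong (u * s * v * block_idem) 0"
    using outer.cong_trans by (simp add: mult.assoc)
  then show ?case
    using two_sided_ideal_add[OF step(3)] by (simp add: outer.cong_def distrib_right)
qed (simp add: two_sided_ideal.zero)

lemma cong_iff_outer: "a \<approx> b \<longleftrightarrow> outer.cong (a * block_idem) (b * block_idem)"
proof
  assume "a \<approx> b"
  then have "outer.cong ((a - b) * block_idem) 0" using block_to_outer cong_iff_diff by blast
  then show "outer.cong (a * block_idem) (b * block_idem)"
    by (subst outer.cong_iff_diff) (simp add: left_diff_distrib)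
next
  assume "outer.cong (a * block_idem) (b * block_idem)"
  then have "a * block_idem \<approx> b * block_idem" by (rule outer_le)
  moreover have "x * block_idem \<approx> x" for x using cong_lmult[OF block_idem_one, of x] by simp
  ultimately show "a \<approx> b" using cong_sym cong_trans by metis
qed

lemma restrict_outer: "outer.cong (restrict_gens G a) a"
proof (induction a rule: free_algebra_induct)
  case (gen g)
  then show ?case using outer.cong_sym[OF outer_outside[of g]] by (auto simp: restrict_gens_gen)
next
  case (add a b)
  then show ?case unfolding restrict_gens_add by (rule outer.cong_add)
next
  case (mult a b)
  then show ?case unfolding restrict_gens_mult by (rule outer.cong_mult)
qed (simp add: restrict_gens_scalar)

lemma relations_restrict: "r \<in> klr_relations l Q n \<Longrightarrow> restrict_gens G r = r"
  by (rule klr_relations_restrict[OF _ size_pos])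

abbreviation "F \<equiv> free_algebra G :: ('k, 'k klr_free) module"

interpretation F: ring F by (rule free_algebra_ring)

lemma klr_ideal_ideal: "ideal (klr_ideal l Q n) F"
  unfolding klr_ideal_def Let_def
  by (rule F.genideal_ideal) (auto simp: free_algebra_carrier_iff relations_restrict)

interpretation J: ideal "klr_ideal l Q n" F by (rule klr_ideal_ideal)

lemma klr_relations_in_ideal: "klr_relations l Q n \<subseteq> klr_ideal l Q n"
  unfolding klr_ideal_def Let_def
  by (rule F.genideal_self) (auto simp: free_algebra_carrier_iff relations_restrict)

lemma outer_ideal_restrict: "a \<in> two_sided_ideal outer_relations \<Longrightarrow> restrict_gens G a \<in> klr_ideal l Q n"
proof (induction rule: two_sided_ideal.induct)
  case zero
  show ?case using J.zero_closed by (simp add: restrict_gens_zero free_algebra_ops)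
next
  case (step a s u v)
  have s: "restrict_gens G s \<in> klr_ideal l Q n"
    using step(2) unfolding outer_relations_def
  proof
    assume "s \<in> klr_relations l Q n"
    then show ?thesis using klr_relations_in_ideal by (auto simp: relations_restrict)
  next
    assume "s \<in> gen ` (- G)"
    then have "restrict_gens G s = 0" by (auto simp: restrict_gens_gen)
    then show ?thesis using J.zero_closed by (simp add: free_algebra_ops)
  qed
  have F: "restrict_gens G x \<in> carrier F" for x
    by (simp add: free_algebra_carrier_iff restrict_gens_idem)
  show ?case
    using J.a_closed[OF step(3) J.I_r_closed[OF J.I_l_closed[OF s F] F]]
    by (simp add: free_algebra_ops restrict_gens_simps)
qed

text \<open>
  The ideal of the relations is generated inside the free algebra on \<open>G\<close>. It is compared with the ideal in
  the larger free algebra by intersecting the latter with the smaller algebra.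
\<close>

lemma klr_ideal_le_outer: "klr_ideal l Q n \<subseteq> two_sided_ideal outer_relations"
proof -
  have "ideal (two_sided_ideal outer_relations \<inter> carrier F) F"
  proof (rule idealI)
    show "ring F" by (rule free_algebra_ring)
    show "subgroup (two_sided_ideal outer_relations \<inter> carrier F) (add_monoid F)"
    proof (rule subgroup.intro)
      fix x assume "x \<in> two_sided_ideal outer_relations \<inter> carrier F"
      then have x: "x \<in> carrier F" "- x \<in> two_sided_ideal outer_relations \<inter> carrier F"
        by (auto simp: two_sided_ideal_uminus free_algebra_carrier_iff restrict_gens_simps)
      have "\<ominus>\<^bsub>F\<^esub> x = - x"
        by (rule F.minus_equality) (use x in \<open>auto simp: free_algebra_ops\<close>)
      then show "inv\<^bsub>add_monoid F\<^esub> x \<in> two_sided_ideal outer_relations \<inter> carrier F"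
        using x by (simp add: a_inv_def)
    qed (auto simp: free_algebra_ops free_algebra_carrier_iff restrict_gens_simps
        two_sided_ideal_add two_sided_ideal.zero)
  qed (auto simp: free_algebra_ops free_algebra_carrier_iff restrict_gens_simps
        intro: two_sided_ideal_lmult two_sided_ideal_rmult)
  moreover have "klr_relations l Q n \<subseteq> two_sided_ideal outer_relations \<inter> carrier F"
    by (auto simp: free_algebra_carrier_iff relations_restrict outer_relations_def intro: two_sided_ideal_base)
  ultimately have "klr_ideal l Q n \<subseteq> two_sided_ideal outer_relations \<inter> carrier F"
    unfolding klr_ideal_def Let_def by (rule F.genideal_minimal)
  then show ?thesis by blast
qed

lemma coset_eq_iff:
  "klr_ideal l Q n +>\<^bsub>F\<^esub> restrict_gens G a = klr_ideal l Q n +>\<^bsub>F\<^esub> restrict_gens G b \<longleftrightarrow> outer.cong a b"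
proof -
  let ?J = "klr_ideal l Q n"
  have F: "restrict_gens G x \<in> carrier F" for x
    by (simp add: free_algebra_carrier_iff restrict_gens_idem)
  have minus: "x \<ominus>\<^bsub>F\<^esub> y = x - y" if "x \<in> carrier F" "y \<in> carrier F" for x y
  proof -
    have "\<ominus>\<^bsub>F\<^esub> y = - y"
      by (rule F.minus_equality) (use that in \<open>auto simp: free_algebra_ops free_algebra_carrier_iff restrict_gens_simps\<close>)
    then show ?thesis by (simp add: a_minus_def free_algebra_ops)
  qed
  have "?J +>\<^bsub>F\<^esub> restrict_gens G a = ?J +>\<^bsub>F\<^esub> restrict_gens G b \<longleftrightarrow>
      restrict_gens G a \<in> ?J +>\<^bsub>F\<^esub> restrict_gens G b"
    using J.a_repr_independence'[OF _ F, of "restrict_gens G a" b] J.a_rcos_self[OF F, of a] by auto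
  also have "\<dots> \<longleftrightarrow> restrict_gens G a \<ominus>\<^bsub>F\<^esub> restrict_gens G b \<in> ?J"
    using J.a_rcos_module[OF F[of b] F[of a]] by (simp add: a_minus_def)
  also have "\<dots> \<longleftrightarrow> restrict_gens G (a - b) \<in> ?J"
    by (simp add: minus F restrict_gens_minus)
  also have "\<dots> \<longleftrightarrow> outer.cong a b"
  proof
    assume "restrict_gens G (a - b) \<in> ?J"
    then have "outer.cong (restrict_gens G (a - b)) 0"
      using klr_ideal_le_outer by (auto simp: outer.cong_def)
    then show "outer.cong a b"
      using outer.cong_trans[OF outer.cong_sym[OF restrict_outer]] outer.cong_iff_diff by blast
  qed (auto simp: outer.cong_def outer_ideal_restrict)
  finally show ?thesis .
qed

text \<open>
  With this equivalence every identity of the block becomes a congruence in the free algebra.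
\<close>

lemma block_map_eq_iff: "block_map a = block_map b \<longleftrightarrow> a \<approx> b"
  unfolding block_map_def coset_eq_iff cong_iff_outer ..

lemma klr_block_presentation: "algebra_presentation (klr_block l Q \<beta>) block_map scalar"
proof -
  let ?J = "klr_ideal l Q n"
  let ?R = "quotient_algebra F ?J"
  let ?c = "\<lambda>a. ?J +>\<^bsub>F\<^esub> restrict_gens G a"
  have sm: "\<forall>c. \<forall>a\<in>carrier F. c \<odot>\<^bsub>F\<^esub> a \<in> carrier F"
    by (simp add: free_algebra_ops free_algebra_carrier_iff restrict_gens_simps)
  have smJ: "\<forall>c. \<forall>a\<in>carrier F. \<forall>b\<in>?J +>\<^bsub>F\<^esub> a. c \<odot>\<^bsub>F\<^esub> b \<in> ?J +>\<^bsub>F\<^esub> (c \<odot>\<^bsub>F\<^esub> a)"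
  proof (intro allI ballI)
    fix c a b assume a: "a \<in> carrier F" "b \<in> ?J +>\<^bsub>F\<^esub> a"
    obtain j where j: "j \<in> ?J" "b = j + a" using a by (auto simp: a_r_coset_def' free_algebra_ops)
    have "scalar c \<in> carrier F" by (simp add: free_algebra_carrier_iff restrict_gens_simps)
    then have "scalar c * j \<in> ?J" using J.I_l_closed[OF j(1)] by (simp add: free_algebra_ops)
    then show "c \<odot>\<^bsub>F\<^esub> b \<in> ?J +>\<^bsub>F\<^esub> (c \<odot>\<^bsub>F\<^esub> a)" using j by (auto simp: a_r_coset_def' free_algebra_ops distrib_left)
  qed
  have F: "restrict_gens G x \<in> carrier F" for x
    by (simp add: free_algebra_carrier_iff restrict_gens_idem)
  note ops = quotient_algebra_ops[OF free_algebra_ring klr_ideal_ideal sm smJ]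
  have c_add: "?c a \<oplus>\<^bsub>?R\<^esub> ?c b = ?c (a + b)" and c_mult: "?c a \<otimes>\<^bsub>?R\<^esub> ?c b = ?c (a * b)"
    and c_smult: "x \<odot>\<^bsub>?R\<^esub> ?c a = ?c (scalar x * a)" for a b x
    using ops(2,3)[OF F F, of a b] ops(6)[OF F, of x a]
    by (simp_all add: free_algebra_ops restrict_gens_simps)
  have c_carrier: "carrier ?R = range ?c"
    unfolding ops(1) by (auto simp: free_algebra_carrier_iff restrict_gens_idem image_iff) metis
  have be: "klr_block_idem l Q \<beta> = ?c block_idem"
  proof -
    have "restrict_gens G block_idem = block_idem"
      unfolding block_idem_def restrict_gens_sum
      by (intro sum.cong refl) (auto simp: restrict_gens_gen klr_gens_def seqs_weight_iff)
    then show ?thesis by (simp add: klr_block_idem_def block_idem_def)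
  qed
  have block: "klr_block l Q \<beta> = ?R\<lparr>carrier := {r \<otimes>\<^bsub>?R\<^esub> ?c block_idem | r. r \<in> carrier ?R}, one := ?c block_idem\<rparr>"
    unfolding klr_block_def be klr_algebra_def Let_def ..
  show ?thesis
  proof
    show "carrier (klr_block l Q \<beta>) = range block_map"
      unfolding block block_map_def by (simp add: c_carrier) (auto simp: c_mult[symmetric])
    show "block_map a \<oplus>\<^bsub>klr_block l Q \<beta>\<^esub> block_map b = block_map (a + b)" for a b
      unfolding block block_map_def by (simp add: c_add distrib_right)
    show "block_map a \<otimes>\<^bsub>klr_block l Q \<beta>\<^esub> block_map b = block_map (a * b)" for a b
    proof -
      have "outer.cong (a * block_idem * b * block_idem) (a * (b * block_idem) * block_idem)"
        using outer.cong_mid[OF outer.cong_sym[OF outer_block_central[of b]], of a block_idem] by (simp add: mult.assoc)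
      also have "outer.cong \<dots> (a * b * block_idem)"
        using outer.cong_lmult[OF outer_block_idem, of "a * b"] by (simp add: mult.assoc)
      finally show ?thesis unfolding block block_map_def by (simp add: c_mult coset_eq_iff mult.assoc)
    qed
    show "\<one>\<^bsub>klr_block l Q \<beta>\<^esub> = block_map 1" unfolding block block_map_def by simp
    show "\<zero>\<^bsub>klr_block l Q \<beta>\<^esub> = block_map 0"
      unfolding block block_map_def using ops(5) by (simp add: free_algebra_ops restrict_gens_simps)
    show "c \<odot>\<^bsub>klr_block l Q \<beta>\<^esub> block_map a = block_map (scalar c * a)" for c a
      unfolding block block_map_def by (simp add: c_smult mult.assoc)
  qed (rule scalar_add scalar_mult scalar_one scalar_central)+
qed

end

section \<open>The polynomials of neighbouring and of distant letters\<close>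

lemma eval2_two_terms:
  fixes u v w :: "'a::ring_1"
  assumes supp: "\<And>p q. coeff2 P p q \<noteq> 0 \<Longrightarrow> p = a \<and> q = 0 \<or> p = 0 \<and> q = b"
    and ab: "0 < a" "0 < b" and \<iota>: "\<iota> 0 = 0"
  shows "eval2 \<iota> P u v = \<iota> (coeff2 P a 0) * u ^ a + \<iota> (coeff2 P 0 b) * v ^ b"
    and "eval_divided_difference \<iota> P u v w =
      \<iota> (coeff2 P a 0) * (\<Sum>i<a. u ^ i * w ^ (a - Suc i))"
proof -
  let ?S = "SIGMA q:{..degree P}. {..degree (coeff P q)}" and ?T = "{(0, a), (b, 0)}"
  have outside: "coeff2 P p q = 0" if "(q, p) \<notin> ?S" for p q
    using that coeff_eq_0[of P q] coeff_eq_0[of "coeff P q" p] by (force simp: coeff2_def not_le)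
  have "(\<Sum>(q, p)\<in>?S. \<iota> (coeff2 P p q) * f p q) = (\<Sum>(q, p)\<in>?T. \<iota> (coeff2 P p q) * f p q)"
    for f :: "nat \<Rightarrow> nat \<Rightarrow> 'a"
  proof (rule sum.mono_neutral_cong)
    show "finite ?T" "finite ?S" by simp_all
    fix x assume "x \<in> ?T - ?S"
    then show "(case x of (q, p) \<Rightarrow> \<iota> (coeff2 P p q) * f p q) = 0"
      using outside \<iota> by (cases x) simp
  next
    fix x assume x: "x \<in> ?S - ?T"
    obtain q p where [simp]: "x = (q, p)" by (cases x)
    have "coeff2 P p q = 0" using supp[of p q] x by auto
    then show "(case x of (q, p) \<Rightarrow> \<iota> (coeff2 P p q) * f p q) = 0" using \<iota> by simp
  qed simp
  then have *: "(\<Sum>q\<le>degree P. \<Sum>p\<le>degree (coeff P q). \<iota> (coeff2 P p q) * f p q) =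
      \<iota> (coeff2 P a 0) * f a 0 + \<iota> (coeff2 P 0 b) * f 0 b" for f :: "nat \<Rightarrow> nat \<Rightarrow> 'a"
    using ab by (simp add: sum.Sigma)
  show "eval2 \<iota> P u v = \<iota> (coeff2 P a 0) * u ^ a + \<iota> (coeff2 P 0 b) * v ^ b"
    unfolding eval2_def * by simp
  show "eval_divided_difference \<iota> P u v w = \<iota> (coeff2 P a 0) * (\<Sum>i<a. u ^ i * w ^ (a - Suc i))"
    unfolding eval_divided_difference_def * by simp
qed

lemma eval2_zero: "\<iota> 0 = 0 \<Longrightarrow> eval2 \<iota> 0 u v = 0"
  by (simp add: eval2_def coeff2_def)

lemma eval2_one: "eval2 \<iota> 1 u v = \<iota> 1"
  by (simp add: eval2_def coeff2_def)

lemma eval_divided_difference_one: "eval_divided_difference \<iota> 1 u v w = 0"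
  by (simp add: eval_divided_difference_def)

definition far :: "nat \<Rightarrow> nat \<Rightarrow> bool"
  where "far i j \<longleftrightarrow> i + 2 \<le> j \<or> j + 2 \<le> i"

text \<open>
  The exponent of \<open>u\<close> in \<open>Q i j\<close> for neighbours \<open>i\<close> and \<open>j\<close>, that is, minus the Cartan integer.
\<close>

definition edge_exp :: "nat \<Rightarrow> nat \<Rightarrow> nat \<Rightarrow> nat"
  where "edge_exp l i j = (if i = 0 \<or> i = l then 2 else 1)"

lemma cartan_edge:
  assumes "2 \<le> l" "i \<le> l" "j \<le> l" "j = Suc i \<or> i = Suc j"
  shows "cartan l i j = - int (edge_exp l i j)"
  using assms(4)
proof
  assume "j = Suc i"
  then show ?thesis using assms(1-3) by (simp add: cartan_def edge_exp_def)
next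
  assume i: "i = Suc j"
  have "i = l \<and> j = l - 1 \<longleftrightarrow> i = l" using i by auto
  then show ?thesis using assms(1-3) i by (simp add: cartan_def edge_exp_def)
qed

lemma far_sym: "far i j \<longleftrightarrow> far j i"
  by (auto simp: far_def)

locale klr_data =
  fixes l :: nat and Q :: "nat \<Rightarrow> nat \<Rightarrow> 'k::field poly poly"
  assumes l2: "2 \<le> l" and klr_Q: "klr_polynomials l Q"
begin

lemma Q_self: "i \<le> l \<Longrightarrow> Q i i = 0"
  using klr_Q by (simp add: klr_polynomials_def)

lemma Q_far: "i \<le> l \<Longrightarrow> j \<le> l \<Longrightarrow> far i j \<Longrightarrow> Q i j = 1"
proof -
  assume "i \<le> l" "j \<le> l" "far i j"
  moreover from this have "cartan l i j = 0" by (auto simp: cartan_def far_def)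
  moreover have "\<forall>i\<le>l. \<forall>j\<le>l. cartan l i j = 0 \<longrightarrow> Q i j = 1"
    using klr_Q unfolding klr_polynomials_def by (elim conjE)
  ultimately show "Q i j = 1" by simp
qed

text \<open>
  By homogeneity only two monomials can occur for neighbours, one in \<open>u\<close> and one in \<open>v\<close>, and both
  coefficients are nonzero; their values do not matter below.
\<close>

lemma Q_neighbours:
  assumes "i \<le> l" "j \<le> l" "j = Suc i \<or> i = Suc j"
  obtains c d where "c \<noteq> 0" "d \<noteq> 0"
    and "\<And>\<iota> (u :: 'a::ring_1) v. \<iota> 0 = 0 \<Longrightarrow>
      eval2 \<iota> (Q i j) u v = \<iota> c * u ^ edge_exp l i j + \<iota> d * v ^ edge_exp l j i"
    and "\<And>\<iota> (u :: 'a) v w. \<iota> 0 = 0 \<Longrightarrow> eval_divided_difference \<iota> (Q i j) u v w =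
      \<iota> c * (\<Sum>t<edge_exp l i j. u ^ t * w ^ (edge_exp l i j - Suc t))"
proof -
  have ne: "i \<noteq> j" using assms by auto
  have klr: "(\<forall>p q. coeff2 (Q i j) p q \<noteq> 0 \<longrightarrow>
          int p * pairing l i i + int q * pairing l j j + 2 * pairing l i j = 0) \<and>
       coeff2 (Q i j) (nat (- cartan l i j)) 0 \<noteq> 0 \<and>
       (\<forall>p q. coeff2 (Q i j) p q = coeff2 (Q j i) q p)" if "i \<le> l" "j \<le> l" "i \<noteq> j" for i j
  proof -
    have "\<forall>i\<le>l. \<forall>j\<le>l. i \<noteq> j \<longrightarrow> (\<forall>p q. coeff2 (Q i j) p q \<noteq> 0 \<longrightarrow>
          int p * pairing l i i + int q * pairing l j j + 2 * pairing l i j = 0) \<and>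
       coeff2 (Q i j) (nat (- cartan l i j)) 0 \<noteq> 0 \<and>
       (\<forall>p q. coeff2 (Q i j) p q = coeff2 (Q j i) q p)"
      using klr_Q unfolding klr_polynomials_def by (elim conjE)
    then show ?thesis using that by simp
  qed
  have deg: "int p * pairing l i i + int q * pairing l j j + 2 * pairing l i j = 0"
    if "coeff2 (Q i j) p q \<noteq> 0" for p q
    using klr[OF assms(1,2) ne] that by simp
  have exp: "nat (- cartan l i j) = edge_exp l i j" "nat (- cartan l j i) = edge_exp l j i"
    using cartan_edge[OF l2 assms(1,2)] cartan_edge[OF l2 assms(2,1)] assms(3) by auto
  have pos: "0 < edge_exp l i j" "0 < edge_exp l j i" by (auto simp: edge_exp_def)
  have supp: "p = edge_exp l i j \<and> q = 0 \<or> p = 0 \<and> q = edge_exp l j i"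
    if "coeff2 (Q i j) p q \<noteq> 0" for p q
  proof -
    define si sj where "si = sym_factor l i" and "sj = sym_factor l j"
    have s: "si = (if i = 0 \<or> i = l then 1 else 2)" "sj = (if j = 0 \<or> j = l then 1 else 2)"
      by (simp_all add: si_def sj_def sym_factor_def)
    have "si * cartan l i j = - 2" unfolding cartan_edge[OF l2 assms] s edge_exp_def by simp
    then have "2 * (int p * si + int q * sj) = 4"
      using deg[OF that] unfolding pairing_def si_def[symmetric] sj_def[symmetric]
      by (simp add: cartan_def)
    then have eq: "int p * si + int q * sj = 2" by simp
    have exps: "edge_exp l i j = (if si = 1 then 2 else 1)" "edge_exp l j i = (if sj = 1 then 2 else 1)"
      by (simp_all add: edge_exp_def s)
    consider "si = 1" "sj = 2" | "si = 2" "sj = 1" | "si = 2" "sj = 2"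
      using s assms l2 by (auto split: if_splits)
    then show ?thesis using eq unfolding exps by cases (simp, presburger)+
  qed
  have c: "coeff2 (Q i j) (edge_exp l i j) 0 \<noteq> 0" "coeff2 (Q i j) 0 (edge_exp l j i) \<noteq> 0"
  proof -
    have top: "coeff2 (Q i j) (nat (- cartan l i j)) 0 \<noteq> 0"
      "coeff2 (Q j i) (nat (- cartan l j i)) 0 \<noteq> 0"
      using klr[OF assms(1,2) ne] klr[OF assms(2,1)] ne by blast+
    show "coeff2 (Q i j) (edge_exp l i j) 0 \<noteq> 0" using top(1) unfolding exp .
    have "coeff2 (Q i j) 0 (edge_exp l j i) = coeff2 (Q j i) (edge_exp l j i) 0"
      using klr[OF assms(1,2) ne] by blast
    then show "coeff2 (Q i j) 0 (edge_exp l j i) \<noteq> 0"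
      using top(2) unfolding exp by simp
  qed
  show ?thesis
    by (rule that[OF c]) (rule eval2_two_terms(1)[OF supp pos], assumption+,
        rule eval2_two_terms(2)[OF supp pos], assumption+)
qed

end

context klr_presentation
begin

section \<open>Local forms of the defining relations\<close>

lemma relation: "a - b \<in> klr_relations l Q n \<Longrightarrow> a \<approx> b"
  by (rule cong_base) (simp add: block_relations_def outer_relations_def)

lemma outside: "g \<notin> G \<Longrightarrow> gen g \<approx> 0"
  by (rule cong_base) (simp add: block_relations_def outer_relations_def)

lemma outside_x: "k \<notin> {1..n} \<Longrightarrow> xx k \<approx> 0"
  by (rule outside) (auto simp: klr_gens_def)

lemma outside_psi: "k \<notin> {1..<n} \<Longrightarrow> psi k \<approx> 0"
  by (rule outside) (auto simp: klr_gens_def)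

lemma idem_zero: "\<nu> \<notin> seqs_weight l \<beta> \<Longrightarrow> idem \<nu> \<approx> 0"
proof (cases "\<nu> \<in> seqs l n")
  case True
  then show "\<nu> \<notin> seqs_weight l \<beta> \<Longrightarrow> idem \<nu> \<approx> 0"
    by (intro cong_base) (simp add: block_relations_def)
qed (auto intro: outside simp: klr_gens_def)

lemma both_zero: "a \<approx> 0 \<Longrightarrow> b \<approx> 0 \<Longrightarrow> a \<approx> b"
  using cong_trans cong_sym by blast

lemma idem_mult: "idem \<nu> * idem \<nu>' \<approx> (if \<nu> = \<nu>' then idem \<nu> else 0)"
proof (cases "\<nu> \<in> seqs l n \<and> \<nu>' \<in> seqs l n")
  case True
  then show ?thesis by (intro relation klr_relations.idem_idem) auto
next
  case False
  then have "idem \<nu> \<approx> 0 \<or> idem \<nu>' \<approx> 0"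
    using idem_zero by (auto simp: seqs_weight_iff)
  then show ?thesis by (auto intro: both_zero cong_zero_lmult cong_zero_rmult)
qed

lemma idem_idem: "idem \<nu> * idem \<nu> \<approx> idem \<nu>"
  using idem_mult[of \<nu> \<nu>] by simp

lemma x_idem: "xx k * idem \<nu> \<approx> idem \<nu> * xx k"
proof -
  consider "k \<in> {1..n}" "\<nu> \<in> seqs l n" | "xx k \<approx> 0" | "idem \<nu> \<approx> 0"
    using idem_zero outside_x by (auto simp: seqs_weight_iff)
  then show ?thesis
  proof cases
    case 1
    then show ?thesis by (intro relation klr_relations.x_idem)
  qed (auto intro: both_zero cong_zero_lmult cong_zero_rmult)
qed

lemma x_x: "xx k * xx m \<approx> xx m * xx k"
proof -
  consider "k \<in> {1..n}" "m \<in> {1..n}" | "xx k \<approx> 0" | "xx m \<approx> 0"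
    using outside_x by blast
  then show ?thesis
  proof cases
    case 1
    then show ?thesis by (intro relation klr_relations.x_x)
  qed (auto intro: both_zero cong_zero_lmult cong_zero_rmult)
qed

lemma psi_psi_comm: "k + 1 < m \<or> m + 1 < k \<Longrightarrow> psi k * psi m \<approx> psi m * psi k"
proof -
  assume km: "k + 1 < m \<or> m + 1 < k"
  consider "k \<in> {1..<n}" "m \<in> {1..<n}" | "psi k \<approx> 0" | "psi m \<approx> 0"
    using outside_psi by blast
  then show ?thesis
  proof cases
    case 1
    then show ?thesis using km by (intro relation klr_relations.psi_psi) auto
  qed (auto intro: both_zero cong_zero_lmult cong_zero_rmult)
qed

lemma split_seqs: "p @ a # b # s \<in> seqs l n \<Longrightarrow> Suc (length p) \<in> {1..<n}"
  by (auto simp: seqs_def)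

lemma entry_first: "entry (p @ a # s) (Suc (length p)) = a"
  by (simp add: entry_def)

lemma entry_second: "entry (p @ a # b # s) (Suc (Suc (length p))) = b"
  by (simp add: entry_def nth_append)

lemma entry_third: "entry (p @ a # b # c # s) (Suc (Suc (Suc (length p)))) = c"
  by (simp add: entry_def nth_append)

lemma psi_idem:
  assumes k: "k = Suc (length p)"
  shows "psi k * idem (p @ a # b # s) \<approx> idem (p @ b # a # s) * psi k"
proof (cases "p @ a # b # s \<in> seqs l n")
  case True
  then show ?thesis
    using relation[OF klr_relations.psi_idem[OF True, of k]] split_seqs[OF True] k
    by (simp add: swap_entries_append)
next
  case False
  then have "p @ b # a # s \<notin> seqs l n" by (auto simp: seqs_def)
  with False show ?thesis
    by (intro both_zero[OF cong_zero_lmult[OF idem_zero] cong_zero_rmult[OF idem_zero]])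
      (simp_all add: seqs_weight_iff)
qed

lemma psi_square:
  assumes k: "k = Suc (length p)"
  shows "psi k * (psi k * idem (p @ a # b # s)) \<approx>
    eval2 scalar (Q a b) (xx k) (xx (Suc k)) * idem (p @ a # b # s)"
proof (cases "p @ a # b # s \<in> seqs l n")
  case True
  then show ?thesis
    using relation[OF klr_relations.psi_square[OF True, of k]] split_seqs[OF True] k
    by (simp add: entry_first entry_second power2_eq_square mult.assoc)
next
  case False
  then have "idem (p @ a # b # s) \<approx> 0" by (intro idem_zero) (simp add: seqs_weight_iff)
  then show ?thesis by (intro both_zero[OF cong_zero_lmult[OF cong_zero_lmult] cong_zero_lmult])
qed

lemma psi_x_pair:
  assumes k: "k = Suc (length p)"
  shows "psi k * xx k * idem (p @ a # b # s) \<approx>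
      xx (Suc k) * psi k * idem (p @ a # b # s) - (if a = b then idem (p @ a # b # s) else 0)" (is ?A)
    and "psi k * xx (Suc k) * idem (p @ a # b # s) \<approx>
      xx k * psi k * idem (p @ a # b # s) + (if a = b then idem (p @ a # b # s) else 0)" (is ?B)
proof -
  have "?A \<and> ?B"
  proof (cases "p @ a # b # s \<in> seqs l n")
    case True
    have kn: "k \<in> {1..<n}" "k \<in> {1..n}" "k + 1 \<in> {1..n}" using split_seqs[OF True] k by auto
    have ent: "entry (p @ a # b # s) k = a" "entry (p @ a # b # s) (k + 1) = b"
      using entry_first[of p a "b # s"] entry_second[of p a b s] k by simp_all
    have tr: "Transposition.transpose k (k + 1) k = k + 1" "Transposition.transpose k (k + 1) (k + 1) = k"
      by simp_all
    have A: "(psi k * xx k - xx (Suc k) * psi k) * idem (p @ a # b # s) \<approx>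
        (if a = b then - idem (p @ a # b # s) else 0)"
      using relation[OF klr_relations.psi_x[OF True kn(1,2)]] unfolding ent tr by (cases "a = b") simp_all
    have B: "(psi k * xx (Suc k) - xx k * psi k) * idem (p @ a # b # s) \<approx>
        (if a = b then idem (p @ a # b # s) else 0)"
      using relation[OF klr_relations.psi_x[OF True kn(1,3)]] unfolding ent tr by (cases "a = b") simp_all
    show ?thesis
      using cong_add[OF A cong_refl, of "xx (Suc k) * psi k * idem (p @ a # b # s)"]
        cong_add[OF B cong_refl, of "xx k * psi k * idem (p @ a # b # s)"]
      by (auto simp: algebra_simps split: if_splits)
  next
    case False
    then have z: "idem (p @ a # b # s) \<approx> 0" by (intro idem_zero) (auto simp: seqs_weight_iff)
    have "x * idem (p @ a # b # s) - (if a = b then idem (p @ a # b # s) else 0) \<approx> 0 - 0" for x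
      by (rule cong_minus[OF cong_zero_lmult[OF z]]) (use z in auto)
    moreover have "x * idem (p @ a # b # s) + (if a = b then idem (p @ a # b # s) else 0) \<approx> 0 + 0" for x
      by (rule cong_add[OF cong_zero_lmult[OF z]]) (use z in auto)
    ultimately show ?thesis using both_zero[OF cong_zero_lmult[OF z]] by simp
  qed
  then show ?A ?B by simp_all
qed

lemma one_sum: "(\<Sum>\<nu>\<in>seqs_weight l \<beta>. idem \<nu>) \<approx> 1"
  using block_idem_one by (simp add: block_idem_def)

lemma cong_by_idem: "(\<And>\<nu>. \<nu> \<in> seqs l n \<Longrightarrow> a * idem \<nu> \<approx> b * idem \<nu>) \<Longrightarrow> a \<approx> b"
proof -
  assume *: "\<And>\<nu>. \<nu> \<in> seqs l n \<Longrightarrow> a * idem \<nu> \<approx> b * idem \<nu>"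
  have "a * (\<Sum>\<nu>\<in>seqs_weight l \<beta>. idem \<nu>) \<approx> b * (\<Sum>\<nu>\<in>seqs_weight l \<beta>. idem \<nu>)"
    unfolding sum_distrib_left by (intro cong_sum *) (simp add: seqs_weight_iff)
  moreover have "x * (\<Sum>\<nu>\<in>seqs_weight l \<beta>. idem \<nu>) \<approx> x" for x
    using cong_lmult[OF one_sum, of x] by simp
  ultimately show ?thesis using cong_sym cong_trans by metis
qed

text \<open>
  The relation is given on each idempotent; the idempotents add up to 1.
\<close>

lemma psi_x_comm:
  assumes "m \<noteq> k" "m \<noteq> Suc k"
  shows "psi k * xx m \<approx> xx m * psi k"
proof -
  consider "k \<in> {1..<n}" "m \<in> {1..n}" | "psi k \<approx> 0" | "xx m \<approx> 0"
    using outside_psi outside_x by blast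
  then show ?thesis
  proof cases
    case 1
    show ?thesis
    proof (rule cong_by_idem)
      fix \<nu> assume "\<nu> \<in> seqs l n"
      from relation[OF klr_relations.psi_x[OF this 1]]
      have "(psi k * xx m - xx m * psi k) * idem \<nu> \<approx> 0"
        using assms by (simp add: Transposition.transpose_def)
      then show "psi k * xx m * idem \<nu> \<approx> xx m * psi k * idem \<nu>"
        by (subst cong_iff_diff) (simp add: left_diff_distrib)
    qed
  qed (auto intro: both_zero cong_zero_lmult cong_zero_rmult)
qed

lemma braid:
  assumes k: "k = Suc (length p)"
  shows "psi (Suc k) * psi k * psi (Suc k) * idem (p @ a # b # c # s) \<approx>
    psi k * psi (Suc k) * psi k * idem (p @ a # b # c # s) +
    (if a = c then eval_divided_difference scalar (Q a b) (xx k) (xx (Suc k)) (xx (Suc (Suc k))) *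
       idem (p @ a # b # c # s) else 0)"
proof (cases "p @ a # b # c # s \<in> seqs l n")
  case True
  have "1 \<le> k" "k + 2 \<le> n" using k True by (auto simp: seqs_def)
  from relation[OF klr_relations.braid[OF True this]]
  have "(psi (Suc k) * psi k * psi (Suc k) - psi k * psi (Suc k) * psi k) * idem (p @ a # b # c # s) \<approx>
    (if a = c then eval_divided_difference scalar (Q a b) (xx k) (xx (Suc k)) (xx (Suc (Suc k))) *
       idem (p @ a # b # c # s) else 0)"
    unfolding k by (cases "a = c") (simp_all add: entry_first entry_second entry_third)
  from cong_add[OF this cong_refl, of "psi k * psi (Suc k) * psi k * idem (p @ a # b # c # s)"]
  show ?thesis by (simp add: algebra_simps)
next
  case False
  then have z: "idem (p @ a # b # c # s) \<approx> 0" by (intro idem_zero) (auto simp: seqs_weight_iff)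
  have "x * idem (p @ a # b # c # s) + (if a = c then y * idem (p @ a # b # c # s) else 0) \<approx> 0 + 0" for x y
    by (rule cong_add[OF cong_zero_lmult[OF z]]) (use cong_zero_lmult[OF z, of y] in auto)
  then show ?thesis using both_zero[OF cong_zero_lmult[OF z]] by simp
qed

lemma first_letter_zero: "a \<noteq> 0 \<Longrightarrow> idem (a # s) \<approx> 0"
proof (cases "a # s \<in> seqs l n")
  case True
  assume "a \<noteq> 0"
  then have "idem (a # s) \<in> klr_relations l Q n"
    by (intro klr_relations.cyclotomic_nonzero[OF True]) (simp add: entry_def)
  then show ?thesis using relation[of "idem (a # s)" 0] by simp
qed (auto intro: idem_zero simp: seqs_weight_iff)

lemma first_x_zero: "xx 1 * idem (0 # s) \<approx> 0"
proof (cases "0 # s \<in> seqs l n")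
  case True
  then have "xx 1 * idem (0 # s) \<in> klr_relations l Q n"
    by (intro klr_relations.cyclotomic_zero) (simp_all add: entry_def)
  then show ?thesis using relation[of "xx 1 * idem (0 # s)" 0] by simp
qed (auto intro!: cong_zero_lmult idem_zero simp: seqs_weight_iff)

end

locale klr_block_data = klr_data l Q + klr_presentation l Q \<beta>
  for l :: nat and Q :: "nat \<Rightarrow> nat \<Rightarrow> 'k::field poly poly" and \<beta> :: "nat multiset"
begin

lemma idem_zero_letter: "a \<in> set \<nu> \<Longrightarrow> l < a \<Longrightarrow> idem \<nu> \<approx> 0"
  by (rule idem_zero) (auto simp: seqs_weight_iff seqs_def)

lemma psi_square_far:
  assumes k: "k = Suc (length p)" and "far a b"
  shows "psi k * (psi k * idem (p @ a # b # s)) \<approx> idem (p @ a # b # s)"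
proof (cases "a \<le> l \<and> b \<le> l")
  case True
  then show ?thesis using psi_square[OF k, of a b s] assms by (simp add: Q_far eval2_one scalar_one)
next
  case False
  then have "idem (p @ a # b # s) \<approx> 0" using idem_zero_letter[of a "p @ a # b # s"] idem_zero_letter[of b "p @ a # b # s"] by auto
  then show ?thesis by (intro both_zero[OF cong_zero_lmult[OF cong_zero_lmult]])
qed

text \<open>
  The crossing of two distant letters has square 1, so it transports the vanishing of one idempotent to
  the other.
\<close>

lemma far_vanish:
  assumes "far a b" "idem (p @ b # a # s) \<approx> 0"
  shows "idem (p @ a # b # s) \<approx> 0"
proof -
  let ?k = "Suc (length p)"
  have "idem (p @ a # b # s) \<approx> psi ?k * (psi ?k * idem (p @ a # b # s))"
    using psi_square_far[OF refl assms(1)] by (rule cong_sym)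
  also have "\<dots> \<approx> psi ?k * (idem (p @ b # a # s) * psi ?k)"
    by (intro cong_lmult psi_idem) simp
  also have "\<dots> \<approx> 0" by (rule cong_zero_lmult[OF cong_zero_rmult[OF assms(2)]])
  finally show ?thesis .
qed

lemma psi_square_self:
  assumes "k = Suc (length p)"
  shows "psi k * (psi k * idem (p @ a # a # s)) \<approx> 0"
proof (cases "a \<le> l")
  case True
  then show ?thesis using psi_square[OF assms, of a a s] by (simp add: Q_self eval2_zero scalar_def)
next
  case False
  then have "idem (p @ a # a # s) \<approx> 0" using idem_zero_letter[of a "p @ a # a # s"] by simp
  then show ?thesis by (intro cong_zero_lmult)
qed

text \<open>
  If \<open>x\<^sub>k\<close> kills the idempotent, the relation \<open>\<psi> x\<^sub>k\<^sub>+\<^sub>1 = x\<^sub>k \<psi> + 1\<close> writes the idempotent through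
  terms that contain \<open>x\<^sub>k\<close> or the square of the crossing of equal letters, which is zero.
\<close>

lemma repeat_vanish:
  assumes k: "k = Suc (length p)" and x: "xx k * idem (p @ a # a # s) \<approx> 0"
  shows "idem (p @ a # a # s) \<approx> 0"
proof -
  let ?e = "idem (p @ a # a # s)"
  have "psi k * (xx k * ?e) \<approx> xx (Suc k) * psi k * ?e - ?e"
    using psi_x_pair(1)[OF k, of a a s] by (simp add: mult.assoc)
  then have "xx (Suc k) * psi k * ?e - ?e \<approx> 0"
    using cong_trans[OF cong_sym cong_zero_lmult[OF x]] by blast
  then have e1: "?e \<approx> xx (Suc k) * (psi k * ?e)"
    using cong_iff_diff cong_sym by (simp add: mult.assoc)
  have "xx k * (psi k * ?e) \<approx> xx k * (?e * psi k)" by (intro cong_lmult psi_idem k)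
  also have "\<dots> \<approx> 0" using cong_zero_rmult[OF x, of "psi k"] by (simp add: mult.assoc)
  finally have f: "xx k * (psi k * ?e) \<approx> 0" .
  have "psi k * xx (Suc k) * ?e \<approx> xx k * psi k * ?e + ?e"
    using psi_x_pair(2)[OF k, of a a s] by simp
  also have "\<dots> \<approx> 0 + ?e" using cong_add[OF f cong_refl, of ?e] by (simp add: mult.assoc)
  finally have "psi k * (psi k * xx (Suc k) * ?e) \<approx> psi k * ?e" by (intro cong_lmult) simp
  then have "psi k * ?e \<approx> psi k * (psi k * (xx (Suc k) * ?e))" by (simp add: mult.assoc cong_sym)
  also have "\<dots> \<approx> psi k * (psi k * (?e * xx (Suc k)))" by (intro cong_lmult x_idem)
  also have "\<dots> \<approx> 0"
    using cong_zero_rmult[OF psi_square_self[OF k, of a s], of "xx (Suc k)"] by (simp add: mult.assoc)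
  finally have "psi k * ?e \<approx> 0" .
  then have "xx (Suc k) * (psi k * ?e) \<approx> 0" by (rule cong_zero_lmult)
  with e1 show ?thesis by (rule cong_trans)
qed

text \<open>
  The symmetric polynomial \<open>x\<^sub>k + x\<^sub>k\<^sub>+\<^sub>1\<close> is what the divided difference makes of \<open>x\<^sub>k\<^sup>2 = 0\<close>.
\<close>

lemma repeat_x_sum:
  assumes k: "k = Suc (length p)" and x: "xx k * (xx k * idem (p @ a # a # s)) \<approx> 0"
  shows "(xx k + xx (Suc k)) * idem (p @ a # a # s) \<approx> 0"
proof -
  let ?e = "idem (p @ a # a # s)" and ?y = "xx k" and ?z = "xx (Suc k)" and ?f = "psi k"
  have fe: "?f * ?e \<approx> ?e * ?f" by (rule psi_idem[OF k])
  have fy: "?f * ?y * ?e \<approx> ?z * ?f * ?e - ?e" using psi_x_pair(1)[OF k, of a a s] by simp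
  have "?f * ?y * ?e * ?y \<approx> (?z * ?f * ?e - ?e) * ?y" by (rule cong_rmult[OF fy])
  also have "\<dots> = ?z * ?f * (?e * ?y) - ?e * ?y" by (simp add: algebra_simps)
  also have "\<dots> \<approx> ?z * ?f * (?y * ?e) - ?y * ?e"
    by (intro cong_minus cong_lmult cong_sym[OF x_idem])
  also have "\<dots> \<approx> ?z * (?z * ?f * ?e - ?e) - ?y * ?e"
    using cong_minus[OF cong_lmult[OF fy, of ?z] cong_refl, of "?y * ?e"] by (simp add: mult.assoc)
  finally have 1: "?f * ?y * ?e * ?y \<approx> ?z * ?z * ?f * ?e - (?y + ?z) * ?e"
    by (simp add: algebra_simps)
  have "?f * ?y * ?e * ?y \<approx> ?f * ?y * (?y * ?e)"
    using cong_lmult[OF cong_sym[OF x_idem], of "?f * ?y" "p @ a # a # s" k] by (simp add: mult.assoc)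
  also have "\<dots> \<approx> 0" using cong_zero_lmult[OF x, of ?f] by (simp add: mult.assoc)
  finally have "?z * ?z * ?f * ?e - (?y + ?z) * ?e \<approx> 0" using 1 cong_sym cong_trans by blast
  then have 2: "(?y + ?z) * ?e \<approx> ?z * ?z * ?f * ?e" using cong_iff_diff cong_sym by blast
  have "(?y + ?z) * ?f * ?e \<approx> (?y + ?z) * ?e * ?f"
    using cong_lmult[OF fe, of "?y + ?z"] by (simp add: mult.assoc)
  also have "\<dots> \<approx> ?z * ?z * ?f * ?e * ?f" by (rule cong_rmult[OF 2])
  also have "\<dots> \<approx> ?z * ?z * (?f * (?f * ?e))"
    using cong_lmult[OF cong_sym[OF fe], of "?z * ?z * ?f"] by (simp add: mult.assoc)
  also have "\<dots> \<approx> 0" by (intro cong_zero_lmult psi_square_self[OF k])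
  finally have 3: "(?y + ?z) * ?f * ?e \<approx> 0" .
  have "(?y + ?z) * ?f * ?e * ?y \<approx> (?y + ?z) * (?f * ?y * ?e)"
    using cong_lmult[OF cong_sym[OF x_idem], of "(?y + ?z) * ?f" "p @ a # a # s" k] by (simp add: mult.assoc)
  also have "\<dots> \<approx> (?y + ?z) * (?z * ?f * ?e - ?e)" by (rule cong_lmult[OF fy])
  also have "\<dots> = (?y * ?z + ?z * ?z) * ?f * ?e - (?y + ?z) * ?e" by (simp add: algebra_simps)
  also have "\<dots> \<approx> (?z * ?y + ?z * ?z) * ?f * ?e - (?y + ?z) * ?e"
    by (intro cong_minus cong_rmult cong_add x_x cong_refl)
  also have "\<dots> = ?z * ((?y + ?z) * ?f * ?e) - (?y + ?z) * ?e" by (simp add: algebra_simps)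
  also have "\<dots> \<approx> 0 - (?y + ?z) * ?e" by (intro cong_minus cong_zero_lmult[OF 3] cong_refl)
  finally have "(?y + ?z) * ?f * ?e * ?y \<approx> 0 - (?y + ?z) * ?e" .
  from cong_trans[OF cong_sym[OF this] cong_zero_rmult[OF 3]]
  have "- ((?y + ?z) * ?e) \<approx> 0" by simp
  from cong_uminus[OF this] show ?thesis by simp
qed

lemma edge_relation:
  assumes k: "k = Suc (length p)" and "idem (p @ b # a # s) \<approx> 0"
  shows "eval2 scalar (Q a b) (xx k) (xx (Suc k)) * idem (p @ a # b # s) \<approx> 0"
proof -
  have "psi k * (psi k * idem (p @ a # b # s)) \<approx> psi k * (idem (p @ b # a # s) * psi k)"
    by (intro cong_lmult psi_idem k)
  also have "\<dots> \<approx> 0" by (rule cong_zero_lmult[OF cong_zero_rmult[OF assms(2)]])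
  finally show ?thesis using psi_square[OF k, of a b s] cong_sym cong_trans by blast
qed

lemma braid_relation:
  assumes k: "k = Suc (length p)"
    and z: "idem (p @ a # a # b # s) \<approx> 0" "idem (p @ b # a # a # s) \<approx> 0"
  shows "eval_divided_difference scalar (Q a b) (xx k) (xx (Suc k)) (xx (Suc (Suc k))) *
    idem (p @ a # b # a # s) \<approx> 0" (is "?d \<approx> 0")
proof -
  let ?e = "idem (p @ a # b # a # s)"
  have "psi (Suc k) * ?e \<approx> idem (p @ a # a # b # s) * psi (Suc k)"
    using psi_idem[of "Suc k" "p @ [a]" b a s] k by simp
  then have "psi (Suc k) * ?e \<approx> 0" by (rule cong_trans) (rule cong_zero_rmult[OF z(1)])
  then have 1: "psi (Suc k) * psi k * psi (Suc k) * ?e \<approx> 0"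
    using cong_zero_lmult[of "psi (Suc k) * ?e" "psi (Suc k) * psi k"] by (simp add: mult.assoc)
  have "psi k * ?e \<approx> idem (p @ b # a # a # s) * psi k" by (rule psi_idem[OF k])
  then have "psi k * ?e \<approx> 0" by (rule cong_trans) (rule cong_zero_rmult[OF z(2)])
  then have 2: "psi k * psi (Suc k) * psi k * ?e \<approx> 0"
    using cong_zero_lmult[of "psi k * ?e" "psi k * psi (Suc k)"] by (simp add: mult.assoc)
  have "0 \<approx> psi k * psi (Suc k) * psi k * ?e + ?d"
    using braid[OF k, of a b a s] cong_trans[OF cong_sym[OF 1]] by simp
  also have "\<dots> \<approx> 0 + ?d" by (intro cong_add 2 cong_refl)
  finally show ?thesis by (simp add: cong_sym)
qed

lemma scalar_cancel:
  assumes "scalar c * a \<approx> 0" "c \<noteq> 0"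
  shows "a \<approx> 0"
proof -
  have "scalar (1 / c) * (scalar c * a) = a"
    using assms(2) by (simp add: scalar_one flip: mult.assoc scalar_mult)
  then show ?thesis using cong_zero_lmult[OF assms(1), of "scalar (1 / c)"] by simp
qed

end

section \<open>Words, residues and the ballot condition\<close>

text \<open>
  The residue of the box of the first row that has \<open>a\<close> boxes to its left, for \<open>a\<close> at most \<open>2 l + 1\<close>. In
  the second row the residue is the number of boxes to the left, as that row has at most \<open>l\<close> boxes.
\<close>

definition row1_res :: "nat \<Rightarrow> nat \<Rightarrow> nat"
  where "row1_res l a = (if a \<le> l then a else 2 * l + 1 - a)"

abbreviation len1 :: "bool list \<Rightarrow> nat" where "len1 w \<equiv> count_list w False"
abbreviation len2 :: "bool list \<Rightarrow> nat" where "len2 w \<equiv> count_list w True"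

text \<open>
  A word records the order in which a two-row diagram is filled: \<open>False\<close> adds a box to the first row and
  \<open>True\<close> to the second. The state \<open>(a, b)\<close> holds the current lengths of the two rows.
\<close>

fun residues :: "nat \<Rightarrow> nat \<Rightarrow> nat \<Rightarrow> bool list \<Rightarrow> nat list"
where
  "residues l a b [] = []"
| "residues l a b (False # w) = row1_res l a # residues l (Suc a) b w"
| "residues l a b (True # w) = b # residues l a (Suc b) w"

text \<open>
  The box of the second row in column \<open>b + 2\<close> lies below a box of the first row, which must be there
  already; hence the strict inequality.
\<close>

fun ballot :: "nat \<Rightarrow> nat \<Rightarrow> bool list \<Rightarrow> bool"
where
  "ballot a b [] \<longleftrightarrow> True"
| "ballot a b (False # w) \<longleftrightarrow> ballot (Suc a) b w"
| "ballot a b (True # w) \<longleftrightarrow> Suc b < a \<and> ballot a (Suc b) w"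

lemma residues_append: "residues l a b (u @ v) = residues l a b u @ residues l (a + len1 u) (b + len2 u) v"
  by (induction l a b u rule: residues.induct) simp_all

lemma ballot_append: "ballot a b (u @ v) \<longleftrightarrow> ballot a b u \<and> ballot (a + len1 u) (b + len2 u) v"
  by (induction a b u rule: ballot.induct) simp_all

lemma length_residues [simp]: "length (residues l a b w) = length w"
  by (induction l a b w rule: residues.induct) simp_all

lemma length_word: "length w = len1 w + len2 w"
  by (induction w) auto

lemma ballot_state:
  "ballot a b w \<Longrightarrow> b < a \<or> (a = 0 \<and> b = 0) \<Longrightarrow>
    b + len2 w < a + len1 w \<or> (a + len1 w = 0 \<and> b + len2 w = 0)"
  by (induction a b w rule: ballot.induct) auto

lemma ballot_state0: "ballot 0 0 w \<Longrightarrow> len2 w < len1 w \<or> len1 w = 0 \<and> len2 w = 0"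
  using ballot_state[of 0 0 w] by simp

text \<open>
  The word that fills the first row completely before the second; it is the reference word to which all
  words with the same row lengths are compared.
\<close>

definition two_block :: "nat \<Rightarrow> nat \<Rightarrow> bool list"
  where "two_block a b = replicate a False @ replicate b True"

lemma count_list_replicate: "count_list (replicate n x) y = (if x = y then n else 0)"
  by (induction n) auto

lemma len_two_block [simp]: "len1 (two_block a b) = a" "len2 (two_block a b) = b"
  by (simp_all add: two_block_def count_list_replicate count_list_append)

lemma length_two_block [simp]: "length (two_block a b) = a + b"
  by (simp add: two_block_def)

lemma two_block_Suc: "two_block a (Suc b) = two_block a b @ [True]"
  by (simp add: two_block_def replicate_append_same)

lemma two_block_row_Suc: "two_block (Suc a) 0 = two_block a 0 @ [False]"
  by (simp add: two_block_def replicate_append_same)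

lemma residues_two_block_Suc: "residues l 0 0 (two_block a (Suc b)) = residues l 0 0 (two_block a b) @ [b]"
  by (simp add: two_block_Suc residues_append)

lemma residues_row_Suc: "residues l 0 0 (two_block (Suc a) 0) = residues l 0 0 (two_block a 0) @ [row1_res l a]"
  by (simp add: two_block_row_Suc residues_append)

lemma ballot_two_block: "b < a \<or> b = 0 \<Longrightarrow> ballot 0 0 (two_block a b)"
proof (induction b)
  case 0
  show ?case by (induction a) (simp add: two_block_def, simp add: two_block_row_Suc ballot_append)
next
  case (Suc b)
  then show ?case by (simp add: two_block_Suc ballot_append)
qed

lemma count_residues:
  "count_list (residues l a b w) j =
    card {t \<in> {a..<a + len1 w}. row1_res l t = j} + (if b \<le> j \<and> j < b + len2 w then 1 else 0)"
proof (induction l a b w rule: residues.induct)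
  case (2 l a b w)
  have "{t \<in> {a..<a + len1 (False # w)}. row1_res l t = j} =
      (if row1_res l a = j then insert a {t \<in> {Suc a..<Suc a + len1 w}. row1_res l t = j}
       else {t \<in> {Suc a..<Suc a + len1 w}. row1_res l t = j})"
    by (auto simp: le_less Suc_le_eq)
  then show ?case using 2 by simp
qed auto

text \<open>
  This bounds the row lengths from above by the weight; a first row of length more than \<open>2 l + 1 - j\<close>
  contains the residue \<open>j\<close> twice.
\<close>

lemma count_residues_ge:
  assumes "j \<le> l"
  shows "(if j < len1 w then 1 else 0) + (if 2 * l + 1 - j < len1 w then 1 else 0) +
    (if j < len2 w then 1 else 0) \<le> count_list (residues l 0 0 w) j"
proof -
  let ?T = "{t \<in> {0..<len1 w}. row1_res l t = j}"
  let ?S = "(if j < len1 w then {j} else {}) \<union> (if 2 * l + 1 - j < len1 w then {2 * l + 1 - j} else {})"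
  have "?S \<subseteq> ?T" using assms by (auto simp: row1_res_def)
  then have "card ?S \<le> card ?T" by (intro card_mono) auto
  moreover have "j \<noteq> 2 * l + 1 - j" using assms by auto
  then have "card ?S = (if j < len1 w then 1 else 0) + (if 2 * l + 1 - j < len1 w then 1 else 0)" by auto
  ultimately show ?thesis unfolding count_residues by simp
qed

section \<open>Paths of intertwiners\<close>

text \<open>
  The crossings that move a new box of the first row past the \<open>b\<close> boxes of the second row that were
  added before it.
\<close>

fun cycle :: "nat \<Rightarrow> nat \<Rightarrow> 'k::comm_ring_1 klr_free"
where
  "cycle a 0 = 1"
| "cycle a (Suc b) = psi (Suc (a + b)) * cycle a b"

fun cycle_rev :: "nat \<Rightarrow> nat \<Rightarrow> 'k::comm_ring_1 klr_free"
where
  "cycle_rev a 0 = 1"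
| "cycle_rev a (Suc b) = cycle_rev a b * psi (Suc (a + b))"

text \<open>
  The product of crossings that carries the two-block word to the given word, one cycle for each box of
  the first row.
\<close>

fun path :: "nat \<Rightarrow> nat \<Rightarrow> bool list \<Rightarrow> 'k::comm_ring_1 klr_free"
where
  "path a b [] = 1"
| "path a b (False # w) = cycle a b * path (Suc a) b w"
| "path a b (True # w) = path a (Suc b) w"

fun path_rev :: "nat \<Rightarrow> nat \<Rightarrow> bool list \<Rightarrow> 'k::comm_ring_1 klr_free"
where
  "path_rev a b [] = 1"
| "path_rev a b (False # w) = path_rev (Suc a) b w * cycle_rev a b"
| "path_rev a b (True # w) = path_rev a (Suc b) w"

lemma path_append: "path a b (u @ v) = path a b u * path (a + len1 u) (b + len2 u) v"
  by (induction a b u rule: path.induct) (simp_all add: mult.assoc)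

lemma path_rev_append: "path_rev a b (u @ v) = path_rev (a + len1 u) (b + len2 u) v * path_rev a b u"
  by (induction a b u rule: path.induct) (simp_all add: mult.assoc)

context klr_presentation
begin

text \<open>
  The elements \<open>p\<close> and \<open>q\<close> are mutually inverse isomorphisms between the projective modules of the
  idempotents \<open>e\<close> and \<open>f\<close>, and every dot on the left of \<open>p\<close> becomes a dot on its right.
\<close>

definition link :: "'k klr_free \<Rightarrow> 'k klr_free \<Rightarrow> 'k klr_free \<Rightarrow> 'k klr_free \<Rightarrow> bool"
  where "link p q e f \<longleftrightarrow> e * p \<approx> p * f \<and> q * e \<approx> f * q \<and> q * (p * f) \<approx> f \<and> p * (q * e) \<approx> e \<and>
    (\<forall>k. \<exists>j. xx k * (p * f) \<approx> p * (xx j * f))"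

lemma link_zero:
  assumes "e \<approx> 0" "f \<approx> 0"
  shows "link p q e f"
proof -
  note e = cong_zero_lmult[OF assms(1)] cong_zero_rmult[OF assms(1)]
    and f = cong_zero_lmult[OF assms(2)] cong_zero_rmult[OF assms(2)]
  show ?thesis
    unfolding link_def
    using both_zero[OF e(2) f(1)] both_zero[OF e(1) f(2)] both_zero[OF cong_zero_lmult[OF f(1)] assms(2)]
      both_zero[OF cong_zero_lmult[OF e(1)] assms(1)] both_zero[OF cong_zero_lmult[OF f(1)] cong_zero_lmult[OF f(1)]]
    by blast
qed

lemma link_refl: "link 1 1 e e"
  unfolding link_def by auto

lemma link_trans:
  assumes "link p q e f" "link p' q' f g"
  shows "link (p * p') (q' * q) e g"
proof -
  note 1 = assms(1)[unfolded link_def] and 2 = assms(2)[unfolded link_def]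
  have ep: "e * p \<approx> p * f" and qe: "q * e \<approx> f * q" and qpf: "q * (p * f) \<approx> f" and pqe: "p * (q * e) \<approx> e"
    using 1 by blast+
  have fp: "f * p' \<approx> p' * g" and qf: "q' * f \<approx> g * q'" and qpg: "q' * (p' * g) \<approx> g" and pqf: "p' * (q' * f) \<approx> f"
    using 2 by blast+
  have "e * (p * p') \<approx> p * f * p'" using cong_rmult[OF ep, of p'] by (simp add: mult.assoc)
  also have "\<dots> \<approx> p * p' * g" using cong_lmult[OF fp, of p] by (simp add: mult.assoc)
  finally have A: "e * (p * p') \<approx> p * p' * g" .
  have "q' * q * e \<approx> q' * f * q" using cong_lmult[OF qe, of q'] by (simp add: mult.assoc)
  also have "\<dots> \<approx> g * (q' * q)" using cong_rmult[OF qf, of q] by (simp add: mult.assoc)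
  finally have B: "q' * q * e \<approx> g * (q' * q)" .
  have "q' * q * (p * p' * g) \<approx> q' * (q * (p * (f * p')))"
    using cong_lmult[OF cong_sym[OF fp], of "q' * q * p"] by (simp add: mult.assoc)
  also have "\<dots> \<approx> q' * (f * p')" using cong_lmult[OF cong_rmult[OF qpf, of p'], of q'] by (simp add: mult.assoc)
  also have "\<dots> \<approx> q' * (p' * g)" by (rule cong_lmult[OF fp])
  also have "\<dots> \<approx> g" by (rule qpg)
  finally have C: "q' * q * (p * p' * g) \<approx> g" .
  have "p * p' * (q' * q * e) \<approx> p * (p' * (q' * (f * q)))"
    using cong_lmult[OF qe, of "p * p' * q'"] by (simp add: mult.assoc)
  also have "\<dots> \<approx> p * (f * q)" using cong_lmult[OF cong_rmult[OF pqf, of q], of p] by (simp add: mult.assoc)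
  also have "\<dots> \<approx> p * (q * e)" by (rule cong_lmult[OF cong_sym[OF qe]])
  also have "\<dots> \<approx> e" by (rule pqe)
  finally have D: "p * p' * (q' * q * e) \<approx> e" .
  have "\<exists>j. xx k * (p * p' * g) \<approx> p * p' * (xx j * g)" for k
  proof -
    obtain j where j: "xx k * (p * f) \<approx> p * (xx j * f)" using 1 by blast
    obtain j' where j': "xx j * (p' * g) \<approx> p' * (xx j' * g)" using 2 by blast
    have "xx k * (p * p' * g) \<approx> xx k * (p * f) * p'"
      using cong_lmult[OF cong_sym[OF fp], of "xx k * p"] by (simp add: mult.assoc)
    also have "\<dots> \<approx> p * (xx j * (f * p'))" using cong_rmult[OF j, of p'] by (simp add: mult.assoc)
    also have "\<dots> \<approx> p * (xx j * (p' * g))" using cong_lmult[OF fp, of "p * xx j"] by (simp add: mult.assoc)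
    also have "\<dots> \<approx> p * p' * (xx j' * g)" using cong_lmult[OF j', of p] by (simp add: mult.assoc)
    finally show ?thesis by blast
  qed
  with A B C D show ?thesis unfolding link_def by blast
qed

lemma link_vanish:
  assumes "link p q e f"
  shows "e \<approx> 0 \<longleftrightarrow> f \<approx> 0"
proof
  note l = assms[unfolded link_def]
  assume "e \<approx> 0"
  have "f \<approx> q * (p * f)" using l cong_sym by blast
  also have "\<dots> \<approx> q * (e * p)" using l cong_sym cong_lmult by blast
  also have "\<dots> \<approx> 0" by (rule cong_zero_lmult[OF cong_zero_rmult[OF \<open>e \<approx> 0\<close>]])
  finally show "f \<approx> 0" .
next
  note l = assms[unfolded link_def]
  assume "f \<approx> 0"
  have "e \<approx> p * (q * e)" using l cong_sym by blast
  also have "\<dots> \<approx> p * (f * q)" using l cong_lmult by blast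
  also have "\<dots> \<approx> 0" by (rule cong_zero_lmult[OF cong_zero_rmult[OF \<open>f \<approx> 0\<close>]])
  finally show "e \<approx> 0" .
qed

lemma psi_cycle_comm: "a + b + 1 < k \<or> k < a \<Longrightarrow> psi k * cycle a b \<approx> cycle a b * psi k"
proof (induction b)
  case (Suc b)
  have "psi k * cycle a (Suc b) \<approx> psi (Suc (a + b)) * (psi k * cycle a b)"
    using cong_rmult[OF psi_psi_comm[of k "Suc (a + b)"], of "cycle a b"] Suc.prems by (simp add: mult.assoc) linarith
  also have "\<dots> \<approx> psi (Suc (a + b)) * (cycle a b * psi k)" using Suc by (intro cong_lmult) auto
  finally show ?case by (simp add: mult.assoc)
qed simp

lemma psi_path_comm: "a + b + length w < k \<or> k < a \<Longrightarrow> psi k * path a b w \<approx> path a b w * psi k"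
proof (induction a b w rule: path.induct)
  case (2 a b w)
  have "psi k * (cycle a b * path (Suc a) b w) \<approx> cycle a b * (psi k * path (Suc a) b w)"
    using cong_rmult[OF psi_cycle_comm[of a b k], of "path (Suc a) b w"] 2 by (auto simp: mult.assoc)
  also have "\<dots> \<approx> cycle a b * (path (Suc a) b w * psi k)" using 2 by (intro cong_lmult) auto
  finally show ?case by (simp add: mult.assoc)
qed auto

lemma x_cycle_comm: "a + b + 1 < k \<Longrightarrow> xx k * cycle a b \<approx> cycle a b * xx k"
proof (induction b)
  case (Suc b)
  have "xx k * cycle a (Suc b) \<approx> psi (Suc (a + b)) * (xx k * cycle a b)"
    using cong_rmult[OF cong_sym[OF psi_x_comm[of k "Suc (a + b)"]], of "cycle a b"] Suc.prems
    by (simp add: mult.assoc)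
  also have "\<dots> \<approx> psi (Suc (a + b)) * (cycle a b * xx k)" using Suc by (intro cong_lmult) auto
  finally show ?case by (simp add: mult.assoc)
qed simp

lemma x_path_comm: "a + b + length w < k \<Longrightarrow> xx k * path a b w \<approx> path a b w * xx k"
proof (induction a b w rule: path.induct)
  case (2 a b w)
  have "xx k * (cycle a b * path (Suc a) b w) \<approx> cycle a b * (xx k * path (Suc a) b w)"
    using cong_rmult[OF x_cycle_comm[of a b k], of "path (Suc a) b w"] 2 by (auto simp: mult.assoc)
  also have "\<dots> \<approx> cycle a b * (path (Suc a) b w * xx k)" using 2 by (intro cong_lmult) auto
  finally show ?case by (simp add: mult.assoc)
qed auto

end

context klr_block_data
begin

lemma link_psi:
  assumes k: "k = Suc (length p)" and "far a b"
  shows "link (psi k) (psi k) (idem (p @ b # a # s)) (idem (p @ a # b # s))"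
proof -
  let ?f = "idem (p @ a # b # s)" and ?e = "idem (p @ b # a # s)"
  have ab: "a \<noteq> b" using assms(2) by (auto simp: far_def)
  have "\<exists>j. xx m * (psi k * ?f) \<approx> psi k * (xx j * ?f)" for m
  proof -
    consider "m = k" | "m = Suc k" | "m \<noteq> k" "m \<noteq> Suc k" by blast
    then show ?thesis
    proof cases
      case 1
      then show ?thesis using psi_x_pair(2)[OF k, of a b s] ab by (auto simp: mult.assoc intro!: exI[of _ "Suc k"] cong_sym)
    next
      case 2
      then show ?thesis using psi_x_pair(1)[OF k, of a b s] ab by (auto simp: mult.assoc intro!: exI[of _ k] cong_sym)
    next
      case 3
      from cong_rmult[OF cong_sym[OF psi_x_comm[OF this]], of ?f] show ?thesis by (auto simp: mult.assoc)
    qed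
  qed
  moreover have "psi k * (psi k * ?f) \<approx> ?f" "psi k * (psi k * ?e) \<approx> ?e"
    using psi_square_far[OF k] assms(2) far_sym by blast+
  moreover have "psi k * ?f \<approx> ?e * psi k" "psi k * ?e \<approx> ?f * psi k"
    by (rule psi_idem[OF k])+
  ultimately show ?thesis unfolding link_def using cong_sym by blast
qed

lemma far_x_power:
  assumes k: "k = Suc (length p)" and "far a b" and x: "xx k ^ m * idem (p @ a # b # s) \<approx> 0"
  shows "xx (Suc k) ^ m * idem (p @ b # a # s) \<approx> 0"
proof -
  let ?f = "idem (p @ a # b # s)" and ?e = "idem (p @ b # a # s)"
  have ab: "a \<noteq> b" using assms(2) by (auto simp: far_def)
  have sw: "xx (Suc k) * (psi k * ?f) \<approx> psi k * (xx k * ?f)"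
    using psi_x_pair(1)[OF k, of a b s] ab by (simp add: mult.assoc cong_sym)
  have pw: "xx (Suc k) ^ m * (psi k * ?f) \<approx> psi k * (xx k ^ m * ?f)" for m
  proof (induction m)
    case (Suc m)
    have "xx (Suc k) ^ Suc m * (psi k * ?f) \<approx> xx (Suc k) ^ m * (psi k * (xx k * ?f))"
      using cong_lmult[OF sw, of "xx (Suc k) ^ m"] by (simp add: power_Suc2 mult.assoc del: power_Suc)
    also have "\<dots> \<approx> xx (Suc k) ^ m * (psi k * (?f * xx k))" by (intro cong_lmult x_idem)
    also have "\<dots> \<approx> psi k * (xx k ^ m * ?f) * xx k"
      using cong_rmult[OF Suc, of "xx k"] by (simp add: mult.assoc)
    also have "\<dots> \<approx> psi k * (xx k ^ m * (xx k * ?f))"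
      using cong_lmult[OF cong_sym[OF x_idem[of k "p @ a # b # s"]], of "psi k * xx k ^ m"] by (simp add: mult.assoc)
    finally show ?case by (simp add: power_Suc2 mult.assoc del: power_Suc)
  qed simp
  have "?e \<approx> psi k * (psi k * ?e)" using psi_square_far[OF k] assms(2) far_sym cong_sym by blast
  also have "\<dots> \<approx> psi k * (?f * psi k)" by (intro cong_lmult psi_idem k)
  finally have "xx (Suc k) ^ m * ?e \<approx> xx (Suc k) ^ m * (psi k * ?f) * psi k"
    using cong_lmult[of ?e _ "xx (Suc k) ^ m"] by (simp add: mult.assoc)
  also have "\<dots> \<approx> psi k * (xx k ^ m * ?f) * psi k" by (rule cong_rmult[OF pw])
  also have "\<dots> \<approx> 0" by (rule cong_zero_rmult[OF cong_zero_lmult[OF x]])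
  finally show ?thesis .
qed

end

section \<open>The weight of the block\<close>

locale klr_two_delta = klr_data l Q
  for l :: nat and Q :: "nat \<Rightarrow> nat \<Rightarrow> 'k::field poly poly" +
  fixes i :: nat
  assumes i_le: "i \<le> l"
begin

definition weight :: "nat multiset"
  where "weight = null_root l + null_root l - simple_root i"

lemma count_null_root: "count (null_root l) j = (if j \<le> l then 1 else 0)"
proof -
  have "count (\<Sum>j\<in>{0..l}. simple_root j) j = (\<Sum>m\<in>{0..l}. if m = j then 1 else 0)"
    by (simp add: count_sum simple_root_def)
  then show ?thesis by (simp add: null_root_def)
qed

lemma count_weight: "count weight j = (if j \<le> l then (if j = i then 1 else 2) else 0)"
  by (simp add: weight_def count_null_root simple_root_def)

lemma size_weight: "size weight = 2 * l + 1"
proof -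
  have "size (null_root l) = Suc l" by (simp add: null_root_def size_multiset_sum simple_root_def)
  moreover have "simple_root i \<subseteq># null_root l + null_root l"
    using i_le by (simp add: simple_root_def count_null_root flip: count_greater_zero_iff)
  ultimately show ?thesis by (simp add: weight_def size_Diff_submset simple_root_def)
qed

sublocale klr_block_data l Q weight
  by unfold_locales (simp add: size_weight)

notation cong (infix \<open>\<approx>\<close> 50)

lemma nonzero_content:
  assumes "\<not> idem \<nu> \<approx> 0"
  shows "count_list \<nu> j = (if j \<le> l then (if j = i then 1 else 2) else 0)" and "length \<nu> = 2 * l + 1"
proof -
  have "\<nu> \<in> seqs_weight l weight" using assms idem_zero by blast
  then have "mset \<nu> = weight" "length \<nu> = 2 * l + 1" by (auto simp: seqs_weight_iff seqs_def size_weight)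
  then show "count_list \<nu> j = (if j \<le> l then (if j = i then 1 else 2) else 0)" "length \<nu> = 2 * l + 1"
    using count_weight[of j] by (simp_all flip: count_mset)
qed

lemma nonzero_bounds:
  assumes "\<not> idem (residues l 0 0 w @ s) \<approx> 0"
  shows "j \<le> l \<Longrightarrow> (if j < len1 w then 1 else 0) + (if 2 * l + 1 - j < len1 w then 1 else 0) +
    (if j < len2 w then 1 else 0) + count_list s j \<le> (if j = i then 1 else (2::nat))"
    and "len1 w + len2 w + length s = 2 * l + 1"
    and "c \<in> set s \<Longrightarrow> c \<le> l"
proof -
  note nz = nonzero_content[OF assms]
  show "len1 w + len2 w + length s = 2 * l + 1" using nz(2) length_word[of w] by simp
  show "(if j < len1 w then 1 else 0) + (if 2 * l + 1 - j < len1 w then 1 else 0) +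
    (if j < len2 w then 1 else 0) + count_list s j \<le> (if j = i then 1 else 2)" if "j \<le> l"
    using nz(1)[of j] count_residues_ge[OF that, of w] that by (simp add: count_list_append)
  show "c \<le> l" if "c \<in> set s"
    using nz(1)[of c] that by (auto simp: count_list_append count_list_0_iff split: if_splits)
qed

text \<open>
  A box of the first row and one of the second that may be added in either order have distant residues,
  unless the weight of the block is exceeded, in which case both idempotents vanish.
\<close>

lemma far_or_vanish:
  assumes w: "len1 w = a" "len2 w = b" and "Suc b < a"
  shows "far (row1_res l a) b \<or> (idem (residues l 0 0 w @ row1_res l a # b # s) \<approx> 0 \<and>
           idem (residues l 0 0 w @ b # row1_res l a # s) \<approx> 0)"
proof -
  have "far (row1_res l a) b" if nz: "\<not> idem (residues l 0 0 w @ t) \<approx> 0" and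
    t: "t = row1_res l a # b # s \<or> t = b # row1_res l a # s" for t
  proof (cases "a \<le> l")
    case True
    then show ?thesis using assms(3) by (simp add: far_def row1_res_def)
  next
    case False
    note nb = nonzero_bounds[OF nz]
    have "row1_res l a \<noteq> i" "b \<noteq> i" "b \<le> i"
      using nb(1)[OF i_le] t False i_le w assms(3) by (auto split: if_splits)
    moreover have "2 * l + 1 - i \<ge> a" using nb(1)[OF i_le] False i_le w by (auto split: if_splits)
    ultimately show ?thesis using False by (auto simp: far_def row1_res_def)
  qed
  then show ?thesis by blast
qed

lemma link_row_step:
  assumes w: "len1 w = a" "len2 w = b" and "Suc b < a"
  shows "link (psi (Suc (a + b))) (psi (Suc (a + b)))
    (idem (residues l 0 0 w @ b # row1_res l a # s)) (idem (residues l 0 0 w @ row1_res l a # b # s))"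
proof -
  have k: "Suc (a + b) = Suc (length (residues l 0 0 w))" using w length_word[of w] by simp
  from far_or_vanish[OF assms, of s] show ?thesis
    using link_psi[OF k, of "row1_res l a" b s] link_zero by blast
qed

lemma link_cycle:
  assumes "b < a \<or> b = 0"
  shows "link (cycle a b) (cycle_rev a b)
    (idem (residues l 0 0 (two_block a b) @ row1_res l a # s)) (idem (residues l 0 0 (two_block (Suc a) b) @ s))"
  using assms
proof (induction b arbitrary: s)
  case 0
  show ?case using link_refl by (simp add: residues_row_Suc)
next
  case (Suc b)
  have "link (psi (Suc (a + b))) (psi (Suc (a + b)))
    (idem (residues l 0 0 (two_block a b) @ b # row1_res l a # s))
    (idem (residues l 0 0 (two_block a b) @ row1_res l a # b # s))"
    using Suc.prems by (intro link_row_step) auto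
  moreover have "link (cycle a b) (cycle_rev a b)
    (idem (residues l 0 0 (two_block a b) @ row1_res l a # b # s))
    (idem (residues l 0 0 (two_block (Suc a) b) @ b # s))"
    using Suc by auto
  ultimately show ?case using link_trans by (simp add: residues_two_block_Suc)
qed

text \<open>
  Hence the idempotents of all words with the same row lengths are conjugate to that of the two-block
  word, whatever letters \<open>s\<close> follow.
\<close>

lemma link_path:
  assumes "ballot 0 0 w"
  shows "link (path 0 0 w) (path_rev 0 0 w) (idem (residues l 0 0 w @ s))
    (idem (residues l 0 0 (two_block (len1 w) (len2 w)) @ s))"
  using assms
proof (induction w arbitrary: s rule: rev_induct)
  case Nil
  show ?case using link_refl by (simp add: two_block_def)
next
  case (snoc x w)
  have w: "ballot 0 0 w" using snoc.prems by (simp add: ballot_append)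
  show ?case
  proof (cases x)
    case True
    then show ?thesis
      using snoc.IH[OF w, of "len2 w # s"] by (simp add: path_append path_rev_append residues_append residues_two_block_Suc)
  next
    case False
    have "link (path 0 0 w) (path_rev 0 0 w) (idem (residues l 0 0 w @ row1_res l (len1 w) # s))
       (idem (residues l 0 0 (two_block (len1 w) (len2 w)) @ row1_res l (len1 w) # s))"
      by (rule snoc.IH[OF w])
    from link_trans[OF this link_cycle] show ?thesis
      using False ballot_state0[OF w] by (auto simp: path_append path_rev_append residues_append)
  qed
qed

lemma vanish_two_block:
  "ballot 0 0 w \<Longrightarrow> idem (residues l 0 0 w @ s) \<approx> 0 \<longleftrightarrow>
    idem (residues l 0 0 (two_block (len1 w) (len2 w)) @ s) \<approx> 0"
  by (rule link_vanish[OF link_path])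

lemma x_vanish_two_block:
  assumes w: "ballot 0 0 w" and k: "length w < k"
    and x: "xx k * idem (residues l 0 0 w @ s) \<approx> 0"
  shows "xx k * idem (residues l 0 0 (two_block (len1 w) (len2 w)) @ s) \<approx> 0"
proof -
  let ?p = "path 0 0 w" and ?q = "path_rev 0 0 w" and ?e = "idem (residues l 0 0 w @ s)"
  let ?f = "idem (residues l 0 0 (two_block (len1 w) (len2 w)) @ s)"
  note lk = link_path[OF w, of s, unfolded link_def]
  have "?p * (xx k * ?f) \<approx> xx k * (?p * ?f)"
    using cong_rmult[OF cong_sym[OF x_path_comm[of 0 0 w k]], of ?f] k by (simp add: mult.assoc)
  also have "\<dots> \<approx> xx k * (?e * ?p)" using lk cong_sym cong_lmult by blast
  also have "\<dots> \<approx> 0" using cong_zero_rmult[OF x, of ?p] by (simp add: mult.assoc)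
  finally have 1: "?p * (xx k * ?f) \<approx> 0" .
  have "xx k * ?f \<approx> ?f * xx k" by (rule x_idem)
  also have "\<dots> \<approx> ?q * (?p * ?f) * xx k" using lk cong_sym cong_rmult by blast
  also have "\<dots> \<approx> ?q * (?p * (xx k * ?f))"
    using cong_lmult[OF cong_sym[OF x_idem], of "?q * ?p"] by (simp add: mult.assoc)
  also have "\<dots> \<approx> 0" by (rule cong_zero_lmult[OF 1])
  finally show ?thesis .
qed

end

context klr_block_data
begin

section \<open>Vanishing idempotents\<close>

lemma x_power_zero: "xx k * e \<approx> 0 \<Longrightarrow> 0 < m \<Longrightarrow> xx k ^ m * e \<approx> 0"
  using cong_zero_lmult[of "xx k * e" "xx k ^ (m - 1)"]
  by (cases m) (simp_all add: power_Suc2 mult.assoc del: power_Suc)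

lemma edge_exp_pos: "0 < edge_exp l a b"
  by (simp add: edge_exp_def)

lemma edge_x_zero:
  assumes k: "k = Suc (length p)" and ab: "a \<le> l" "b \<le> l" "b = Suc a \<or> a = Suc b"
    and z: "idem (p @ b # a # s) \<approx> 0"
    and x: "xx k ^ edge_exp l a b * idem (p @ a # b # s) \<approx> 0"
  shows "xx (Suc k) ^ edge_exp l b a * idem (p @ a # b # s) \<approx> 0"
proof -
  let ?e = "idem (p @ a # b # s)"
  obtain c d where "d \<noteq> 0" and ev: "\<And>\<iota> (u :: 'k klr_free) v. \<iota> 0 = 0 \<Longrightarrow>
      eval2 \<iota> (Q a b) u v = \<iota> c * u ^ edge_exp l a b + \<iota> d * v ^ edge_exp l b a"
    by (rule Q_neighbours[OF ab, where 'a = "'k klr_free"]) (rule that)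
  have "scalar c * (xx k ^ edge_exp l a b * ?e) + scalar d * (xx (Suc k) ^ edge_exp l b a * ?e) \<approx> 0"
    using edge_relation[OF k z] ev[of scalar "xx k" "xx (Suc k)"] by (simp add: scalar_def distrib_right mult.assoc)
  from cong_minus[OF this cong_zero_lmult[OF x, of "scalar c"]]
  have "scalar d * (xx (Suc k) ^ edge_exp l b a * ?e) \<approx> 0" by simp
  then show ?thesis using scalar_cancel \<open>d \<noteq> 0\<close> by blast
qed

text \<open>
  When both outer terms of the braid relation factor through vanishing idempotents, the divided
  difference kills the middle idempotent; for exponent 1 it is a nonzero constant.
\<close>

lemma braid_vanish:
  assumes ab: "a \<le> l" "b \<le> l" "b = Suc a \<or> a = Suc b" "edge_exp l a b = 1"
    and z: "idem (p @ a # a # b # s) \<approx> 0" "idem (p @ b # a # a # s) \<approx> 0"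
  shows "idem (p @ a # b # a # s) \<approx> 0"
proof -
  obtain c d where "c \<noteq> 0" and ev: "\<And>\<iota> (u :: 'k klr_free) v w. \<iota> 0 = 0 \<Longrightarrow>
     eval_divided_difference \<iota> (Q a b) u v w = \<iota> c * (\<Sum>t<edge_exp l a b. u ^ t * w ^ (edge_exp l a b - Suc t))"
    by (rule Q_neighbours[OF ab(1-3), where 'a = "'k klr_free"]) (rule that)
  have "scalar c * idem (p @ a # b # a # s) \<approx> 0"
    using braid_relation[OF refl z] by (simp add: ev scalar_def ab(4))
  then show ?thesis using scalar_cancel \<open>c \<noteq> 0\<close> by blast
qed

end

context klr_two_delta
begin

abbreviation res :: "bool list \<Rightarrow> nat list" where "res \<equiv> residues l 0 0"

text \<open>
  The residues of the boxes that can be added to rows of lengths \<open>a\<close> and \<open>b\<close>.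
\<close>

definition next_residue :: "nat \<Rightarrow> nat \<Rightarrow> nat \<Rightarrow> bool"
  where "next_residue a b c \<longleftrightarrow> c = row1_res l a \<or> c = b \<and> Suc b < a"

lemma res_row_small: "a \<le> Suc l \<Longrightarrow> res (two_block a 0) = [0..<a]"
proof (induction a)
  case (Suc a)
  then show ?case by (simp add: residues_row_Suc row1_res_def)
qed (simp add: two_block_def)

text \<open>
  A dot moves along the row: at each step the idempotent with the two neighbouring letters exchanged is
  zero, so the square of the crossing gives a relation between powers of two consecutive dots.
\<close>

lemma row_x_from_vanish:
  assumes V: "\<And>m c s. Suc m < a \<Longrightarrow> \<not> next_residue m 0 c \<Longrightarrow> idem (res (two_block m 0) @ c # s) \<approx> 0"
  shows "1 \<le> m \<Longrightarrow> m \<le> a \<Longrightarrow> m \<le> l \<Longrightarrow> xx m * idem (res (two_block m 0) @ s) \<approx> 0"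
proof (induction m arbitrary: s)
  case (Suc m)
  show ?case
  proof (cases m)
    case 0
    then show ?thesis using first_x_zero[of s] by (simp add: res_row_small)
  next
    case [simp]: (Suc m')
    let ?p = "res (two_block m' 0)"
    have eq: "res (two_block m 0) @ Suc m' # s = ?p @ m' # Suc m' # s"
      "res (two_block (Suc m) 0) @ s = ?p @ m' # Suc m' # s"
      using \<open>Suc m \<le> l\<close> by (simp_all add: residues_row_Suc row1_res_def)
    have k: "Suc m' = Suc (length ?p)" by simp
    have "idem (?p @ Suc m' # m' # s) \<approx> 0"
      using Suc.prems by (intro V) (auto simp: next_residue_def row1_res_def)
    moreover have "xx (Suc m') ^ edge_exp l m' (Suc m') * idem (?p @ m' # Suc m' # s) \<approx> 0"
      using Suc.IH[of "Suc m' # s"] Suc.prems eq by (intro x_power_zero edge_exp_pos) simp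
    ultimately have "xx (Suc (Suc m')) ^ edge_exp l (Suc m') m' * idem (?p @ m' # Suc m' # s) \<approx> 0"
      using Suc.prems by (intro edge_x_zero[OF k]) auto
    moreover have "edge_exp l (Suc m') m' = 1 \<or> Suc m' = l" by (auto simp: edge_exp_def)
    ultimately show ?thesis using eq Suc.prems by auto
  qed
qed simp

text \<open>
  An idempotent is zero as soon as its sequence leaves the residue sequences of growing two-row diagrams.
  By the links the initial part may be assumed to be a two-block word. The last letter before \<open>c\<close> is
  then compared with \<open>c\<close>: distant letters are exchanged, and the shorter initial part gives zero by
  induction; equal or neighbouring letters either exceed the weight or are excluded by the quadratic or
  the braid relation.
\<close>

lemma vanish:
  assumes "ballot 0 0 w" "\<not> next_residue (len1 w) (len2 w) c"
  shows "idem (res w @ c # s) \<approx> 0"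
  using assms
proof (induction "length w" arbitrary: w c s rule: less_induct)
  case less
  define a b where "a = len1 w" and "b = len2 w"
  have ba: "b < a \<or> a = 0 \<and> b = 0" using ballot_state0[OF less.prems(1)] by (simp add: a_def b_def)
  have not_next: "\<not> next_residue a b c" using less.prems by (simp add: a_def b_def)
  have len: "length w = a + b" by (simp add: length_word a_def b_def)
  have IH: "idem (res w' @ c' # s') \<approx> 0"
    if "length w' < a + b" "ballot 0 0 w'" "\<not> next_residue (len1 w') (len2 w') c'" for w' c' s'
    using less.hyps[of w'] that len by simp
  have IH': "idem (res (two_block a' b') @ c' # s') \<approx> 0"
    if "a' + b' < a + b" "b' < a' \<or> b' = 0" "\<not> next_residue a' b' c'" for a' b' c' s'
    using IH[of "two_block a' b'"] that ballot_two_block by simp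
  have "idem (res (two_block a b) @ c # s) \<approx> 0"
  proof (rule ccontr)
    assume nz: "\<not> idem (res (two_block a b) @ c # s) \<approx> 0"
    have bnd: "j \<le> l \<Longrightarrow> (if j < a then 1 else 0) + (if 2 * l + 1 - j < a then 1 else 0) +
      (if j < b then 1 else 0) + (if j = c then 1 else 0) \<le> (if j = i then 1 else (2::nat))" for j
      using nonzero_bounds(1)[OF nz, of j] by (auto split: if_splits)
    have ab: "a + b \<le> 2 * l" using nonzero_bounds(2)[OF nz] by simp
    have c: "c \<le> l" using nonzero_bounds(3)[OF nz, of c] by simp
    show False
    proof (cases b)
      (* The last letter is the residue b' of the second row. *)
      case [simp]: (Suc b')
      have b': "b' < l" using ba ab by auto
      have eq: "res (two_block a b) @ c # s = res (two_block a b') @ b' # c # s"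
        by (simp add: residues_two_block_Suc)
      have "\<not> far b' c"
      proof
        assume far: "far b' c"
        then have "c \<noteq> b'" by (auto simp: far_def)
        then have "idem (res (two_block a b') @ c # b' # s) \<approx> 0"
          using not_next ba by (intro IH') (auto simp: next_residue_def)
        then show False using far_vanish[OF far] nz eq by simp
      qed
      moreover have "c \<noteq> b'" using bnd[of b'] b' ba by (auto split: if_splits)
      moreover have "Suc c \<noteq> b'" using bnd[of c] c ba by (auto split: if_splits)
      ultimately have cb: "c = b" by (auto simp: far_def)
      then have a: "a = Suc b" using not_next ba by (auto simp: next_residue_def)
      have "b \<le> i" using bnd[OF i_le] a by (auto split: if_splits)
      moreover have "b \<noteq> i" using bnd[OF i_le] a cb by (auto split: if_splits)
      ultimately have bl: "b < l" using i_le by simp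
      (* Only c = b with both rows blocked is left. The conjugate word ?w ends in b, b', so that the
         sequence b, b', b appears and the braid relation applies. *)
      let ?w = "two_block b b' @ [False, True]"
      have w: "ballot 0 0 ?w" "len1 ?w = a" "len2 ?w = b"
        using a ballot_two_block[of b' b] by (simp_all add: ballot_append count_list_append)
      have rw: "res ?w = res (two_block b b') @ [b, b']"
        using bl by (simp add: residues_append row1_res_def)
      have "idem (res (two_block b b' @ [False]) @ b # b' # s) \<approx> 0"
        using a bl ballot_two_block[of b' b]
        by (intro IH) (auto simp: ballot_append count_list_append next_residue_def row1_res_def)
      then have "idem (res (two_block b b') @ b # b # b' # s) \<approx> 0"
        using bl by (simp add: residues_append row1_res_def)
      moreover have "idem (res (two_block b b') @ b' # b # b # s) \<approx> 0"
        using a bl by (intro IH') (auto simp: next_residue_def row1_res_def)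
      ultimately have "idem (res (two_block b b') @ b # b' # b # s) \<approx> 0"
        using bl b' by (intro braid_vanish) (auto simp: edge_exp_def)
      then have "idem (res ?w @ c # s) \<approx> 0" using rw cb by simp
      then show False using vanish_two_block[OF w(1), of "c # s"] w nz by simp
    next
      case [simp]: 0
      show False
      proof (cases a)
        case 0
        then have "c \<noteq> 0" using not_next by (simp add: next_residue_def row1_res_def)
        then show False using first_letter_zero[of c s] nz 0 by (simp add: two_block_def)
      next
        case [simp]: (Suc a')
        define m where "m = row1_res l a'"
        have eq: "res (two_block a b) @ c # s = res (two_block a' 0) @ m # c # s"
          by (simp add: residues_row_Suc m_def)
        have near: "\<not> far m c"
        proof
          assume far: "far m c"
          then have "c \<noteq> m" by (auto simp: far_def)
          then have "idem (res (two_block a' 0) @ c # m # s) \<approx> 0"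
            using not_next by (intro IH') (auto simp: next_residue_def m_def)
          then show False using far_vanish[OF far] nz eq by simp
        qed
        show False
        proof (cases "a' \<le> l")
          case True
          then have m: "m = a'" by (simp add: m_def row1_res_def)
          have "c \<noteq> Suc a'" using not_next c by (auto simp: next_residue_def row1_res_def)
          (* A repeated letter: the dot before it vanishes, hence the idempotent does. *)
          moreover have "c \<noteq> a'"
          proof
            assume ca: "c = a'"
            have "a' \<noteq> l" using not_next ca by (auto simp: next_residue_def row1_res_def)
            then have "xx (Suc a') * idem (res (two_block (Suc a') 0) @ c # s) \<approx> 0"
              using True by (intro row_x_from_vanish[of "Suc a'"] IH') auto
            then have "xx (Suc a') * idem (res (two_block a' 0) @ a' # a' # s) \<approx> 0"
              using eq ca m by simp
            from repeat_vanish[OF _ this] show False using nz eq ca m by simp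
          qed
          (* The letters c, a', c with c = a' - 1: the braid relation applies again. *)
          ultimately have ca: "Suc c = a'" using near m by (auto simp: far_def)
          have "c \<noteq> 0" using not_next ca by (auto simp: next_residue_def)
          have p: "res (two_block a' 0) @ t = res (two_block c 0) @ c # t" for t
            using ca True residues_row_Suc[of l c] by (auto simp: row1_res_def)
          have "idem (res (two_block c 0) @ c # c # a' # s) \<approx> 0"
            unfolding p[symmetric] using ca \<open>c \<noteq> 0\<close> True
            by (intro IH') (auto simp: next_residue_def row1_res_def)
          moreover have "idem (res (two_block c 0) @ a' # c # c # s) \<approx> 0"
            using ca True by (intro IH') (auto simp: next_residue_def row1_res_def)
          ultimately have "idem (res (two_block c 0) @ c # a' # c # s) \<approx> 0"
            using ca True \<open>c \<noteq> 0\<close> by (intro braid_vanish) (auto simp: edge_exp_def)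
          then show False using nz eq m p by simp
        next
          case False
          (* Beyond the middle of the row every letter that is not admissible occurs too often. *)
          have m: "m = 2 * l + 1 - a'" "2 \<le> m" "m \<le> l" using False ab by (auto simp: m_def row1_res_def)
          have "c \<noteq> m"
          proof
            assume "c = m"
            then show False using bnd[of m] m False ab by (auto split: if_splits)
          qed
          moreover have "c \<noteq> Suc m"
          proof
            assume "c = Suc m"
            then show False using bnd[of c] m c False ab by (auto split: if_splits)
          qed
          moreover have "Suc c \<noteq> m" using not_next m False ab by (auto simp: next_residue_def row1_res_def)
          ultimately show False using near by (auto simp: far_def)
        qed
      qed
    qed
  qed
  then show ?case using vanish_two_block[OF less.prems(1)] by (simp add: a_def b_def)
qed

lemma vanish_row: "\<not> next_residue m b c \<Longrightarrow> b < m \<or> b = 0 \<Longrightarrow> idem (res (two_block m b) @ c # s) \<approx> 0"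
  by (rule vanish) (simp_all add: ballot_two_block)

section \<open>Dots on the two-block idempotents\<close>

lemma row_x_zero: "1 \<le> m \<Longrightarrow> m \<le> l \<Longrightarrow> xx m * idem (res (two_block m 0) @ s) \<approx> 0"
  by (rule row_x_from_vanish[of m]) (auto intro: vanish_row)

text \<open>
  The letter \<open>l\<close> follows \<open>l - 1\<close>, and the polynomial of this edge contains the square of the dot at \<open>l\<close>;
  this is where the nilpotent dot of the block comes from.
\<close>

lemma row_x_square:
  "xx (Suc l) * (xx (Suc l) * idem (res (two_block (Suc l) 0) @ s)) \<approx> 0"
proof -
  obtain m where m: "Suc m = l" using l2 by (cases l) auto
  have r: "row1_res l m = m" "row1_res l l = l" using m by (auto simp: row1_res_def)
  let ?p = "res (two_block m 0)"
  have "res (two_block l 0) = ?p @ [m]"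
    using residues_row_Suc[of l m] r by (simp add: m)
  then have eq: "res (two_block (Suc l) 0) @ s = ?p @ m # l # s" "res (two_block l 0) @ l # s = ?p @ m # l # s"
    by (simp_all add: residues_row_Suc r)
  have k: "Suc (length ?p) = l" using m by simp
  have "xx l * idem (?p @ m # l # s) \<approx> 0"
    using row_x_zero[of l "l # s"] l2 unfolding eq by simp
  then have "xx (Suc (length ?p)) ^ edge_exp l m l * idem (?p @ m # l # s) \<approx> 0"
    unfolding k by (intro x_power_zero edge_exp_pos)
  moreover have "idem (?p @ l # m # s) \<approx> 0"
    using m l2 r by (intro vanish_row) (auto simp: next_residue_def)
  ultimately have "xx (Suc (Suc (length ?p))) ^ edge_exp l l m * idem (?p @ m # l # s) \<approx> 0"
    using m by (intro edge_x_zero[OF refl]) auto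
  then show ?thesis unfolding eq k by (simp add: edge_exp_def power2_eq_square mult.assoc)
qed

text \<open>
  The two equal letters \<open>l\<close> in the middle of the row are a case of \<open>repeat_x_sum\<close>.
\<close>

lemma row_x_sum:
  "(xx (Suc l) + xx (Suc (Suc l))) * idem (res (two_block (Suc (Suc l)) 0) @ s) \<approx> 0"
proof -
  let ?p = "res (two_block l 0)"
  have eq: "res (two_block (Suc (Suc l)) 0) @ s = ?p @ l # l # s" "res (two_block (Suc l) 0) @ l # s = ?p @ l # l # s"
    by (simp_all add: residues_row_Suc row1_res_def)
  show ?thesis unfolding eq
    by (rule repeat_x_sum) (use row_x_square[of "l # s"] in \<open>simp_all add: eq\<close>)
qed

lemma row_x_square':
  "xx (Suc (Suc l)) * (xx (Suc (Suc l)) * idem (res (two_block (Suc (Suc l)) 0) @ s)) \<approx> 0"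
proof -
  let ?e = "idem (res (two_block (Suc (Suc l)) 0) @ s)" and ?y = "xx (Suc l)" and ?z = "xx (Suc (Suc l))"
  have z: "?z * ?e \<approx> - (?y * ?e)"
    using cong_minus[OF row_x_sum[of s] cong_refl, of "?y * ?e"] by (simp add: distrib_right)
  have "?z * (?z * ?e) \<approx> - (?z * (?y * ?e))" using cong_lmult[OF z, of ?z] by simp
  also have "\<dots> \<approx> - (?y * (?z * ?e))"
    using cong_uminus[OF cong_rmult[OF x_x[of "Suc (Suc l)" "Suc l"], of ?e]] by (simp add: mult.assoc)
  also have "\<dots> \<approx> ?y * (?y * ?e)" using cong_uminus[OF cong_lmult[OF z, of ?y]] by simp
  also have "\<dots> \<approx> 0" using row_x_square[of "l # s"] by (simp add: residues_row_Suc row1_res_def)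
  finally show ?thesis .
qed

text \<open>
  After the two letters \<open>l\<close> comes \<open>l - 1\<close>, and the polynomial of this edge is linear in the dot at \<open>l - 1\<close>
  and quadratic in the nilpotent one before it. From there on each dot is zero because the previous one is.
\<close>

lemma row_x_zero_tail:
  "l + 3 \<le> m \<Longrightarrow> m \<le> 2 * l + 1 \<Longrightarrow> xx m * idem (res (two_block m 0) @ s) \<approx> 0"
proof (induction m arbitrary: s)
  case (Suc m)
  define m' where "m' = m - 1"
  then have m: "m = Suc m'" using Suc.prems by simp
  let ?p = "res (two_block m' 0)" and ?a = "row1_res l m'" and ?b = "row1_res l m"
  have eq: "res (two_block (Suc m) 0) @ s = ?p @ ?a # ?b # s" "res (two_block m 0) @ ?b # s = ?p @ ?a # ?b # s"
    by (simp_all add: m residues_row_Suc)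
  have ab: "?a = Suc ?b" "1 \<le> ?b" "?a \<le> l" "?b \<le> l"
    using Suc.prems m by (auto simp: row1_res_def)
  have "idem (?p @ ?b # ?a # s) \<approx> 0"
    using ab by (intro vanish_row) (auto simp: next_residue_def)
  moreover have "xx (Suc (length ?p)) ^ edge_exp l ?a ?b * idem (?p @ ?a # ?b # s) \<approx> 0"
  proof (cases "m = Suc (Suc l)")
    case True
    then have "edge_exp l ?a ?b = 2" "Suc (length ?p) = Suc (Suc l)"
      using m by (simp_all add: edge_exp_def row1_res_def)
    moreover have "xx (Suc (Suc l)) * (xx (Suc (Suc l)) * idem (res (two_block m 0) @ ?b # s)) \<approx> 0"
      using row_x_square'[of "?b # s"] True by simp
    ultimately show ?thesis unfolding eq by (simp add: power2_eq_square mult.assoc)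
  next
    case False
    then have "xx m * idem (res (two_block m 0) @ ?b # s) \<approx> 0"
      using Suc by auto
    then show ?thesis unfolding eq using m by (intro x_power_zero edge_exp_pos) simp
  qed
  ultimately have "xx (Suc (Suc (length ?p))) ^ edge_exp l ?b ?a * idem (?p @ ?a # ?b # s) \<approx> 0"
    using ab by (intro edge_x_zero[OF refl]) auto
  moreover have "edge_exp l ?b ?a = 1" using ab by (auto simp: edge_exp_def)
  ultimately have "xx (Suc m) * idem (?p @ ?a # ?b # s) \<approx> 0" using m by simp
  then show ?case by (subst eq(1))
qed simp

text \<open>
  The letter of the first row is moved past the \<open>b\<close> letters of the second by crossings of distant letters,
  and its dot moves along.
\<close>

lemma move_row_x:
  assumes x: "\<And>s. xx (Suc a) ^ e * idem (res (two_block a 0) @ row1_res l a # s) \<approx> 0"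
  shows "b < a \<or> b = 0 \<Longrightarrow> xx (Suc (a + b)) ^ e * idem (res (two_block a b) @ row1_res l a # s) \<approx> 0"
proof (induction b arbitrary: s)
  case 0
  then show ?case using x by simp
next
  case (Suc b)
  let ?p = "res (two_block a b)"
  have eq: "res (two_block a (Suc b)) @ row1_res l a # s = ?p @ b # row1_res l a # s"
    by (simp add: residues_two_block_Suc)
  have k: "Suc (a + b) = Suc (length ?p)" by simp
  from far_or_vanish[of "two_block a b" a b s] Suc.prems
  consider "far (row1_res l a) b" | "idem (?p @ b # row1_res l a # s) \<approx> 0" by auto
  then show ?case
  proof cases
    case 1
    then show ?thesis using far_x_power[OF k 1, of e s] Suc eq by simp
  qed (simp add: eq cong_zero_lmult)
qed

text \<open>
  Induction on the length of the first row. At the start the box below the end of the first row is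
  compared with the last box of that row: the dot at the letter \<open>b + 1\<close> is already understood, and the edge
  relation is linear in the dot at \<open>b\<close>. For \<open>b = 0\<close> it is quadratic, and the braid relation on \<open>0, 1, 0\<close>
  relates the dot to \<open>x\<^sub>1\<close>, which is zero by the cyclotomic relation.
\<close>

lemma second_row_x_zero:
  assumes "b + 2 \<le> a"
  shows "xx (Suc (a + b)) * idem (res (two_block a b) @ b # s) \<approx> 0"
  using assms
proof (induction a arbitrary: s rule: dec_induct)
  case base
  let ?w = "two_block (Suc b) b @ [False]" and ?p = "res (two_block (Suc b) b)"
  let ?e = "idem (?p @ row1_res l (Suc b) # b # s)"
  have w: "ballot 0 0 ?w" "len1 ?w = b + 2" "len2 ?w = b" "length ?w < Suc (b + 2 + b)"
    by (simp_all add: ballot_append ballot_two_block count_list_append)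
  have rw: "res ?w @ b # s = ?p @ row1_res l (Suc b) # b # s" by (simp add: residues_append)
  have "xx (Suc (b + 2 + b)) * ?e \<approx> 0"
  proof (cases "?e \<approx> 0")
    case nz: False
    have "Suc b \<le> i" "b \<noteq> i"
      using nonzero_bounds(1)[of ?w "b # s" i] nz rw i_le w by (auto split: if_splits)
    then have bl: "Suc b \<le> l" and r: "row1_res l (Suc b) = Suc b" using i_le by (auto simp: row1_res_def)
    show ?thesis
    proof (cases "b = 0")
      case True
      have z: "idem ([] @ 0 # 0 # 1 # s) \<approx> 0" "idem ([] @ 1 # 0 # 0 # s) \<approx> 0"
        using vanish_row[of 1 0 0 "1 # s"] first_letter_zero[of 1 "0 # 0 # s"] l2
        by (simp_all add: next_residue_def row1_res_def res_row_small)
      have p: "?p = [0]" using True by (simp add: res_row_small)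
      have e: "?e = idem (0 # 1 # 0 # s)" using True r p by simp
      have nb: "0 \<le> l" "1 \<le> l" "1 = Suc 0 \<or> 0 = Suc (1::nat)" using l2 by simp_all
      obtain c d where "c \<noteq> 0" and ev: "\<And>\<iota> (u :: 'k klr_free) v w. \<iota> 0 = 0 \<Longrightarrow>
         eval_divided_difference \<iota> (Q 0 1) u v w = \<iota> c * (\<Sum>t<edge_exp l 0 1. u ^ t * w ^ (edge_exp l 0 1 - Suc t))"
        by (rule Q_neighbours[OF nb, where 'a = "'k klr_free"]) (rule that)
      have dd: "eval_divided_difference scalar (Q 0 1) (xx 1) (xx 2) (xx 3) = scalar c * (xx 3 + xx 1 :: 'k klr_free)"
        by (subst ev) (simp_all add: scalar_def edge_exp_def numeral_2_eq_2)
      have "eval_divided_difference scalar (Q 0 1) (xx 1) (xx 2) (xx 3) * ?e \<approx> 0"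
        using braid_relation[OF refl z] unfolding e by (simp add: numeral_2_eq_2 numeral_3_eq_3)
      then have "scalar c * ((xx 3 + xx 1) * ?e) \<approx> 0" unfolding dd by (simp only: mult.assoc)
      then have "xx 3 * ?e + xx 1 * ?e \<approx> 0"
        using scalar_cancel \<open>c \<noteq> 0\<close> by (simp add: distrib_right)
      moreover have "xx 1 * ?e \<approx> 0" unfolding e by (rule first_x_zero)
      ultimately have "xx 3 * ?e \<approx> 0" using cong_minus[of "xx 3 * ?e + xx 1 * ?e" 0 "xx 1 * ?e" 0] by simp
      then show ?thesis using True by (simp add: numeral_3_eq_3)
    next
      case False
      have "xx (Suc (Suc b)) ^ edge_exp l (Suc b) b * idem (res (two_block (Suc b) 0) @ row1_res l (Suc b) # s) \<approx> 0" for s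
      proof (cases "Suc b = l")
        case True
        then have "edge_exp l (Suc b) b = 2" by (simp add: edge_exp_def)
        then show ?thesis
          using row_x_square[of s] True r residues_row_Suc[of l "Suc b"] by (simp add: power2_eq_square mult.assoc)
      next
        case False
        then have "xx (Suc (Suc b)) * idem (res (two_block (Suc (Suc b)) 0) @ s) \<approx> 0"
          using bl by (intro row_x_zero) auto
        then show ?thesis
          using residues_row_Suc[of l "Suc b"] by (intro x_power_zero edge_exp_pos) simp
      qed
      from move_row_x[of "Suc b", OF this, of b "b # s"]
      have "xx (Suc (length ?p)) ^ edge_exp l (Suc b) b * idem (?p @ Suc b # b # s) \<approx> 0"
        using r by simp
      moreover have "idem (?p @ b # Suc b # s) \<approx> 0"
        using r by (intro vanish_row) (auto simp: next_residue_def)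
      ultimately have "xx (Suc (Suc (length ?p))) ^ edge_exp l b (Suc b) * idem (?p @ Suc b # b # s) \<approx> 0"
        using bl by (intro edge_x_zero[OF refl]) auto
      moreover have "edge_exp l b (Suc b) = 1" using False bl by (auto simp: edge_exp_def)
      ultimately show ?thesis using r by simp
    qed
  qed (rule cong_zero_lmult)
  then have "xx (Suc (b + 2 + b)) * idem (res ?w @ b # s) \<approx> 0" by (simp only: rw)
  from x_vanish_two_block[OF w(1,4) this] show ?case using w by simp
next
  case (step a)
  let ?w = "two_block a b @ [False]" and ?p = "res (two_block a b)"
  have w: "ballot 0 0 ?w" "len1 ?w = Suc a" "len2 ?w = b" "length ?w < Suc (Suc a + b)"
    using step.hyps by (simp_all add: ballot_append ballot_two_block count_list_append)
  have rw: "res ?w @ b # s = ?p @ row1_res l a # b # s" by (simp add: residues_append)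
  have k: "Suc (a + b) = Suc (length ?p)" by simp
  from far_or_vanish[of "two_block a b" a b s] step.hyps
  consider "far (row1_res l a) b" | "idem (?p @ row1_res l a # b # s) \<approx> 0" by auto
  then have "xx (Suc (Suc (a + b))) * idem (?p @ row1_res l a # b # s) \<approx> 0"
  proof cases
    case 1
    then show ?thesis
      using far_x_power[OF k, of b "row1_res l a" 1 s] step.IH[of "row1_res l a # s"] far_sym by simp
  qed (rule cong_zero_lmult)
  then have "xx (Suc (Suc a + b)) * idem (res ?w @ b # s) \<approx> 0" by (simp add: rw)
  from x_vanish_two_block[OF w(1,4) this] show ?case using w by simp
qed

end

section \<open>Tableau idempotents add up to one\<close>

text \<open>
  At a place where both rows may grow the two residues differ, so the residue sequence determines the
  word.
\<close>

lemma residues_inj: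
  assumes "residues l a b w = residues l a b w'" "ballot a b w" "ballot a b w'"
    and "a + len1 w = 2 * l + 1 - i" "b + len2 w = i" "a + len1 w' = 2 * l + 1 - i" "b + len2 w' = i" "i \<le> l"
  shows "w = w'"
  using assms
proof (induction l a b w arbitrary: w' rule: residues.induct)
  case (1 l a b)
  then show ?case using arg_cong[OF 1(1), of length] by simp
next
  case (2 l a b w)
  then obtain y v where [simp]: "w' = y # v" by (cases w') auto
  have "y = False"
  proof (cases y)
    case True
    then have "row1_res l a = b" "Suc b < a" "a < 2 * l + 1 - i" "b < i" using 2 by auto
    then show ?thesis using 2(9) by (auto simp: row1_res_def split: if_splits)
  qed simp
  with 2 show ?case by simp
next
  case (3 l a b w)
  then obtain y v where [simp]: "w' = y # v" by (cases w') auto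
  have "y = True"
  proof (cases y)
    case False
    then have "row1_res l a = b" "Suc b < a" "a < 2 * l + 1 - i" "b < i" using 3 by auto
    then show ?thesis using 3(9) by (auto simp: row1_res_def split: if_splits)
  qed simp
  with 3 show ?case by simp
qed

lemma scalar_left_commute: "a * (scalar c * b) = scalar c * (a * (b :: 'g gword \<Rightarrow>\<^sub>0 'k::comm_ring_1))"
  using scalar_central[of c a] by (simp flip: mult.assoc)

lemma path_two_block: "path 0 0 (two_block a b) = (1 :: 'k::comm_ring_1 klr_free)"
proof (induction b)
  case 0
  show ?case
  proof (induction a)
    case (Suc a)
    then show ?case by (simp add: two_block_row_Suc path_append)
  qed (simp add: two_block_def)
next
  case (Suc b)
  then show ?case by (simp add: two_block_Suc path_append)
qed

lemma path_rev_two_block: "path_rev 0 0 (two_block a b) = (1 :: 'k::comm_ring_1 klr_free)"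
proof (induction b)
  case 0
  show ?case
  proof (induction a)
    case (Suc a)
    then show ?case by (simp add: two_block_row_Suc path_rev_append)
  qed (simp add: two_block_def)
next
  case (Suc b)
  then show ?case by (simp add: two_block_Suc path_rev_append)
qed

definition ballot_words :: "nat \<Rightarrow> nat \<Rightarrow> bool list set"
  where "ballot_words a b = {w. ballot 0 0 w \<and> len1 w = a \<and> len2 w = b}"

lemma finite_ballot_words: "finite (ballot_words a b)"
proof -
  have "ballot_words a b \<subseteq> {w. set w \<subseteq> UNIV \<and> length w = a + b}"
    by (auto simp: ballot_words_def length_word)
  then show ?thesis
    by (rule finite_subset) (rule finite_lists_length_eq, simp)
qed

context klr_two_delta
begin

definition words :: "bool list set" where "words = ballot_words (2 * l + 1 - i) i"

abbreviation "w0 \<equiv> two_block (2 * l + 1 - i) i"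
abbreviation "e0 \<equiv> idem (res w0) :: 'k klr_free"
abbreviation "xe \<equiv> xx (Suc l) * e0 :: 'k klr_free"
abbreviation "pe \<equiv> psi (Suc l) * e0 :: 'k klr_free"

lemma wordsD: "w \<in> words \<Longrightarrow> ballot 0 0 w \<and> len1 w = 2 * l + 1 - i \<and> len2 w = i"
  by (simp add: words_def ballot_words_def)

lemma length_words: "w \<in> words \<Longrightarrow> length w = 2 * l + 1"
  using wordsD[of w] length_word[of w] i_le by simp

lemma w0_words: "w0 \<in> words"
  using i_le by (auto simp: words_def ballot_words_def intro: ballot_two_block)

lemma res_inj: "w \<in> words \<Longrightarrow> w' \<in> words \<Longrightarrow> res w = res w' \<Longrightarrow> w = w'"
  using residues_inj[of l 0 0 w w' i] i_le wordsD by auto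

lemma link_word: "w \<in> words \<Longrightarrow> link (path 0 0 w) (path_rev 0 0 w) (idem (res w)) e0"
  using link_path[of w "[]"] wordsD by fastforce

text \<open>
  Following the letters one by one, \<open>vanish\<close> forces a ballot word, and the weight forces its row lengths.
\<close>

lemma classify:
  assumes "\<not> idem \<nu> \<approx> 0"
  shows "\<nu> \<in> res ` words"
proof -
  have "k \<le> length \<nu> \<Longrightarrow> \<exists>w. ballot 0 0 w \<and> length w = k \<and> take k \<nu> = res w" for k
  proof (induction k)
    case 0
    show ?case by (intro exI[of _ "[]"]) simp
  next
    case (Suc k)
    then obtain w where w: "ballot 0 0 w" "length w = k" "take k \<nu> = res w" by auto
    define c where "c = \<nu> ! k"
    have \<nu>: "\<nu> = res w @ c # drop (Suc k) \<nu>"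
      using Suc.prems w(3) unfolding c_def by (metis Suc_le_eq id_take_nth_drop)
    have "next_residue (len1 w) (len2 w) c"
      using vanish[OF w(1), of c "drop (Suc k) \<nu>"] assms \<nu> by metis
    moreover have "take (Suc k) \<nu> = res w @ [c]"
      using Suc.prems w(3) by (simp add: take_Suc_conv_app_nth c_def)
    ultimately show ?case
    proof (cases "c = row1_res l (len1 w)")
      case True
      then show ?thesis using w \<open>take (Suc k) \<nu> = _\<close>
        by (intro exI[of _ "w @ [False]"]) (simp add: ballot_append residues_append)
    next
      case False
      then show ?thesis using w \<open>take (Suc k) \<nu> = _\<close> \<open>next_residue _ _ _\<close>
        by (intro exI[of _ "w @ [True]"]) (simp add: ballot_append residues_append next_residue_def)
    qed
  qed
  from this[of "length \<nu>"] obtain w where w: "ballot 0 0 w" "length w = length \<nu>" "\<nu> = res w" by auto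
  have nz: "\<not> idem (res w @ []) \<approx> 0" using assms w by simp
  note st = ballot_state0[OF w(1)]
  have "len1 w + len2 w = 2 * l + 1" using nonzero_bounds(2)[OF nz] by simp
  moreover have "len1 w \<le> 2 * l + 1 - i" "len2 w \<le> i"
    using nonzero_bounds(1)[OF nz i_le] st i_le by (auto split: if_splits)
  ultimately have "w \<in> words" using w i_le by (auto simp: words_def ballot_words_def)
  then show ?thesis using w by blast
qed

lemma words_partition: "(\<Sum>w\<in>words. idem (res w)) \<approx> 1"
proof -
  have fin: "finite words" by (simp add: words_def finite_ballot_words)
  have inj: "inj_on res words" using res_inj by (auto simp: inj_on_def)
  let ?U = "seqs_weight l weight \<union> res ` words"
  have sub: "(\<Sum>\<nu>\<in>?U. idem \<nu>) \<approx> (\<Sum>\<nu>\<in>W. idem \<nu>)"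
    if "W \<subseteq> ?U" "\<And>\<nu>. \<nu> \<notin> W \<Longrightarrow> idem \<nu> \<approx> 0" for W
  proof -
    have "(\<Sum>\<nu>\<in>?U. idem \<nu>) \<approx> (\<Sum>\<nu>\<in>?U. if \<nu> \<in> W then idem \<nu> else 0)"
      by (rule cong_sum) (use that(2) in auto)
    also have "(\<Sum>\<nu>\<in>?U. if \<nu> \<in> W then idem \<nu> else 0) = (\<Sum>\<nu>\<in>W. idem \<nu>)"
      using that(1) fin finite_seqs_weight by (subst sum.inter_restrict[symmetric]) (auto simp: Int_absorb1)
    finally show ?thesis .
  qed
  have "(\<Sum>w\<in>words. idem (res w)) = (\<Sum>\<nu>\<in>res ` words. idem \<nu>)"
    by (simp add: sum.reindex[OF inj])
  also have "\<dots> \<approx> (\<Sum>\<nu>\<in>?U. idem \<nu>)" by (rule cong_sym[OF sub]) (use classify in auto)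
  also have "\<dots> \<approx> (\<Sum>\<nu>\<in>seqs_weight l weight. idem \<nu>)" by (rule sub) (use idem_zero in auto)
  also have "\<dots> \<approx> 1" by (rule one_sum)
  finally show ?thesis .
qed

section \<open>Crossings on paths\<close>

lemma idem_path: "w \<in> words \<Longrightarrow> idem (res w) * (path 0 0 w * e0) \<approx> path 0 0 w * e0"
proof -
  assume w: "w \<in> words"
  have "idem (res w) * path 0 0 w * e0 \<approx> path 0 0 w * e0 * e0"
    using link_word[OF w, unfolded link_def] cong_rmult by blast
  also have "\<dots> \<approx> path 0 0 w * e0" using cong_lmult[OF idem_idem] by (simp add: mult.assoc)
  finally show ?thesis by (simp add: mult.assoc)
qed

lemma path_swap:
  fixes u v :: "bool list"
  assumes k: "k = Suc (length u)"
  shows "psi k * path 0 0 (u @ False # True # v) \<approx> path 0 0 (u @ True # False # v)"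
proof -
  have "psi k * path 0 0 u * cycle (len1 u) (len2 u) * path (Suc (len1 u)) (Suc (len2 u)) v \<approx>
      path 0 0 u * psi k * cycle (len1 u) (len2 u) * path (Suc (len1 u)) (Suc (len2 u)) v"
    by (intro cong_rmult psi_path_comm) (simp add: k)
  then show ?thesis using k length_word[of u] by (simp add: path_append mult.assoc)
qed

lemma psi_kills_nonballot:
  assumes w: "u @ x # y # v \<in> words" and k: "k = Suc (length u)"
    and c: "c = (if y then len2 u + (if x then 1 else 0) else row1_res l (len1 u + (if x then 0 else 1)))"
    and nn: "\<not> next_residue (len1 u) (len2 u) c"
  shows "psi k * (path 0 0 (u @ x # y # v) * e0) \<approx> 0"
proof -
  let ?w = "u @ x # y # v"
  obtain d t where rw: "res ?w = res u @ d # c # t" using c by (cases x; cases y) (auto simp: residues_append)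
  have "psi k * (path 0 0 ?w * e0) \<approx> psi k * (idem (res ?w) * (path 0 0 ?w * e0))"
    by (rule cong_lmult[OF cong_sym[OF idem_path[OF w]]])
  also have "\<dots> = psi k * idem (res u @ d # c # t) * (path 0 0 ?w * e0)" unfolding rw by (simp add: mult.assoc)
  also have "\<dots> \<approx> idem (res u @ c # d # t) * psi k * (path 0 0 ?w * e0)"
    by (rule cong_rmult[OF psi_idem]) (simp add: k)
  also have "\<dots> \<approx> 0"
    using wordsD[OF w] by (intro cong_zero_rmult vanish nn) (simp add: ballot_append)
  finally show ?thesis .
qed

lemma psi_square_path:
  assumes w: "u @ False # True # v \<in> words" and b: "Suc (len2 u) < len1 u" and k: "k = Suc (length u)"
  shows "psi k * (psi k * (path 0 0 (u @ False # True # v) * e0)) \<approx> path 0 0 (u @ False # True # v) * e0"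
proof -
  let ?w = "u @ False # True # v"
  obtain t where rw: "res ?w = res u @ row1_res l (len1 u) # len2 u # t" by (simp add: residues_append)
  have sq: "psi k * (psi k * idem (res ?w)) \<approx> idem (res ?w)"
    using far_or_vanish[OF refl refl b, of t]
  proof
    assume "far (row1_res l (len1 u)) (len2 u)"
    then show ?thesis unfolding rw by (intro psi_square_far) (simp_all add: k)
  next
    assume "idem (res u @ row1_res l (len1 u) # len2 u # t) \<approx> 0 \<and>
      idem (res u @ len2 u # row1_res l (len1 u) # t) \<approx> 0"
    then have z: "idem (res ?w) \<approx> 0" unfolding rw by simp
    show ?thesis by (rule both_zero[OF cong_zero_lmult[OF cong_zero_lmult[OF z]] z])
  qed
  have "psi k * (psi k * (path 0 0 ?w * e0)) \<approx> psi k * (psi k * idem (res ?w)) * (path 0 0 ?w * e0)"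
    using cong_lmult[OF cong_sym[OF idem_path[OF w]], of "psi k * psi k"] by (simp add: mult.assoc)
  also have "\<dots> \<approx> idem (res ?w) * (path 0 0 ?w * e0)" by (rule cong_rmult[OF sq])
  also have "\<dots> \<approx> path 0 0 ?w * e0" by (rule idem_path[OF w])
  finally show ?thesis .
qed

text \<open>
  Each step is a braid relation across a letter \<open>b\<close> of the second row. As \<open>b < i < l\<close>, that letter is
  distant from the two letters \<open>l\<close>, and the correction term of the braid relation vanishes.
\<close>

lemma psi_double_cycle:
  assumes "i < l"
  shows "b \<le> i \<Longrightarrow> psi (Suc (l + b)) * (cycle l b * cycle (Suc l) b * idem (res (two_block (Suc (Suc l)) b) @ s)) \<approx>
    cycle l b * cycle (Suc l) b * (psi (Suc l) * idem (res (two_block (Suc (Suc l)) b) @ s))"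
proof (induction b arbitrary: s)
  case (Suc b)
  let ?C = "cycle l b :: 'k klr_free" and ?D = "cycle (Suc l) b :: 'k klr_free"
  let ?e = "idem (res (two_block (Suc (Suc l)) (Suc b)) @ s) :: 'k klr_free"
  let ?m = "Suc (l + b)" and ?h = "idem (res (two_block l b) @ l # l # b # s) :: 'k klr_free"
  have e: "?e = idem (res (two_block (Suc (Suc l)) b) @ b # s)" by (simp add: residues_two_block_Suc)
  have comm: "psi (Suc ?m) * ?C \<approx> ?C * psi (Suc ?m)" by (rule psi_cycle_comm) simp
  have split: "cycle l (Suc b) * cycle (Suc l) (Suc b) * X \<approx> psi ?m * (psi (Suc ?m) * (?C * ?D * X))" for X :: "'k klr_free"
    using cong_mid[OF cong_sym[OF comm], of "psi ?m" "?D * X"] by (simp add: mult.assoc)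
  \<comment> \<open>the element passes through the two cycles to the idempotent\<close>
  have l1: "link ?C (cycle_rev l b) (idem (res (two_block l b) @ l # t)) (idem (res (two_block (Suc l) b) @ t))"
    and l2': "link ?D (cycle_rev (Suc l) b) (idem (res (two_block (Suc l) b) @ l # t)) (idem (res (two_block (Suc (Suc l)) b) @ t))" for t
    using link_cycle[of b l t] link_cycle[of b "Suc l" t] Suc.prems assms by (auto simp: row1_res_def)
  have "link (?C * ?D) (cycle_rev (Suc l) b * cycle_rev l b) ?h ?e"
    unfolding e using link_trans[OF l1[of "l # b # s"] l2'[of "b # s"]] by simp
  then have he: "?h * (?C * ?D) \<approx> ?C * ?D * ?e" unfolding link_def by blast
  have far: "far l b" using Suc.prems assms by (simp add: far_def)
  have ne: "l \<noteq> b" using Suc.prems assms by simp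
  have br: "psi (Suc ?m) * psi ?m * psi (Suc ?m) * ?h \<approx> psi ?m * psi (Suc ?m) * psi ?m * ?h"
    using braid[of ?m "res (two_block l b)" l l b s] ne by simp
  have "psi (Suc ?m) * (cycle l (Suc b) * cycle (Suc l) (Suc b) * ?e) \<approx>
      psi (Suc ?m) * (psi ?m * (psi (Suc ?m) * (?C * ?D * ?e)))" by (rule cong_lmult[OF split])
  also have "\<dots> \<approx> psi (Suc ?m) * psi ?m * psi (Suc ?m) * (?h * (?C * ?D))"
    using cong_lmult[OF cong_sym[OF he], of "psi (Suc ?m) * psi ?m * psi (Suc ?m)"] by (simp add: mult.assoc)
  also have "\<dots> \<approx> psi ?m * psi (Suc ?m) * psi ?m * (?h * (?C * ?D))"
    using cong_rmult[OF br, of "?C * ?D"] by (simp add: mult.assoc)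
  also have "\<dots> \<approx> psi ?m * psi (Suc ?m) * (psi ?m * (?C * ?D * ?e))"
    using cong_lmult[OF he, of "psi ?m * psi (Suc ?m) * psi ?m"] by (simp add: mult.assoc)
  also have "\<dots> \<approx> psi ?m * psi (Suc ?m) * (?C * ?D * (psi (Suc l) * ?e))"
    using Suc by (intro cong_lmult) (simp add: e)
  also have "\<dots> \<approx> cycle l (Suc b) * cycle (Suc l) (Suc b) * (psi (Suc l) * ?e)"
    using cong_sym[OF split] by (simp add: mult.assoc)
  finally show ?case by simp
qed simp

lemma psi_double_path:
  assumes w: "u @ False # False # v \<in> words" and u: "len1 u = l" and k: "k = Suc (length u)" and il: "i < l"
  shows "psi k * (path 0 0 (u @ False # False # v) * e0) \<approx> path 0 0 (u @ False # False # v) * pe"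
proof -
  let ?b = "len2 u" and ?pv = "path (Suc (Suc l)) (len2 u) v :: 'k klr_free"
  let ?C = "cycle l (len2 u) :: 'k klr_free" and ?D = "cycle (Suc l) (len2 u) :: 'k klr_free"
  let ?w = "u @ False # False # v"
  have pw: "path 0 0 ?w = path 0 0 u * (?C * ?D * ?pv)"
    by (simp add: path_append u mult.assoc)
  have bi: "?b \<le> i" using wordsD[OF w] by (simp add: count_list_append)
  have kb: "k = Suc (l + ?b)" using k u length_word[of u] by simp
  have c1: "psi k * path 0 0 u \<approx> path 0 0 u * psi k" by (rule psi_path_comm) (simp add: k)
  have c2: "psi (Suc l) * ?pv \<approx> ?pv * psi (Suc l)" by (rule psi_path_comm) simp
  \<comment> \<open>the idempotent in front of the remaining path\<close>
  let ?f = "idem (res (two_block (Suc (Suc l)) ?b) @ residues l (Suc (Suc l)) ?b v) :: 'k klr_free"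
  have fe: "?f * ?pv * e0 \<approx> ?pv * e0"
  proof -
    have "ballot 0 0 (two_block (Suc (Suc l)) ?b @ v)"
      using wordsD[OF w] bi il by (simp add: ballot_append ballot_two_block u)
    moreover have "two_block (len1 (two_block (Suc (Suc l)) ?b @ v)) (len2 (two_block (Suc (Suc l)) ?b @ v)) = w0"
      using wordsD[OF w] u by (simp add: count_list_append)
    ultimately have "link (path 0 0 (two_block (Suc (Suc l)) ?b @ v)) (path_rev 0 0 (two_block (Suc (Suc l)) ?b @ v))
       ?f e0"
      using link_path[of "two_block (Suc (Suc l)) ?b @ v" "[]"] by (simp add: residues_append)
    then have "?f * ?pv \<approx> ?pv * e0"
      by (simp add: path_append path_two_block link_def)
    then have "?f * ?pv * e0 \<approx> ?pv * e0 * e0" by (rule cong_rmult)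
    also have "\<dots> \<approx> ?pv * e0" using cong_lmult[OF idem_idem] by (simp add: mult.assoc)
    finally show ?thesis .
  qed
  have "psi k * (path 0 0 ?w * e0) \<approx> path 0 0 u * (psi k * (?C * ?D * (?pv * e0)))"
    using cong_rmult[OF c1, of "?C * ?D * ?pv * e0"] by (simp add: pw mult.assoc)
  also have "\<dots> \<approx> path 0 0 u * (psi k * (?C * ?D * (?f * (?pv * e0))))"
    using cong_lmult[OF cong_sym[OF fe], of "path 0 0 u * (psi k * (?C * ?D))"] by (simp add: mult.assoc)
  also have "\<dots> = path 0 0 u * (psi (Suc (l + ?b)) * (?C * ?D * ?f)) * (?pv * e0)"
    by (simp add: kb mult.assoc)
  also have "\<dots> \<approx> path 0 0 u * (?C * ?D * (psi (Suc l) * ?f)) * (?pv * e0)"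
    by (intro cong_mid psi_double_cycle il bi)
  also have "\<dots> \<approx> path 0 0 u * (?C * ?D * (psi (Suc l) * (?pv * e0)))"
    using cong_lmult[OF fe, of "path 0 0 u * (?C * ?D * psi (Suc l))"] by (simp add: mult.assoc)
  also have "\<dots> \<approx> path 0 0 ?w * pe"
    using cong_mid[OF c2, of "path 0 0 u * (?C * ?D)" e0] by (simp add: pw mult.assoc)
  finally show ?thesis .
qed

text \<open>
  A crossing permutes the paths, kills them, or, at the two equal letters \<open>l\<close> in the middle of the first
  row, passes through the path to the corner.
\<close>

lemma psi_path_cases:
  assumes w: "w \<in> words"
  shows "(\<exists>w'\<in>words. psi k * (path 0 0 w * e0) \<approx> path 0 0 w' * e0) \<or>
    psi k * (path 0 0 w * e0) \<approx> 0 \<or> (i < l \<and> psi k * (path 0 0 w * e0) \<approx> path 0 0 w * pe)"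
proof (cases "1 \<le> k \<and> k < length w")
  case False
  then have "psi k \<approx> 0" using length_words[OF w] by (intro outside_psi) (auto simp: size_weight)
  then show ?thesis by (intro disjI2 disjI1 cong_zero_rmult)
next
  case True
  then obtain u x y v where wd: "w = u @ x # y # v" and k: "k = Suc (length u)"
    using split_at_pair[of k w] by blast
  let ?a = "len1 u" and ?b = "len2 u"
  have W: "ballot 0 0 u" "?a + len1 (x # y # v) = 2 * l + 1 - i" "?b + len2 (x # y # v) = i"
    "ballot ?a ?b (x # y # v)"
    using wordsD[OF w] by (simp_all add: wd ballot_append count_list_append)
  note st = ballot_state0[OF W(1)]
  consider (TF) "x" "\<not> y" | (FT) "\<not> x" "y" "Suc ?b < ?a" | (FT') "\<not> x" "y" "\<not> Suc ?b < ?a"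
    | (TT) "x" "y" | (double) "\<not> x" "\<not> y" "?a = l" "i < l" | (FF) "\<not> x" "\<not> y" "\<not> (?a = l \<and> i < l)" by blast
  then show ?thesis
  proof cases
    case TF
    have sw: "u @ False # True # v \<in> words"
      using w TF st by (auto simp: wd words_def ballot_words_def ballot_append count_list_append)
    have "psi k * (path 0 0 w * e0) \<approx> psi k * (psi k * (path 0 0 (u @ False # True # v) * e0))"
      using cong_lmult[OF cong_rmult[OF cong_sym[OF path_swap[OF k]]], of "psi k" v e0] TF by (simp add: wd mult.assoc)
    also have "\<dots> \<approx> path 0 0 (u @ False # True # v) * e0"
      using W TF by (intro psi_square_path sw k) simp
    finally show ?thesis using sw by blast
  next
    case FT
    have sw: "u @ True # False # v \<in> words"
      using w FT by (auto simp: wd words_def ballot_words_def ballot_append count_list_append)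
    have "psi k * (path 0 0 w * e0) \<approx> path 0 0 (u @ True # False # v) * e0"
      using cong_rmult[OF path_swap[OF k], of v e0] FT by (simp add: wd mult.assoc)
    then show ?thesis using sw by blast
  next
    case FT'
    have "psi k * (path 0 0 (u @ x # y # v) * e0) \<approx> 0"
    proof (rule psi_kills_nonballot[OF _ k refl])
      show "\<not> next_residue ?a ?b (if y then ?b + (if x then 1 else 0) else row1_res l (?a + (if x then 0 else 1)))"
        using FT' W st i_le by (auto simp: next_residue_def row1_res_def split: if_splits)
    qed (use w wd in simp)
    then show ?thesis by (simp add: wd)
  next
    case TT
    have "psi k * (path 0 0 (u @ x # y # v) * e0) \<approx> 0"
    proof (rule psi_kills_nonballot[OF _ k refl])
      show "\<not> next_residue ?a ?b (if y then ?b + (if x then 1 else 0) else row1_res l (?a + (if x then 0 else 1)))"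
        using TT W st i_le by (auto simp: next_residue_def row1_res_def split: if_splits)
    qed (use w wd in simp)
    then show ?thesis by (simp add: wd)
  next
    case double
    then show ?thesis using psi_double_path[OF _ _ k, of v] w by (simp add: wd)
  next
    case FF
    have "psi k * (path 0 0 (u @ x # y # v) * e0) \<approx> 0"
    proof (rule psi_kills_nonballot[OF _ k refl])
      show "\<not> next_residue ?a ?b (if y then ?b + (if x then 1 else 0) else row1_res l (?a + (if x then 0 else 1)))"
        using FF W st i_le by (auto simp: next_residue_def row1_res_def split: if_splits)
    qed (use w wd in simp)
    then show ?thesis by (simp add: wd)
  qed
qed

lemma x_path_cases: "w \<in> words \<Longrightarrow> \<exists>j. xx k * (path 0 0 w * e0) \<approx> path 0 0 w * (xx j * e0)"
  using link_word unfolding link_def by blast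

end

context klr_two_delta
begin

section \<open>The corner algebra\<close>

lemma w0_split_row: "m \<le> 2 * l + 1 - i \<Longrightarrow> \<exists>t. res w0 = res (two_block m 0) @ t"
proof -
  assume m: "m \<le> 2 * l + 1 - i"
  then have "w0 = two_block m 0 @ (replicate (2 * l + 1 - i - m) False @ replicate i True)"
    by (simp add: two_block_def flip: replicate_add append_assoc)
  then show ?thesis by (metis residues_append)
qed

lemma w0_split_second: "b < i \<Longrightarrow> \<exists>t. res w0 = res (two_block (2 * l + 1 - i) b) @ b # t"
proof -
  assume b: "b < i"
  then have "w0 = two_block (2 * l + 1 - i) b @ True # replicate (i - Suc b) True"
    by (simp add: two_block_def flip: replicate_add replicate_Suc)
  then have "res w0 = res (two_block (2 * l + 1 - i) b) @ residues l (2 * l + 1 - i) b (True # replicate (i - Suc b) True)"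
    by (simp only: residues_append len_two_block add_0)
  then show ?thesis by auto
qed

text \<open>
  The reference tableau has the first row followed by the second, so the earlier results on the two rows
  cover every place but the one or two places of the letter \<open>l\<close> in the first row.
\<close>

lemma x_e0_zero:
  assumes "j \<noteq> Suc l" "\<not> (i < l \<and> j = Suc (Suc l))"
  shows "xx j * e0 \<approx> 0"
proof -
  consider "j \<notin> {1..2 * l + 1}" | "1 \<le> j" "j \<le> 2 * l + 1 - i" | "2 * l + 1 - i < j" "j \<le> 2 * l + 1"
    by fastforce
  then show ?thesis
  proof cases
    case 1
    then have "xx j \<approx> 0" by (intro outside_x) (simp add: size_weight)
    then show ?thesis by (rule cong_zero_rmult)
  next
    case 2
    obtain t where t: "res w0 = res (two_block j 0) @ t" using w0_split_row 2 by blast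
    have "j \<le> l \<or> l + 3 \<le> j" using assms 2 i_le by auto
    then show ?thesis unfolding t using 2 row_x_zero[of j t] row_x_zero_tail[of j t] by auto
  next
    case 3
    define b where "b = j - Suc (2 * l + 1 - i)"
    have b: "j = Suc (2 * l + 1 - i + b)" "b < i" using 3 i_le by (auto simp: b_def)
    obtain t where t: "res w0 = res (two_block (2 * l + 1 - i) b) @ b # t" using w0_split_second b(2) by blast
    show ?thesis unfolding t b(1) using b(2) i_le by (intro second_row_x_zero) auto
  qed
qed

lemma xe_square: "xe * xe \<approx> 0"
proof -
  have le: "Suc l \<le> 2 * l + 1 - i" using i_le by simp
  obtain t where t: "res w0 = res (two_block (Suc l) 0) @ t" using w0_split_row[of "Suc l", OF le] by blast
  have "xe * xe \<approx> xx (Suc l) * (xx (Suc l) * e0) * e0"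
    using cong_mid[OF cong_sym[OF x_idem], of "xx (Suc l)"] by (simp add: mult.assoc)
  also have "\<dots> \<approx> 0" unfolding t by (rule cong_zero_rmult[OF row_x_square])
  finally show ?thesis .
qed

lemma e0_xe: "e0 * xe \<approx> xe" and xe_e0: "xe * e0 \<approx> xe"
proof -
  have "e0 * xe \<approx> xx (Suc l) * e0 * e0" using cong_rmult[OF cong_sym[OF x_idem], where x = e0] by (simp add: mult.assoc)
  moreover have e: "xx (Suc l) * e0 * e0 \<approx> xe" using cong_lmult[OF idem_idem] by (simp add: mult.assoc)
  ultimately show "e0 * xe \<approx> xe" "xe * e0 \<approx> xe" using cong_trans by blast+
qed

lemma x_e0_second:
  assumes "i < l"
  shows "xx (Suc (Suc l)) * e0 \<approx> - xe"
proof -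
  have le: "Suc (Suc l) \<le> 2 * l + 1 - i" using assms by simp
  obtain t where t: "res w0 = res (two_block (Suc (Suc l)) 0) @ t" using w0_split_row[OF le] by blast
  have "(xx (Suc l) + xx (Suc (Suc l))) * e0 \<approx> 0" unfolding t by (rule row_x_sum)
  from cong_minus[OF this cong_refl, of xe] show ?thesis by (simp add: distrib_right)
qed

context
  assumes il: "i < l"
begin

lemma w0_split_double: "\<exists>t. res w0 = res (two_block l 0) @ l # l # t"
proof -
  have le: "Suc (Suc l) \<le> 2 * l + 1 - i" using il by simp
  show ?thesis using w0_split_row[OF le] by (auto simp: residues_row_Suc row1_res_def)
qed

lemma pe_comm: "pe \<approx> e0 * psi (Suc l)"
proof -
  obtain t where t: "res w0 = res (two_block l 0) @ l # l # t" using w0_split_double by blast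
  show ?thesis unfolding t by (rule psi_idem) simp
qed

lemma pe_e0: "pe * e0 \<approx> pe"
  using cong_lmult[OF idem_idem] by (simp add: mult.assoc)

lemma e0_pe: "e0 * pe \<approx> pe"
proof -
  have "e0 * pe \<approx> e0 * e0 * psi (Suc l)" using cong_lmult[OF pe_comm] by (simp add: mult.assoc)
  also have "\<dots> \<approx> e0 * psi (Suc l)" by (rule cong_rmult[OF idem_idem])
  also have "\<dots> \<approx> pe" by (rule cong_sym[OF pe_comm])
  finally show ?thesis .
qed

lemma pe_square: "pe * pe \<approx> 0"
proof -
  obtain t where t: "res w0 = res (two_block l 0) @ l # l # t" using w0_split_double by blast
  have "pe * pe \<approx> psi (Suc l) * pe"
    using cong_lmult[OF e0_pe, of "psi (Suc l)"] by (simp add: mult.assoc)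
  also have "\<dots> \<approx> 0" unfolding t by (rule psi_square_self) simp
  finally show ?thesis .
qed

text \<open>
  The nil Hecke relation at the two letters \<open>l\<close>, where the second dot is minus the first: with
  \<open>xe\<close> and \<open>pe\<close> of square zero the corner is a quotient of a Clifford algebra, that is, of the two by two matrices.
\<close>

lemma pe_xe: "pe * xe \<approx> - (xe * pe) - e0"
proof -
  obtain t where t: "res w0 = res (two_block l 0) @ l # l # t" using w0_split_double by blast
  have "pe * xe \<approx> psi (Suc l) * xx (Suc l) * e0"
    using cong_lmult[OF e0_xe, of "psi (Suc l)"] by (simp add: mult.assoc)
  also have "\<dots> \<approx> xx (Suc (Suc l)) * psi (Suc l) * e0 - e0"
    unfolding t using psi_x_pair(1)[of "Suc l" "res (two_block l 0)" l l t] by simp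
  also have "\<dots> \<approx> - (xe * pe) - e0"
  proof (rule cong_minus[OF _ cong_refl])
    have "xx (Suc (Suc l)) * psi (Suc l) * e0 \<approx> xx (Suc (Suc l)) * e0 * psi (Suc l)"
      using cong_lmult[OF pe_comm] by (simp add: mult.assoc)
    also have "\<dots> \<approx> - xe * psi (Suc l)" by (rule cong_rmult[OF x_e0_second[OF il]])
    also have "\<dots> \<approx> - xx (Suc l) * pe" using cong_lmult[OF cong_sym[OF pe_comm], of "- xx (Suc l)"] by (simp add: mult.assoc)
    also have "\<dots> \<approx> - xx (Suc l) * (e0 * pe)" by (rule cong_lmult[OF cong_sym[OF e0_pe]])
    finally show "xx (Suc (Suc l)) * psi (Suc l) * e0 \<approx> - (xe * pe)" by (simp add: mult.assoc)
  qed
  finally show ?thesis .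
qed

end

text \<open>
  The span of the possible corner elements. For \<open>i = l\<close> the first row has only \<open>l + 1\<close> boxes, the letter
  \<open>l\<close> occurs once, and there is no crossing in the corner.
\<close>

definition corner_span :: "'k klr_free set"
  where "corner_span = {b. \<exists>c1 c2 c3 c4. (i = l \<longrightarrow> c3 = 0 \<and> c4 = 0) \<and>
    b \<approx> scalar c1 * e0 + scalar c2 * xe + scalar c3 * pe + scalar c4 * (xe * pe)}"

lemma corner_spanI:
  "i = l \<longrightarrow> c3 = 0 \<and> c4 = 0 \<Longrightarrow>
    b \<approx> scalar c1 * e0 + scalar c2 * xe + scalar c3 * pe + scalar c4 * (xe * pe) \<Longrightarrow> b \<in> corner_span"
  unfolding corner_span_def by blast

lemma corner_span_cong: "b \<in> corner_span \<Longrightarrow> b' \<approx> b \<Longrightarrow> b' \<in> corner_span"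
  unfolding corner_span_def using cong_trans by blast

lemma scalar_zero: "scalar 0 = (0 :: 'k klr_free)"
  by (simp add: scalar_def)

lemma corner_span_zero: "0 \<in> corner_span"
  by (rule corner_spanI[of 0 0 _ 0 0]) (simp_all add: scalar_zero)

lemma corner_span_e0: "e0 \<in> corner_span"
  by (rule corner_spanI[of 0 0 _ 1 0]) (simp_all add: scalar_zero scalar_one)

lemma corner_span_add:
  assumes "a \<in> corner_span" "b \<in> corner_span"
  shows "a + b \<in> corner_span"
proof -
  obtain c1 c2 c3 c4 where a: "i = l \<longrightarrow> c3 = 0 \<and> c4 = 0"
    "a \<approx> scalar c1 * e0 + scalar c2 * xe + scalar c3 * pe + scalar c4 * (xe * pe)"
    using assms(1) unfolding corner_span_def by blast
  obtain d1 d2 d3 d4 where b: "i = l \<longrightarrow> d3 = 0 \<and> d4 = 0"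
    "b \<approx> scalar d1 * e0 + scalar d2 * xe + scalar d3 * pe + scalar d4 * (xe * pe)"
    using assms(2) unfolding corner_span_def by blast
  show ?thesis
    by (rule corner_spanI[of "c3 + d3" "c4 + d4" _ "c1 + d1" "c2 + d2"])
      (use a(1) b(1) cong_add[OF a(2) b(2)] in \<open>simp_all add: scalar_add algebra_simps\<close>)
qed

lemma corner_span_scalar:
  assumes "a \<in> corner_span"
  shows "scalar c * a \<in> corner_span"
proof -
  obtain c1 c2 c3 c4 where a: "i = l \<longrightarrow> c3 = 0 \<and> c4 = 0"
    "a \<approx> scalar c1 * e0 + scalar c2 * xe + scalar c3 * pe + scalar c4 * (xe * pe)"
    using assms(1) unfolding corner_span_def by blast
  show ?thesis
    by (rule corner_spanI[of "c * c3" "c * c4" _ "c * c1" "c * c2"])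
      (use a(1) cong_lmult[OF a(2), of "scalar c"] in \<open>simp_all add: scalar_mult distrib_left mult.assoc\<close>)
qed

lemma corner_span_xe:
  assumes "a \<in> corner_span"
  shows "xe * a \<in> corner_span"
proof -
  obtain c1 c2 c3 c4 where a: "i = l \<longrightarrow> c3 = 0 \<and> c4 = 0"
    "a \<approx> scalar c1 * e0 + scalar c2 * xe + scalar c3 * pe + scalar c4 * (xe * pe)"
    using assms(1) unfolding corner_span_def by blast
  have "xe * a \<approx> xe * (scalar c1 * e0 + scalar c2 * xe + scalar c3 * pe + scalar c4 * (xe * pe))"
    by (rule cong_lmult[OF a(2)])
  also have "\<dots> = scalar c1 * (xe * e0) + scalar c2 * (xe * xe) + scalar c3 * (xe * pe) + scalar c4 * (xe * xe * pe)"
    by (simp only: distrib_left scalar_left_commute[of xe]) (simp add: mult.assoc)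
  also have "\<dots> \<approx> scalar c1 * xe + scalar c2 * 0 + scalar c3 * (xe * pe) + scalar c4 * (0 * pe)"
    by (intro cong_add cong_lmult cong_rmult xe_e0 xe_square cong_refl)
  finally show ?thesis
    using a(1) by (intro corner_spanI[of 0 c3 _ 0 c1]) (simp_all add: scalar_zero)
qed

lemma corner_span_pe_mult:
  assumes il: "i < l" and "a \<in> corner_span"
  shows "pe * a \<in> corner_span"
proof -
  obtain c1 c2 c3 c4 where a:
    "a \<approx> scalar c1 * e0 + scalar c2 * xe + scalar c3 * pe + scalar c4 * (xe * pe)"
    using assms(2) unfolding corner_span_def by blast
  have yxy: "pe * xe * pe \<approx> - pe"
  proof -
    have "pe * xe * pe \<approx> (- (xe * pe) - e0) * pe" by (rule cong_rmult[OF pe_xe[OF il]])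
    also have "\<dots> = - (xe * (pe * pe)) - e0 * pe" by (simp add: algebra_simps)
    also have "\<dots> \<approx> - (xe * 0) - pe"
      by (intro cong_minus cong_uminus cong_lmult pe_square[OF il] e0_pe[OF il])
    finally show ?thesis by simp
  qed
  have "pe * a \<approx> pe * (scalar c1 * e0 + scalar c2 * xe + scalar c3 * pe + scalar c4 * (xe * pe))"
    by (rule cong_lmult[OF a])
  also have "\<dots> = scalar c1 * (pe * e0) + scalar c2 * (pe * xe) + scalar c3 * (pe * pe) + scalar c4 * (pe * xe * pe)"
    by (simp only: distrib_left scalar_left_commute[of pe]) (simp add: mult.assoc)
  also have "\<dots> \<approx> scalar c1 * pe + scalar c2 * (- (xe * pe) - e0) + scalar c3 * 0 + scalar c4 * (- pe)"
    by (intro cong_add cong_lmult pe_e0[OF il] pe_xe[OF il] pe_square[OF il] yxy)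
  also have "\<dots> = scalar (- c2) * e0 + scalar 0 * xe + scalar (c1 - c4) * pe + scalar (- c2) * (xe * pe)"
    by (simp add: scalar_def single_uminus single_diff algebra_simps)
  finally show ?thesis using il by (intro corner_spanI) simp_all
qed

lemma e0_corner_span: "b \<in> corner_span \<Longrightarrow> e0 * b \<approx> b" and corner_span_e0_right: "b \<in> corner_span \<Longrightarrow> b * e0 \<approx> b"
proof -
  assume "b \<in> corner_span"
  then obtain c1 c2 c3 c4 where a: "i = l \<longrightarrow> c3 = 0 \<and> c4 = 0"
    "b \<approx> scalar c1 * e0 + scalar c2 * xe + scalar c3 * pe + scalar c4 * (xe * pe)"
    unfolding corner_span_def by blast
  have pe_left: "scalar c3 * (e0 * pe) \<approx> scalar c3 * pe"
  proof (cases "c3 = 0")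
    case False
    then have "i < l" using a(1) i_le by linarith
    then show ?thesis by (intro cong_lmult e0_pe)
  qed (simp add: scalar_zero)
  have xpe: "e0 * (xe * pe) \<approx> xe * pe" using cong_rmult[OF e0_xe, of pe] by (simp add: mult.assoc)
  have pe_right: "pe * e0 \<approx> pe" using cong_lmult[OF idem_idem] by (simp add: mult.assoc)
  have xpe': "xe * pe * e0 \<approx> xe * pe" using cong_lmult[OF pe_right, of xe] by (simp add: mult.assoc)
  have "e0 * b \<approx> e0 * (scalar c1 * e0 + scalar c2 * xe + scalar c3 * pe + scalar c4 * (xe * pe))"
    by (rule cong_lmult[OF a(2)])
  also have "\<dots> = scalar c1 * (e0 * e0) + scalar c2 * (e0 * xe) + scalar c3 * (e0 * pe) + scalar c4 * (e0 * (xe * pe))"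
    by (simp only: distrib_left scalar_left_commute[of e0])
  also have "\<dots> \<approx> scalar c1 * e0 + scalar c2 * xe + scalar c3 * pe + scalar c4 * (xe * pe)"
    by (intro cong_add pe_left cong_lmult[OF idem_idem] cong_lmult[OF e0_xe] cong_lmult[OF xpe])
  finally show "e0 * b \<approx> b" using cong_trans cong_sym[OF a(2)] by blast
  have "b * e0 \<approx> (scalar c1 * e0 + scalar c2 * xe + scalar c3 * pe + scalar c4 * (xe * pe)) * e0"
    by (rule cong_rmult[OF a(2)])
  also have "\<dots> = scalar c1 * (e0 * e0) + scalar c2 * (xe * e0) + scalar c3 * (pe * e0) + scalar c4 * (xe * pe * e0)"
    by (simp only: distrib_right mult.assoc)
  also have "\<dots> \<approx> scalar c1 * e0 + scalar c2 * xe + scalar c3 * pe + scalar c4 * (xe * pe)"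
    by (intro cong_add cong_lmult idem_idem xe_e0 pe_right xpe')
  finally show "b * e0 \<approx> b" using cong_trans cong_sym[OF a(2)] by blast
qed

lemma corner_span_x: "b \<in> corner_span \<Longrightarrow> xx j * b \<in> corner_span"
proof -
  assume b: "b \<in> corner_span"
  have eb: "xx j * b \<approx> xx j * e0 * b"
    using cong_lmult[OF cong_sym[OF e0_corner_span[OF b]], of "xx j"] by (simp add: mult.assoc)
  consider "j = Suc l" | "i < l" "j = Suc (Suc l)" | "xx j * e0 \<approx> 0" using x_e0_zero by blast
  then show ?thesis
  proof cases
    case 1
    then show ?thesis using corner_span_cong[OF corner_span_xe[OF b]] eb by simp
  next
    case 2
    have "xx j * b \<approx> - xe * b" using cong_trans[OF eb cong_rmult] x_e0_second 2 by blast
    also have "- xe * b = scalar (- 1) * (xe * b)" by (simp add: scalar_def single_uminus)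
    finally show ?thesis using corner_span_cong[OF corner_span_scalar[OF corner_span_xe[OF b]]] by blast
  next
    case 3
    then show ?thesis using corner_span_cong[OF corner_span_zero] cong_trans[OF eb cong_zero_rmult] by blast
  qed
qed

section \<open>A spanning set of the block\<close>

text \<open>
  Sums of products of a path, a corner element and a reversed path, closed under congruence.
\<close>

inductive_set block_span :: "'k klr_free set"
where
  zero: "0 \<in> block_span"
| step: "a \<in> block_span \<Longrightarrow> w \<in> words \<Longrightarrow> w' \<in> words \<Longrightarrow> b \<in> corner_span \<Longrightarrow>
    a' \<approx> a + path 0 0 w * b * path_rev 0 0 w' \<Longrightarrow> a' \<in> block_span"

lemma block_span_add: "a \<in> block_span \<Longrightarrow> a' \<in> block_span \<Longrightarrow> a' + a \<in> block_span"
proof (induction a arbitrary: rule: block_span.induct)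
  case (step a w w' b a'')
  have "a' + a'' \<approx> (a' + a) + path 0 0 w * b * path_rev 0 0 w'"
    using cong_add[OF cong_refl step.hyps(5), of a'] by (simp add: add.assoc)
  then show ?case using block_span.step[OF step.IH[OF step.prems] step.hyps(2-4)] by blast
qed simp

lemma block_span_cong:
  assumes "a \<in> block_span" "a' \<approx> a"
  shows "a' \<in> block_span"
  using assms(1)
proof (cases rule: block_span.cases)
  case zero
  then show ?thesis
    using block_span.step[OF block_span.zero w0_words w0_words corner_span_zero, of a'] assms(2) by simp
next
  case (step a1 w w' b)
  then show ?thesis using block_span.step[of a1 w w' b a'] cong_trans[OF assms(2)] by blast
qed

lemma block_span_base: "w \<in> words \<Longrightarrow> w' \<in> words \<Longrightarrow> b \<in> corner_span \<Longrightarrow>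
    path 0 0 w * b * path_rev 0 0 w' \<in> block_span"
  using block_span.step[OF block_span.zero] by fastforce

lemma block_span_sum: "(\<And>t. t \<in> T \<Longrightarrow> f t \<in> block_span) \<Longrightarrow> sum f T \<in> block_span"
  by (induction T rule: infinite_finite_induct) (simp_all add: block_span.zero block_span_add)

lemma block_span_gen:
  assumes w: "w \<in> words" and w': "w' \<in> words" and b: "b \<in> corner_span"
  shows "gen g * (path 0 0 w * b * path_rev 0 0 w') \<in> block_span"
proof -
  let ?q = "path_rev 0 0 w'" and ?p = "path 0 0 w"
  have eb: "x * (?p * b * ?q) \<approx> x * (?p * e0) * (b * ?q)" for x
    using cong_mid[OF cong_sym[OF e0_corner_span[OF b]], of "x * ?p" ?q] by (simp add: mult.assoc)
  have zero: "gen g * (?p * b * ?q) \<in> block_span" if "gen g * (?p * e0) \<approx> 0"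
    using block_span_cong[OF block_span.zero cong_trans[OF eb cong_zero_rmult[OF that]]] .
  show ?thesis
  proof (cases g)
    case (E \<nu>)
    have "idem \<nu> * (?p * e0) \<approx> idem \<nu> * idem (res w) * (?p * e0)"
      using cong_lmult[OF cong_sym[OF idem_path[OF w]], of "idem \<nu>"] by (simp add: mult.assoc)
    also have "\<dots> \<approx> (if \<nu> = res w then idem \<nu> else 0) * (?p * e0)" by (rule cong_rmult[OF idem_mult])
    finally have 1: "idem \<nu> * (?p * e0) \<approx> (if \<nu> = res w then idem \<nu> else 0) * (?p * e0)" .
    show ?thesis
    proof (cases "\<nu> = res w")
      case True
      have "idem \<nu> * (?p * b * ?q) \<approx> ?p * e0 * (b * ?q)"
        using cong_trans[OF eb cong_rmult[OF idem_path[OF w]]] True by simp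
      also have "\<dots> \<approx> ?p * b * ?q"
        using cong_mid[OF e0_corner_span[OF b], of ?p ?q] by (simp add: mult.assoc)
      finally show ?thesis using block_span_cong[OF block_span_base[OF w w' b]] E by simp
    next
      case False
      then show ?thesis using zero 1 E by simp
    qed
  next
    case (X j)
    obtain m where m: "xx j * (?p * e0) \<approx> ?p * (xx m * e0)" using x_path_cases[OF w] by blast
    have "xx j * (?p * b * ?q) \<approx> ?p * (xx m * e0) * (b * ?q)"
      using cong_trans[OF eb cong_rmult[OF m]] .
    also have "\<dots> \<approx> ?p * (xx m * b) * ?q"
      using cong_mid[OF e0_corner_span[OF b], of "?p * xx m" ?q] by (simp add: mult.assoc)
    finally show ?thesis
      using block_span_cong[OF block_span_base[OF w w' corner_span_x[OF b]]] X by simp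
  next
    case (Psi k)
    from psi_path_cases[OF w, of k]
    consider w'' where "w'' \<in> words" "psi k * (?p * e0) \<approx> path 0 0 w'' * e0" | "psi k * (?p * e0) \<approx> 0"
      | "i < l" "psi k * (?p * e0) \<approx> ?p * pe" by blast
    then show ?thesis
    proof cases
      case 1
      have "psi k * (?p * b * ?q) \<approx> path 0 0 w'' * e0 * (b * ?q)"
        using cong_trans[OF eb cong_rmult[OF 1(2)]] .
      also have "\<dots> \<approx> path 0 0 w'' * b * ?q"
        using cong_mid[OF e0_corner_span[OF b], of "path 0 0 w''" ?q] by (simp add: mult.assoc)
      finally show ?thesis using block_span_cong[OF block_span_base[OF 1(1) w' b]] Psi by simp
    next
      case 2
      then show ?thesis using zero Psi by simp
    next
      case 3
      have "psi k * (?p * b * ?q) \<approx> ?p * pe * (b * ?q)"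
        using cong_trans[OF eb cong_rmult[OF 3(2)]] .
      then have "psi k * (?p * b * ?q) \<approx> ?p * (pe * b) * ?q" by (simp add: mult.assoc)
      then show ?thesis
        using block_span_cong[OF block_span_base[OF w w' corner_span_pe_mult[OF 3(1) b]]] Psi by simp
    qed
  qed
qed

lemma block_span_lmult: "a \<in> block_span \<Longrightarrow> x * a \<in> block_span"
proof (induction x arbitrary: a rule: free_algebra_induct)
  case (scalar c)
  then show ?case
  proof (induction rule: block_span.induct)
    case (step a w w' b a')
    have "scalar c * a' \<approx> scalar c * a + path 0 0 w * (scalar c * b) * path_rev 0 0 w'"
      using cong_lmult[OF step.hyps(5), of "scalar c"]
      by (simp add: distrib_left scalar_left_commute mult.assoc)
    then show ?case
      using block_span.step[OF step.IH step.hyps(2,3) corner_span_scalar[OF step.hyps(4)]] by blast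
  qed (simp add: block_span.zero)
next
  case (gen g)
  then show ?case
  proof (induction rule: block_span.induct)
    case (step a w w' b a')
    have "gen g * a' \<approx> gen g * (path 0 0 w * b * path_rev 0 0 w') + gen g * a"
      using cong_lmult[OF step.hyps(5), of "gen g"] by (simp add: distrib_left add.commute)
    then show ?case
      by (rule block_span_cong[rotated]) (intro block_span_add step.IH block_span_gen step.hyps)
  qed (simp add: block_span.zero)
next
  case (add x y)
  then show ?case by (simp add: distrib_right block_span_add)
next
  case (mult x y)
  then show ?case by (simp add: mult.assoc)
qed

text \<open>
  Each path is part of a link, so the summands are the tableau idempotents.
\<close>

lemma path_partition: "(\<Sum>w\<in>words. path 0 0 w * e0 * path_rev 0 0 w) \<approx> 1"
proof -
  have "path 0 0 w * e0 * path_rev 0 0 w \<approx> idem (res w)" if w: "w \<in> words" for w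
  proof -
    have lk: "path_rev 0 0 w * idem (res w) \<approx> e0 * path_rev 0 0 w" "path 0 0 w * (path_rev 0 0 w * idem (res w)) \<approx> idem (res w)"
      using link_word[OF w] unfolding link_def by blast+
    have "path 0 0 w * e0 * path_rev 0 0 w \<approx> path 0 0 w * (path_rev 0 0 w * idem (res w))"
      using cong_lmult[OF cong_sym[OF lk(1)], of "path 0 0 w"] by (simp add: mult.assoc)
    then show ?thesis using lk(2) cong_trans by blast
  qed
  then have "(\<Sum>w\<in>words. path 0 0 w * e0 * path_rev 0 0 w) \<approx> (\<Sum>w\<in>words. idem (res w))"
    by (rule cong_sum)
  then show ?thesis by (rule cong_trans[OF _ words_partition])
qed

text \<open>
  The span is a left ideal and contains 1.
\<close>

lemma block_span_all: "a \<in> block_span"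
proof -
  have "(\<Sum>w\<in>words. path 0 0 w * e0 * path_rev 0 0 w) \<in> block_span"
    by (intro block_span_sum block_span_base corner_span_e0)
  then have "1 \<in> block_span" using block_span_cong cong_sym[OF path_partition] by blast
  from block_span_lmult[OF this, of a] show ?thesis by simp
qed

lemma path_rev_path:
  assumes w: "w \<in> words" and w': "w' \<in> words"
  shows "e0 * path_rev 0 0 w * (path 0 0 w' * e0) \<approx> (if w = w' then e0 else 0)"
proof -
  have lk: "path_rev 0 0 w * idem (res w) \<approx> e0 * path_rev 0 0 w" "path_rev 0 0 w * (path 0 0 w * e0) \<approx> e0"
    using link_word[OF w] unfolding link_def by blast+
  have "e0 * path_rev 0 0 w * (path 0 0 w' * e0) \<approx> path_rev 0 0 w * idem (res w) * (idem (res w') * (path 0 0 w' * e0))"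
    by (intro cong_mult cong_sym[OF lk(1)] cong_sym[OF idem_path[OF w']])
  also have "\<dots> = path_rev 0 0 w * (idem (res w) * idem (res w')) * (path 0 0 w' * e0)" by (simp add: mult.assoc)
  also have "\<dots> \<approx> path_rev 0 0 w * (if res w = res w' then idem (res w) else 0) * (path 0 0 w' * e0)"
    by (rule cong_mid[OF idem_mult])
  also have "\<dots> \<approx> (if w = w' then e0 else 0)"
  proof (cases "w = w'")
    case True
    have "path_rev 0 0 w * idem (res w) * (path 0 0 w * e0) \<approx> path_rev 0 0 w * (path 0 0 w * e0)"
      using cong_lmult[OF idem_path[OF w], of "path_rev 0 0 w"] by (simp add: mult.assoc)
    also have "\<dots> \<approx> e0" by (rule lk(2))
    finally show ?thesis using True by simp
  next
    case False
    then show ?thesis using res_inj[OF w w'] by auto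
  qed
  finally show ?thesis .
qed

text \<open>
  Of a product of two paths around a corner element only the trivial paths survive between two copies of
  the reference idempotent.
\<close>

lemma corner_in_span: "e0 * a * e0 \<in> corner_span"
  using block_span_all[of a]
proof induction
  case zero
  show ?case by (simp add: corner_span_zero)
next
  case (step a w w' b a')
  have sw: "e0 * path 0 0 w * e0 \<approx> (if w0 = w then e0 else 0)"
    using path_rev_path[OF w0_words step.hyps(2)] by (simp add: path_rev_two_block mult.assoc)
  have sw': "e0 * path_rev 0 0 w' * e0 \<approx> (if w' = w0 then e0 else 0)"
    using path_rev_path[OF step.hyps(3) w0_words] by (simp add: path_two_block)
  have sum: "e0 * a' * e0 \<approx> e0 * a * e0 + e0 * (path 0 0 w * b * path_rev 0 0 w') * e0"
    using cong_mid[OF step.hyps(5), of e0 e0] by (simp add: distrib_left distrib_right)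
  have "e0 * (path 0 0 w * b * path_rev 0 0 w') * e0 \<in> corner_span"
  proof -
    have "e0 * (path 0 0 w * b * path_rev 0 0 w') * e0 \<approx> e0 * path 0 0 w * (e0 * b * e0) * path_rev 0 0 w' * e0"
      using cong_mid[OF cong_sym[OF cong_trans[OF cong_rmult[OF e0_corner_span] corner_span_e0_right]],
          OF step.hyps(4,4), of "e0 * path 0 0 w" "path_rev 0 0 w' * e0"] by (simp add: mult.assoc)
    also have "\<dots> = e0 * path 0 0 w * e0 * b * (e0 * path_rev 0 0 w' * e0)" by (simp add: mult.assoc)
    also have "\<dots> \<approx> (if w0 = w then e0 else 0) * b * (if w' = w0 then e0 else 0)"
      by (intro cong_mult sw sw' cong_refl)
    also have "\<dots> \<approx> (if w0 = w \<and> w' = w0 then b else 0)"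
      using cong_trans[OF cong_rmult[OF e0_corner_span[OF step.hyps(4)]] corner_span_e0_right[OF step.hyps(4)]] by auto
    finally have c: "e0 * (path 0 0 w * b * path_rev 0 0 w') * e0 \<approx> (if w0 = w \<and> w' = w0 then b else 0)" .
    have "(if w0 = w \<and> w' = w0 then b else 0) \<in> corner_span"
      using step.hyps(4) corner_span_zero by (simp only: split: if_split) blast
    from corner_span_cong[OF this c] show ?thesis .
  qed
  from corner_span_cong[OF corner_span_add[OF step.IH this] sum] show ?case .
qed

end

section \<open>Standard tableaux of two-row shape as ballot words\<close>

lemma count_list_take_card:
  "k \<le> length w \<Longrightarrow> count_list (take k w) x = card {j \<in> {1..k}. w ! (j - 1) = x}"
proof (induction k)
  case (Suc k)
  have "{j \<in> {1..Suc k}. w ! (j - 1) = x} =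
      (if w ! k = x then insert (Suc k) {j \<in> {1..k}. w ! (j - 1) = x} else {j \<in> {1..k}. w ! (j - 1) = x})"
    by (auto simp: le_Suc_eq)
  then show ?case using Suc by (simp add: take_Suc_conv_app_nth count_list_append)
qed simp

lemma take_snoc: "1 \<le> k \<Longrightarrow> k \<le> length w \<Longrightarrow> take k w = take (k - 1) w @ [w ! (k - 1)]"
  by (cases k) (simp_all add: take_Suc_conv_app_nth)

lemma ballot_iff: "ballot 0 0 w \<longleftrightarrow> (\<forall>k<length w. w ! k \<longrightarrow> Suc (len2 (take k w)) < len1 (take k w))"
proof (induction w rule: rev_induct)
  case (snoc x w)
  have "ballot 0 0 (w @ [x]) \<longleftrightarrow> ballot 0 0 w \<and> (x \<longrightarrow> Suc (len2 w) < len1 w)"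
    by (cases x) (simp_all add: ballot_append)
  also have "\<dots> \<longleftrightarrow> (\<forall>k<length (w @ [x]). (w @ [x]) ! k \<longrightarrow>
      Suc (len2 (take k (w @ [x]))) < len1 (take k (w @ [x])))"
    unfolding snoc by (auto simp: less_Suc_eq nth_append)
  finally show ?case .
qed simp

lemma nth_residues:
  "k < length w \<Longrightarrow> residues l 0 0 w ! k = (if w ! k then len2 (take k w) else row1_res l (len1 (take k w)))"
proof -
  assume k: "k < length w"
  have "residues l 0 0 w = residues l 0 0 (take k w @ w ! k # drop (Suc k) w)"
    using k by (simp flip: id_take_nth_drop)
  then show ?thesis using k by (cases "w ! k") (simp_all add: residues_append nth_append)
qed

definition word_box :: "bool list \<Rightarrow> nat \<Rightarrow> nat \<times> nat"
  where "word_box w k = (if w ! (k - 1) then (2, Suc (len2 (take k w))) else (1, len1 (take k w)))"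

text \<open>
  Fillings are zero outside the diagram.
\<close>

definition word_tableau :: "bool list \<Rightarrow> tableau"
  where "word_tableau w c = (if c \<in> word_box w ` {1..length w} then inv_into {1..length w} (word_box w) c else 0)"

lemma word_box_append: "word_box (u @ x # s) (Suc (length u)) = (if x then (2, len2 u + 2) else (1, Suc (len1 u)))"
  by (simp add: word_box_def nth_append count_list_append)

locale two_row_shape =
  fixes l i :: nat
  assumes i_le: "i \<le> l"
begin

abbreviation "A \<equiv> 2 * l + 1 - i"
abbreviation "N \<equiv> 2 * l + 1"
abbreviation "\<mu> \<equiv> two_row l i"

lemma diagram: "shifted_diagram \<mu> = Pair 1 ` {1..A} \<union> Pair 2 ` {2..Suc i}"
  using i_le by (auto simp: shifted_diagram_def two_row_def coxeter_def nth_Cons' split: if_splits)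

lemma sum_shape: "sum_list \<mu> = N"
  using i_le by (auto simp: two_row_def coxeter_def)

context
  fixes w :: "bool list"
  assumes w: "len1 w = A" "len2 w = i"
begin

lemma length_w: "length w = N"
  using w i_le length_word[of w] by simp

lemma word_box_inj: "inj_on (word_box w) {1..N}"
proof -
  have False if jk: "j \<in> {1..N}" "k \<in> {1..N}" "j < k" "word_box w j = word_box w k" for j k
  proof -
    let ?x = "w ! (k - 1)"
    have x: "w ! (j - 1) = ?x" using jk(4) by (auto simp: word_box_def split: if_splits)
    have le: "j \<le> k - 1" "k - 1 < length w" using jk length_w by auto
    have "take k w = take (k - 1) w @ [?x]"
      using le(2) jk take_Suc_conv_app_nth[of "k - 1" w] by simp
    moreover have "take (k - 1) w = take j w @ take (k - 1 - j) (drop j w)"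
      using le(1) take_add[of j "k - 1 - j" w] by (simp only: le_add_diff_inverse)
    ultimately have "take k w = take j w @ take (k - 1 - j) (drop j w) @ [?x]" by simp
    then have lt: "count_list (take j w) ?x < count_list (take k w) ?x"
      by (simp only: count_list_append) simp
    show False
    proof (cases ?x)
      case True
      then have "len2 (take j w) = len2 (take k w)" using jk(4) x by (simp add: word_box_def)
      then show False using lt True by simp
    next
      case False
      then have "len1 (take j w) = len1 (take k w)" using jk(4) x by (simp add: word_box_def)
      then show False using lt False by simp
    qed
  qed
  from this show ?thesis by (intro inj_onI) (metis linorder_neqE_nat)
qed

lemma word_box_image: "word_box w ` {1..N} = shifted_diagram \<mu>"
proof (rule card_seteq)
  show "finite (shifted_diagram \<mu>)" by (simp add: diagram)
  have "card (shifted_diagram \<mu>) = A + i"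
    unfolding diagram by (subst card_Un_disjoint) (auto simp: card_image inj_on_def)
  then show "card (shifted_diagram \<mu>) \<le> card (word_box w ` {1..N})"
    using i_le card_image[OF word_box_inj] by simp
  show "word_box w ` {1..N} \<subseteq> shifted_diagram \<mu>"
  proof (rule image_subsetI)
    fix k assume k: "k \<in> {1..N}"
    then have kw: "k - 1 < length w" "take k w = take (k - 1) w @ [w ! (k - 1)]"
      using length_w take_Suc_conv_app_nth[of "k - 1" w] by auto
    have "count_list w x = count_list (take k w) x + count_list (drop k w) x" for x
      by (metis append_take_drop_id count_list_append)
    then have "len1 (take k w) \<le> A" "len2 (take k w) \<le> i" using w by (metis le_add1)+
    moreover have "w ! (k - 1) \<Longrightarrow> 1 \<le> len2 (take k w)" "\<not> w ! (k - 1) \<Longrightarrow> 1 \<le> len1 (take k w)"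
      unfolding kw(2) by (simp_all add: count_list_append)
    ultimately show "word_box w k \<in> shifted_diagram \<mu>"
      by (auto simp: diagram word_box_def)
  qed
qed

lemma word_tableau_box: "k \<in> {1..N} \<Longrightarrow> word_tableau w (word_box w k) = k"
  using word_box_inj by (simp add: word_tableau_def length_w)

lemma word_tableau_outside: "c \<notin> shifted_diagram \<mu> \<Longrightarrow> word_tableau w c = 0"
  using word_box_image by (simp add: word_tableau_def length_w)

lemma word_tableau_bij: "bij_betw (word_tableau w) (shifted_diagram \<mu>) {1..N}"
proof -
  have "bij_betw (inv_into {1..N} (word_box w)) (shifted_diagram \<mu>) {1..N}"
    using word_box_inj word_box_image by (intro bij_betw_inv_into) (simp add: bij_betw_def)
  then show ?thesis
    using word_box_image by (rule_tac bij_betw_cong[THEN iffD1, rotated]) (auto simp: word_tableau_def length_w)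
qed

lemma box_of_word_tableau: "k \<in> {1..N} \<Longrightarrow> box_of \<mu> (word_tableau w) k = word_box w k"
  unfolding box_of_def
  by (rule inv_into_f_eq)
    (use word_tableau_bij word_box_image word_tableau_box in \<open>auto simp: bij_betw_def\<close>)

lemma residue_seq_word_tableau: "residue_seq l \<mu> (word_tableau w) = residues l 0 0 w"
proof (rule nth_equalityI)
  show len: "length (residue_seq l \<mu> (word_tableau w)) = length (residues l 0 0 w)"
    unfolding residue_seq_def sum_shape by (simp add: length_w del: upt_Suc)
  fix k assume "k < length (residue_seq l \<mu> (word_tableau w))"
  then have k: "k < N" using len length_w by simp
  then have t: "take (Suc k) w = take k w @ [w ! k]" by (simp add: take_Suc_conv_app_nth length_w)
  have "word_box w (Suc k) \<in> shifted_diagram \<mu>" using word_box_image k by auto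
  then have d: "word_box w (Suc k) \<in> Pair 1 ` {1..A} \<union> Pair 2 ` {2..Suc i}" by (simp add: diagram)
  have "residue_seq l \<mu> (word_tableau w) ! k = box_residue l (word_box w (Suc k))"
    using k unfolding residue_seq_def sum_shape by (simp add: box_of_word_tableau del: upt_Suc)
  also have "\<dots> = residues l 0 0 w ! k"
    using d i_le k
    by (auto simp: nth_residues length_w word_box_def t count_list_append box_residue_def coxeter_def row1_res_def Let_def split: if_splits)
  finally show "residue_seq l \<mu> (word_tableau w) ! k = residues l 0 0 w ! k" .
qed

end

definition tableau_word :: "tableau \<Rightarrow> bool list"
  where "tableau_word T = map (\<lambda>k. fst (box_of \<mu> T k) = 2) [1..<Suc N]"

lemma length_tableau_word: "length (tableau_word T) = N"
  by (simp add: tableau_word_def del: upt_Suc)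

lemma nth_tableau_word: "k < N \<Longrightarrow> tableau_word T ! k \<longleftrightarrow> fst (box_of \<mu> T (Suc k)) = 2"
  by (simp add: tableau_word_def del: upt_Suc)

lemma tableau_word_tableau:
  assumes w: "len1 w = A" "len2 w = i"
  shows "tableau_word (word_tableau w) = w"
proof (rule nth_equalityI)
  show "length (tableau_word (word_tableau w)) = length w" by (simp add: length_tableau_word length_w[OF w])
  fix k assume "k < length (tableau_word (word_tableau w))"
  then have "k < N" by (simp add: length_tableau_word)
  then show "tableau_word (word_tableau w) ! k = w ! k"
    by (simp add: nth_tableau_word box_of_word_tableau[OF w] word_box_def)
qed

lemma word_tableau_standard:
  assumes "w \<in> ballot_words A i"
  shows "word_tableau w \<in> standard_tableaux \<mu>"
proof -
  have w: "len1 w = A" "len2 w = i" and ba: "ballot 0 0 w"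
    using assms by (simp_all add: ballot_words_def)
  note len = length_w[OF w]
  have count_mono: "count_list (take j w) x \<le> count_list (take k w) x" if "j \<le> k" for j k x
    using that by (metis count_list_append le_add1 le_add_diff_inverse take_add)
  have rowE: "\<exists>k\<in>{1..N}. word_box w k = c" if "c \<in> shifted_diagram \<mu>" for c
    using that word_box_image[OF w] by (metis imageE)
  have inc: "word_tableau w (a, b) < word_tableau w (a, b')"
    if D: "(a, b) \<in> shifted_diagram \<mu>" "(a, b') \<in> shifted_diagram \<mu>" "b < b'" for a b b'
  proof -
    obtain k k' where k: "k \<in> {1..N}" "word_box w k = (a, b)" "k' \<in> {1..N}" "word_box w k' = (a, b')"
      using rowE[OF D(1)] rowE[OF D(2)] by blast
    have "k < k'"
    proof (rule ccontr)
      assume "\<not> k < k'"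
      then have "k' \<le> k" by simp
      then show False
        using k(2,4) D(3) count_mono[of k' k True] count_mono[of k' k False]
        by (auto simp: word_box_def split: if_splits)
    qed
    then show ?thesis using word_tableau_box[OF w] k by metis
  qed
  have col: "word_tableau w (a, b) < word_tableau w (a', b)"
    if D: "(a, b) \<in> shifted_diagram \<mu>" "(a', b) \<in> shifted_diagram \<mu>" "a < a'" for a a' b
  proof -
    have a: "a = 1" "a' = 2" using D by (auto simp: diagram)
    obtain k k' where k: "k \<in> {1..N}" "word_box w k = (1, b)" "k' \<in> {1..N}" "word_box w k' = (2, b)"
      using rowE[OF D(1)] rowE[OF D(2)] a by blast
    have k': "k' - 1 < length w" "w ! (k' - 1)" "b = Suc (len2 (take k' w))"
      using k len by (auto simp: word_box_def split: if_splits)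
    have "take k' w = take (k' - 1) w @ [True]"
      using k'(2) k(3) len take_snoc[of k' w] by simp
    then have "b \<le> len1 (take (k' - 1) w)"
      using ba[unfolded ballot_iff] k' by (auto simp: count_list_append)
    moreover have "b = len1 (take k w)" "\<not> w ! (k - 1)" using k(2) by (auto simp: word_box_def split: if_splits)
    ultimately have "k \<noteq> k'" "\<not> k' < k"
    proof -
      show "k \<noteq> k'" using k by auto
      show "\<not> k' < k"
      proof
        assume "k' < k"
        have "take k w = take (k - 1) w @ [False]"
          using \<open>\<not> w ! (k - 1)\<close> k(1) len take_snoc[of k w] by simp
        then have "len1 (take (k - 1) w) < b" using \<open>b = len1 (take k w)\<close> by (simp add: count_list_append)
        moreover have "len1 (take (k' - 1) w) \<le> len1 (take (k - 1) w)" using \<open>k' < k\<close> by (intro count_mono) simp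
        ultimately show False using \<open>b \<le> len1 (take (k' - 1) w)\<close> by simp
      qed
    qed
    then show ?thesis using word_tableau_box[OF w] k a by (metis linorder_neqE_nat)
  qed
  show ?thesis
    unfolding standard_tableaux_def
    using word_tableau_bij[OF w] word_tableau_outside[OF w] inc col by (auto simp: sum_shape)
qed

text \<open>
  The rows of a standard tableau increase, so the number of entries up to \<open>k\<close> in a row is the length of an
  initial part of that row. The column condition then says that the word is a ballot word.
\<close>

lemma standard_tableau_word:
  assumes T: "T \<in> standard_tableaux \<mu>"
  shows "tableau_word T \<in> ballot_words A i" and "word_tableau (tableau_word T) = T"
proof -
  let ?D = "shifted_diagram \<mu>"
  let ?w = "tableau_word T"
  have bij: "bij_betw T ?D {1..N}" and out: "\<And>c. c \<notin> ?D \<Longrightarrow> T c = 0"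
    and row: "\<And>a b b'. (a, b) \<in> ?D \<Longrightarrow> (a, b') \<in> ?D \<Longrightarrow> b < b' \<Longrightarrow> T (a, b) < T (a, b')"
    and col: "\<And>a a' b. (a, b) \<in> ?D \<Longrightarrow> (a', b) \<in> ?D \<Longrightarrow> a < a' \<Longrightarrow> T (a, b) < T (a', b)"
    using T unfolding standard_tableaux_def sum_shape by blast+
  have len: "length ?w = N" by (rule length_tableau_word)
  have bT: "box_of \<mu> T k \<in> ?D" "T (box_of \<mu> T k) = k" if "k \<in> {1..N}" for k
    using bij that unfolding box_of_def bij_betw_def by (metis inv_into_into, metis f_inv_into_f)
  have Tb: "box_of \<mu> T (T c) = c" if "c \<in> ?D" for c
    using bij that unfolding box_of_def bij_betw_def by (metis inv_into_f_f)
  have Tr: "T c \<in> {1..N}" if "c \<in> ?D" for c using bij that by (auto simp: bij_betw_def)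
  have nth: "?w ! (k - 1) \<longleftrightarrow> fst (box_of \<mu> T k) = 2" if "k \<in> {1..N}" for k
    using that nth_tableau_word[of "k - 1" T] by (cases k) auto
  have row_le: "T (a, b') \<le> T (a, b) \<longleftrightarrow> b' \<le> b" if "(a, b) \<in> ?D" "(a, b') \<in> ?D" for a b b'
    using row[OF that] row[OF that(2,1)] by (metis leD le_less_linear linorder_less_linear order_less_imp_le order_refl)
  \<comment> \<open>the entries up to that of a box of a row occupy the boxes to its left\<close>
  have count1: "len1 (take k ?w) = card {c. (1, c) \<in> ?D \<and> T (1, c) \<le> k}"
    and count2: "len2 (take k ?w) = card {c. (2, c) \<in> ?D \<and> T (2, c) \<le> k}" if k: "k \<le> N" for k
  proof -
    have "{j \<in> {1..k}. ?w ! (j - 1) = x} = (\<lambda>c. T (r, c)) ` {c. (r, c) \<in> ?D \<and> T (r, c) \<le> k}"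
      if r: "r = (if x then 2 else 1)" for x r
    proof (intro equalityI subsetI)
      fix j assume j: "j \<in> {j \<in> {1..k}. ?w ! (j - 1) = x}"
      then have j': "j \<in> {1..N}" using k by auto
      obtain a c where ac: "box_of \<mu> T j = (a, c)" by (cases "box_of \<mu> T j")
      have "a = r" using bT(1)[OF j'] nth[OF j'] j ac r by (auto simp: diagram)
      then show "j \<in> (\<lambda>c. T (r, c)) ` {c. (r, c) \<in> ?D \<and> T (r, c) \<le> k}"
        using bT[OF j'] ac j by (auto intro!: image_eqI[of _ _ c])
    next
      fix j assume "j \<in> (\<lambda>c. T (r, c)) ` {c. (r, c) \<in> ?D \<and> T (r, c) \<le> k}"
      then obtain c where c: "(r, c) \<in> ?D" "T (r, c) \<le> k" "j = T (r, c)" by auto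
      then show "j \<in> {j \<in> {1..k}. ?w ! (j - 1) = x}"
        using Tr[OF c(1)] nth[OF Tr[OF c(1)]] Tb[OF c(1)] r by auto
    qed
    moreover have "inj_on (\<lambda>c. T (r, c)) {c. (r, c) \<in> ?D \<and> T (r, c) \<le> k}" for r
      using Tb by (intro inj_onI) (metis (mono_tags, lifting) mem_Collect_eq snd_conv)
    ultimately have "card {j \<in> {1..k}. ?w ! (j - 1) = x} = card {c. (r, c) \<in> ?D \<and> T (r, c) \<le> k}"
      if r: "r = (if x then 2 else 1)" for x r using r by (simp add: card_image)
    from this[of 1 False] this[of 2 True]
    show "len1 (take k ?w) = card {c. (1, c) \<in> ?D \<and> T (1, c) \<le> k}"
      "len2 (take k ?w) = card {c. (2, c) \<in> ?D \<and> T (2, c) \<le> k}"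
      using k len by (simp_all add: count_list_take_card)
  qed
  have c1: "len1 (take (T (1, b)) ?w) = b" if "(1, b) \<in> ?D" for b
  proof -
    have "{c. (1, c) \<in> ?D \<and> T (1, c) \<le> T (1, b)} = {1..b}"
      using that row_le[OF that] by (auto simp: diagram)
    then show ?thesis using count1 Tr[OF that] by simp
  qed
  have c2: "len2 (take (T (2, b)) ?w) = b - 1" if "(2, b) \<in> ?D" for b
  proof -
    have "{c. (2, c) \<in> ?D \<and> T (2, c) \<le> T (2, b)} = {2..b}"
      using that row_le[OF that] by (auto simp: diagram)
    then show ?thesis using count2 Tr[OF that] by simp
  qed
  have box: "word_box ?w k = box_of \<mu> T k" if k: "k \<in> {1..N}" for k
  proof -
    obtain a c where ac: "box_of \<mu> T k = (a, c)" by (cases "box_of \<mu> T k")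
    have D: "(a, c) \<in> ?D" and Tk: "T (a, c) = k" using bT[OF k] ac by simp_all
    then have "a = 1 \<or> a = 2 \<and> 2 \<le> c" by (auto simp: diagram)
    then show ?thesis using nth[OF k] ac D Tk c1[of c] c2[of c] by (auto simp: word_box_def)
  qed
  have "len1 ?w = card {c. (1, c) \<in> ?D \<and> T (1, c) \<le> N}" "len2 ?w = card {c. (2, c) \<in> ?D \<and> T (2, c) \<le> N}"
    using count1[of N] count2[of N] len by simp_all
  moreover have "{c. (1, c) \<in> ?D \<and> T (1, c) \<le> N} = {1..A}" "{c. (2, c) \<in> ?D \<and> T (2, c) \<le> N} = {2..Suc i}"
    using Tr by (auto simp: diagram)
  ultimately have w: "len1 ?w = A" "len2 ?w = i" by simp_all
  have "ballot 0 0 ?w"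
    unfolding ballot_iff
  proof (intro allI impI)
    fix k assume k: "k < length ?w" "?w ! k"
    then have k': "Suc k \<in> {1..N}" using len by simp
    obtain c where c: "box_of \<mu> T (Suc k) = (2, c)"
      using nth[OF k'] k(2) by (cases "box_of \<mu> T (Suc k)") simp
    have D: "(2, c) \<in> ?D" "T (2, c) = Suc k" using bT[OF k'] c by simp_all
    then have D1: "(1, c) \<in> ?D" "2 \<le> c" using i_le by (auto simp: diagram)
    have "T (1, c) \<le> k" using col[OF D1(1) D(1)] D(2) by simp
    have "len1 (take (T (1, c)) ?w) \<le> len1 (take k ?w)"
      using \<open>T (1, c) \<le> k\<close> by (metis count_list_append le_add1 le_add_diff_inverse take_add)
    moreover have "len2 (take (Suc k) ?w) = c - 1" using c2[OF D(1)] D(2) by simp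
    moreover have "take (Suc k) ?w = take k ?w @ [True]" using k by (simp add: take_Suc_conv_app_nth)
    ultimately show "Suc (len2 (take k ?w)) < len1 (take k ?w)"
      using c1[OF D1(1)] D1(2) by (simp add: count_list_append)
  qed
  then show "?w \<in> ballot_words A i" using w by (simp add: ballot_words_def)
  show "word_tableau ?w = T"
  proof
    fix c show "word_tableau ?w c = T c"
    proof (cases "c \<in> ?D")
      case True
      have "word_tableau ?w (word_box ?w (T c)) = T c" by (rule word_tableau_box[OF w Tr[OF True]])
      then show ?thesis using box[OF Tr[OF True]] Tb[OF True] by simp
    qed (simp add: out word_tableau_outside[OF w])
  qed
qed

lemma standard_tableaux_eq: "standard_tableaux \<mu> = word_tableau ` ballot_words A i"
  using word_tableau_standard standard_tableau_word by (auto simp: image_iff) metis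

lemma word_tableau_inj: "inj_on word_tableau (ballot_words A i)"
  by (rule inj_on_inverseI[of _ tableau_word]) (simp add: tableau_word_tableau ballot_words_def)

lemma word_tableau_standard_iff:
  "len1 w = A \<Longrightarrow> len2 w = i \<Longrightarrow> word_tableau w \<in> standard_tableaux \<mu> \<longleftrightarrow> w \<in> ballot_words A i"
  using word_tableau_standard standard_tableau_word(1)[of "word_tableau w"] tableau_word_tableau[of w] by auto

lemma swap_word_tableau:
  assumes w: "len1 (u @ x # y # s) = A" "len2 (u @ x # y # s) = i" and k: "k = Suc (length u)"
    and xy: "x \<noteq> y"
  shows "swap_tableau k (word_tableau (u @ x # y # s)) = word_tableau (u @ y # x # s)"
proof
  let ?w = "u @ x # y # s" and ?w' = "u @ y # x # s" and ?t = "Transposition.transpose k (k + 1)"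
  have w': "len1 ?w' = A" "len2 ?w' = i" using w by (simp_all add: count_list_append add.left_commute split: if_splits)
  have kN: "k \<in> {1..N}" "Suc k \<in> {1..N}" using length_w[OF w] k by auto
  have tN: "j \<in> {1..N} \<Longrightarrow> ?t j \<in> {1..N}" for j using kN by (auto simp: Transposition.transpose_def)
  have box: "word_box ?w' (?t j) = word_box ?w j" if j: "j \<in> {1..N}" for j
  proof -
    consider "j < k" | "j = k" | "j = Suc k" | "Suc k < j" by linarith
    then show ?thesis
    proof cases
      case 1
      then have "take j ?w = take j u" "take j ?w' = take j u" "?w ! (j - 1) = u ! (j - 1)" "?w' ! (j - 1) = u ! (j - 1)"
        using k j by (auto simp: nth_append)
      then show ?thesis using 1 by (simp add: word_box_def Transposition.transpose_def)
    next
      case 2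
      then show ?thesis using k xy by (cases x; cases y) (simp_all add: word_box_def nth_append count_list_append)
    next
      case 3
      then show ?thesis using k xy by (cases x; cases y) (simp_all add: word_box_def nth_append count_list_append)
    next
      case 4
      then obtain m where m: "j = Suc (Suc (Suc (length u + m)))" using k by (metis Suc_leI le_Suc_ex add_Suc)
      have "?t j = j" using 4 by (simp add: Transposition.transpose_def)
      moreover have "word_box ?w' j = word_box ?w j"
        using xy unfolding m by (cases x; cases y) (simp_all add: word_box_def nth_append count_list_append numeral_3_eq_3)
      ultimately show ?thesis by simp
    qed
  qed
  fix c show "swap_tableau k (word_tableau ?w) c = word_tableau ?w' c"
  proof (cases "c \<in> shifted_diagram \<mu>")
    case True
    then obtain j where j: "j \<in> {1..N}" "c = word_box ?w j" using word_box_image[OF w] by (metis imageE)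
    have "word_tableau ?w' c = ?t j"
      using word_tableau_box[OF w' tN[OF j(1)]] box[OF j(1)] j(2) by simp
    then show ?thesis using word_tableau_box[OF w j(1)] j(2) by (simp add: swap_tableau_def)
  next
    case False
    then show ?thesis
      using word_tableau_outside[OF w] word_tableau_outside[OF w'] k
      by (simp add: swap_tableau_def Transposition.transpose_def)
  qed
qed

text \<open>
  Consecutive numbers in the same row are adjacent there and cannot be exchanged.
\<close>

lemma swap_row_not_standard:
  assumes w: "len1 (u @ x # x # s) = A" "len2 (u @ x # x # s) = i" and k: "k = Suc (length u)"
  shows "swap_tableau k (word_tableau (u @ x # x # s)) \<notin> standard_tableaux \<mu>"
proof
  let ?w = "u @ x # x # s"
  assume st: "swap_tableau k (word_tableau ?w) \<in> standard_tableaux \<mu>"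
  have kN: "k \<in> {1..N}" "Suc k \<in> {1..N}" using length_w[OF w] k by auto
  obtain a b where ab: "word_box ?w k = (a, b)" "word_box ?w (Suc k) = (a, Suc b)"
    using k by (cases x) (simp_all add: word_box_def nth_append count_list_append)
  have D: "(a, b) \<in> shifted_diagram \<mu>" "(a, Suc b) \<in> shifted_diagram \<mu>"
    using ab word_box_image[OF w] kN by (metis imageI)+
  have "swap_tableau k (word_tableau ?w) (a, b) < swap_tableau k (word_tableau ?w) (a, Suc b)"
    using st D lessI[of b] unfolding standard_tableaux_def by blast
  moreover have "word_tableau ?w (a, b) = k" "word_tableau ?w (a, Suc b) = Suc k"
    using ab word_tableau_box[OF w] kN by metis+
  ultimately show False by (simp add: swap_tableau_def)
qed

end

lemma ballot_words_snoc: "w @ [x] \<in> ballot_words a b \<longleftrightarrow>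
    (if x then \<exists>b'. b = Suc b' \<and> Suc b' < a \<and> w \<in> ballot_words a b'
     else \<exists>a'. a = Suc a' \<and> w \<in> ballot_words a' b)"
  by (auto simp: ballot_words_def ballot_append count_list_append)

text \<open>
  Removing the last letter gives the recursion of a difference of binomial coefficients; it is the
  reflection principle.
\<close>

lemma card_ballot_words:
  "b < a \<Longrightarrow> int (card (ballot_words a b)) =
    int ((a + b - 1) choose b) - (if b = 0 then 0 else int ((a + b - 1) choose (b - 1)))"
proof (induction "a + b" arbitrary: a b rule: less_induct)
  case less
  have snocE: "ballot_words a b = {v @ [y] | v y. v @ [y] \<in> ballot_words a b}"
  proof -
    have "w \<in> ballot_words a b \<Longrightarrow> \<exists>v x. w = v @ [x]" for w
      using less.prems by (cases w rule: rev_cases) (auto simp: ballot_words_def)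
    then show ?thesis by blast
  qed
  obtain a' where a: "a = Suc a'" using less.prems by (cases a) auto
  have IH: "b' < m \<Longrightarrow> m + b' < a + b \<Longrightarrow> int (card (ballot_words m b')) =
    int ((m + b' - 1) choose b') - (if b' = 0 then 0 else int ((m + b' - 1) choose (b' - 1)))" for m b'
    using less.hyps by blast
  show ?case
  proof (cases b)
    case 0
    have "ballot_words a 0 = (\<lambda>w. w @ [False]) ` ballot_words a' 0"
      by (subst snocE[unfolded 0]) (auto simp: ballot_words_snoc a split: if_splits)
    then have "card (ballot_words a 0) = card (ballot_words a' 0)" by (simp add: card_image inj_on_def)
    moreover have "ballot_words 0 0 = {[]}"
      by (auto simp: ballot_words_def) (metis add.right_neutral length_0_conv length_word)
    ultimately show ?thesis using IH[of 0 a'] 0 a by (cases a') auto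
  next
    case (Suc b')
    have eq: "ballot_words a b = (\<lambda>w. w @ [False]) ` ballot_words a' b \<union>
        (\<lambda>w. w @ [True]) ` ballot_words a b'"
      by (subst snocE) (use less.prems in \<open>auto simp: ballot_words_snoc a Suc split: if_splits\<close>)
    have card: "card (ballot_words a b) = card (ballot_words a' b) + card (ballot_words a b')"
      unfolding eq by (subst card_Un_disjoint) (auto simp: finite_ballot_words card_image inj_on_def)
    have c2: "int (card (ballot_words a b')) = int ((a' + b') choose b') - (if b' = 0 then 0 else int ((a' + b') choose (b' - 1)))"
      using IH[of b' a] less.prems a Suc by simp
    have c1: "int (card (ballot_words a' b)) = int ((a' + b') choose b) - int ((a' + b') choose b')"
    proof (cases "b < a'")
      case True
      then show ?thesis using IH[of b a'] a Suc by simp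
    next
      case False
      then have ab: "a' = b" using less.prems a by simp
      have "ballot_words a' b = {}"
        using ballot_state0 ab Suc by (fastforce simp: ballot_words_def)
      moreover have "(a' + b') choose b = (a' + b') choose b'"
        using binomial_symmetric[of b "a' + b'"] ab Suc by simp
      ultimately show ?thesis by simp
    qed
    have "(a' + b) choose b = ((a' + b') choose b) + ((a' + b') choose b')" using Suc by simp
    moreover have "(a' + b) choose b' = ((a' + b') choose b') + (if b' = 0 then 0 else (a' + b') choose (b' - 1))"
      using Suc by (cases b') simp_all
    ultimately show ?thesis using card c1 c2 a Suc by simp
  qed
qed

section \<open>Operators of the free algebra on sums of tableaux\<close>

lemma tensor_zero: "tensor 0 T = (\<lambda>_. 0)"
  by (simp add: tensor_def)

lemma tensor_add: "tensor (v + v') T S = tensor v T S + tensor v' T S"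
  by (simp add: tensor_def)

lemma tensor_scale: "tensor (c *s v) T S = c *s tensor v T S"
  by (simp add: tensor_def)

lemma gen_action_add: "gen_action l i g (v + v') T S = gen_action l i g v T S + gen_action l i g v' T S"
  by (cases g) (simp_all add: tensor_add matrix_vector_right_distrib)

lemma gen_action_scale: "gen_action l i g (c *s (v :: 'k::field^2)) T S = c *s gen_action l i g v T S"
  by (cases g) (simp_all add: tensor_scale vector_scalar_commute)

lemma gen_action_zero: "gen_action l i g (0 :: 'k::field^2) T S = 0"
  using gen_action_scale[of l i g 0 0 T S] by (simp add: vec_eq_iff)

lemma gen_operator_add: "gen_operator l i g (\<lambda>S. f S + h S) = (\<lambda>S. gen_operator l i g f S + gen_operator l i g h S)"
  by (simp add: gen_operator_def gen_action_add sum.distrib)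

lemma gen_operator_scale: "gen_operator l i g (\<lambda>S. (c :: 'k::field) *s f S) = (\<lambda>S. c *s gen_operator l i g f S)"
  by (simp add: gen_operator_def gen_action_scale vec.scale_sum_right)

lemma foldr_gen_operator_add: "foldr (gen_operator l i) gs (\<lambda>S. f S + h S) =
    (\<lambda>S. foldr (gen_operator l i) gs f S + foldr (gen_operator l i) gs h S)"
  by (induction gs) (simp_all add: gen_operator_add)

lemma foldr_gen_operator_scale: "foldr (gen_operator l i) gs (\<lambda>S. (c :: 'k::field) *s f S) =
    (\<lambda>S. c *s foldr (gen_operator l i) gs f S)"
  by (induction gs) (simp_all add: gen_operator_scale)

lemma free_operator_superset:
  assumes "finite W" "Poly_Mapping.keys a \<subseteq> W"
  shows "free_operator l i a f S = (\<Sum>w\<in>W. Poly_Mapping.lookup a w *s foldr (gen_operator l i) (letters w) f S)"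
  unfolding free_operator_def
  using assms by (intro sum.mono_neutral_left) (auto simp: in_keys_iff)

lemma free_operator_plus: "free_operator l i (a + b) (f :: 'k::field tabsum) = (\<lambda>S. free_operator l i a f S + free_operator l i b f S)"
proof
  fix S
  let ?W = "Poly_Mapping.keys a \<union> Poly_Mapping.keys b"
  show "free_operator l i (a + b) f S = free_operator l i a f S + free_operator l i b f S"
    using free_operator_superset[of ?W a l i f S] free_operator_superset[of ?W b l i f S]
      free_operator_superset[of ?W "a + b" l i f S] Poly_Mapping.keys_add[of a b]
    by (simp add: lookup_add vec.scale_left_distrib sum.distrib)
qed

lemma free_operator_single: "free_operator l i (Poly_Mapping.single w c) f =
    (\<lambda>S. c *s foldr (gen_operator l i) (letters w) f S)"
  using free_operator_superset[of "{w}" "Poly_Mapping.single w c" l i f] by auto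

lemma free_operator_0: "free_operator l i 0 f = (\<lambda>_. 0)"
  by (simp add: free_operator_def)

lemma free_operator_linear_add: "free_operator l i a (\<lambda>S. (f :: 'k::field tabsum) S + h S) =
    (\<lambda>S. free_operator l i a f S + free_operator l i a h S)"
  by (simp add: free_operator_def foldr_gen_operator_add vec.scale_right_distrib sum.distrib)

lemma free_operator_linear_scale: "free_operator l i a (\<lambda>S. (c :: 'k::field) *s f S) = (\<lambda>S. c *s free_operator l i a f S)"
  by (simp add: free_operator_def foldr_gen_operator_scale vec.scale_sum_right mult.commute)

lemma free_operator_zero: "free_operator l i (a :: 'k::field klr_free) (\<lambda>_. 0) = (\<lambda>_. 0)"
  using free_operator_linear_scale[of l i a 0 "\<lambda>_. 0"] by simp

lemma free_operator_linear_sum: "free_operator l i (a :: 'k::field klr_free) (\<lambda>S. \<Sum>t\<in>I. f t S) = (\<lambda>S. \<Sum>t\<in>I. free_operator l i a (f t) S)"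
  by (induction I rule: infinite_finite_induct) (simp_all add: free_operator_zero free_operator_linear_add)

text \<open>
  The free algebra thus acts on all functions; only the relations need a computation.
\<close>

lemma free_operator_mult: "free_operator l i (a * b) (f :: 'k::field tabsum) = free_operator l i a (free_operator l i b f)"
proof (induction a rule: monomial_induct)
  case (monomial a u c)
  have "free_operator l i (Poly_Mapping.single u c * b) f = free_operator l i (Poly_Mapping.single u c) (free_operator l i b f)"
  proof (induction b rule: monomial_induct)
    case zero
    then show ?case by (simp add: free_operator_0 free_operator_zero)
  next
    case (monomial b v d)
    have "free_operator l i (Poly_Mapping.single u c * Poly_Mapping.single v d) f =
        free_operator l i (Poly_Mapping.single u c) (free_operator l i (Poly_Mapping.single v d) f)"
      by (simp add: mult_single free_operator_single plus_gword_def foldr_gen_operator_scale)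
    with monomial show ?case by (simp add: distrib_left free_operator_plus free_operator_linear_add)
  qed
  with monomial show ?case by (simp add: distrib_right free_operator_plus)
qed (simp add: free_operator_0)

lemma free_operator_scalar: "free_operator l i (scalar c) (f :: 'k::field tabsum) = (\<lambda>S. c *s f S)"
  by (simp add: scalar_def free_operator_single zero_gword_def)

lemma free_operator_one: "free_operator l i 1 (f :: 'k::field tabsum) = f"
  using free_operator_scalar[of l i 1 f] by (simp add: scalar_one)

lemma free_operator_gen: "free_operator l i (gen g) (f :: 'k::field tabsum) = gen_operator l i g f"
  by (simp add: gen_def free_operator_single)

lemma free_operator_uminus: "free_operator l i (- a) (f :: 'k::field tabsum) = (\<lambda>S. - free_operator l i a f S)"
proof -
  have "- a = scalar (- 1) * a" by (simp add: scalar_def single_uminus)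
  then show ?thesis by (simp only: free_operator_mult free_operator_scalar) simp
qed

lemma free_operator_minus: "free_operator l i (a - b) (f :: 'k::field tabsum) = (\<lambda>S. free_operator l i a f S - free_operator l i b f S)"
  using free_operator_plus[of l i a "- b" f] by (simp add: free_operator_uminus)

lemma free_operator_sum: "free_operator l i (sum F I) (f :: 'k::field tabsum) = (\<lambda>S. \<Sum>t\<in>I. free_operator l i (F t) f S)"
  by (induction I rule: infinite_finite_induct) (simp_all add: free_operator_0 free_operator_plus)

lemmas free_operator_simps = free_operator_plus free_operator_minus free_operator_uminus free_operator_mult
  free_operator_zero free_operator_0 free_operator_one

lemma vec2_eq_iff: "(x :: 'k^2) = y \<longleftrightarrow> x $ 1 = y $ 1 \<and> x $ 2 = y $ 2"
  by (simp add: vec_eq_iff forall_2)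

lemma xi_mult_vec [simp]:
  "(xi1 *v v) $ 1 = v $ 2" "(xi1 *v v) $ 2 = (0 :: 'k::comm_ring_1)"
  "(xi2 *v v) $ 1 = - (v $ 2)" "(xi2 *v v) $ 2 = 0"
  "(partial *v v) $ 1 = 0" "(partial *v v) $ 2 = - (v $ 1)"
  by (simp_all add: xi1_def xi2_def partial_def matrix_vector_mult_def sum_2 vector_2)

context klr_two_delta
begin

sublocale two_row_shape l i
  by unfold_locales (rule i_le)

abbreviation "opr \<equiv> free_operator l i :: 'k klr_free \<Rightarrow> 'k tabsum \<Rightarrow> 'k tabsum"
abbreviation "tw v w \<equiv> tensor v (word_tableau w) :: 'k tabsum"

definition dot :: "bool list \<Rightarrow> bool \<Rightarrow> 'k^2^2"
  where "dot u x = (if \<not> x \<and> len1 u = l then xi1 else if i < l \<and> \<not> x \<and> len1 u = Suc l then xi2 else 0)"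

lemma standard_words: "standard_tableaux \<mu> = word_tableau ` words"
  by (simp add: standard_tableaux_eq words_def)

lemma finite_words: "finite words"
  by (simp add: words_def finite_ballot_words)

lemma word_tableau_inj_words: "inj_on word_tableau words"
  using word_tableau_inj by (simp add: words_def)

lemma words_len: "w \<in> words \<Longrightarrow> len1 w = A" "w \<in> words \<Longrightarrow> len2 w = i"
  using wordsD by auto

lemma opr_gen: "w \<in> words \<Longrightarrow> opr (gen g) (tw v w) = gen_action l i g v (word_tableau w)"
proof
  fix S assume w: "w \<in> words"
  have "opr (gen g) (tw v w) S = (\<Sum>T\<in>standard_tableaux \<mu>. gen_action l i g (tw v w T) T S)"
    by (simp add: free_operator_gen gen_operator_def)
  also have "\<dots> = (\<Sum>T\<in>standard_tableaux \<mu>. if T = word_tableau w then gen_action l i g v (word_tableau w) S else 0)"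
    by (rule sum.cong) (auto simp: tensor_def gen_action_zero)
  also have "\<dots> = gen_action l i g v (word_tableau w) S"
    using w finite_words by (simp add: standard_words)
  finally show "opr (gen g) (tw v w) S = gen_action l i g v (word_tableau w) S" .
qed

lemma opr_idem: "w \<in> words \<Longrightarrow> opr (idem \<nu>) (tw v w) = (if \<nu> = res w then tw v w else (\<lambda>_. 0))"
  using residue_seq_word_tableau[OF words_len] by (simp add: opr_gen)

lemma opr_x:
  assumes w: "u @ x # s \<in> words" and k: "k = Suc (length u)"
  shows "opr (xx k) (tw v (u @ x # s)) = tw (dot u x *v v) (u @ x # s)"
proof -
  have "k \<in> {1..N}" using length_words[OF w] k by auto
  then have "box_of \<mu> (word_tableau (u @ x # s)) k = (if x then (2, len2 u + 2) else (1, Suc (len1 u)))"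
    using box_of_word_tableau[OF words_len[OF w]] k by (simp add: word_box_append)
  then show ?thesis using w by (simp add: opr_gen dot_def tensor_zero)
qed

lemma psi_boxes:
  assumes w: "u @ x # y # s \<in> words" and k: "k = Suc (length u)"
  shows "box_of \<mu> (word_tableau (u @ x # y # s)) k = (1, l + 1) \<and>
    box_of \<mu> (word_tableau (u @ x # y # s)) (k + 1) = (1, l + 2) \<longleftrightarrow> \<not> x \<and> \<not> y \<and> len1 u = l"
proof -
  have kN: "k \<in> {1..N}" "k + 1 \<in> {1..N}" using length_words[OF w] k by auto
  have "word_box (u @ x # y # s) k = (if x then (2, len2 u + 2) else (1, Suc (len1 u)))"
    "word_box (u @ x # y # s) (k + 1) = (if y then (2, len2 (u @ [x]) + 2) else (1, Suc (len1 (u @ [x]))))"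
    using k word_box_append[of u x "y # s"] word_box_append[of "u @ [x]" y s] by simp_all
  then show ?thesis
    using box_of_word_tableau[OF words_len[OF w]] kN by (auto simp: count_list_append)
qed

lemma swap_words: "u @ True # False # s \<in> words \<longleftrightarrow> u @ False # True # s \<in> words \<and> Suc (len2 u) < len1 u"
  by (auto simp: words_def ballot_words_def ballot_append count_list_append)

lemma opr_psi_swap:
  assumes w: "u @ x # y # s \<in> words" and k: "k = Suc (length u)" and "x \<noteq> y"
  shows "opr (psi k) (tw v (u @ x # y # s)) = (if u @ y # x # s \<in> words then tw v (u @ y # x # s) else (\<lambda>_. 0))"
proof -
  have sw: "swap_tableau k (word_tableau (u @ x # y # s)) = word_tableau (u @ y # x # s)"
    by (rule swap_word_tableau[OF words_len[OF w] k assms(3)])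
  have "len1 (u @ y # x # s) = A" "len2 (u @ y # x # s) = i"
    using words_len[OF w] by (simp_all add: count_list_append split: if_splits)
  then have "word_tableau (u @ y # x # s) \<in> standard_tableaux \<mu> \<longleftrightarrow> u @ y # x # s \<in> words"
    using word_tableau_standard_iff by (simp add: words_def)
  then have st: "word_tableau (u @ y # x # s) \<in> standard_tableaux \<mu> \<longleftrightarrow> u @ y # x # s \<in> words" .
  have c: "\<not> (i < l \<and> box_of \<mu> (word_tableau (u @ x # y # s)) k = (1, l + 1) \<and>
    box_of \<mu> (word_tableau (u @ x # y # s)) (k + 1) = (1, l + 2))"
    using psi_boxes[OF w k] assms(3) by blast
  show ?thesis by (simp only: opr_gen[OF w] gen_action.simps if_not_P[OF c] sw st)
qed

lemma opr_psi_same: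
  assumes w: "u @ x # x # s \<in> words" and k: "k = Suc (length u)"
  shows "opr (psi k) (tw v (u @ x # x # s)) =
    (if \<not> x \<and> len1 u = l \<and> i < l then tw (partial *v v) (u @ x # x # s) else (\<lambda>_. 0))"
  using psi_boxes[OF w k] swap_row_not_standard[OF words_len[OF w] k] w by (auto simp: opr_gen)

lemma opr_psi:
  assumes k: "k = Suc (length u)"
  shows "u @ False # True # s \<in> words \<Longrightarrow> opr (psi k) (tw v (u @ False # True # s)) =
      (if Suc (len2 u) < len1 u then tw v (u @ True # False # s) else (\<lambda>_. 0))"
    and "u @ True # False # s \<in> words \<Longrightarrow> opr (psi k) (tw v (u @ True # False # s)) = tw v (u @ False # True # s)"
    and "u @ True # True # s \<in> words \<Longrightarrow> opr (psi k) (tw v (u @ True # True # s)) = (\<lambda>_. 0)"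
    and "u @ False # False # s \<in> words \<Longrightarrow> opr (psi k) (tw v (u @ False # False # s)) =
      (if len1 u = l \<and> i < l then tw (partial *v v) (u @ False # False # s) else (\<lambda>_. 0))"
  using opr_psi_swap[OF _ k, of False True s v] opr_psi_swap[OF _ k, of True False s v] swap_words[of u s]
    opr_psi_same[OF _ k, of True s v] opr_psi_same[OF _ k, of False s v] by simp_all

lemma word_data:
  assumes "u @ v \<in> words"
  shows "len2 u < len1 u \<or> len1 u = 0 \<and> len2 u = 0" "len1 u + len1 v = A" "len2 u + len2 v = i"
    "ballot (len1 u) (len2 u) v"
  using wordsD[OF assms] ballot_state0[of u] by (simp_all add: ballot_append count_list_append)

lemma res_pair: "res (u @ x # y # s) = res u @ (if x then len2 u else row1_res l (len1 u)) #
    (if y then len2 u + (if x then 1 else 0) else row1_res l (len1 u + (if x then 0 else 1))) #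
    residues l (len1 (u @ [x, y])) (len2 (u @ [x, y])) s"
  by (cases x; cases y) (simp_all add: residues_append count_list_append)

text \<open>
  A crossing exchanges two distant letters, acts by \<open>partial\<close> on the two letters \<open>l\<close>, or kills the vector,
  and then the letters are neighbours. The relations are checked in these three cases.
\<close>

lemma psi_trichotomy:
  assumes w: "u @ x # y # s \<in> words" and k: "k = Suc (length u)"
    and c: "c = (if x then len2 u else row1_res l (len1 u))"
    and d: "d = (if y then len2 u + (if x then 1 else 0) else row1_res l (len1 u + (if x then 0 else 1)))"
  obtains (swap) "x \<noteq> y" "u @ y # x # s \<in> words" "far c d" "\<And>v. opr (psi k) (tw v (u @ x # y # s)) = tw v (u @ y # x # s)"
  | (double) "\<not> x" "\<not> y" "len1 u = l" "i < l" "c = l" "d = l"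
      "\<And>v. opr (psi k) (tw v (u @ x # y # s)) = tw (partial *v v) (u @ x # y # s)"
  | (kill) "d = Suc c \<or> c = Suc d" "\<And>v. opr (psi k) (tw v (u @ x # y # s)) = (\<lambda>_. 0)"
proof -
  note wd = word_data[OF w]
  consider "x \<noteq> y" "u @ y # x # s \<in> words" | "\<not> x" "y" "u @ y # x # s \<notin> words" | "x" "\<not> y" "u @ y # x # s \<notin> words"
    | "x" "y" | "\<not> x" "\<not> y" "len1 u = l" "i < l" | "\<not> x" "\<not> y" "\<not> (len1 u = l \<and> i < l)" by blast
  then show ?thesis
  proof cases
    case 1
    have sw: "Suc (len2 u) < len1 u" using 1 w swap_words[of u s] by (cases x; cases y) auto
    have "far c d" using 1 wd sw i_le unfolding c d far_def row1_res_def by (cases x; cases y) auto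
    then show ?thesis using swap[OF 1] opr_psi_swap[OF w k 1(1)] 1(2) by simp
  next
    case 2
    then have "\<not> Suc (len2 u) < len1 u" using w swap_words[of u s] by auto
    then have "d = Suc c \<or> c = Suc d" using 2 wd i_le unfolding c d row1_res_def by auto
    then show ?thesis using kill opr_psi_swap[OF w k] 2 by simp
  next
    case 3
    then show ?thesis using w swap_words[of u s] by auto
  next
    case 4
    then have "d = Suc c \<or> c = Suc d" unfolding c d by simp
    then show ?thesis using kill opr_psi(3)[OF k] 4 w by simp
  next
    case 5
    then show ?thesis using double opr_psi(4)[OF k] w unfolding c d by (simp add: row1_res_def)
  next
    case 6
    then have "len1 u \<noteq> l" using wd by auto
    then have "d = Suc c \<or> c = Suc d" using 6 wd i_le unfolding c d row1_res_def by auto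
    then show ?thesis using kill opr_psi(4)[OF k] 6 w by auto
  qed
qed

lemma dot_zero:
  assumes "u @ x # s \<in> words" "(if x then len2 u else row1_res l (len1 u)) \<noteq> l"
  shows "dot u x = 0"
  using assms(2) by (auto simp: dot_def row1_res_def split: if_splits)

lemma dot_dot: "dot u x *v (dot u' x' *v v) = 0"
  by (auto simp: dot_def vec2_eq_iff)

lemma opr_x_power_edge:
  assumes w: "u @ x # s \<in> words" and k: "k = Suc (length u)"
    and c: "c = (if x then len2 u else row1_res l (len1 u))"
  shows "opr (xx k ^ edge_exp l c d) (tw v (u @ x # s)) = (\<lambda>_. 0)"
proof (cases "c = l")
  case True
  then show ?thesis
    by (simp add: edge_exp_def power2_eq_square free_operator_mult opr_x[OF w k] dot_dot tensor_zero)
next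
  case False
  then have z: "opr (xx k) (tw v (u @ x # s)) = (\<lambda>_. 0)" for v
    using dot_zero[OF w] c by (simp add: opr_x[OF w k] tensor_zero)
  then have "opr (xx k ^ Suc m) (tw v (u @ x # s)) = (\<lambda>_. 0)" for m
    by (simp only: power_Suc2 free_operator_mult z free_operator_zero)
  moreover obtain m where "edge_exp l c d = Suc m" using edge_exp_pos[of c d] gr0_implies_Suc by blast
  ultimately show ?thesis by simp
qed

text \<open>
  The square of the crossing is zero on such a tableau, so the edge polynomial in the dots must kill the
  vector: dots are zero or of square zero, and a nonzero dot occurs only at the letter \<open>l\<close>, where the
  exponent is 2.
\<close>

lemma opr_eval2_edge:
  assumes w: "u @ x # y # s \<in> words" and k: "k = Suc (length u)"
    and c: "c = (if x then len2 u else row1_res l (len1 u))"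
    and d: "d = (if y then len2 u + (if x then 1 else 0) else row1_res l (len1 u + (if x then 0 else 1)))"
    and cd: "d = Suc c \<or> c = Suc d" "c \<le> l" "d \<le> l"
  shows "opr (eval2 scalar (Q c d) (xx k) (xx (Suc k))) (tw v (u @ x # y # s)) = (\<lambda>_. 0)"
proof -
  obtain \<gamma> \<delta> where ev: "eval2 scalar (Q c d) (xx k) (xx (Suc k)) =
     scalar \<gamma> * xx k ^ edge_exp l c d + scalar \<delta> * (xx (Suc k) :: 'k klr_free) ^ edge_exp l d c"
    by (rule Q_neighbours[OF cd(2,3,1), where 'a = "'k klr_free"]) (simp add: scalar_def)
  have "opr (xx (Suc k) ^ edge_exp l d c) (tw v ((u @ [x]) @ y # s)) = (\<lambda>_. 0)"
    using w k d by (intro opr_x_power_edge) (auto simp: count_list_append)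
  then show ?thesis
    using opr_x_power_edge[OF w k c, of d v] unfolding ev
    by (simp add: free_operator_plus free_operator_mult free_operator_scalar)
qed

lemma letters_le: "w \<in> words \<Longrightarrow> c \<in> set (res w) \<Longrightarrow> c \<le> l"
proof -
  assume w: "w \<in> words" and c: "c \<in> set (res w)"
  then have "0 < count_list (res w) c" by (metis count_list_0_iff gr0I)
  then have "0 < card {t \<in> {0..<A}. row1_res l t = c} \<or> c < i"
    using words_len[OF w] unfolding count_residues by (auto split: if_splits)
  then show "c \<le> l"
    using i_le by (auto simp: card_gt_0_iff row1_res_def split: if_splits)
qed

lemma mset_res: "w \<in> words \<Longrightarrow> mset (res w) = weight"
proof (rule multiset_eqI)
  fix j assume w: "w \<in> words"
  have "{t \<in> {0..<A}. row1_res l t = j} = (if j \<le> l then (if i < j then {j, 2 * l + 1 - j} else {j}) else {})"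
    using i_le by (auto simp: row1_res_def split: if_splits)
  moreover have "j \<noteq> 2 * l + 1 - j" if "j \<le> l" using that by auto
  ultimately have "count_list (res w) j = (if j \<le> l then (if j = i then 1 else 2) else 0)"
    using words_len[OF w] i_le by (auto simp: count_residues)
  then show "count (mset (res w)) j = count weight j" by (simp add: count_weight count_mset)
qed

lemma res_seqs_weight: "w \<in> words \<Longrightarrow> res w \<in> seqs_weight l weight"
  using mset_res letters_le length_words by (auto simp: seqs_weight_iff seqs_def size_weight)

end

context klr_two_delta
begin

section \<open>The defining relations act by zero\<close>

definition dot_at :: "bool list \<Rightarrow> nat \<Rightarrow> 'k^2^2"
  where "dot_at w m = dot (take (m - 1) w) (w ! (m - 1))"

lemma opr_x_at:
  assumes w: "w \<in> words" and m: "m \<in> {1..N}"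
  shows "opr (xx m) (tw v w) = tw (dot_at w m *v v) w"
proof -
  have "m - 1 < length w" using m length_words[OF w] by auto
  then have eq: "w = take (m - 1) w @ w ! (m - 1) # drop (Suc (m - 1)) w" by (rule id_take_nth_drop)
  have "m = Suc (length (take (m - 1) w))" using m length_words[OF w] by (auto simp: min_def)
  from opr_x[of "take (m - 1) w" "w ! (m - 1)" "drop (Suc (m - 1)) w" m v] this eq w
  show ?thesis by (simp add: dot_at_def)
qed

lemma dot_at_swap:
  assumes "x \<noteq> y" and k: "k = Suc (length u)" and m: "1 \<le> m"
  shows "dot_at (u @ y # x # s) (Transposition.transpose k (k + 1) m) = dot_at (u @ x # y # s) m"
proof -
  consider "m < k" | "m = k" | "m = Suc k" | "Suc k < m" by linarith
  then show ?thesis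
  proof cases
    case 1
    then have "m - 1 < length u" using k m by simp
    then show ?thesis using 1 by (simp add: Transposition.transpose_def dot_at_def nth_append)
  next
    case 2
    then show ?thesis using k assms(1)
      by (cases x; cases y) (simp_all add: dot_at_def nth_append dot_def count_list_append)
  next
    case 3
    then show ?thesis using k assms(1)
      by (cases x; cases y) (simp_all add: dot_at_def nth_append dot_def count_list_append)
  next
    case 4
    then obtain j where j: "m = Suc (Suc (Suc (length u + j)))" using k by (metis Suc_leI le_Suc_ex add_Suc)
    then have "dot_at (u @ y # x # s) m = dot_at (u @ x # y # s) m"
      using assms(1) by (cases x; cases y) (simp_all add: dot_at_def nth_append dot_def count_list_append)
    then show ?thesis using 4 by (simp add: Transposition.transpose_def)
  qed
qed

lemma dot_at_double:
  assumes u: "len1 u = l" and il: "i < l" and k: "k = Suc (length u)"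
  shows "dot_at (u @ False # False # s) k = xi1" "dot_at (u @ False # False # s) (Suc k) = xi2"
    and "1 \<le> m \<Longrightarrow> m \<le> length (u @ False # False # s) \<Longrightarrow> m \<noteq> k \<Longrightarrow> m \<noteq> Suc k \<Longrightarrow> dot_at (u @ False # False # s) m = 0"
proof -
  show "dot_at (u @ False # False # s) k = xi1" "dot_at (u @ False # False # s) (Suc k) = xi2"
    using assms by (simp_all add: dot_at_def nth_append dot_def count_list_append)
  assume m: "1 \<le> m" "m \<le> length (u @ False # False # s)" "m \<noteq> k" "m \<noteq> Suc k"
  then consider "m < k" | "Suc k < m" by linarith
  then show "dot_at (u @ False # False # s) m = 0"
  proof cases
    case 1
    then have "u = take (m - 1) u @ u ! (m - 1) # drop (Suc (m - 1)) u"
      using k m by (intro id_take_nth_drop) auto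
    then have "len1 u = len1 (take (m - 1) u) + len1 (u ! (m - 1) # drop (Suc (m - 1)) u)"
      by (metis count_list_append)
    then have "\<not> u ! (m - 1) \<Longrightarrow> len1 (take (m - 1) u) < l" using u by simp
    then show ?thesis using 1 k m by (auto simp: dot_at_def nth_append dot_def)
  next
    case 2
    then obtain j where j: "m = Suc (Suc (Suc (length u + j)))" using k by (metis Suc_leI le_Suc_ex add_Suc)
    then show ?thesis using u by (simp add: dot_at_def dot_def count_list_append)
  qed
qed

lemma opr_psi_psi:
  assumes w: "u @ x # y # t @ x' # y' # s \<in> words" and k: "k = Suc (length u)"
    and m: "m = Suc (length (u @ x # y # t))"
  shows "opr (psi k) (opr (psi m) (tw v (u @ x # y # t @ x' # y' # s))) =
    opr (psi m) (opr (psi k) (tw v (u @ x # y # t @ x' # y' # s)))"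
proof -
  note rk = opr_psi[OF k]
  have rm: "u @ x # y # t @ False # True # s \<in> words \<Longrightarrow> opr (psi m) (tw v (u @ x # y # t @ False # True # s)) =
      (if Suc (len2 (u @ x # y # t)) < len1 (u @ x # y # t) then tw v (u @ x # y # t @ True # False # s) else (\<lambda>_. 0))"
    "u @ x # y # t @ True # False # s \<in> words \<Longrightarrow> opr (psi m) (tw v (u @ x # y # t @ True # False # s)) =
       tw v (u @ x # y # t @ False # True # s)"
    "u @ x # y # t @ True # True # s \<in> words \<Longrightarrow> opr (psi m) (tw v (u @ x # y # t @ True # True # s)) = (\<lambda>_. 0)"
    "u @ x # y # t @ False # False # s \<in> words \<Longrightarrow> opr (psi m) (tw v (u @ x # y # t @ False # False # s)) =
      (if len1 (u @ x # y # t) = l \<and> i < l then tw (partial *v v) (u @ x # y # t @ False # False # s) else (\<lambda>_. 0))"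
    if "length (u @ x # y # t) = m - 1" for x y v
    using opr_psi[of m "u @ x # y # t" s] that m by simp_all
  have mem: "u @ True # False # v \<in> words \<longleftrightarrow> u @ False # True # v \<in> words \<and> Suc (len2 u) < len1 u" for v
    by (rule swap_words)
  have mem': "u @ x # y # t @ True # False # s \<in> words \<longleftrightarrow>
     u @ x # y # t @ False # True # s \<in> words \<and> Suc (len2 (u @ x # y # t)) < len1 (u @ x # y # t)" for x y
    using swap_words[of "u @ x # y # t" s] by simp
  have len: "length (u @ x # y # t) = m - 1" for x y using m by simp
  show ?thesis
    using w
    by (cases x; cases y; cases x'; cases y')
      (auto simp: rk rm[OF len] mem mem' free_operator_zero count_list_append)
qed

lemma opr_braid:
  assumes w: "u @ x # y # z # s \<in> words" and k: "k = Suc (length u)"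
  shows "opr (psi (Suc k)) (opr (psi k) (opr (psi (Suc k)) (tw v (u @ x # y # z # s)))) =
    opr (psi k) (opr (psi (Suc k)) (opr (psi k) (tw v (u @ x # y # z # s))))"
proof -
  note rk = opr_psi[OF k]
  have len: "Suc k = Suc (length (u @ [x]))" for x using k by simp
  have rm: "u @ x # False # True # s \<in> words \<Longrightarrow> opr (psi (Suc k)) (tw v (u @ x # False # True # s)) =
      (if Suc (len2 (u @ [x])) < len1 (u @ [x]) then tw v (u @ x # True # False # s) else (\<lambda>_. 0))"
    "u @ x # True # False # s \<in> words \<Longrightarrow> opr (psi (Suc k)) (tw v (u @ x # True # False # s)) =
       tw v (u @ x # False # True # s)"
    "u @ x # True # True # s \<in> words \<Longrightarrow> opr (psi (Suc k)) (tw v (u @ x # True # True # s)) = (\<lambda>_. 0)"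
    "u @ x # False # False # s \<in> words \<Longrightarrow> opr (psi (Suc k)) (tw v (u @ x # False # False # s)) =
      (if len1 (u @ [x]) = l \<and> i < l then tw (partial *v v) (u @ x # False # False # s) else (\<lambda>_. 0))"
    for x v
    using opr_psi[OF len[of x], of s v] by simp_all
  have mem: "u @ True # False # v \<in> words \<longleftrightarrow> u @ False # True # v \<in> words \<and> Suc (len2 u) < len1 u" for v
    by (rule swap_words)
  have mem': "u @ x # True # False # s \<in> words \<longleftrightarrow>
     u @ x # False # True # s \<in> words \<and> Suc (len2 (u @ [x])) < len1 (u @ [x])" for x
    using swap_words[of "u @ [x]" s] by simp
  note wd = word_data[OF w]
  have "len1 u = l \<Longrightarrow> \<not> x \<Longrightarrow> y \<Longrightarrow> i < l \<Longrightarrow> Suc (len2 u) < l" using wd i_le by auto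
  moreover have "len1 u = l \<Longrightarrow> \<not> x \<Longrightarrow> \<not> y \<Longrightarrow> z \<Longrightarrow> i < l \<Longrightarrow> Suc (len2 u) < l" using wd by auto
  ultimately show ?thesis
    using w wd
    by (cases x; cases y; cases z)
      (auto simp: rk rm mem mem' free_operator_zero count_list_append)
qed

text \<open>
  In a standard tableau of two-row shape the pattern \<open>c, d, c\<close> with neighbouring letters can only be
  \<open>0, 1, 0\<close>, and there are no dots at the letter 0.
\<close>

lemma braid_letters:
  assumes w: "u @ x # y # z # s \<in> words"
    and c: "c = (if x then len2 u else row1_res l (len1 u))"
    and d: "d = (if y then len2 u + (if x then 1 else 0) else row1_res l (len1 u + (if x then 0 else 1)))"
    and e: "e = (if z then len2 (u @ [x, y]) else row1_res l (len1 (u @ [x, y])))"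
    and "c = e"
  shows "far c d \<or> c = 0 \<and> d = 1"
  using assms(5) word_data[OF w] i_le l2
  by (cases x; cases y; cases z) (auto simp: c d e row1_res_def far_def count_list_append split: if_splits)

lemma opr_divided_difference:
  assumes w: "u @ x # y # z # s \<in> words" and k: "k = Suc (length u)"
    and c: "c = (if x then len2 u else row1_res l (len1 u))"
    and d: "d = (if y then len2 u + (if x then 1 else 0) else row1_res l (len1 u + (if x then 0 else 1)))"
    and e: "e = (if z then len2 (u @ [x, y]) else row1_res l (len1 (u @ [x, y])))"
    and ce: "c = e" and le: "c \<le> l" "d \<le> l"
  shows "opr (eval_divided_difference scalar (Q c d) (xx k) (xx (Suc k)) (xx (Suc (Suc k)))) (tw v (u @ x # y # z # s)) = (\<lambda>_. 0)"
  using braid_letters[OF w c d e ce]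
proof
  assume "far c d"
  then show ?thesis using le by (simp add: Q_far eval_divided_difference_one free_operator_0)
next
  assume cd: "c = 0 \<and> d = 1"
  have nb: "0 \<le> l" "1 \<le> l" "1 = Suc 0 \<or> 0 = Suc (1::nat)" using l2 by simp_all
  obtain \<gamma> where dd: "eval_divided_difference scalar (Q 0 1) (xx k) (xx (Suc k)) (xx (Suc (Suc k))) =
      scalar \<gamma> * (xx (Suc (Suc k)) + xx k :: 'k klr_free)"
    by (rule Q_neighbours[OF nb, where 'a = "'k klr_free"]) (simp add: scalar_def edge_exp_def numeral_2_eq_2)
  have "opr (xx k) (tw v (u @ x # y # z # s)) = (\<lambda>_. 0)"
    using dot_zero[OF w] c cd l2 by (simp add: opr_x[OF w k] tensor_zero)
  moreover have "opr (xx (Suc (Suc k))) (tw v ((u @ [x, y]) @ z # s)) = (\<lambda>_. 0)"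
  proof -
    have w': "(u @ [x, y]) @ z # s \<in> words" using w by simp
    have "dot (u @ [x, y]) z = 0" by (rule dot_zero[OF w']) (use e ce cd l2 in auto)
    then show ?thesis using opr_x[OF w', of "Suc (Suc k)" v] k by (simp add: tensor_zero)
  qed
  ultimately show ?thesis
    using cd by (simp add: dd[unfolded One_nat_def] free_operator_mult free_operator_plus free_operator_scalar)
qed

text \<open>
  Every relation is evaluated on a single tableau vector, where crossings and dots are known explicitly.
\<close>

lemma relation_acts_zero:
  assumes r: "r \<in> klr_relations l Q n" and w: "w \<in> words"
  shows "opr r (tw v w) = (\<lambda>_. 0)"
proof -
  note simps = free_operator_simps opr_idem[OF w]
  have nN: "n = N" by (rule size_weight)
  have eq: "opr (a - b) (tw v w) = (\<lambda>_. 0)" if "opr a (tw v w) = opr b (tw v w)" for a b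
    using that by (simp add: free_operator_minus)
  have at_idem: "opr (a * idem \<nu> - (if p then b * idem \<nu> else 0)) (tw v w) = (\<lambda>_. 0)"
    if "\<nu> = res w \<Longrightarrow> opr a (tw v w) = (if p then opr b (tw v w) else (\<lambda>_. 0))" for a b \<nu> p
    using that by (cases "\<nu> = res w") (auto simp: simps)
  have pair: "\<exists>u x y s. w = u @ x # y # s \<and> k = Suc (length u)" if "k \<in> {1..<n}" for k
  proof -
    have "1 \<le> k" "k < length w" using that length_words[OF w] nN by auto
    then show ?thesis using split_at_pair by metis
  qed
  from r show ?thesis
  proof cases
    case (idem_idem \<nu> \<nu>')
    then show ?thesis by (cases "\<nu> = \<nu>'") (auto simp: simps)
  next
    case idem_sum
    have "res w \<in> seqs l n" using res_seqs_weight[OF w] by (simp add: seqs_weight_iff)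
    then have "opr (\<Sum>\<nu>\<in>seqs l n. idem \<nu>) (tw v w) = tw v w"
      by (auto simp: free_operator_sum opr_idem[OF w] fun_eq_iff if_distribR if_distrib[of "\<lambda>f. f _"] finite_seqs cong: if_cong)
    then show ?thesis unfolding idem_sum by (intro eq) (simp add: free_operator_one)
  next
    case (x_idem \<nu> k)
    then show ?thesis
      unfolding x_idem(1) using nN by (intro eq) (auto simp: simps opr_x_at[OF w] opr_idem[OF w])
  next
    case (x_x k m)
    then show ?thesis
      unfolding x_x(1) using nN by (intro eq) (auto simp: simps opr_x_at[OF w] dot_at_def dot_dot)
  next
    case (psi_idem \<nu> k)
    obtain u x y s where wu: "w = u @ x # y # s" and k: "k = Suc (length u)" using pair psi_idem by blast
    have inv: "swap_entries k \<nu> = \<rho> \<longleftrightarrow> \<nu> = swap_entries k \<rho>" if "length \<rho> = n" for \<rho>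
      using swap_entries_involution[of k \<nu>] swap_entries_involution[of k \<rho>] psi_idem that
      by (auto simp: seqs_def)
    note wW = w[unfolded wu]
    have ln: "length (res w') = n" if "w' \<in> words" for w' using length_words[OF that] nN by simp
    show ?thesis
      unfolding psi_idem(1)
    proof (rule eq)
      show "opr (psi k * idem \<nu>) (tw v w) = opr (idem (swap_entries k \<nu>) * psi k) (tw v w)"
      proof (cases rule: psi_trichotomy[OF wW k refl refl, case_names swap double kill])
        case swap
        have "res (u @ y # x # s) = swap_entries k (res w)"
        proof -
          have "len1 (u @ [y, x]) = len1 (u @ [x, y])" "len2 (u @ [y, x]) = len2 (u @ [x, y])"
            by (simp_all add: count_list_append)
          then show ?thesis
            unfolding wu res_pair using swap(1) k by (cases x; cases y) (simp_all add: swap_entries_append)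
        qed
        then have "swap_entries k \<nu> = res (u @ y # x # s) \<longleftrightarrow> \<nu> = res w"
          using inv[OF ln[OF swap(2)]] swap_entries_involution[of k "res w"] psi_idem ln[OF w] by auto
        then show ?thesis
          using swap(4)[of v] opr_idem[OF swap(2), of "swap_entries k \<nu>" v]
          by (simp add: simps wu[symmetric])
      next
        case double
        have "swap_entries k (res w) = res w"
          unfolding wu res_pair using double(1-3) k by (simp add: swap_entries_append row1_res_def)
        then have "swap_entries k \<nu> = res w \<longleftrightarrow> \<nu> = res w" using inv[OF ln[OF w]] by auto
        then show ?thesis
          using double(7)[of v] opr_idem[OF w, of "swap_entries k \<nu>" "partial *v v"]
          by (simp add: simps wu[symmetric])
      next
        case kill
        then show ?thesis using kill(2)[of v] by (simp add: simps wu[symmetric])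
      qed
    qed
  next
    case (psi_psi k m)
    have *: "opr (psi k * psi m) (tw v w) = opr (psi m * psi k) (tw v w)" if km: "k + 1 < m" "k \<in> {1..<n}" "m \<in> {1..<n}" for k m
    proof -
      obtain u' x' y' s where wu': "w = u' @ x' # y' # s" and m: "m = Suc (length u')" using pair km by blast
      have "1 \<le> k" "k < length u'" using km m by auto
      then obtain u x y t where u': "u' = u @ x # y # t" and k: "k = Suc (length u)" using split_at_pair by metis
      show ?thesis
        using opr_psi_psi[of u x y t x' y' s k m v] w k m unfolding wu' u' by (simp add: free_operator_mult)
    qed
    have "k + 1 < m \<or> m + 1 < k" using psi_psi by linarith
    then show ?thesis unfolding psi_psi(1) using *[of k m] *[of m k] psi_psi by (intro eq) auto
  next
    case (psi_square \<nu> k)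
    obtain u x y s where wu: "w = u @ x # y # s" and k: "k = Suc (length u)" using pair psi_square by blast
    note wW = w[unfolded wu]
    let ?c = "if x then len2 u else row1_res l (len1 u)"
    let ?d = "if y then len2 u + (if x then 1 else 0) else row1_res l (len1 u + (if x then 0 else 1))"
    have ent: "entry (res w) k = ?c" "entry (res w) (k + 1) = ?d"
      unfolding wu res_pair using entry_first[of "res u"] entry_second[of "res u"] k by simp_all
    have cd: "?c \<le> l" "?d \<le> l"
      using letters_le[OF w, of ?c] letters_le[OF w, of ?d] unfolding wu res_pair by auto
    have "opr (psi k ^ 2) (tw v w) = opr (eval2 scalar (Q ?c ?d) (xx k) (xx (Suc k))) (tw v w)"
    proof (cases rule: psi_trichotomy[OF wW k refl refl, case_names swap double kill])
      case swap
      have "opr (psi k) (tw v (u @ y # x # s)) = tw v (u @ x # y # s)"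
        using opr_psi_swap[OF swap(2) k] swap(1) wW by simp
      then show ?thesis
        using swap(4)[of v] Q_far[OF cd swap(3)]
        by (simp add: wu power2_eq_square free_operator_mult eval2_one free_operator_scalar)
    next
      case double
      have "partial *v (partial *v v) = 0" by (simp add: vec2_eq_iff)
      then show ?thesis
        using double(7) double(5,6) Q_self[of l]
        by (simp add: wu power2_eq_square free_operator_mult tensor_zero eval2_zero scalar_def free_operator_0)
    next
      case kill
      show ?thesis
        using kill(2) opr_eval2_edge[OF wW k refl refl kill(1) cd, of v]
        by (simp add: wu power2_eq_square free_operator_mult free_operator_zero)
    qed
    then show ?thesis
      unfolding psi_square(1) using ent by (intro eq) (auto simp: simps)
  next
    case (psi_x \<nu> k m)
    obtain u x y s where wu: "w = u @ x # y # s" and k: "k = Suc (length u)" using pair psi_x by blast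
    note wW = w[unfolded wu]
    let ?c = "if x then len2 u else row1_res l (len1 u)"
    let ?d = "if y then len2 u + (if x then 1 else 0) else row1_res l (len1 u + (if x then 0 else 1))"
    let ?t = "Transposition.transpose k (k + 1)"
    have ent: "entry (res w) k = ?c" "entry (res w) (k + 1) = ?d"
      unfolding wu res_pair using entry_first[of "res u"] entry_second[of "res u"] k by simp_all
    have mN: "m \<in> {1..N}" "?t m \<in> {1..N}" using psi_x nN by (auto simp: Transposition.transpose_def)
    define sg :: 'k where "sg = (if m = k \<and> ?c = ?d then - 1 else if m = k + 1 \<and> ?c = ?d then 1 else 0)"
    have main: "opr (psi k * xx m - xx (?t m) * psi k) (tw v w) = (\<lambda>S. sg *s tw v w S)"
    proof (cases rule: psi_trichotomy[OF wW k refl refl, case_names swap double kill])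
      case swap
      have "?c \<noteq> ?d" using swap(3) by (auto simp: far_def)
      then have sg: "sg = 0" unfolding sg_def by simp
      have "opr (xx (?t m)) (tw v (u @ y # x # s)) = tw (dot_at (u @ x # y # s) m *v v) (u @ y # x # s)"
        using opr_x_at[OF swap(2) mN(2)] dot_at_swap[OF swap(1) k, of m s] mN(1) by simp
      then show ?thesis
        using swap(4) opr_x_at[OF wW mN(1)] by (simp add: wu sg free_operator_minus free_operator_mult)
    next
      case double
      have w': "w = u @ False # False # s" using wu double by simp
      note dd = dot_at_double[OF double(3,4) k, where s = s, folded w']
      have step: "opr (psi k * xx m - xx (?t m) * psi k) (tw v w) =
          (\<lambda>S. tw (partial *v (dot_at w m *v v)) w S - tw (dot_at w (?t m) *v (partial *v v)) w S)"
        using double(7)[folded wu] by (simp add: free_operator_minus free_operator_mult opr_x_at[OF w mN(1)] opr_x_at[OF w mN(2), unfolded Suc_eq_plus1[symmetric]])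
      consider "m = k" | "m = Suc k" | "m \<noteq> k" "m \<noteq> Suc k" by blast
      then show ?thesis
      proof cases
        case 1
        have "sg = - 1" using 1 double by (simp add: sg_def)
        moreover have "?t m = Suc k" using 1 by simp
        ultimately show ?thesis
          unfolding step using 1 by (intro ext) (simp add: dd(1,2) tensor_def vec2_eq_iff)
      next
        case 2
        have "sg = 1" using 2 double by (simp add: sg_def)
        moreover have "?t m = k" using 2 by simp
        ultimately show ?thesis
          unfolding step using 2 by (intro ext) (simp add: dd(1,2) tensor_def vec2_eq_iff)
      next
        case 3
        have "sg = 0" using 3 by (simp add: sg_def)
        moreover have "?t m = m" using 3 by (simp add: Transposition.transpose_def)
        moreover have "dot_at w m = 0" using dd(3)[of m] 3 mN length_words[OF w] by simp
        ultimately show ?thesis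
          using double(7)[folded wu] mN
          by (simp add: free_operator_minus free_operator_mult opr_x_at[OF w] tensor_zero free_operator_zero)
      qed
    next
      case kill
      have "?c \<noteq> ?d" using kill(1) by auto
      then have "sg = 0" unfolding sg_def by simp
      then show ?thesis
        using kill(2)[folded wu] mN by (simp add: free_operator_minus free_operator_mult opr_x_at[OF w] free_operator_zero)
    qed
    have rhs: "(if m = k \<and> entry \<nu> k = entry \<nu> (k + 1) then - idem \<nu>
          else if m = k + 1 \<and> entry \<nu> k = entry \<nu> (k + 1) then idem \<nu> else 0) = scalar sg * idem \<nu>" if "\<nu> = res w"
      using that ent by (simp add: sg_def scalar_def single_uminus)
    show ?thesis
    proof (cases "\<nu> = res w")
      case True
      show ?thesis
        unfolding psi_x(1) rhs[OF True]
        using main True by (intro eq) (simp only: free_operator_mult opr_idem[OF w] simp_thms if_True free_operator_scalar)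
    next
      case False
      then show ?thesis unfolding psi_x(1) by (auto simp: simps)
    qed
  next
    case (braid \<nu> k)
    obtain u x y s' where wu': "w = u @ x # y # s'" and k: "k = Suc (length u)" using pair[of k] braid by fastforce
    have "s' \<noteq> []" using length_words[OF w] braid nN wu' k by auto
    then obtain z s where wu: "w = u @ x # y # z # s" using wu' by (cases s') auto
    note wW = w[unfolded wu]
    let ?c = "if x then len2 u else row1_res l (len1 u)"
    let ?d = "if y then len2 u + (if x then 1 else 0) else row1_res l (len1 u + (if x then 0 else 1))"
    let ?e = "if z then len2 (u @ [x, y]) else row1_res l (len1 (u @ [x, y]))"
    have rw: "res w = res u @ ?c # ?d # ?e # residues l (len1 (u @ [x, y, z])) (len2 (u @ [x, y, z])) s"
      unfolding wu res_pair by (cases z) (simp_all add: count_list_append)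
    have ent: "entry (res w) k = ?c" "entry (res w) (k + 1) = ?d" "entry (res w) (k + 2) = ?e"
      unfolding rw using entry_first[of "res u"] entry_second[of "res u"] entry_third[of "res u"] k by simp_all
    have cd: "?c \<le> l" "?d \<le> l"
      using letters_le[OF w, of ?c] letters_le[OF w, of ?d] unfolding rw by auto
    have lhs: "opr (psi (k + 1) * psi k * psi (k + 1) - psi k * psi (k + 1) * psi k) (tw v w) = (\<lambda>_. 0)"
      using opr_braid[OF wW k, of v] by (simp add: wu free_operator_minus free_operator_mult)
    show ?thesis
    proof (cases "\<nu> = res w")
      case True
      let ?D = "eval_divided_difference scalar (Q ?c ?d) (xx k) (xx (k + 1)) (xx (k + 2)) * idem (res w)"
      have "opr (if ?c = ?e then ?D else 0) (tw v w) = (\<lambda>_. 0)"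
      proof (cases "?c = ?e")
        case True
        have "opr (eval_divided_difference scalar (Q ?c ?d) (xx k) (xx (k + 1)) (xx (k + 2))) (tw v w) = (\<lambda>_. 0)"
          using opr_divided_difference[OF wW k refl refl refl True cd, of v] by (simp add: wu)
        then show ?thesis unfolding if_P[OF True] by (simp only: free_operator_mult opr_idem[OF w] simp_thms if_True)
      next
        case False
        then show ?thesis unfolding if_not_P[OF False] by (simp only: free_operator_0)
      qed
      moreover have "opr ((psi (k + 1) * psi k * psi (k + 1) - psi k * psi (k + 1) * psi k) * idem (res w)) (tw v w) = (\<lambda>_. 0)"
        using lhs by (simp only: free_operator_mult opr_idem[OF w] simp_thms if_True)
      ultimately show ?thesis
        unfolding braid(1) True ent by (intro eq) (simp only:)
    next
      case False
      then show ?thesis unfolding braid(1) by (auto simp: simps)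
    qed
  next
    case (cyclotomic_zero \<nu>)
    have "dot_at w 1 = 0"
      using l2 by (simp add: dot_at_def dot_def)
    then show ?thesis
      unfolding cyclotomic_zero(1) by (simp add: simps opr_x_at[OF w] tensor_zero)
  next
    case (cyclotomic_nonzero \<nu>)
    have "\<nu> \<noteq> res w"
    proof
      assume "\<nu> = res w"
      obtain x v where "w = x # v" using length_words[OF w] by (cases w) auto
      then show False using \<open>\<nu> = res w\<close> cyclotomic_nonzero wordsD[OF w] by (cases x) (auto simp: entry_def row1_res_def)
    qed
    then show ?thesis unfolding cyclotomic_nonzero(1) by (simp add: simps)
  qed
qed

end

section \<open>The modules over the block\<close>

lemma gen_action_outside:
  assumes "T \<in> standard_tableaux (two_row l i)" "S \<notin> standard_tableaux (two_row l i)"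
  shows "gen_action l i g v T S = 0"
  using assms by (cases g) (auto simp: tensor_def)

lemma gen_action_second_zero: "v $ 2 = 0 \<Longrightarrow> gen_action l l g v T S $ 2 = 0"
  by (cases g) (auto simp: tensor_def)

lemma free_operator_second_zero:
  assumes "\<forall>S. (f :: 'k::field tabsum) S $ 2 = 0"
  shows "\<forall>S. free_operator l l a f S $ 2 = 0"
  using assms
proof (induction a arbitrary: f rule: free_algebra_induct)
  case (gen g)
  then show ?case by (simp add: free_operator_gen gen_operator_def sum_component gen_action_second_zero)
qed (simp_all add: free_operator_scalar free_operator_plus free_operator_mult)

context klr_two_delta
begin

definition tab_functions :: "'k tabsum set"
  where "tab_functions = {f. \<forall>T. T \<notin> standard_tableaux \<mu> \<longrightarrow> f T = 0}"

lemma tab_functions_add: "f \<in> tab_functions \<Longrightarrow> h \<in> tab_functions \<Longrightarrow> (\<lambda>T. f T + h T) \<in> tab_functions"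
  by (simp add: tab_functions_def)

lemma tab_expand:
  assumes "f \<in> tab_functions"
  shows "f = (\<lambda>S. \<Sum>w\<in>words. tw (f (word_tableau w)) w S)"
proof
  fix S
  have "(\<Sum>w\<in>words. tw (f (word_tableau w)) w S) = (\<Sum>T\<in>standard_tableaux \<mu>. tensor (f T) T S)"
    unfolding standard_words by (simp add: sum.reindex[OF word_tableau_inj_words])
  also have "\<dots> = (\<Sum>T\<in>standard_tableaux \<mu>. if S = T then f S else 0)"
    by (rule sum.cong) (auto simp: tensor_def)
  also have "\<dots> = f S"
    using assms finite_words by (simp add: tab_functions_def standard_words)
  finally show "f S = (\<Sum>w\<in>words. tw (f (word_tableau w)) w S)" by simp
qed

lemma tw_tab_functions: "w \<in> words \<Longrightarrow> tw v w \<in> tab_functions"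
  by (auto simp: tab_functions_def tensor_def standard_words)

lemma opr_expand:
  assumes "f \<in> tab_functions"
  shows "opr a f = (\<lambda>S. \<Sum>w\<in>words. opr a (tw (f (word_tableau w)) w) S)"
  by (subst tab_expand[OF assms]) (rule free_operator_linear_sum)

lemma opr_closed: "f \<in> tab_functions \<Longrightarrow> opr a f \<in> tab_functions"
proof (induction a arbitrary: f rule: free_algebra_induct)
  case (gen g)
  then show ?case by (simp add: free_operator_gen gen_operator_def tab_functions_def gen_action_outside)
qed (auto simp: free_operator_scalar free_operator_plus free_operator_mult tab_functions_def)

text \<open>
  The restriction to the generators of the algebra is needed because an operator is attached to every
  generator, whereas in the presentation those outside the algebra are zero.
\<close>

definition act :: "'k klr_free \<Rightarrow> 'k tabsum \<Rightarrow> 'k tabsum"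
  where "act a = opr (restrict_gens G a)"

lemma act_closed: "f \<in> tab_functions \<Longrightarrow> act a f \<in> tab_functions"
  unfolding act_def by (rule opr_closed)

lemma act_simps:
  "act (a + b) f = (\<lambda>S. act a f S + act b f S)" "act (a * b) f = act a (act b f)"
  "act (- a) f = (\<lambda>S. - act a f S)" "act (scalar c) f = (\<lambda>S. c *s f S)" "act 1 f = f" "act 0 f = (\<lambda>_. 0)"
  "act (a - b) f = (\<lambda>S. act a f S - act b f S)"
  by (simp_all add: act_def restrict_gens_simps free_operator_simps free_operator_scalar)

lemma act_linear: "act a (\<lambda>S. f S + h S) = (\<lambda>S. act a f S + act a h S)"
  by (simp add: act_def free_operator_linear_add)

lemma act_zero_fun: "act a (\<lambda>_. 0) = (\<lambda>_. 0)"
  by (simp add: act_def free_operator_zero)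

lemma act_gen: "g \<in> G \<Longrightarrow> act (gen g) f = opr (gen g) f"
  by (simp add: act_def restrict_gens_gen)

lemma block_relation_acts:
  assumes s: "s \<in> block_relations" and f: "f \<in> tab_functions"
  shows "act s f = (\<lambda>_. 0)"
proof -
  consider "s \<in> klr_relations l Q n" | g where "s = gen g" "g \<notin> G"
    | \<nu> where "s = idem \<nu>" "\<nu> \<in> seqs l n" "\<nu> \<notin> seqs_weight l weight"
    using s by (auto simp: block_relations_def outer_relations_def)
  then show ?thesis
  proof cases
    case 1
    then show ?thesis
      by (simp add: act_def relations_restrict opr_expand[OF f] relation_acts_zero)
  next
    case 2
    then show ?thesis by (simp add: act_def restrict_gens_gen free_operator_0)
  next
    case 3
    then have "act s f = opr (idem \<nu>) f" by (simp add: act_gen klr_gens_def)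
    also have "\<dots> = (\<lambda>_. 0)"
      using 3(3) res_seqs_weight by (auto simp: opr_expand[OF f] opr_idem intro!: ext sum.neutral)
    finally show ?thesis .
  qed
qed

lemma act_cong:
  assumes "a \<approx> b" and f: "f \<in> tab_functions"
  shows "act a f = act b f"
proof -
  have "act d f = (\<lambda>_. 0)" if "d \<in> two_sided_ideal block_relations" for d
    using that
  proof (induction rule: two_sided_ideal.induct)
    case (step a s u v)
    then show ?case
      by (simp add: act_simps block_relation_acts[OF _ act_closed[OF f]] act_zero_fun)
  qed (simp add: act_simps)
  then have "act (a - b) f = (\<lambda>_. 0)" using assms(1) by (simp add: cong_def)
  then show ?thesis by (simp add: act_simps fun_eq_iff)
qed

abbreviation "B \<equiv> klr_block l Q weight"
abbreviation "L \<equiv> L_module l i :: ('k klr_free set, 'k tabsum) module"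

sublocale blk: algebra_presentation B block_map scalar
  by (rule klr_block_presentation)

lemma L_ops: "carrier L = tab_functions" "zero L = (\<lambda>_. 0)" "add L = (\<lambda>f g T. f T + g T)"
  by (simp_all add: L_module_def tab_functions_def)

text \<open>
  A coset acts through any representative, since the ideal acts by zero.
\<close>

lemma L_smult:
  assumes f: "f \<in> tab_functions"
  shows "block_map a \<odot>\<^bsub>L\<^esub> f = act a f"
proof -
  let ?r = "restrict_gens G (a * block_idem)"
  have J: "opr j f = (\<lambda>_. 0)" if "j \<in> klr_ideal l Q n" for j
  proof -
    have "j \<in> two_sided_ideal block_relations"
      using that klr_ideal_le_outer two_sided_ideal_mono[of outer_relations block_relations]
      by (auto simp: block_relations_def)
    then have "act j f = act 0 f" by (intro act_cong f) (simp add: cong_def)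
    moreover have "restrict_gens G j = j"
      using that ideal.Icarr[OF klr_ideal_ideal] by (simp add: free_algebra_carrier_iff)
    ultimately show ?thesis by (simp add: act_simps) (simp add: act_def)
  qed
  have zero: "0 \<in> klr_ideal l Q n"
    using additive_subgroup.zero_closed[OF ideal.axioms(1)[OF klr_ideal_ideal]] by (simp add: free_algebra_ops)
  have coset: "block_map a = (\<lambda>j. j + ?r) ` klr_ideal l Q n"
    by (auto simp: block_map_def a_r_coset_def' free_algebra_ops)
  have "opr (j + ?r) f = opr ?r f" if "j \<in> klr_ideal l Q n" for j
    using J[OF that] by (simp add: free_operator_plus)
  then have "(\<lambda>c. opr c f) ` block_map a = (\<lambda>j. opr ?r f) ` klr_ideal l Q n"
    unfolding coset image_image by (intro image_cong refl)
  then have "(\<lambda>c. opr c f) ` block_map a = {opr ?r f}" using zero by auto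
  moreover have "opr ?r f = act (a * block_idem) f" by (simp add: act_def)
  moreover have "\<dots> = act a f"
    using cong_lmult[OF block_idem_one, of a] by (intro act_cong f) simp
  ultimately show ?thesis by (simp add: L_module_def)
qed

lemma L_left_module: "left_module B L"
proof -
  have "abelian_group L"
  proof (rule abelian_groupI)
    fix f assume "f \<in> carrier L"
    then show "\<exists>h\<in>carrier L. h \<oplus>\<^bsub>L\<^esub> f = \<zero>\<^bsub>L\<^esub>"
      by (intro bexI[of _ "\<lambda>T. - f T"]) (auto simp: L_ops tab_functions_def)
  qed (auto simp: L_ops tab_functions_def algebra_simps)
  then show ?thesis
    by (intro left_module.intro left_module_axioms.intro blk.ring)
      (auto simp: blk.carrier_range blk.add_image blk.mult_image blk.one_image L_ops L_smult act_closed act_simps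
        act_linear tab_functions_add)
qed

lemma L_tilde_submodule:
  assumes il: "i = l"
  shows "Module.submodule {f \<in> tab_functions. \<forall>T. f T $ 2 = 0} B L"
proof -
  have "\<forall>S. act a f S $ 2 = 0" if "\<forall>S. f S $ 2 = 0" for a f
    using free_operator_second_zero[OF that, of l "restrict_gens G a"] unfolding act_def by (simp only: il simp_thms)
  moreover have "(\<lambda>_. 0) \<in> tab_functions" by (simp add: tab_functions_def)
  ultimately show ?thesis
    unfolding blk.submodule_iff[OF L_left_module]
    by (auto simp: L_ops L_smult act_closed tab_functions_add)
qed

lemma L_tilde_eq: "i = l \<Longrightarrow> (L_tilde l :: ('k klr_free set, 'k tabsum) module) =
    L\<lparr>carrier := {f \<in> tab_functions. \<forall>T. f T $ 2 = 0}\<rparr>"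
proof -
  have "(\<exists>c. v = c *s vector [1, 0]) \<longleftrightarrow> v $ 2 = 0" for v :: "'k^2"
    by (auto simp: vec2_eq_iff vector_2 intro!: exI[of _ "v $ 1"])
  then show "i = l \<Longrightarrow> ?thesis" using L_ops(1) by (simp add: L_tilde_def)
qed

section \<open>The corner on tableau vectors\<close>

lemma w0_gens: "E (res w0) \<in> G" "X (Suc l) \<in> G" "Psi (Suc l) \<in> G"
  using res_seqs_weight[OF w0_words] l2
  by (auto simp: klr_gens_def seqs_weight_iff size_weight)

lemma act_e0:
  assumes f: "f \<in> tab_functions"
  shows "act e0 f = tw (f (word_tableau w0)) w0"
proof -
  have "opr e0 (tw v w) = (if w = w0 then tw v w else (\<lambda>_. 0))" if "w \<in> words" for v w
    using res_inj[OF w0_words that] by (auto simp: opr_idem[OF that])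
  then have "opr e0 f = (\<lambda>S. \<Sum>w\<in>words. if w = w0 then tw (f (word_tableau w)) w S else 0)"
    unfolding opr_expand[OF f] by (intro ext sum.cong) auto
  also have "\<dots> = tw (f (word_tableau w0)) w0"
    using w0_words finite_words by (simp add: fun_eq_iff)
  finally show ?thesis using act_gen[OF w0_gens(1), of f] by simp
qed

lemma w0_middle: "\<exists>t. w0 = replicate l False @ False # t" "i < l \<Longrightarrow> \<exists>t. w0 = replicate l False @ False # False # t"
proof -
  have "replicate (2 * l + 1 - i) False = replicate l False @ replicate (l + 1 - i) False"
    using i_le by (simp flip: replicate_add)
  moreover have "i < l \<Longrightarrow> \<exists>k. l + 1 - i = Suc (Suc k)" by presburger
  moreover have "\<exists>k. l + 1 - i = Suc k" using i_le by presburger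
  ultimately show "\<exists>t. w0 = replicate l False @ False # t" "i < l \<Longrightarrow> \<exists>t. w0 = replicate l False @ False # False # t"
    by (auto simp: two_block_def)
qed

lemma act_xe:
  assumes f: "f \<in> tab_functions"
  shows "act xe f = tw (xi1 *v f (word_tableau w0)) w0"
proof -
  obtain t where t: "w0 = replicate l False @ False # t" using w0_middle(1) by blast
  have "opr (xx (Suc l)) (tw v w0) = tw (xi1 *v v) w0" for v
    using opr_x[of "replicate l False" False t "Suc l" v, folded t] w0_words
    by (simp add: dot_def count_list_replicate)
  then show ?thesis by (simp only: act_simps act_gen[OF w0_gens(2)] act_e0[OF f])
qed

lemma act_pe:
  assumes f: "f \<in> tab_functions" and "i < l"
  shows "act pe f = tw (partial *v f (word_tableau w0)) w0"
proof -
  obtain t where t: "w0 = replicate l False @ False # False # t" using w0_middle(2) assms by blast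
  have "opr (psi (Suc l)) (tw v w0) = tw (partial *v v) w0" for v
    using opr_psi(4)[of "Suc l" "replicate l False" t v, folded t] w0_words assms(2)
    by (simp add: count_list_replicate)
  then show ?thesis by (simp only: act_simps act_gen[OF w0_gens(3)] act_e0[OF f])
qed

end

section \<open>The dual numbers\<close>

text \<open>
  Two polynomials are congruent modulo the square of the variable iff their two lowest coefficients agree.
\<close>

lemma dual_numbers_presentation:
  obtains \<rho> :: "'k::field poly \<Rightarrow> 'k poly set"
  where "algebra_presentation (dual_numbers :: ('k, 'k poly set) module) \<rho> (\<lambda>c. [:c:])"
    and "\<And>p q. \<rho> p = \<rho> q \<longleftrightarrow> coeff p 0 = coeff q 0 \<and> coeff p 1 = coeff q 1"
proof -
  define P :: "('k, 'k poly) module" where "P = type_algebra Polynomial.smult"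
  have P: "carrier P = UNIV" "mult P = (*)" "one P = 1" "zero P = 0" "add P = (+)" "smult P = Polynomial.smult"
    by (simp_all add: P_def type_algebra_def)
  have "abelian_group P"
  proof (rule abelian_groupI)
    fix p :: "'k poly"
    show "\<exists>q\<in>carrier P. q \<oplus>\<^bsub>P\<^esub> p = \<zero>\<^bsub>P\<^esub>" by (intro bexI[of _ "- p"]) (simp_all add: P)
  qed (auto simp: P algebra_simps)
  then have "cring P"
    by (intro cringI comm_monoidI) (auto simp: P algebra_simps)
  then interpret P: cring P .
  define m :: "'k poly" where "m = monom 1 2"
  define J where "J = Idl\<^bsub>P\<^esub> {m}"
  have J: "ideal J P" unfolding J_def by (rule P.genideal_ideal) (simp add: P)
  interpret J: ideal J P by (rule J)
  have "J = PIdl\<^bsub>P\<^esub> m" unfolding J_def by (rule P.cgenideal_eq_genideal[symmetric]) (simp add: P)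
  then have J_eq: "J = range (\<lambda>q. q * m)" by (auto simp: cgenideal_def P)
  have J_iff: "p \<in> J \<longleftrightarrow> coeff p 0 = 0 \<and> coeff p 1 = 0" for p
  proof -
    have "p \<in> J \<longleftrightarrow> m dvd p" unfolding J_eq by (auto simp: dvd_def mult.commute)
    also have "\<dots> \<longleftrightarrow> (\<forall>k<2. coeff p k = 0)" unfolding m_def by (rule monom_1_dvd_iff')
    also have "\<dots> \<longleftrightarrow> coeff p 0 = 0 \<and> coeff p 1 = 0" by (auto simp: less_2_cases_iff)
    finally show ?thesis .
  qed
  have coset: "J +>\<^bsub>P\<^esub> p = {q. q - p \<in> J}" for p
  proof -
    have "J +>\<^bsub>P\<^esub> p = (\<lambda>j. j + p) ` J" by (auto simp: a_r_coset_def' P)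
    also have "\<dots> = {q. q - p \<in> J}" by (auto intro!: image_eqI[of q "\<lambda>j. j + p" "q - p" for q])
    finally show ?thesis .
  qed
  have eq_iff: "J +>\<^bsub>P\<^esub> p = J +>\<^bsub>P\<^esub> q \<longleftrightarrow> coeff p 0 = coeff q 0 \<and> coeff p 1 = coeff q 1" for p q
  proof
    assume "J +>\<^bsub>P\<^esub> p = J +>\<^bsub>P\<^esub> q"
    then have "p \<in> J +>\<^bsub>P\<^esub> q" by (auto simp: coset J_iff)
    then show "coeff p 0 = coeff q 0 \<and> coeff p 1 = coeff q 1" by (simp add: coset J_iff)
  qed (auto simp: coset J_iff)
  have sm: "\<forall>c. \<forall>a\<in>carrier P. c \<odot>\<^bsub>P\<^esub> a \<in> carrier P" by (simp add: P)
  have smJ: "\<forall>c. \<forall>a\<in>carrier P. \<forall>b\<in>J +>\<^bsub>P\<^esub> a. c \<odot>\<^bsub>P\<^esub> b \<in> J +>\<^bsub>P\<^esub> (c \<odot>\<^bsub>P\<^esub> a)"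
    by (simp add: coset P J_iff)
  note ops = quotient_algebra_ops[OF P.ring_axioms J sm smJ, unfolded P]
  have D: "dual_numbers = quotient_algebra P J"
    by (simp add: dual_numbers_def Let_def P_def J_def m_def)
  show ?thesis
  proof (rule that[of "\<lambda>p. J +>\<^bsub>P\<^esub> p"])
    show "algebra_presentation (dual_numbers :: ('k, 'k poly set) module) (\<lambda>p. J +>\<^bsub>P\<^esub> p) (\<lambda>c. [:c:])"
      unfolding D by unfold_locales (simp_all add: ops one_pCons)
  qed (rule eq_iff)
qed

context klr_two_delta
begin

section \<open>Matrix units of the block\<close>

lemma e0_e0: "e0 * e0 \<approx> e0"
  by (rule e0_corner_span) (rule corner_span_e0)

text \<open>
  Matrix units \<open>c s\<close>, \<open>r s\<close> of the corner are spread over the block by the paths. The index of a matrix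
  unit of the block is a word together with an index of the corner.
\<close>

lemma path_matrix_units:
  fixes I :: "'t set" and r c :: "'t \<Rightarrow> 'k klr_free"
  assumes I: "finite I"
    and r: "\<And>s. s \<in> I \<Longrightarrow> r s * e0 \<approx> r s" "\<And>s. s \<in> I \<Longrightarrow> \<epsilon> * r s \<approx> r s"
    and c: "\<And>s. s \<in> I \<Longrightarrow> e0 * c s \<approx> c s" "\<And>s. s \<in> I \<Longrightarrow> c s * \<epsilon> \<approx> c s"
    and rc: "\<And>s t. s \<in> I \<Longrightarrow> t \<in> I \<Longrightarrow> r s * c t \<approx> (if s = t then \<epsilon> else 0)"
    and cr: "(\<Sum>s\<in>I. c s * r s) \<approx> e0"
    and \<epsilon>: "\<epsilon> * \<epsilon> \<approx> \<epsilon>" and y: "\<epsilon> * y \<approx> y" "y * \<epsilon> \<approx> y" "y * y \<approx> 0"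
    and corner: "\<And>a. \<exists>k d. \<epsilon> * a * \<epsilon> \<approx> scalar k * \<epsilon> + scalar d * y"
  shows "matrix_units B block_map scalar (words \<times> I)
    (\<lambda>(w, s). path 0 0 w * c s) (\<lambda>(w, s). r s * path_rev 0 0 w) \<epsilon> y"
proof (unfold_locales; (unfold block_map_eq_iff)?)
  show "finite (words \<times> I)" using I finite_words by simp
  fix p q :: "bool list \<times> 't"
  assume pq: "p \<in> words \<times> I" "q \<in> words \<times> I"
  obtain w s where p: "p = (w, s)" by (cases p)
  obtain w' t where q: "q = (w', t)" by (cases q)
  have 1: "w \<in> words" "w' \<in> words" "s \<in> I" "t \<in> I" using pq p q by auto
  have "r s * path_rev 0 0 w * (path 0 0 w' * c t) \<approx> (r s * e0) * path_rev 0 0 w * (path 0 0 w' * (e0 * c t))"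
    by (rule cong_sym) (intro cong_mult cong_refl r c 1)
  also have "\<dots> = r s * (e0 * path_rev 0 0 w * (path 0 0 w' * e0)) * c t" by (simp only: mult.assoc)
  also have "\<dots> \<approx> r s * (if w = w' then e0 else 0) * c t" by (intro cong_mid path_rev_path 1)
  also have "\<dots> \<approx> (if w = w' then r s * c t else 0)"
    using cong_rmult[OF r(1)[OF 1(3)], of "c t"] by simp
  also have "\<dots> \<approx> (if p = q then \<epsilon> else 0)"
    using rc[OF 1(3,4)] by (cases "s = t"; cases "w = w'") (simp_all add: p q)
  finally show "(case p of (w, s) \<Rightarrow> r s * path_rev 0 0 w) * (case q of (w, s) \<Rightarrow> path 0 0 w * c s) \<approx> (if p = q then \<epsilon> else 0)"
    by (simp add: p q)
next
  have "(\<Sum>p\<in>words \<times> I. (case p of (w, s) \<Rightarrow> path 0 0 w * c s) * (case p of (w, s) \<Rightarrow> r s * path_rev 0 0 w)) =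
      (\<Sum>w\<in>words. path 0 0 w * (\<Sum>s\<in>I. c s * r s) * path_rev 0 0 w)"
    by (simp add: sum.cartesian_product' sum_distrib_left sum_distrib_right mult.assoc)
  also have "\<dots> \<approx> (\<Sum>w\<in>words. path 0 0 w * e0 * path_rev 0 0 w)" by (intro cong_sum cong_mid cr)
  also have "\<dots> \<approx> 1" by (rule path_partition)
  finally show "(\<Sum>p\<in>words \<times> I. (case p of (w, s) \<Rightarrow> path 0 0 w * c s) * (case p of (w, s) \<Rightarrow> r s * path_rev 0 0 w)) \<approx> 1" .
next
  fix p :: "bool list \<times> 't" assume "p \<in> words \<times> I"
  then obtain w s where p: "p = (w, s)" "s \<in> I" by auto
  show "(case p of (w, s) \<Rightarrow> path 0 0 w * c s) * \<epsilon> \<approx> (case p of (w, s) \<Rightarrow> path 0 0 w * c s)"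
    using cong_lmult[OF c(2)[OF p(2)]] by (simp add: p mult.assoc)
  show "\<epsilon> * (case p of (w, s) \<Rightarrow> r s * path_rev 0 0 w) \<approx> (case p of (w, s) \<Rightarrow> r s * path_rev 0 0 w)"
    using cong_rmult[OF r(2)[OF p(2)]] by (simp add: p flip: mult.assoc)
qed (fact \<epsilon> y corner)+

lemma scalar_mult_scalar:
  "scalar c * a * (scalar d * b) = scalar (c * d) * (a * b)" for a b :: "'k klr_free"
proof -
  have "scalar c * a * (scalar d * b) = scalar c * (a * scalar d) * b" by (simp only: mult.assoc)
  also have "\<dots> = scalar (c * d) * (a * b)"
    by (simp only: scalar_central[of d a, symmetric] scalar_mult mult.assoc)
  finally show ?thesis .
qed

lemma act_scale: "act (scalar c * a) f = (\<lambda>S. c *s act a f S)"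
  by (simp add: act_simps)

lemma matrix_units_dual:
  assumes "i = l"
  shows "matrix_units B block_map scalar (words \<times> {()})
    (\<lambda>(w, s). path 0 0 w * e0) (\<lambda>(w, s). e0 * path_rev 0 0 w) e0 xe"
proof (rule path_matrix_units)
  fix a
  obtain c1 c2 c3 c4 where c: "i = l \<longrightarrow> c3 = 0 \<and> c4 = 0"
    and a: "e0 * a * e0 \<approx> scalar c1 * e0 + scalar c2 * xe + scalar c3 * pe + scalar c4 * (xe * pe)"
    using corner_in_span[of a] unfolding corner_span_def by blast
  have "c3 = 0" "c4 = 0" using c assms by blast+
  with a show "\<exists>k d. e0 * a * e0 \<approx> scalar k * e0 + scalar d * xe"
    by (intro exI[of _ c1] exI[of _ c2]) (simp add: scalar_zero)
qed (use e0_e0 e0_xe xe_e0 xe_square in simp_all)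

text \<open>
  For \<open>i < l\<close> the corner is a two by two matrix algebra with matrix units \<open>-xe pe\<close>, \<open>xe\<close>, \<open>-pe\<close> and
  \<open>e0 + xe pe\<close>; this is the first diagonal one.
\<close>

abbreviation "eps \<equiv> - (xe * pe)"

context
  assumes il: "i < l"
begin

text \<open>
  The relations below are consequences of \<open>pe xe = - xe pe - e0\<close> and the vanishing of the squares.
\<close>

lemma pe_xe_pe: "pe * xe * pe \<approx> - pe"
proof -
  have "pe * xe * pe \<approx> (- (xe * pe) - e0) * pe" by (rule cong_rmult) (rule pe_xe[OF il])
  also have "\<dots> = - (xe * (pe * pe)) - e0 * pe" by (simp add: left_diff_distrib mult.assoc)
  also have "\<dots> \<approx> - 0 - pe"
    by (intro cong_minus cong_uminus cong_zero_lmult[where x = xe] pe_square e0_pe il)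
  finally show ?thesis by simp
qed

lemma xe_pe_xe: "xe * (pe * xe) \<approx> - xe"
proof -
  have "xe * (pe * xe) \<approx> xe * (- (xe * pe) - e0)" by (rule cong_lmult) (rule pe_xe[OF il])
  also have "\<dots> = - (xe * xe * pe) - xe * e0" by (simp add: right_diff_distrib mult.assoc)
  also have "\<dots> \<approx> - 0 - xe"
    by (intro cong_minus cong_uminus cong_zero_rmult[where x = pe] xe_square xe_e0)
  finally show ?thesis by simp
qed

lemma eps_eps: "eps * eps \<approx> eps"
proof -
  have "eps * eps = xe * (pe * xe * pe)" by (simp add: mult.assoc)
  also have "\<dots> \<approx> xe * - pe" by (rule cong_lmult) (rule pe_xe_pe)
  finally show ?thesis by simp
qed

lemma eps_xe: "eps * xe \<approx> xe"
proof -
  have "eps * xe = - (xe * (pe * xe))" by (simp add: mult.assoc)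
  also have "\<dots> \<approx> - (- xe)" by (rule cong_uminus) (rule xe_pe_xe)
  finally show ?thesis by simp
qed

lemma pe_eps: "- pe * eps \<approx> - pe"
  using pe_xe_pe by (simp add: mult.assoc)

lemma eps_pe: "eps * pe \<approx> 0"
proof -
  have "eps * pe = - (xe * (pe * pe))" by (simp add: mult.assoc)
  also have "\<dots> \<approx> - 0" by (intro cong_uminus cong_zero_lmult[where x = xe] pe_square il)
  finally show ?thesis by simp
qed

lemma xe_eps: "xe * eps \<approx> 0"
proof -
  have "xe * eps = - (xe * xe * pe)" by (simp add: mult.assoc)
  also have "\<dots> \<approx> - 0" by (intro cong_uminus cong_zero_rmult[where x = pe] xe_square)
  finally show ?thesis by simp
qed

lemma e0_eps: "e0 * eps \<approx> eps"
  using cong_uminus[OF cong_rmult[OF e0_xe, of pe]] by (simp add: mult.assoc)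

lemma eps_e0: "eps * e0 \<approx> eps"
  using cong_uminus[OF cong_lmult[OF pe_e0[OF il], of xe]] by (simp add: mult.assoc)

text \<open>
  The four spanning elements of the corner contribute \<open>eps\<close>, 0, 0 and \<open>-eps\<close>.
\<close>

lemma eps_corner: "\<exists>k. eps * a * eps \<approx> scalar k * eps"
proof -
  obtain c1 c2 c3 c4 where a: "e0 * a * e0 \<approx> scalar c1 * e0 + scalar c2 * xe + scalar c3 * pe + scalar c4 * (xe * pe)"
    using corner_in_span[of a] by (auto simp: corner_span_def)
  have "eps * a * eps \<approx> (eps * e0) * a * (e0 * eps)"
    by (rule cong_sym) (intro cong_mult cong_refl eps_e0 e0_eps)
  also have "\<dots> = eps * (e0 * a * e0) * eps" by (simp only: mult.assoc)
  also have "\<dots> \<approx> eps * (scalar c1 * e0 + scalar c2 * xe + scalar c3 * pe + scalar c4 * (xe * pe)) * eps"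
    by (rule cong_mid) (rule a)
  also have "\<dots> = scalar c1 * (eps * e0 * eps) + scalar c2 * (eps * (xe * eps)) + scalar c3 * (eps * pe * eps)
      - scalar c4 * (eps * eps * eps)"
    by (simp only: distrib_left distrib_right mult.assoc scalar_left_commute) (simp add: mult.assoc)
  also have "\<dots> \<approx> scalar c1 * (eps * eps) + scalar c2 * 0 + scalar c3 * 0 - scalar c4 * (eps * eps)"
    by (intro cong_add cong_minus cong_lmult[where x = "scalar _"] cong_rmult eps_e0 eps_eps
        cong_zero_lmult[where x = eps, OF xe_eps] cong_zero_rmult[where x = eps, OF eps_pe])
  also have "\<dots> = scalar (c1 - c4) * (eps * eps)"
  proof -
    have "scalar (c1 - c4) + scalar c4 = (scalar c1 :: 'k klr_free)" by (simp flip: scalar_add)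
    then have "scalar (c1 - c4) = (scalar c1 - scalar c4 :: 'k klr_free)" by (simp add: eq_diff_eq)
    then show ?thesis by (simp add: left_diff_distrib)
  qed
  also have "\<dots> \<approx> scalar (c1 - c4) * eps" by (rule cong_lmult) (rule eps_eps)
  finally show ?thesis by blast
qed

lemma matrix_units_field:
  "matrix_units B block_map scalar (words \<times> (UNIV :: bool set))
    (\<lambda>(w, s). path 0 0 w * (if s then - pe else eps)) (\<lambda>(w, s). (if s then xe else eps) * path_rev 0 0 w) eps 0"
proof (rule path_matrix_units)
  show "\<exists>k d. eps * a * eps \<approx> scalar k * eps + scalar d * 0" for a
    using eps_corner[of a] by simp
  have "e0 * - pe \<approx> - pe" using cong_uminus[OF e0_pe[OF il]] by simp
  then show "e0 * (if s then - pe else eps) \<approx> (if s then - pe else eps)" for s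
    using e0_eps by (cases s) simp_all
  have 1: "xe * - pe \<approx> eps" by simp
  have 2: "eps * - pe \<approx> 0" using cong_uminus[OF eps_pe] by simp
  show "(if s then xe else eps) * (if t then - pe else eps) \<approx> (if s = t then eps else 0)" for s t
    using 1 2 eps_eps xe_eps by (cases s; cases t) (simp_all only: if_True if_False simp_thms)
  have "(\<Sum>s\<in>UNIV. (if s then - pe else eps) * (if s then xe else eps)) = eps * eps - pe * xe"
    by (simp add: UNIV_bool)
  also have "\<dots> \<approx> eps - (- (xe * pe) - e0)" by (intro cong_minus eps_eps pe_xe il)
  finally show "(\<Sum>s\<in>UNIV. (if s then - pe else eps) * (if s then xe else eps)) \<approx> e0" by simp
  show "(if s then xe else eps) * e0 \<approx> (if s then xe else eps)" for s
    using xe_e0 eps_e0 by (cases s) (simp_all only: if_True if_False)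
  show "eps * (if s then xe else eps) \<approx> (if s then xe else eps)" for s
    using eps_xe eps_eps by (cases s) (simp_all only: if_True if_False)
  show "(if s then - pe else eps) * eps \<approx> (if s then - pe else eps)" for s
    using pe_eps eps_eps by (cases s) (simp_all only: if_True if_False)
  show "eps * eps \<approx> eps" by (rule eps_eps)
qed simp_all

interpretation mu: matrix_units B block_map scalar "words \<times> (UNIV :: bool set)"
    "\<lambda>(w, s). path 0 0 w * (if s then - pe else eps)" "\<lambda>(w, s). (if s then xe else eps) * path_rev 0 0 w" eps 0
  by (rule matrix_units_field)

section \<open>The simple blocks\<close>

abbreviation "v0 \<equiv> tw (vector [1, 0]) w0"

text \<open>
  The product of \<open>xi1\<close> and \<open>partial\<close> is minus the projection to the first coordinate.
\<close>

lemma act_eps: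
  assumes f: "f \<in> tab_functions"
  shows "act eps f = act (scalar (f (word_tableau w0) $ 1)) v0"
proof -
  have "act eps f = (\<lambda>S. - tw (xi1 *v (partial *v f (word_tableau w0))) w0 S)"
    unfolding act_simps(3) act_simps(2)[of xe pe] act_pe[OF f il] act_xe[OF tw_tab_functions[OF w0_words]] by (simp add: tensor_def)
  also have "\<dots> = (\<lambda>S. f (word_tableau w0) $ 1 *s v0 S)"
    by (rule ext) (simp add: tensor_def vec2_eq_iff vector_2)
  finally show ?thesis by (simp only: act_simps)
qed

lemma v0: "v0 \<in> carrier L" "v0 \<noteq> \<zero>\<^bsub>L\<^esub>" "block_map eps \<odot>\<^bsub>L\<^esub> v0 = v0"
proof -
  have t: "v0 \<in> tab_functions" by (rule tw_tab_functions) (rule w0_words)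
  show "v0 \<in> carrier L" using t by (simp add: L_ops)
  show "v0 \<noteq> \<zero>\<^bsub>L\<^esub>"
  proof
    assume "v0 = \<zero>\<^bsub>L\<^esub>"
    from fun_cong[OF this, of "word_tableau w0"] show False
      by (simp add: L_ops tensor_def vec2_eq_iff vector_2)
  qed
  show "block_map eps \<odot>\<^bsub>L\<^esub> v0 = v0"
    unfolding L_smult[OF t] act_eps[OF t] act_simps(4) by (simp add: tensor_def vector_2)
qed

lemma eps_line: "f \<in> carrier L \<Longrightarrow> \<exists>c. block_map eps \<odot>\<^bsub>L\<^esub> f = block_map (scalar c) \<odot>\<^bsub>L\<^esub> v0"
  using act_eps L_smult v0(1) by (auto simp: L_ops)

lemma L_irreducible: "irreducible_module B L"
  by (rule mu.irreducible_criterion[OF L_left_module v0 eps_line])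

lemma L_dim: "module_dim B L = 2 * card words"
  using mu.dimension[OF L_left_module v0 eps_line] by (simp add: card_cartesian_product)

lemma B_unique: "irreducible_module B M \<Longrightarrow> irreducible_module B M' \<Longrightarrow> module_isomorphic B M M'"
  by (rule mu.irreducible_unique)

lemma B_matrix: "algebra_isomorphic B (matrix_algebra (module_dim B L) base_algebra)"
proof -
  have "algebra_isomorphic B (matrix_algebra (card (words \<times> (UNIV :: bool set))) base_algebra)"
  proof (rule mu.matrix_algebra_isomorphic[OF base_algebra_presentation, where \<tau> = "\<lambda>c. scalar c * eps"];
      unfold block_map_eq_iff)
    fix s t :: 'k
    have "scalar (s * t) * eps \<approx> scalar (s * t) * (eps * eps)" by (rule cong_lmult) (rule cong_sym[OF eps_eps])
    also have "\<dots> = scalar s * eps * (scalar t * eps)"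
      by (rule scalar_mult_scalar[symmetric])
    finally show "scalar (s * t) * eps \<approx> scalar s * eps * (scalar t * eps)" .
    show "(s = t) = (scalar s * eps \<approx> scalar t * eps)"
    proof
      assume "scalar s * eps \<approx> scalar t * eps"
      then have "act (scalar s * eps) v0 = act (scalar t * eps) v0" by (rule act_cong) (rule tw_tab_functions[OF w0_words])
      moreover have "act eps v0 = v0"
        using v0(3) by (simp only: L_smult[OF tw_tab_functions[OF w0_words]])
      ultimately have "(\<lambda>S. s *s v0 S) = (\<lambda>S. t *s v0 S)" by (simp only: act_scale)
      from fun_cong[OF this, of "word_tableau w0"] show "s = t" by (simp add: tensor_def vec2_eq_iff vector_2)
    qed simp
    show "scalar (s + t) * eps \<approx> scalar s * eps + scalar t * eps" by (simp only: scalar_add distrib_right cong_refl)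
    show "scalar (s * t) * eps \<approx> scalar s * (scalar t * eps)" by (simp only: scalar_mult mult.assoc cong_refl)
    show "scalar 1 * eps \<approx> eps" by (simp only: scalar_one mult_1_left cong_refl)
    show "\<exists>s. eps * a * eps \<approx> scalar s * eps" for a by (rule eps_corner)
  qed
  then show ?thesis by (simp add: L_dim card_cartesian_product mult.commute)
qed

end

section \<open>The block over the dual numbers\<close>

context
  assumes il: "i = l"
begin

interpretation mu: matrix_units B block_map scalar "words \<times> {()}"
    "\<lambda>(w, s). path 0 0 w * e0" "\<lambda>(w, s). e0 * path_rev 0 0 w" e0 xe
  by (rule matrix_units_dual) (rule il)

abbreviation "Lt \<equiv> L_tilde l :: ('k klr_free set, 'k tabsum) module"
abbreviation "g0 \<equiv> tw (vector [0, 1]) w0"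

lemma Lt_ops: "carrier Lt = {f \<in> tab_functions. \<forall>T. f T $ 2 = 0}" "zero Lt = (\<lambda>_. 0)"
    "f \<in> tab_functions \<Longrightarrow> block_map a \<odot>\<^bsub>Lt\<^esub> f = act a f"
  unfolding L_tilde_eq[OF il] by (simp_all add: L_ops L_smult)

lemma Lt_left_module: "left_module B Lt"
  unfolding L_tilde_eq[OF il] by (rule blk.submodule_left_module[OF L_left_module L_tilde_submodule[OF il]])

lemma v0_tilde: "v0 \<in> carrier Lt" "v0 \<noteq> \<zero>\<^bsub>Lt\<^esub>" "block_map e0 \<odot>\<^bsub>Lt\<^esub> v0 = v0"
proof -
  have t: "v0 \<in> tab_functions" by (rule tw_tab_functions) (rule w0_words)
  show "v0 \<in> carrier Lt" using t by (simp add: Lt_ops tensor_def vector_2)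
  show "v0 \<noteq> \<zero>\<^bsub>Lt\<^esub>"
  proof
    assume "v0 = \<zero>\<^bsub>Lt\<^esub>"
    from fun_cong[OF this, of "word_tableau w0"] show False
      by (simp add: Lt_ops tensor_def vec2_eq_iff vector_2)
  qed
  show "block_map e0 \<odot>\<^bsub>Lt\<^esub> v0 = v0"
    unfolding Lt_ops(3)[OF t] act_e0[OF t] by (simp add: tensor_def)
qed

lemma e0_line:
  assumes "f \<in> carrier Lt"
  shows "\<exists>c. block_map e0 \<odot>\<^bsub>Lt\<^esub> f = block_map (scalar c) \<odot>\<^bsub>Lt\<^esub> v0"
proof (rule exI)
  have f: "f \<in> tab_functions" "f (word_tableau w0) $ 2 = 0" "v0 \<in> tab_functions"
    using assms v0_tilde(1) by (simp_all only: Lt_ops mem_Collect_eq)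
  show "block_map e0 \<odot>\<^bsub>Lt\<^esub> f = block_map (scalar (f (word_tableau w0) $ 1)) \<odot>\<^bsub>Lt\<^esub> v0"
    unfolding Lt_ops(3)[OF f(1)] Lt_ops(3)[OF f(3)] act_e0[OF f(1)] act_simps
    by (rule ext) (use f(2) in \<open>simp add: tensor_def vec2_eq_iff vector_2\<close>)
qed

lemma Lt_irreducible: "irreducible_module B Lt"
  by (rule mu.irreducible_criterion[OF Lt_left_module v0_tilde e0_line])

lemma Lt_dim: "module_dim B Lt = card words"
  using mu.dimension[OF Lt_left_module v0_tilde e0_line] by (simp add: card_cartesian_product)

lemma B_unique_dual: "irreducible_module B M \<Longrightarrow> irreducible_module B M' \<Longrightarrow> module_isomorphic B M M'"
  by (rule mu.irreducible_unique)

lemma g0_tab: "g0 \<in> tab_functions"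
  by (rule tw_tab_functions) (rule w0_words)

lemma act_corner_g0: "act (scalar c * e0 + scalar d * xe) g0 = tw (vector [d, c]) w0"
  unfolding act_simps(1) act_scale act_e0[OF g0_tab] act_xe[OF g0_tab]
  by (rule ext) (simp add: tensor_def vec2_eq_iff vector_2)

lemma B_matrix_dual: "algebra_isomorphic B (matrix_algebra (module_dim B Lt) dual_numbers)"
proof -
  obtain \<rho> :: "'k poly \<Rightarrow> 'k poly set" where
    pres: "algebra_presentation (dual_numbers :: ('k, 'k poly set) module) \<rho> (\<lambda>c. [:c:])"
    and \<rho>_eq: "\<And>p q. \<rho> p = \<rho> q \<longleftrightarrow> coeff p 0 = coeff q 0 \<and> coeff p 1 = coeff q 1"
    using dual_numbers_presentation by blast
  let ?t = "\<lambda>p :: 'k poly. scalar (coeff p 0) * e0 + scalar (coeff p 1) * xe"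
  have "algebra_isomorphic B (matrix_algebra (card (words \<times> {()})) (dual_numbers :: ('k, 'k poly set) module))"
  proof (rule mu.matrix_algebra_isomorphic[OF pres, where \<tau> = ?t]; unfold block_map_eq_iff)
    fix s t :: "'k poly"
    have "?t s * ?t t = scalar (coeff s 0 * coeff t 0) * (e0 * e0) + (scalar (coeff s 0 * coeff t 1) * (e0 * xe) +
        (scalar (coeff s 1 * coeff t 0) * (xe * e0) + scalar (coeff s 1 * coeff t 1) * (xe * xe)))"
      by (simp only: distrib_left distrib_right scalar_mult_scalar add_ac)
    also have "\<dots> \<approx> scalar (coeff s 0 * coeff t 0) * e0 + (scalar (coeff s 0 * coeff t 1) * xe +
        (scalar (coeff s 1 * coeff t 0) * xe + scalar (coeff s 1 * coeff t 1) * 0))"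
      by (intro cong_add cong_lmult[where x = "scalar _"] e0_e0 e0_xe xe_e0 xe_square)
    also have "\<dots> = ?t (s * t)"
      by (simp add: coeff_mult scalar_add distrib_right)
    finally show "?t (s * t) \<approx> ?t s * ?t t" by (rule cong_sym)
    show "(\<rho> s = \<rho> t) = (?t s \<approx> ?t t)"
      unfolding \<rho>_eq
    proof
      assume "?t s \<approx> ?t t"
      then have "act (?t s) g0 = act (?t t) g0" by (rule act_cong) (rule g0_tab)
      from fun_cong[OF this[unfolded act_corner_g0], of "word_tableau w0"]
      show "coeff s 0 = coeff t 0 \<and> coeff s 1 = coeff t 1" by (simp add: tensor_def vec2_eq_iff vector_2)
    qed simp
    show "?t (s + t) \<approx> ?t s + ?t t" by (simp add: scalar_add distrib_right algebra_simps)
    show "?t ([:c:] * t) \<approx> scalar c * ?t t" for c by (simp add: scalar_mult distrib_left mult.assoc)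
    show "?t 1 \<approx> e0" by (simp add: scalar_one scalar_zero)
    fix a
    obtain c d where cd: "e0 * a * e0 \<approx> scalar c * e0 + scalar d * xe"
      using mu.corner[of a] by (auto simp: block_map_eq_iff)
    then have "e0 * a * e0 \<approx> ?t [:c, d:]" by simp
    then show "\<exists>s. e0 * a * e0 \<approx> ?t s" by blast
  qed
  then show ?thesis by (simp add: Lt_dim card_cartesian_product)
qed

lemma g0: "g0 \<in> carrier L" "block_map e0 \<odot>\<^bsub>L\<^esub> g0 = g0" "block_map xe \<odot>\<^bsub>L\<^esub> g0 \<noteq> \<zero>\<^bsub>L\<^esub>"
proof -
  show "g0 \<in> carrier L" using g0_tab by (simp add: L_ops)
  show "block_map e0 \<odot>\<^bsub>L\<^esub> g0 = g0"
    unfolding L_smult[OF g0_tab] act_e0[OF g0_tab] by (simp add: tensor_def)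
  have "act xe g0 (word_tableau w0) $ 1 = 1"
    unfolding act_xe[OF g0_tab] by (simp add: tensor_def vector_2)
  then show "block_map xe \<odot>\<^bsub>L\<^esub> g0 \<noteq> \<zero>\<^bsub>L\<^esub>"
    unfolding L_smult[OF g0_tab] by (auto simp: L_ops)
qed

text \<open>
  The corner of the module is spanned by the generator and its image under the dot, so each vector is
  recovered from its rows.
\<close>

lemma g0_generates: "carrier L = range (\<lambda>a. block_map a \<odot>\<^bsub>L\<^esub> g0)"
proof
  show "range (\<lambda>a. block_map a \<odot>\<^bsub>L\<^esub> g0) \<subseteq> carrier L"
    using blk.act_closed[OF L_left_module g0(1)] by blast
  show "carrier L \<subseteq> range (\<lambda>a. block_map a \<odot>\<^bsub>L\<^esub> g0)"
  proof
    fix f assume f: "f \<in> carrier L"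
    note [simp] = blk.act_mult[OF L_left_module] blk.act_closed[OF L_left_module]
    show "f \<in> range (\<lambda>a. block_map a \<odot>\<^bsub>L\<^esub> g0)"
    proof (rule mu.act_in_sumI[OF L_left_module f])
      show "\<zero>\<^bsub>L\<^esub> \<in> range (\<lambda>a. block_map a \<odot>\<^bsub>L\<^esub> g0)"
        using blk.act_zero[OF L_left_module g0(1)] by (metis rangeI)
      fix x y assume "x \<in> range (\<lambda>a. block_map a \<odot>\<^bsub>L\<^esub> g0)" "y \<in> range (\<lambda>a. block_map a \<odot>\<^bsub>L\<^esub> g0)"
      then obtain a b where "x = block_map a \<odot>\<^bsub>L\<^esub> g0" "y = block_map b \<odot>\<^bsub>L\<^esub> g0" by blast
      then have "x \<oplus>\<^bsub>L\<^esub> y = block_map (a + b) \<odot>\<^bsub>L\<^esub> g0"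
        by (simp only: blk.act_add[OF L_left_module g0(1)])
      then show "x \<oplus>\<^bsub>L\<^esub> y \<in> range (\<lambda>a. block_map a \<odot>\<^bsub>L\<^esub> g0)" by blast
    next
      fix p assume "p \<in> words \<times> {()}"
      then obtain w where p: "p = (w, ())" by auto
      let ?q = "e0 * path_rev 0 0 w"
      let ?h = "block_map (path_rev 0 0 w) \<odot>\<^bsub>L\<^esub> f"
      have h: "?h \<in> tab_functions" using f blk.act_closed[OF L_left_module f] by (simp add: L_ops)
      have "block_map e0 \<odot>\<^bsub>L\<^esub> ?h = act (scalar (?h (word_tableau w0) $ 2) * e0 + scalar (?h (word_tableau w0) $ 1) * xe) g0"
        unfolding L_smult[OF h] act_e0[OF h] act_corner_g0 by (rule ext) (simp add: vec2_eq_iff vector_2 tensor_def)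
      then obtain b where "block_map e0 \<odot>\<^bsub>L\<^esub> ?h = block_map b \<odot>\<^bsub>L\<^esub> g0"
        using L_smult[OF g0_tab] by metis
      then have "block_map (path 0 0 w * e0 * ?q) \<odot>\<^bsub>L\<^esub> f = block_map (path 0 0 w * e0 * b) \<odot>\<^bsub>L\<^esub> g0"
        using f g0(1) by (simp add: mult.assoc)
      then show "block_map ((case p of (w, s) \<Rightarrow> path 0 0 w * e0) * (case p of (w, s) \<Rightarrow> e0 * path_rev 0 0 w)) \<odot>\<^bsub>L\<^esub> f
          \<in> range (\<lambda>a. block_map a \<odot>\<^bsub>L\<^esub> g0)"
        by (simp add: p)
    qed
  qed
qed

text \<open>
  The generator is fixed by the reference idempotent, and the dot does not kill it.
\<close>

lemma L_projective: "projective_module B L" and L_indecomposable: "indecomposable_module B L"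
  by (rule mu.projective_criterion[OF L_left_module g0 g0_generates]
    mu.indecomposable_criterion[OF L_left_module g0 g0_generates])+

lemma L_projective_unique:
  "projective_module B M \<Longrightarrow> indecomposable_module B M \<Longrightarrow> module_isomorphic B M L"
  by (rule mu.indecomposable_projective_unique[OF _ _ L_left_module g0 g0_generates])

end

lemma card_words: "int (card words) = int ((2 * l) choose i) - (if i = 0 then 0 else int ((2 * l) choose (i - 1)))"
proof -
  have "i < 2 * l + 1 - i" "2 * l + 1 - i + i - 1 = 2 * l" using i_le l2 by simp_all
  then show ?thesis using card_ballot_words[of i "2 * l + 1 - i"] by (simp add: words_def)
qed

end

section \<open>Structure of the blocks\<close>

theorem proposition4p6:
  fixes l h :: nat
    and Q :: "nat \<Rightarrow> nat \<Rightarrow> 'k::alg_closed_field poly poly"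
    and R :: "nat \<Rightarrow> ('k, 'k klr_free set) module"
  assumes "l \<ge> 2"
    and "klr_polynomials l Q"
    and h: "h = coxeter l"
    and R: "\<And>i. R i = klr_block l Q (null_root l + null_root l - simple_root i)"
  shows
    "(\<forall>i\<le>l. (\<exists>M :: ('k klr_free set, 'k tabsum) module. irreducible_module (R i) M) \<and>
       (\<forall>(M :: ('k klr_free set, 'm) module) (N :: ('k klr_free set, 'n) module).
          irreducible_module (R i) M \<and> irreducible_module (R i) N
          \<longrightarrow> module_isomorphic (R i) M N)) \<and>
     (\<forall>i\<le>l - 1.
       algebra_isomorphic (R i) (matrix_algebra (module_dim (R i) (L_module l i)) base_algebra) \<and>
       irreducible_module (R i) (L_module l i) \<and>
       (\<forall>M :: ('k klr_free set, 'm) module.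
          irreducible_module (R i) M \<longrightarrow> module_isomorphic (R i) M (L_module l i)) \<and>
       int (module_dim (R i) (L_module l i)) =
         2 * int ((h - 2) choose i) - 2 * (if i = 0 then 0 else int ((h - 2) choose (i - 1)))) \<and>
     algebra_isomorphic (R l) (matrix_algebra (module_dim (R l) (L_tilde l)) dual_numbers) \<and>
       irreducible_module (R l) (L_tilde l) \<and>
       (\<forall>M :: ('k klr_free set, 'm) module.
          irreducible_module (R l) M \<longrightarrow> module_isomorphic (R l) M (L_tilde l)) \<and>
       int (module_dim (R l) (L_tilde l)) =
         int ((h - 2) choose l) - int ((h - 2) choose (l - 1)) \<and>
       projective_module (R l) (L_module l l) \<and>
       indecomposable_module (R l) (L_module l l) \<and>
       (\<forall>P :: ('k klr_free set, 'm) module.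
          projective_module (R l) P \<and> indecomposable_module (R l) P
          \<longrightarrow> module_isomorphic (R l) P (L_module l l))"
proof -
  have loc: "klr_two_delta l Q i" if "i \<le> l" for i
    using assms(1,2) that by (intro klr_two_delta.intro klr_data.intro klr_two_delta_axioms.intro)
  have Ri: "R i = klr_block l Q (klr_two_delta.weight l i)" if "i \<le> l" for i
    unfolding R klr_two_delta.weight_def[OF loc[OF that]] ..
  have h2: "h - 2 = 2 * l" by (simp add: h coxeter_def)
  have small: "irreducible_module (R i) (L_module l i)"
    "algebra_isomorphic (R i) (matrix_algebra (module_dim (R i) (L_module l i)) base_algebra)"
    "int (module_dim (R i) (L_module l i)) =
         2 * int ((h - 2) choose i) - 2 * (if i = 0 then 0 else int ((h - 2) choose (i - 1)))"
    if "i < l" for i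
    using klr_two_delta.L_irreducible[OF loc that] klr_two_delta.B_matrix[OF loc that]
      klr_two_delta.L_dim[OF loc that] klr_two_delta.card_words[OF loc[of i]] that
    by (simp_all add: Ri h2)
  have small_unique: "module_isomorphic (R i) M N" if "i < l" "irreducible_module (R i) M" "irreducible_module (R i) N"
    for i and M :: "('k klr_free set, 'p) module" and N :: "('k klr_free set, 'q) module"
    using klr_two_delta.B_unique[OF loc that(1)] that by (simp add: Ri)
  note top = loc[OF order_refl]
  have large: "irreducible_module (R l) (L_tilde l)"
    "algebra_isomorphic (R l) (matrix_algebra (module_dim (R l) (L_tilde l)) dual_numbers)"
    "int (module_dim (R l) (L_tilde l)) = int ((h - 2) choose l) - int ((h - 2) choose (l - 1))"
    "projective_module (R l) (L_module l l)" "indecomposable_module (R l) (L_module l l)"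
    using klr_two_delta.Lt_irreducible[OF top refl] klr_two_delta.B_matrix_dual[OF top refl]
      klr_two_delta.Lt_dim[OF top refl] klr_two_delta.card_words[OF top]
      klr_two_delta.L_projective[OF top refl] klr_two_delta.L_indecomposable[OF top refl] assms(1)
    by (simp_all add: Ri h2)
  have large_unique: "module_isomorphic (R l) M N" if "irreducible_module (R l) M" "irreducible_module (R l) N"
    for M :: "('k klr_free set, 'p) module" and N :: "('k klr_free set, 'q) module"
    using klr_two_delta.B_unique_dual[OF top refl] that by (simp add: Ri)
  have large_projective: "module_isomorphic (R l) M (L_module l l)"
    if "projective_module (R l) M" "indecomposable_module (R l) M" for M :: "('k klr_free set, 'm) module"
    using klr_two_delta.L_projective_unique[OF top refl] that by (simp add: Ri)
  have below: "i < l" if "i \<le> l - 1" for i using that assms(1) by simp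
  show ?thesis
  proof (intro conjI allI impI)
    fix i assume i: "i \<le> l"
    show "\<exists>M :: ('k klr_free set, 'k tabsum) module. irreducible_module (R i) M"
      using small(1)[of i] large(1) i by (cases "i = l") auto
    fix M :: "('k klr_free set, 'm) module" and N :: "('k klr_free set, 'n) module"
    assume "irreducible_module (R i) M \<and> irreducible_module (R i) N"
    then show "module_isomorphic (R i) M N"
      using small_unique[of i M N] large_unique[of M N] i by (cases "i = l") auto
  next
    fix i assume i: "i \<le> l - 1"
    note i = below[OF i]
    show "irreducible_module (R i) (L_module l i)"
      "algebra_isomorphic (R i) (matrix_algebra (module_dim (R i) (L_module l i)) base_algebra)"
      "int (module_dim (R i) (L_module l i)) =
         2 * int ((h - 2) choose i) - 2 * (if i = 0 then 0 else int ((h - 2) choose (i - 1)))"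
      by (fact small[OF i])+
    fix M :: "('k klr_free set, 'm) module"
    assume "irreducible_module (R i) M"
    then show "module_isomorphic (R i) M (L_module l i)" by (rule small_unique[OF i _ small(1)[OF i]])
  next
    fix M :: "('k klr_free set, 'm) module"
    assume "irreducible_module (R l) M"
    then show "module_isomorphic (R l) M (L_tilde l)" by (rule large_unique[OF _ large(1)])
  next
    fix M :: "('k klr_free set, 'm) module"
    assume "projective_module (R l) M \<and> indecomposable_module (R l) M"
    then show "module_isomorphic (R l) M (L_module l l)" using large_projective by blast
  qed (fact large)+
qed

end
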